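(* There exist a set $X$, a resistance form $(\mathcal E,\mathcal F)$ on $X$ satisfying assumption (A), and a Borel measure $\mu$ on $X$ with the volume doubling property with respect to the resistance metric $R$, such that the spectral dimension \[ d_s(\mu,\mathcal E_\mu,\mathcal D_\mu)=-2\lim_{t\downarrow0}\frac{\log p_\mu(t,x,x)}{\log t} \] exists and is independent of $x\in X$, and \[ d_s(\mu,\mathcal E_\mu,\mathcal D_\mu)<\dim_{\mathrm{ARC}}(X,R)<2 . \]
   Context: Resistance forms: a resistance form on a set $X$ is a pair $(\mathcal E,\mathcal F)$, $\mathcal F$ a linear space of real functions on $X$, $\mathcal E$ a nonnegative symmetric bilinear form on $\mathcal F$, such that: $1_X\in\mathcal F$ and $\mathcal E(u,u)=0$ iff $u$ is constant; $\mathcal F$ modulo constants with $\mathcal E$ is a Hilbert space; $\mathcal F$ separates points; $R(x,y):=(\inf\{\mathcal E(u,u):u(x)=1,u(y)=0\})^{-1}<\infty$ for $x\ne y$; and $0\vee(1\wedge u)\in\mathcal F$ with $\mathcal E$-energy at most $\mathcal E(u,u)$ for $u\in\mathcal F$. $R$ (with $R(x,x)=0$) is the resistance metric. Conformal dimension: metrics $d,\rho$ are quasisymmetric if there is a homeomorphism $\theta$ of $[0,\infty)$ with $\rho(x,y)/\rho(x,z)\le\theta(d(x,y)/d(x,z))$ for $x\ne z$; $\rho$ is $\alpha$-Ahlfors regular if $\mathcal H_\alpha(B_\rho(x,r))\asymp r^\alpha$ for $0<r\le\mathrm{diam}$; $\dim_{\mathrm{ARC}}(X,d)$ is the infimum of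 $\alpha$ such that some $\alpha$-Ahlfors regular metric on $X$ is quasisymmetric to $d$. Assumption (A): $R$ is complete and $\dim_{\mathrm{ARC}}(X,R)<\infty$. Volume doubling: $0<\mu(B(x,2r))\le C\mu(B(x,r))<\infty$ for all $x\in X,r>0$, balls w.r.t. $R$. For such $\mu$, $\mathcal D_\mu$ is the closure of $\mathcal F\cap C_0(X)$ ($C_0$: compactly supported continuous functions on $(X,R)$) w.r.t. the norm $(\mathcal E(u,u)+\int u^2d\mu)^{1/2}$, $\mathcal E_\mu=\mathcal E|_{\mathcal D_\mu\times\mathcal D_\mu}$; this is a regular Dirichlet form on $L^2(X,\mu)$ and $p_\mu(t,x,y)$ denotes its (jointly continuous) heat kernel, i.e. the integral kernel of the associated Markov semigroup with respect to $\mu$. *)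

theory Defs
  imports "HOL-Analysis.Analysis" "HOL-Probability.Probability"
begin

definition effective_conductance ::
  "'a set \<Rightarrow> (('a \<Rightarrow> real) \<Rightarrow> ('a \<Rightarrow> real) \<Rightarrow> real) \<Rightarrow> ('a \<Rightarrow> real) set \<Rightarrow> 'a \<Rightarrow> 'a \<Rightarrow> real"
  where "effective_conductance X E F x y = Inf {E u u | u. u \<in> F \<and> u x = 1 \<and> u y = 0}"

definition resistance_metric ::
  "'a set \<Rightarrow> (('a \<Rightarrow> real) \<Rightarrow> ('a \<Rightarrow> real) \<Rightarrow> real) \<Rightarrow> ('a \<Rightarrow> real) set \<Rightarrow> 'a \<Rightarrow> 'a \<Rightarrow> real"
  where "resistance_metric X E F x y =
    (if x = y \<or> x \<notin> X \<or> y \<notin> X then 0 else 1 / effective_conductance X E F x y)"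

definition resistance_form ::
  "'a set \<Rightarrow> (('a \<Rightarrow> real) \<Rightarrow> ('a \<Rightarrow> real) \<Rightarrow> real) \<Rightarrow> ('a \<Rightarrow> real) set \<Rightarrow> bool"
  where "resistance_form X E F \<longleftrightarrow>
    \<comment> \<open>F is a linear space of functions on X\<close>
    (\<forall>u\<in>F. \<forall>x. x \<notin> X \<longrightarrow> u x = 0) \<and>
    (\<lambda>x. 0) \<in> F \<and>
    (\<forall>u\<in>F. \<forall>v\<in>F. (\<lambda>x. u x + v x) \<in> F) \<and>
    (\<forall>u\<in>F. \<forall>a::real. (\<lambda>x. a * u x) \<in> F) \<and>
    \<comment> \<open>E is a nonnegative symmetric bilinear form on F\<close>
    (\<forall>u\<in>F. \<forall>v\<in>F. E u v = E v u) \<and>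
    (\<forall>u\<in>F. \<forall>v\<in>F. \<forall>w\<in>F. E (\<lambda>x. u x + v x) w = E u w + E v w) \<and>
    (\<forall>u\<in>F. \<forall>v\<in>F. \<forall>a::real. E (\<lambda>x. a * u x) v = a * E u v) \<and>
    (\<forall>u\<in>F. 0 \<le> E u u) \<and>
    \<comment> \<open>(RF1)\<close>
    indicator X \<in> F \<and>
    (\<forall>u\<in>F. E u u = 0 \<longleftrightarrow> (\<exists>c. \<forall>x\<in>X. u x = c)) \<and>
    \<comment> \<open>(RF2) F modulo constants is complete (Hilbert) w.r.t. E\<close>
    (\<forall>s. (\<forall>n. s n \<in> F) \<and>
         (\<forall>\<epsilon>>0. \<exists>N. \<forall>m\<ge>N. \<forall>n\<ge>N.
             E (\<lambda>x. s m x - s n x) (\<lambda>x. s m x - s n x) < \<epsilon>)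
       \<longrightarrow> (\<exists>u\<in>F. (\<lambda>n. E (\<lambda>x. s n x - u x) (\<lambda>x. s n x - u x)) \<longlonglongrightarrow> 0)) \<and>
    \<comment> \<open>(RF3) F separates points\<close>
    (\<forall>x\<in>X. \<forall>y\<in>X. x \<noteq> y \<longrightarrow> (\<exists>u\<in>F. u x \<noteq> u y)) \<and>
    \<comment> \<open>(RF4) R(x,y) < \<infinity>, i.e. the infimum is positive\<close>
    (\<forall>x\<in>X. \<forall>y\<in>X. x \<noteq> y \<longrightarrow> 0 < effective_conductance X E F x y) \<and>
    \<comment> \<open>(RF5) Markov property\<close>
    (\<forall>u\<in>F. (\<lambda>x. max 0 (min 1 (u x))) \<in> F \<and>
       E (\<lambda>x. max 0 (min 1 (u x))) (\<lambda>x. max 0 (min 1 (u x))) \<le> E u u)"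

definition mdiam :: "('a \<Rightarrow> 'a \<Rightarrow> real) \<Rightarrow> 'a set \<Rightarrow> ennreal"
  where "mdiam \<rho> A = (SUP x\<in>A. SUP y\<in>A. ennreal (\<rho> x y))"

definition diam_power :: "('a \<Rightarrow> 'a \<Rightarrow> real) \<Rightarrow> real \<Rightarrow> 'a set \<Rightarrow> ennreal"
  where "diam_power \<rho> \<alpha> A =
    (if A = {} then 0 else if \<alpha> = 0 then 1 else ennreal (enn2real (mdiam \<rho> A) powr \<alpha>))"

definition hausdorff_pre :: "'a set \<Rightarrow> ('a \<Rightarrow> 'a \<Rightarrow> real) \<Rightarrow> real \<Rightarrow> real \<Rightarrow> 'a set \<Rightarrow> ennreal"
  where "hausdorff_pre X \<rho> \<alpha> \<delta> A =
    (INF C \<in> {C :: nat \<Rightarrow> 'a set. (\<forall>i. C i \<subseteq> X) \<and> A \<subseteq> (\<Union>i. C i) \<and>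
                                   (\<forall>i. mdiam \<rho> (C i) \<le> ennreal \<delta>)}.
       (\<Sum>i. diam_power \<rho> \<alpha> (C i)))"

definition hausdorff_measure :: "'a set \<Rightarrow> ('a \<Rightarrow> 'a \<Rightarrow> real) \<Rightarrow> real \<Rightarrow> 'a set \<Rightarrow> ennreal"
  where "hausdorff_measure X \<rho> \<alpha> A = (SUP \<delta>\<in>{0<..}. hausdorff_pre X \<rho> \<alpha> \<delta> A)"

definition ahlfors_regular :: "'a set \<Rightarrow> ('a \<Rightarrow> 'a \<Rightarrow> real) \<Rightarrow> real \<Rightarrow> bool"
  where "ahlfors_regular X \<rho> \<alpha> \<longleftrightarrow>
    (\<exists>C>0. \<forall>x\<in>X. \<forall>r>0. ennreal r \<le> mdiam \<rho> X \<longrightarrow>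
        ennreal (r powr \<alpha> / C) \<le> hausdorff_measure X \<rho> \<alpha> (Metric_space.mball X \<rho> x r) \<and>
        hausdorff_measure X \<rho> \<alpha> (Metric_space.mball X \<rho> x r) \<le> ennreal (C * r powr \<alpha>))"

definition quasisymmetric :: "'a set \<Rightarrow> ('a \<Rightarrow> 'a \<Rightarrow> real) \<Rightarrow> ('a \<Rightarrow> 'a \<Rightarrow> real) \<Rightarrow> bool"
  where "quasisymmetric X d \<rho> \<longleftrightarrow>
    (\<exists>\<theta> \<theta>'. homeomorphism {0::real..} {0..} \<theta> \<theta>' \<and>
       (\<forall>x\<in>X. \<forall>y\<in>X. \<forall>z\<in>X. x \<noteq> z \<longrightarrow> \<rho> x y / \<rho> x z \<le> \<theta> (d x y / d x z)))"

definition dim_ARC :: "'a set \<Rightarrow> ('a \<Rightarrow> 'a \<Rightarrow> real) \<Rightarrow> ereal"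
  where "dim_ARC X d = Inf {ereal \<alpha> | \<alpha>. \<exists>\<rho>. Metric_space X \<rho> \<and> ahlfors_regular X \<rho> \<alpha> \<and> quasisymmetric X d \<rho>}"

definition borel_measure_on :: "'a set \<Rightarrow> ('a \<Rightarrow> 'a \<Rightarrow> real) \<Rightarrow> 'a measure \<Rightarrow> bool"
  where "borel_measure_on X d \<mu> \<longleftrightarrow>
    space \<mu> = X \<and> sets \<mu> = sigma_sets X {U. openin (Metric_space.mtopology X d) U}"

definition volume_doubling :: "'a set \<Rightarrow> ('a \<Rightarrow> 'a \<Rightarrow> real) \<Rightarrow> 'a measure \<Rightarrow> bool"
  where "volume_doubling X d \<mu> \<longleftrightarrow>
    (\<exists>C. \<forall>x\<in>X. \<forall>r>0.
       0 < emeasure \<mu> (Metric_space.mball X d x (2 * r)) \<and>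
       emeasure \<mu> (Metric_space.mball X d x (2 * r)) \<le> ennreal C * emeasure \<mu> (Metric_space.mball X d x r) \<and>
       emeasure \<mu> (Metric_space.mball X d x (2 * r)) < \<infinity>)"

definition L2 :: "'a measure \<Rightarrow> ('a \<Rightarrow> real) \<Rightarrow> bool"
  where "L2 \<mu> f \<longleftrightarrow> f \<in> borel_measurable \<mu> \<and> integrable \<mu> (\<lambda>x. (f x)\<^sup>2)"

definition L2dist :: "'a measure \<Rightarrow> ('a \<Rightarrow> real) \<Rightarrow> ('a \<Rightarrow> real) \<Rightarrow> real"
  where "L2dist \<mu> f g = sqrt (LINT x|\<mu>. (f x - g x)\<^sup>2)"

definition C0 :: "'a set \<Rightarrow> ('a \<Rightarrow> 'a \<Rightarrow> real) \<Rightarrow> ('a \<Rightarrow> real) set"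
  where "C0 X d = {u. continuous_map (Metric_space.mtopology X d) euclideanreal u \<and>
     compactin (Metric_space.mtopology X d)
        ((Metric_space.mtopology X d) closure_of {x\<in>X. u x \<noteq> 0})}"

definition D_mu :: "'a set \<Rightarrow> (('a \<Rightarrow> real) \<Rightarrow> ('a \<Rightarrow> real) \<Rightarrow> real) \<Rightarrow> ('a \<Rightarrow> real) set
                     \<Rightarrow> 'a measure \<Rightarrow> ('a \<Rightarrow> real) set"
  where "D_mu X E F \<mu> = {u \<in> F. L2 \<mu> u \<and>
     (\<exists>s. (\<forall>n. s n \<in> F \<and> s n \<in> C0 X (resistance_metric X E F) \<and> L2 \<mu> (s n)) \<and>
          (\<lambda>n. E (\<lambda>x. s n x - u x) (\<lambda>x. s n x - u x) + (LINT x|\<mu>. (s n x - u x)\<^sup>2)) \<longlonglongrightarrow> 0)}"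

text \<open>p is the (jointly continuous) heat kernel of (E_mu, D_mu): it is jointly continuous
  on (0,\<infinity>) \<times> X \<times> X and for every f \<in> L^2(mu), P_t f(x) = int p(t,x,y) f(y) dmu(y)
  is the (unique) weak solution of the heat equation associated with (E_mu,D_mu) with
  initial value f, i.e. P_t f = T_t f for the Markov semigroup T_t = exp(-tH).\<close>
definition heat_kernel :: "'a set \<Rightarrow> (('a \<Rightarrow> real) \<Rightarrow> ('a \<Rightarrow> real) \<Rightarrow> real) \<Rightarrow> ('a \<Rightarrow> real) set
                     \<Rightarrow> 'a measure \<Rightarrow> (real \<Rightarrow> 'a \<Rightarrow> 'a \<Rightarrow> real) \<Rightarrow> bool"
  where "heat_kernel X E F \<mu> p \<longleftrightarrow>
    continuous_map
      (prod_topology (subtopology euclideanreal {0<..})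
         (prod_topology (Metric_space.mtopology X (resistance_metric X E F))
                        (Metric_space.mtopology X (resistance_metric X E F))))
      euclideanreal (\<lambda>(t, x, y). p t x y) \<and>
    (\<forall>f. L2 \<mu> f \<longrightarrow>
       (\<exists>w u'. \<forall>t>0.
          w t \<in> D_mu X E F \<mu> \<and>
          (AE x in \<mu>. integrable \<mu> (\<lambda>y. p t x y * f y) \<and> (LINT y|\<mu>. p t x y * f y) = w t x) \<and>
          L2 \<mu> (u' t) \<and>
          ((\<lambda>s. L2dist \<mu> (\<lambda>x. (w s x - w t x) / (s - t)) (u' t)) \<longlongrightarrow> 0) (at t within {0<..}) \<and>
          (\<forall>v\<in>D_mu X E F \<mu>. (LINT x|\<mu>. u' t x * v x) + E (w t) v = 0) \<and>
          ((\<lambda>s. L2dist \<mu> (w s) f) \<longlongrightarrow> 0) (at_right 0)))"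

end

theory Submission
  imports Defs
begin

text \<open>The space consists of unit cells \<open>k = 0, 1, 2, \<dots>\<close>, each of them a binary Cantor set with \<open>2 ^ n\<close> cells
  of level \<open>n\<close> and measure \<open>1 / 2 ^ n\<close>. The form adds up the covariances over all cells, with weight
  \<open>7 * 8 ^ n\<close> at level \<open>n\<close>, and couples neighbouring unit cells. Let \<open>\<rho>\<close> be the \<open>1\<close>-Ahlfors regular metric
  that is \<open>1 / 2 ^ n\<close> at branching level \<open>n\<close> and one plus the index distance between different unit cells. Then the
  resistance metric is comparable to \<open>min \<rho> (\<rho>\<^sup>2)\<close>, hence quasisymmetric to \<open>\<rho>\<close>, and the chains of
  unit cells forbid any dimension below \<open>1\<close>: the conformal dimension \<open>1\<close> is decided at large scales.
  The spectral dimension only sees small scales. The generator acts as \<open>8 ^ (n + 1)\<close> on the Haar components of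
  level \<open>n\<close> and as a bounded operator on functions of the unit cell, so the heat kernel on the
  diagonal is \<open>\<Sum>n. exp (- 8 ^ (n + 1) * t) * 2 ^ n\<close> up to a bounded term, which is of order \<open>t powr (- 1 / 3)\<close>.\<close>

section \<open>Resistance forms\<close>

text \<open>One count lies behind all three numbers. A cell of level \<open>n\<close> has measure
  \<open>1 / 2 ^ n\<close>, and the weights that its indicator feels add up to \<open>8 ^ n\<close>,
  so the indicator costs energy of order \<open>4 ^ n\<close>; this is the square in
  \<open>min \<rho> (\<rho>\<^sup>2)\<close>. At large scales the unit cells are resistors in
  series, hence the linear part. The same count puts about \<open>2 ^ n\<close> eigenvalues of order
  \<open>8 ^ n\<close> into each unit cell, and \<open>2 ^ n = (8 ^ n) powr (1 / 3)\<close> leads to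
  the spectral dimension \<open>2 / 3\<close>. Two obstacles shape the rest.
  \<open>heat_kernel\<close> is a property that any \<open>p\<close> may satisfy, so besides
  constructing one kernel it must be shown that the weak heat equation has only one solution and
  that continuity fixes the diagonal. And the form domain consists of functions rather than classes
  modulo null sets, so its completeness rests on pointwise estimates by the energy. All of this is
  done in an abstract space of binary branches; a concrete model on the line follows at the
  end.\<close>

locale resistance =
  fixes X :: "'a set" and E :: "('a \<Rightarrow> real) \<Rightarrow> ('a \<Rightarrow> real) \<Rightarrow> real" and F :: "('a \<Rightarrow> real) set"
  assumes form: "resistance_form X E F"
begin

abbreviation "R \<equiv> resistance_metric X E F"
abbreviation "G \<equiv> effective_conductance X E F"

lemma F_add: "u \<in> F \<Longrightarrow> v \<in> F \<Longrightarrow> (\<lambda>x. u x + v x) \<in> F"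
  by (rule form[unfolded resistance_form_def, THEN conjunct2, THEN conjunct2, THEN conjunct1, rule_format])

lemma F_scale: "u \<in> F \<Longrightarrow> (\<lambda>x. a * u x) \<in> F"
  by (rule form[unfolded resistance_form_def, THEN conjunct2, THEN conjunct2, THEN conjunct2, THEN conjunct1, rule_format])

lemma E_sym: "u \<in> F \<Longrightarrow> v \<in> F \<Longrightarrow> E u v = E v u"
  by (rule form[unfolded resistance_form_def, THEN conjunct2, THEN conjunct2, THEN conjunct2, THEN conjunct2, THEN conjunct1, rule_format])

lemma E_nonneg: "u \<in> F \<Longrightarrow> 0 \<le> E u u"
  by (rule form[unfolded resistance_form_def, THEN conjunct2, THEN conjunct2, THEN conjunct2, THEN conjunct2, THEN conjunct2, THEN conjunct2, THEN conjunct2, THEN conjunct1, rule_format])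

lemma F_one: "indicator X \<in> F"
  by (rule form[unfolded resistance_form_def, THEN conjunct2, THEN conjunct2, THEN conjunct2, THEN conjunct2, THEN conjunct2, THEN conjunct2, THEN conjunct2, THEN conjunct2, THEN conjunct1, rule_format])

lemma E_zero: "u \<in> F \<Longrightarrow> E u u = 0 \<longleftrightarrow> (\<exists>c. \<forall>x\<in>X. u x = c)"
  by (rule form[unfolded resistance_form_def, THEN conjunct2, THEN conjunct2, THEN conjunct2, THEN conjunct2, THEN conjunct2, THEN conjunct2, THEN conjunct2, THEN conjunct2, THEN conjunct2, THEN conjunct1, rule_format])

lemma F_separates: "x \<in> X \<Longrightarrow> y \<in> X \<Longrightarrow> x \<noteq> y \<Longrightarrow> \<exists>u\<in>F. u x \<noteq> u y"
  by (rule form[unfolded resistance_form_def, THEN conjunct2, THEN conjunct2, THEN conjunct2, THEN conjunct2, THEN conjunct2, THEN conjunct2, THEN conjunct2, THEN conjunct2, THEN conjunct2, THEN conjunct2, THEN conjunct2, THEN conjunct1, rule_format])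

lemma G_pos: "x \<in> X \<Longrightarrow> y \<in> X \<Longrightarrow> x \<noteq> y \<Longrightarrow> 0 < G x y"
  by (rule form[unfolded resistance_form_def, THEN conjunct2, THEN conjunct2, THEN conjunct2, THEN conjunct2, THEN conjunct2, THEN conjunct2, THEN conjunct2, THEN conjunct2, THEN conjunct2, THEN conjunct2, THEN conjunct2, THEN conjunct2, THEN conjunct1, rule_format])

lemma F_clamp: "u \<in> F \<Longrightarrow> (\<lambda>x. max 0 (min 1 (u x))) \<in> F"
  by (rule form[unfolded resistance_form_def, THEN conjunct2, THEN conjunct2, THEN conjunct2, THEN conjunct2, THEN conjunct2, THEN conjunct2, THEN conjunct2, THEN conjunct2, THEN conjunct2, THEN conjunct2, THEN conjunct2, THEN conjunct2, THEN conjunct2, THEN bspec, THEN conjunct1])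

lemma E_clamp: "u \<in> F \<Longrightarrow> E (\<lambda>x. max 0 (min 1 (u x))) (\<lambda>x. max 0 (min 1 (u x))) \<le> E u u"
  by (rule form[unfolded resistance_form_def, THEN conjunct2, THEN conjunct2, THEN conjunct2, THEN conjunct2, THEN conjunct2, THEN conjunct2, THEN conjunct2, THEN conjunct2, THEN conjunct2, THEN conjunct2, THEN conjunct2, THEN conjunct2, THEN conjunct2, THEN bspec, THEN conjunct2])

lemma E_add: "u \<in> F \<Longrightarrow> v \<in> F \<Longrightarrow> w \<in> F \<Longrightarrow> E (\<lambda>x. u x + v x) w = E u w + E v w"
  by (rule form[unfolded resistance_form_def, THEN conjunct2, THEN conjunct2, THEN conjunct2, THEN conjunct2, THEN conjunct2, THEN conjunct1, rule_format])

lemma E_scale: "u \<in> F \<Longrightarrow> v \<in> F \<Longrightarrow> E (\<lambda>x. a * u x) v = a * E u v"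
  by (rule form[unfolded resistance_form_def, THEN conjunct2, THEN conjunct2, THEN conjunct2, THEN conjunct2, THEN conjunct2, THEN conjunct2, THEN conjunct1, rule_format])

lemma F_complete:
  assumes "\<And>n. s n \<in> F"
    and "\<And>e. e > 0 \<Longrightarrow> \<exists>N. \<forall>m\<ge>N. \<forall>n\<ge>N. E (\<lambda>x. s m x - s n x) (\<lambda>x. s m x - s n x) < e"
  shows "\<exists>u\<in>F. (\<lambda>n. E (\<lambda>x. s n x - u x) (\<lambda>x. s n x - u x)) \<longlonglongrightarrow> 0"
proof -
  have "\<forall>s. (\<forall>n. s n \<in> F) \<and>
         (\<forall>\<epsilon>>0. \<exists>N. \<forall>m\<ge>N. \<forall>n\<ge>N.
             E (\<lambda>x. s m x - s n x) (\<lambda>x. s m x - s n x) < \<epsilon>)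
       \<longrightarrow> (\<exists>u\<in>F. (\<lambda>n. E (\<lambda>x. s n x - u x) (\<lambda>x. s n x - u x)) \<longlonglongrightarrow> 0)"
    using form unfolding resistance_form_def by (elim conjE) assumption
  then show ?thesis using assms by blast
qed

lemma E_add_scale: "u \<in> F \<Longrightarrow> v \<in> F \<Longrightarrow> w \<in> F \<Longrightarrow> E (\<lambda>x. u x + a * v x) w = E u w + a * E v w"
  using E_add[of u "\<lambda>x. a * v x" w] by (simp add: F_scale E_scale)

lemma F_add_scale: "u \<in> F \<Longrightarrow> v \<in> F \<Longrightarrow> (\<lambda>x. u x + a * v x) \<in> F"
  by (simp add: F_scale F_add)

lemma F_diff: "u \<in> F \<Longrightarrow> v \<in> F \<Longrightarrow> (\<lambda>x. u x - v x) \<in> F"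
  using F_add_scale[of u v "-1"] by simp

lemma E_diff: "u \<in> F \<Longrightarrow> v \<in> F \<Longrightarrow> w \<in> F \<Longrightarrow> E (\<lambda>x. u x - v x) w = E u w - E v w"
  using E_add_scale[of u v w "-1"] by simp

lemma E_square_add_scale:
  assumes "u \<in> F" "v \<in> F"
  shows "E (\<lambda>x. u x + a * v x) (\<lambda>x. u x + a * v x) = E u u + 2 * a * E u v + a\<^sup>2 * E v v"
proof -
  have w: "(\<lambda>x. u x + a * v x) \<in> F" using assms by (rule F_add_scale)
  show ?thesis
    using assms
    by (simp add: E_add_scale[OF assms w] E_sym[OF _ w] E_add_scale[OF assms] E_sym[of v u]
        algebra_simps power2_eq_square)
qed

lemma E_square_diff:
  assumes "u \<in> F" "v \<in> F"
  shows "E (\<lambda>x. u x - v x) (\<lambda>x. u x - v x) = E u u - 2 * E u v + E v v"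
  using E_square_add_scale[OF assms, of "-1"] by simp

text \<open>A quadratic polynomial in \<open>t\<close> without constant term that never becomes
  negative has no linear term. This is the first-order condition at a minimiser.\<close>

lemma E_cross_zero:
  assumes "u \<in> F" "v \<in> F" "\<And>t. 0 \<le> 2 * t * E u v + t\<^sup>2 * E v v"
  shows "E u v = 0"
proof (cases "E v v = 0")
  case True
  then have "(E u v)\<^sup>2 \<le> 0" using assms(3)[of "- E u v"] by (simp add: power2_eq_square)
  then show ?thesis by simp
next
  case False
  then have "E v v > 0" using E_nonneg assms(2) by (simp add: less_le)
  with assms(3)[of "- E u v / E v v"] have "0 \<le> - (E u v)\<^sup>2 / E v v"
    by (simp add: power2_eq_square)
  with \<open>E v v > 0\<close> show ?thesis by (simp add: divide_le_0_iff not_less)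
qed

lemma E_Cauchy_Schwarz:
  assumes "u \<in> F" "v \<in> F"
  shows "\<bar>E u v\<bar> \<le> sqrt (E u u) * sqrt (E v v)"
proof (cases "E v v = 0")
  case True
  then obtain c where "\<forall>x\<in>X. v x = c" using E_zero assms by blast
  have "E u v = 0"
  proof (rule ccontr)
    assume n: "E u v \<noteq> 0"
    \<comment> \<open>With \<open>E v v = 0\<close> the square of \<open>u + t * v\<close> is affine
      in \<open>t\<close>; this \<open>t\<close> would give it the value \<open>- 1\<close>.\<close>
    define t where "t = - (E u u + 1) / (2 * E u v)"
    have "0 \<le> E u u + 2 * t * E u v"
      using E_nonneg[OF F_add_scale[OF assms, of t]] E_square_add_scale[OF assms, of t] True by simp
    moreover have "2 * t * E u v = - (E u u + 1)" using n by (simp add: t_def)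
    moreover have "0 \<le> E u u" using E_nonneg assms by blast
    ultimately show False by linarith
  qed
  then show ?thesis using True by simp
next
  case False
  then have p: "E v v > 0" using E_nonneg assms(2) by (simp add: less_le)
  \<comment> \<open>The minimiser of \<open>E u u + 2 * a * E u v + a\<^sup>2 * E v v\<close> in
    \<open>a\<close>.\<close>
  define a where "a = - E u v / E v v"
  have "0 \<le> E u u + 2 * a * E u v + a\<^sup>2 * E v v"
    using E_nonneg[OF F_add_scale[OF assms, of a]] E_square_add_scale[OF assms, of a] by simp
  also have "\<dots> = E u u - (E u v)\<^sup>2 / E v v"
    using p by (simp add: a_def power2_eq_square field_simps)
  finally have "0 \<le> E u u - (E u v)\<^sup>2 / E v v" .
  then have "(E u v)\<^sup>2 \<le> E u u * E v v" using p by (simp add: field_simps)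
  then have "sqrt ((E u v)\<^sup>2) \<le> sqrt (E u u * E v v)" by (rule real_sqrt_le_mono)
  then show ?thesis by (simp add: real_sqrt_mult)
qed

text \<open>Constants have zero energy, hence by Cauchy-Schwarz they are orthogonal to the whole
  domain. Members of \<open>F\<close> vanish off \<open>X\<close>, so \<open>c\<close> is asked to
  be constant on \<open>X\<close> only.\<close>

lemma E_shift:
  assumes "u \<in> F" "v \<in> F" "c \<in> F" "\<forall>x\<in>X. c x = a"
  shows "E (\<lambda>x. u x + c x) v = E u v"
proof -
  have "E c c = 0" using E_zero assms by blast
  moreover have "\<bar>E c v\<bar> \<le> sqrt (E c c) * sqrt (E v v)" by (rule E_Cauchy_Schwarz[OF assms(3,2)])
  ultimately have "E c v = 0" by simp
  then show ?thesis using E_add[OF assms(1,3,2)] by simp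
qed

section \<open>Extremal functions for the effective conductance\<close>

lemma conductance_set:
  assumes "x \<in> X" "y \<in> X" "x \<noteq> y"
  shows "{E u u |u. u \<in> F \<and> u x = 1 \<and> u y = 0} \<noteq> {}"
    and "bdd_below {E u u |u. u \<in> F \<and> u x = 1 \<and> u y = 0}"
proof -
  obtain u where u: "u \<in> F" "u x \<noteq> u y" using F_separates assms by blast
  define v where "v z = 1 / (u x - u y) * (u z + (- u y) * indicator X z)" for z
  have "v \<in> F" unfolding v_def using F_scale[OF F_add_scale[OF u(1) F_one]] by fast
  moreover have "v x = 1" "v y = 0" using assms u by (auto simp: v_def)
  ultimately show "{E u u |u. u \<in> F \<and> u x = 1 \<and> u y = 0} \<noteq> {}" by blast
  show "bdd_below {E u u |u. u \<in> F \<and> u x = 1 \<and> u y = 0}"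
    using E_nonneg by (intro bdd_belowI[of _ 0]) auto
qed

text \<open>Subtracting \<open>v y\<close> and dividing by \<open>v x - v y\<close> makes any
  \<open>v\<close> admissible for the infimum. In this homogeneous form the bound also applies to
  differences of functions, as limits require.\<close>

lemma conductance_le:
  assumes "x \<in> X" "y \<in> X" "x \<noteq> y" "v \<in> F"
  shows "G x y * (v x - v y)\<^sup>2 \<le> E v v"
proof (cases "v x = v y")
  case True then show ?thesis using E_nonneg assms by simp
next
  case False
  define c where "c z = (- v y) * indicator X z" for z
  have c: "c \<in> F" unfolding c_def by (rule F_scale[OF F_one])
  define w where "w z = v z + c z" for z
  have w: "w \<in> F" unfolding w_def by (intro F_add assms c)
  have "E w w = E v w" unfolding w_def[abs_def]
    by (rule E_shift[OF assms(4) F_add[OF assms(4) c] c]) (auto simp: c_def)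
  also have "\<dots> = E w v" using E_sym w assms by simp
  also have "\<dots> = E v v" unfolding w_def[abs_def]
    by (rule E_shift[OF _ _ c]) (use assms c in \<open>auto simp: c_def\<close>)
  finally have Ew: "E w w = E v v" .
  define a where "a = 1 / (v x - v y)"
  have aw: "(\<lambda>z. a * w z) \<in> F" by (intro F_scale w)
  have Ea: "E (\<lambda>z. a * w z) (\<lambda>z. a * w z) = a\<^sup>2 * E v v"
    using E_scale[OF w aw, of a] E_sym[OF w aw] E_scale[OF w w, of a] Ew
    by (simp add: power2_eq_square)
  have "a\<^sup>2 * E v v \<in> {E u u |u. u \<in> F \<and> u x = 1 \<and> u y = 0}"
    using aw Ea[symmetric] False assms by (force simp: a_def w_def c_def field_simps)
  then have "G x y \<le> a\<^sup>2 * E v v"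
    unfolding effective_conductance_def by (intro cInf_lower conductance_set assms)
  then show ?thesis using False by (simp add: a_def field_simps power_divide)
qed

text \<open>Closest-point argument in a Hilbert space: the parallelogram identity makes minimising
  sequences Cauchy.\<close>

lemma minimizer:
  assumes xy: "x \<in> X" "y \<in> X" "x \<noteq> y"
  shows "\<exists>u\<in>F. u x = 1 \<and> u y = 0 \<and> E u u = G x y"
proof -
  let ?C = "G x y"
  let ?S = "{E u u |u. u \<in> F \<and> u x = 1 \<and> u y = 0}"
  have "\<exists>u. u \<in> F \<and> u x = 1 \<and> u y = 0 \<and> E u u < ?C + 1 / Suc n" for n :: nat
  proof -
    have "Inf ?S < ?C + 1 / Suc n" by (simp add: effective_conductance_def)
    then show ?thesis using cInf_lessD[OF conductance_set(1)[OF xy]] by blast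
  qed
  then obtain s where s: "\<And>n. s n \<in> F" "\<And>n. s n x = 1" "\<And>n. s n y = 0"
    and sE: "\<And>n. E (s n) (s n) < ?C + 1 / Suc n" by metis
  \<comment> \<open>\<open>s m + s n\<close> differs by 2 between \<open>x\<close> and
    \<open>y\<close>, so its energy is at least \<open>4 * G x y\<close>; the parallelogram identity
    then bounds the energy of \<open>s m - s n\<close>.\<close>
  have par: "E (\<lambda>z. s m z - s n z) (\<lambda>z. s m z - s n z) \<le> 2 / Suc m + 2 / Suc n" for m n
  proof -
    have "?C * ((s m x + 1 * s n x) - (s m y + 1 * s n y))\<^sup>2 \<le> E (\<lambda>z. s m z + 1 * s n z) (\<lambda>z. s m z + 1 * s n z)"
      by (rule conductance_le[OF xy, of "\<lambda>z. s m z + 1 * s n z"]) (intro F_add_scale s)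
    then have "4 * ?C \<le> E (s m) (s m) + 2 * E (s m) (s n) + E (s n) (s n)"
      using E_square_add_scale[OF s(1)[of m] s(1)[of n], of 1] s by simp
    moreover have "E (s m) (s m) < ?C + 1 / Suc m" "E (s n) (s n) < ?C + 1 / Suc n" by (rule sE)+
    moreover have "2 / real (Suc m) = 2 * (1 / real (Suc m))" "2 / real (Suc n) = 2 * (1 / real (Suc n))" by auto
    ultimately show ?thesis
      unfolding E_square_diff[OF s(1)[of m] s(1)[of n]] by linarith
  qed
  have "\<exists>N. \<forall>m\<ge>N. \<forall>n\<ge>N. E (\<lambda>x. s m x - s n x) (\<lambda>x. s m x - s n x) < e" if e: "e > 0" for e
  proof -
    obtain N :: nat where N: "4 / e < N" using reals_Archimedean2 by blast
    have small: "2 / real (Suc m) < e / 2" if "m \<ge> N" for m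
    proof -
      have "4 / e < real (Suc m)" using N that by simp
      then show ?thesis using e by (simp add: field_simps)
    qed
    show ?thesis
    proof (intro exI[of _ N] allI impI)
      fix m n assume "m \<ge> N" "n \<ge> N"
      then show "E (\<lambda>x. s m x - s n x) (\<lambda>x. s m x - s n x) < e"
        using par[of m n] small[of m] small[of n] by simp
    qed
  qed
  from F_complete[OF s(1) this] obtain u where u: "u \<in> F"
    and lim: "(\<lambda>n. E (\<lambda>x. s n x - u x) (\<lambda>x. s n x - u x)) \<longlonglongrightarrow> 0" by auto
  \<comment> \<open>Completeness is modulo constants, so only the difference
    \<open>u x - u y\<close> survives the limit; the value at \<open>y\<close> is restored by the
    shift \<open>c\<close> further down.\<close>
  have "?C * (1 - (u x - u y))\<^sup>2 \<le> E (\<lambda>x. s n x - u x) (\<lambda>x. s n x - u x)" for n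
    using conductance_le[OF xy F_diff[OF s(1) u], of n] s by (simp add: algebra_simps)
  then have "?C * (1 - (u x - u y))\<^sup>2 \<le> 0"
    by (intro LIMSEQ_le_const[OF lim]) auto
  then have u1: "u x - u y = 1" using G_pos[OF xy] by (auto simp: mult_le_0_iff)
  have "(\<lambda>n. E (s n) (s n)) \<longlonglongrightarrow> E u u"
  proof -
    have "E (s n) (s n) = E u u + 2 * E u (\<lambda>x. s n x - u x) + E (\<lambda>x. s n x - u x) (\<lambda>x. s n x - u x)" for n
      using E_square_add_scale[OF u F_diff[OF s(1)[of n] u], of 1] by simp
    then have eq: "(\<lambda>n. E (s n) (s n)) = (\<lambda>n. E u u + 2 * E u (\<lambda>x. s n x - u x) + E (\<lambda>x. s n x - u x) (\<lambda>x. s n x - u x))"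
      by (rule ext)
    let ?D = "\<lambda>n. E (\<lambda>x. s n x - u x) (\<lambda>x. s n x - u x)"
    let ?H = "\<lambda>n. E u (\<lambda>x. s n x - u x)"
    have "(\<lambda>n. sqrt (E u u) * sqrt (?D n)) \<longlonglongrightarrow> sqrt (E u u) * sqrt 0"
      by (rule tendsto_mult[OF tendsto_const tendsto_real_sqrt[OF lim]])
    then have z: "(\<lambda>n. sqrt (E u u) * sqrt (?D n)) \<longlonglongrightarrow> 0" by (simp only: real_sqrt_zero mult_zero_right)
    have "norm (?H n) \<le> sqrt (E u u) * sqrt (?D n)" for n
      using E_Cauchy_Schwarz[OF u F_diff[OF s(1)[of n] u]] by (simp only: real_norm_def)
    then have "?H \<longlonglongrightarrow> 0"
      by (intro Lim_null_comparison[OF _ z] always_eventually allI)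
    then have "(\<lambda>n. E u u + 2 * ?H n + ?D n) \<longlonglongrightarrow> E u u + 2 * 0 + 0"
      by (rule tendsto_add[OF tendsto_add[OF tendsto_const tendsto_mult[OF tendsto_const]] lim])
    then show ?thesis by (subst eq) (simp only: mult_zero_right add_0_right)
  qed
  moreover have "(\<lambda>n. ?C + 1 / Suc n) \<longlonglongrightarrow> ?C + 0"
    by (intro tendsto_intros LIMSEQ_Suc[OF lim_1_over_n])
  ultimately have "E u u \<le> ?C"
    using sE by (intro LIMSEQ_le[of _ _ "\<lambda>n. ?C + 1 / Suc n"]) (auto intro: less_imp_le)
  define c where "c z = (- u y) * indicator X z" for z
  have c: "c \<in> F" unfolding c_def by (rule F_scale[OF F_one])
  have w: "(\<lambda>z. u z + c z) \<in> F" by (intro F_add u c)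
  have "E (\<lambda>z. u z + c z) (\<lambda>z. u z + c z) = E u (\<lambda>z. u z + c z)"
    by (rule E_shift[OF u w c]) (auto simp: c_def)
  also have "\<dots> = E (\<lambda>z. u z + c z) u" by (rule E_sym[OF u w])
  also have "\<dots> = E u u" by (rule E_shift[OF u u c]) (auto simp: c_def)
  finally have "E (\<lambda>z. u z + c z) (\<lambda>z. u z + c z) = E u u" .
  moreover have "?C * ((u x + c x) - (u y + c y))\<^sup>2 \<le> E (\<lambda>z. u z + c z) (\<lambda>z. u z + c z)"
    by (rule conductance_le[OF xy w])
  moreover have "u x + c x = 1" "u y + c y = 0" using xy u1 by (auto simp: c_def)
  ultimately show ?thesis using w \<open>E u u \<le> ?C\<close> by (intro bexI[OF _ w]) auto
qed

text \<open>The Riesz representer of \<open>v \<mapsto> v x - v y\<close>; the Markov property puts its values between those at \<open>y\<close> and \<open>x\<close>.\<close>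

lemma representer:
  assumes xy: "x \<in> X" "y \<in> X"
  shows "\<exists>g\<in>F. (\<forall>v\<in>F. E g v = v x - v y) \<and> (\<forall>z\<in>X. 0 \<le> g z \<and> g z \<le> R x y) \<and> g x = R x y \<and> g y = 0"
proof (cases "x = y")
  case True
  have z: "(\<lambda>x. 0 * indicator X x) \<in> F" by (rule F_scale[OF F_one])
  show ?thesis
    using True E_scale[OF F_one, of _ 0]
    by (intro bexI[OF _ z]) (auto simp: resistance_metric_def)
next
  case False
  let ?C = "G x y"
  obtain u where u: "u \<in> F" "u x = 1" "u y = 0" "E u u = ?C" using minimizer[OF xy False] by auto
  have EL: "E u v = ?C * (v x - v y)" if v: "v \<in> F" for v
  proof -
    define w where "w z = v z + (- (v x - v y)) * u z" for z
    have w: "w \<in> F" unfolding w_def by (intro F_add_scale v u)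
    \<comment> \<open>Perturbing the minimiser by multiples of \<open>w\<close>, which has equal
      values at \<open>x\<close> and \<open>y\<close>, cannot lower the energy.\<close>
    have "E u w = 0"
    proof (rule E_cross_zero[OF u(1) w])
      fix t
      have "?C * ((u x + t * w x) - (u y + t * w y))\<^sup>2 \<le> E (\<lambda>z. u z + t * w z) (\<lambda>z. u z + t * w z)"
        by (rule conductance_le[OF xy False F_add_scale[OF u(1) w]])
      moreover have "w x = w y" using u by (simp add: w_def)
      ultimately show "0 \<le> 2 * t * E u w + t\<^sup>2 * E w w"
        unfolding E_square_add_scale[OF u(1) w] using u by simp
    qed
    moreover have "E w u = E v u + (- (v x - v y)) * E u u"
      unfolding w_def[abs_def] by (rule E_add_scale[OF v u(1) u(1)])
    ultimately show ?thesis using E_sym[OF u(1) v] E_sym[OF u(1) w] u by (simp add: algebra_simps)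
  qed
  define v where "v z = max 0 (min 1 (u z))" for z
  have v: "v \<in> F" unfolding v_def by (rule F_clamp[OF u(1)])
  have vxy: "v x = 1" "v y = 0" using u by (auto simp: v_def)
  have "E v v \<le> ?C" using E_clamp[OF u(1)] u by (simp add: v_def[abs_def])
  \<comment> \<open>The clamp \<open>v\<close> has the values of \<open>u\<close> at
    \<open>x\<close> and \<open>y\<close> and no larger energy. As \<open>EL\<close> gives
    \<open>E u v = E u u\<close>, the two differ by a constant, which is 0 at
    \<open>x\<close>.\<close>
  then have "E (\<lambda>z. u z - v z) (\<lambda>z. u z - v z) \<le> 0"
    unfolding E_square_diff[OF u(1) v] EL[OF v] using u vxy by simp
  then have "E (\<lambda>z. u z - v z) (\<lambda>z. u z - v z) = 0" using E_nonneg[OF F_diff[OF u(1) v]] by simp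
  then obtain c where "\<forall>z\<in>X. u z - v z = c" using E_zero[OF F_diff[OF u(1) v]] by blast
  then have "\<forall>z\<in>X. u z - v z = u x - v x" using xy by simp
  then have "\<forall>z\<in>X. u z = v z" using u vxy by simp
  moreover have "0 \<le> v z \<and> v z \<le> 1" for z by (simp add: v_def)
  ultimately have u01: "\<forall>z\<in>X. 0 \<le> u z \<and> u z \<le> 1" by metis
  have C: "?C > 0" using G_pos[OF xy False] .
  have R: "R x y = 1 / ?C" using xy False by (simp add: resistance_metric_def)
  show ?thesis
  proof (intro bexI conjI ballI)
    show "(\<lambda>z. (1 / ?C) * u z) \<in> F" by (rule F_scale[OF u(1)])
    show "E (\<lambda>z. (1 / ?C) * u z) w = w x - w y" if "w \<in> F" for w
      using E_scale[OF u(1) that, of "1 / ?C"] EL[OF that] C by simp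
    show "0 \<le> 1 / ?C * u z" "1 / ?C * u z \<le> R x y" if "z \<in> X" for z
      using u01 that C by (simp_all add: R divide_right_mono less_imp_le)
  qed (use u R in simp_all)
qed

text \<open>The representer for \<open>x\<close>, \<open>z\<close> is, up to a constant, the sum of
  those for \<open>x\<close>, \<open>y\<close> and for \<open>y\<close>, \<open>z\<close>; comparing
  values at \<open>x\<close> and \<open>z\<close> and using the range bounds gives the triangle
  inequality. For symmetry, the representers for \<open>x\<close>, \<open>y\<close> and for
  \<open>y\<close>, \<open>x\<close> add up to a function of zero energy.\<close>

lemma Metric_space_R: "Metric_space X R"
proof
  show "0 \<le> R x y" for x y
    using G_pos[of x y] by (auto simp: resistance_metric_def intro: less_imp_le)
  show "R x y = R y x" for x y
  proof (cases "x \<in> X \<and> y \<in> X")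
    case False then show ?thesis by (auto simp: resistance_metric_def)
  next
    case True
    obtain g where g: "g \<in> F" "\<forall>v\<in>F. E g v = v x - v y" "g x = R x y" "g y = 0"
      using representer True by blast
    obtain h where h: "h \<in> F" "\<forall>v\<in>F. E h v = v y - v x" "h y = R y x" "h x = 0"
      using representer True by blast
    have gh: "(\<lambda>z. g z + h z) \<in> F" by (rule F_add[OF g(1) h(1)])
    have "E (\<lambda>z. g z + h z) (\<lambda>z. g z + h z) = 0"
      unfolding E_add[OF g(1) h(1) gh] bspec[OF g(2) gh] bspec[OF h(2) gh] by simp
    then obtain c where c: "\<forall>z\<in>X. g z + h z = c" using E_zero[OF gh] by blast
    have "g x + h x = g y + h y" using bspec[OF c, of x] bspec[OF c, of y] True by simp
    then show ?thesis using g(3,4) h(3,4) by simp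
  qed
  show "(R x y = 0) = (x = y)" if "x \<in> X" "y \<in> X" for x y
    using G_pos[of x y] that by (auto simp: resistance_metric_def)
  show "R x z \<le> R x y + R y z" if xyz: "x \<in> X" "y \<in> X" "z \<in> X" for x y z
  proof -
    obtain g where g: "g \<in> F" "\<forall>v\<in>F. E g v = v x - v z" "g x = R x z" "g z = 0"
      using representer[OF xyz(1,3)] by blast
    obtain h where h: "h \<in> F" "\<forall>v\<in>F. E h v = v x - v y" "\<forall>w\<in>X. 0 \<le> h w \<and> h w \<le> R x y"
      using representer[OF xyz(1,2)] by blast
    obtain k where k: "k \<in> F" "\<forall>v\<in>F. E k v = v y - v z" "\<forall>w\<in>X. 0 \<le> k w \<and> k w \<le> R y z"
      using representer[OF xyz(2,3)] by blast
    have heat_ker: "(\<lambda>z. h z + k z) \<in> F" by (rule F_add[OF h(1) k(1)])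
    have ghk: "(\<lambda>z. g z - (h z + k z)) \<in> F" using F_diff[OF g(1) heat_ker] .
    have "E (\<lambda>z. g z - (h z + k z)) (\<lambda>z. g z - (h z + k z)) = 0"
      unfolding E_diff[OF g(1) heat_ker ghk] E_add[OF h(1) k(1) ghk]
        bspec[OF g(2) ghk] bspec[OF h(2) ghk] bspec[OF k(2) ghk] by simp
    then obtain c where c: "\<forall>w\<in>X. g w - (h w + k w) = c" using E_zero[OF ghk] by blast
    have "g x - g z = (h x + k x) - (h z + k z)" using bspec[OF c, of x] bspec[OF c, of z] that by simp
    moreover have "h x \<le> R x y" "k x \<le> R y z" "0 \<le> h z" "0 \<le> k z" using h(3) k(3) that by auto
    ultimately show ?thesis using g by linarith
  qed
qed

end

section \<open>Hausdorff measures along chains of balls\<close>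

text \<open>Continuous and injective means monotone, and a decreasing map would be bounded by its
  maximum on a compact interval although its image is the whole half-line. So
  \<open>\<theta>\<close> increases from 0.\<close>

lemma homeomorphism_halfline:
  fixes \<theta> \<theta>' :: "real \<Rightarrow> real"
  assumes h: "homeomorphism {0::real..} {0..} \<theta> \<theta>'"
  shows "\<theta> 0 = 0" and "0 \<le> s \<Longrightarrow> s < t \<Longrightarrow> \<theta> s < \<theta> t"
    and "0 < e \<Longrightarrow> \<exists>\<eta>>0. \<theta> \<eta> = e"
proof -
  have cont: "continuous_on {0..} \<theta>" and img: "\<theta> ` {0..} = {0..}"
    and inv: "\<And>x. x \<ge> 0 \<Longrightarrow> \<theta>' (\<theta> x) = x"
    using h by (auto simp: homeomorphism_def)
  have inj: "inj_on \<theta> {0..}" using inv by (intro inj_on_inverseI[of _ \<theta>']) auto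
  have mono: "\<theta> s < \<theta> t" if st: "0 \<le> s" "s < t" for s t
  proof (rule ccontr)
    assume "\<not> \<theta> s < \<theta> t"
    moreover have "\<theta> s \<noteq> \<theta> t" using inj_onD[OF inj, of s t] st by force
    ultimately have gt: "\<theta> t < \<theta> s" by simp
    have "compact (\<theta> ` {0..t})"
      by (intro compact_continuous_image continuous_on_subset[OF cont]) auto
    then have "bdd_above (\<theta> ` {0..t})" by (intro bounded_imp_bdd_above compact_imp_bounded)
    then obtain M where "\<forall>y\<in>\<theta> ` {0..t}. y \<le> M" unfolding bdd_above_def by (elim exE)
    then have M: "\<theta> x \<le> M" if "x \<in> {0..t}" for x using that by (rule bspec[OF _ imageI])
    have "\<theta> x \<le> max M (\<theta> s)" if "x \<ge> 0" for x
    proof (cases "x \<le> t")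
      case True then show ?thesis using M[of x] that by auto
    next
      case False
      have "(\<theta> s < \<theta> t \<and> \<theta> t < \<theta> x) \<or> (\<theta> x < \<theta> t \<and> \<theta> t < \<theta> s)"
        by (rule continuous_inj_imp_mono)
          (use st False in \<open>auto intro: continuous_on_subset[OF cont] inj_on_subset[OF inj]\<close>)
      then show ?thesis using gt by auto
    qed
    moreover have "\<bar>max M (\<theta> s)\<bar> + 1 \<in> \<theta> ` {0..}" unfolding img by simp
    ultimately show False by fastforce
  qed
  then show "0 \<le> s \<Longrightarrow> s < t \<Longrightarrow> \<theta> s < \<theta> t" .
  have "0 \<in> \<theta> ` {0..}" unfolding img by simp
  then obtain z where z: "z \<ge> 0" "\<theta> z = 0" by auto
  have "\<theta> 0 \<ge> 0" using img by auto
  then show 0: "\<theta> 0 = 0" using mono[of 0 z] z by (cases "z = 0") auto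
  show "\<exists>\<eta>>0. \<theta> \<eta> = e" if "0 < e"
  proof -
    have "e \<in> \<theta> ` {0..}" unfolding img using that by simp
    then obtain \<eta> where "\<eta> \<ge> 0" "\<theta> \<eta> = e" by auto
    moreover from this have "\<eta> \<noteq> 0" using 0 that by auto
    ultimately show ?thesis by (intro exI[of _ \<eta>]) auto
  qed
qed

lemma hausdorff_pre_antimono:
  assumes "\<delta> \<le> \<delta>'"
  shows "hausdorff_pre X \<rho> \<alpha> \<delta>' A \<le> hausdorff_pre X \<rho> \<alpha> \<delta> A"
  unfolding hausdorff_pre_def
  by (rule INF_superset_mono) (use order_trans[OF _ ennreal_leI[OF assms]] in auto)

text \<open>A supremum along an increasing sequence commutes with finite sums, which the
  superadditivity below needs.\<close>

lemma hausdorff_measure_SUP: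
  "hausdorff_measure X \<rho> \<alpha> A = (SUP n. hausdorff_pre X \<rho> \<alpha> (1 / real (Suc n)) A)"
proof (rule antisym)
  show "hausdorff_measure X \<rho> \<alpha> A \<le> (SUP n. hausdorff_pre X \<rho> \<alpha> (1 / real (Suc n)) A)"
    unfolding hausdorff_measure_def
  proof (rule SUP_least)
    fix \<delta> :: real assume "\<delta> \<in> {0<..}"
    then obtain n where "inverse (real (Suc n)) < \<delta>" using reals_Archimedean[of \<delta>] by auto
    then show "hausdorff_pre X \<rho> \<alpha> \<delta> A \<le> (SUP n. hausdorff_pre X \<rho> \<alpha> (1 / real (Suc n)) A)"
      by (intro SUP_upper2[of n] hausdorff_pre_antimono) (auto simp: inverse_eq_divide)
  qed
  show "(SUP n. hausdorff_pre X \<rho> \<alpha> (1 / real (Suc n)) A) \<le> hausdorff_measure X \<rho> \<alpha> A"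
    unfolding hausdorff_measure_def by (intro SUP_least SUP_upper) auto
qed

lemma le_mdiam: "x \<in> A \<Longrightarrow> y \<in> A \<Longrightarrow> ennreal (\<rho> x y) \<le> mdiam \<rho> A"
  unfolding mdiam_def by (intro SUP_upper2[of x] SUP_upper2[of y]) auto

text \<open>The covering sets are kept whole rather than intersected with the pieces, because
  \<open>diam_power\<close> is not monotone for negative exponents.\<close>

lemma hausdorff_pre_superadditive:
  fixes B :: "nat \<Rightarrow> 'a set"
  assumes sub: "\<And>i. i < n \<Longrightarrow> B i \<subseteq> U"
    and sep: "\<And>i j x y. i < n \<Longrightarrow> j < n \<Longrightarrow> i \<noteq> j \<Longrightarrow> x \<in> B i \<Longrightarrow> y \<in> B j \<Longrightarrow> \<delta> < \<rho> x y"
    and \<delta>: "0 \<le> \<delta>"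
  shows "(\<Sum>i<n. hausdorff_pre X \<rho> \<alpha> \<delta> (B i)) \<le> hausdorff_pre X \<rho> \<alpha> \<delta> U"
  unfolding hausdorff_pre_def[of _ _ _ _ U]
proof (rule INF_greatest)
  fix C :: "nat \<Rightarrow> 'a set"
  assume "C \<in> {C. (\<forall>i. C i \<subseteq> X) \<and> U \<subseteq> (\<Union>i. C i) \<and> (\<forall>i. mdiam \<rho> (C i) \<le> ennreal \<delta>)}"
  then have C: "\<And>i. C i \<subseteq> X" "U \<subseteq> (\<Union>i. C i)" "\<And>i. mdiam \<rho> (C i) \<le> ennreal \<delta>" by auto
  define D where "D i k = (if C k \<inter> B i = {} then {} else C k)" for i k
  have pre: "hausdorff_pre X \<rho> \<alpha> \<delta> (B i) \<le> (\<Sum>k. diam_power \<rho> \<alpha> (D i k))" if i: "i < n" for i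
    unfolding hausdorff_pre_def
  proof (rule INF_lower, intro CollectI conjI allI)
    show "D i k \<subseteq> X" for k using C(1)[of k] by (auto simp: D_def)
    show "B i \<subseteq> (\<Union>k. D i k)"
    proof
      fix x assume x: "x \<in> B i"
      then obtain k where "x \<in> C k" using sub[OF i] C(2) by blast
      with x have "x \<in> D i k" by (auto simp: D_def)
      then show "x \<in> (\<Union>k. D i k)" by blast
    qed
    show "mdiam \<rho> (D i k) \<le> ennreal \<delta>" for k
      using C(3)[of k] by (auto simp: D_def mdiam_def bot_ennreal)
  qed
  \<comment> \<open>A covering set of diameter at most \<open>\<delta>\<close> cannot meet two
    pieces that are more than \<open>\<delta>\<close> apart, so it is counted only once.\<close>
  have one: "(\<Sum>i<n. diam_power \<rho> \<alpha> (D i k)) \<le> diam_power \<rho> \<alpha> (C k)" for k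
  proof (cases "\<exists>i<n. C k \<inter> B i \<noteq> {}")
    case False
    then have "(\<Sum>i<n. diam_power \<rho> \<alpha> (D i k)) = 0"
      by (intro sum.neutral) (auto simp: D_def diam_power_def)
    then show ?thesis by simp
  next
    case True
    then obtain i x where i: "i < n" "x \<in> C k" "x \<in> B i" by blast
    have "D j k = {}" if "j < n" "j \<noteq> i" for j
    proof (rule ccontr)
      assume "D j k \<noteq> {}"
      then obtain y where y: "y \<in> C k" "y \<in> B j" by (auto simp: D_def split: if_splits)
      have "ennreal (\<rho> x y) \<le> ennreal \<delta>"
        using le_mdiam[OF i(2) y(1), of \<rho>] C(3)[of k] by (rule order_trans)
      then show False using sep[OF i(1) that(1) _ i(3) y(2)] that \<delta>
        by (simp add: ennreal_le_iff)
    qed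
    then have "(\<Sum>j<n. diam_power \<rho> \<alpha> (D j k)) = (\<Sum>j\<in>{i}. diam_power \<rho> \<alpha> (D j k))"
      using i by (intro sum.mono_neutral_right) (auto simp: diam_power_def)
    then show ?thesis using i by (auto simp: D_def)
  qed
  have "(\<Sum>i<n. hausdorff_pre X \<rho> \<alpha> \<delta> (B i)) \<le> (\<Sum>i<n. \<Sum>k. diam_power \<rho> \<alpha> (D i k))"
    by (intro sum_mono pre) auto
  also have "\<dots> = (\<Sum>k. \<Sum>i<n. diam_power \<rho> \<alpha> (D i k))"
    by (rule suminf_sum[symmetric]) auto
  also have "\<dots> \<le> (\<Sum>k. diam_power \<rho> \<alpha> (C k))"
    by (intro suminf_le one) auto
  finally show "(\<Sum>i<n. hausdorff_pre X \<rho> \<alpha> \<delta> (B i)) \<le> (\<Sum>k. diam_power \<rho> \<alpha> (C k))" .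
qed

text \<open>A fixed separation \<open>s\<close> exceeds every \<open>\<delta>\<close> below it, and
  only small \<open>\<delta>\<close> matter for the measure.\<close>

lemma hausdorff_measure_superadditive:
  fixes B :: "nat \<Rightarrow> 'a set"
  assumes sub: "\<And>i. i < n \<Longrightarrow> B i \<subseteq> U"
    and sep: "\<And>i j x y. i < n \<Longrightarrow> j < n \<Longrightarrow> i \<noteq> j \<Longrightarrow> x \<in> B i \<Longrightarrow> y \<in> B j \<Longrightarrow> s \<le> \<rho> x y"
    and s: "0 < s"
  shows "(\<Sum>i<n. hausdorff_measure X \<rho> \<alpha> (B i)) \<le> hausdorff_measure X \<rho> \<alpha> U"
proof -
  have "(\<Sum>i<n. hausdorff_measure X \<rho> \<alpha> (B i)) =
      (SUP m. \<Sum>i<n. hausdorff_pre X \<rho> \<alpha> (1 / real (Suc m)) (B i))"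
    unfolding hausdorff_measure_SUP
    by (rule ennreal_SUP_sum[symmetric])
      (auto simp: incseq_def intro!: hausdorff_pre_antimono divide_left_mono)
  also have "\<dots> \<le> hausdorff_measure X \<rho> \<alpha> U"
  proof (rule SUP_least)
    fix m :: nat
    define \<delta> where "\<delta> = min (1 / real (Suc m)) (s / 2)"
    have "(\<Sum>i<n. hausdorff_pre X \<rho> \<alpha> (1 / real (Suc m)) (B i)) \<le> (\<Sum>i<n. hausdorff_pre X \<rho> \<alpha> \<delta> (B i))"
      by (intro sum_mono hausdorff_pre_antimono) (simp add: \<delta>_def)
    also have "\<dots> \<le> hausdorff_pre X \<rho> \<alpha> \<delta> U"
    proof (rule hausdorff_pre_superadditive[OF sub])
      show "\<delta> < \<rho> x y" if "i < n" "j < n" "i \<noteq> j" "x \<in> B i" "y \<in> B j" for i j x y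
        using sep[OF that] s by (auto simp: \<delta>_def)
    qed (use s in \<open>auto simp: \<delta>_def\<close>)
    also have "\<dots> \<le> hausdorff_measure X \<rho> \<alpha> U"
      unfolding hausdorff_measure_def using s by (intro SUP_upper) (auto simp: \<delta>_def)
    finally show "(\<Sum>i<n. hausdorff_pre X \<rho> \<alpha> (1 / real (Suc m)) (B i)) \<le> hausdorff_measure X \<rho> \<alpha> U" .
  qed
  finally show ?thesis .
qed

text \<open>If the unit cells along a chain have \<open>\<rho>\<close>-diameters comparable to the gaps \<open>r i\<close>, then the
  chain has measure about \<open>\<Sum>i. r i powr \<alpha>\<close>, while \<open>\<Sum>i. r i\<close> is at least the diameter \<open>D\<close> and
  quasisymmetry makes \<open>r i / D\<close> uniformly small; this is incompatible with \<open>\<alpha> < 1\<close>.\<close>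

lemma dim_ARC_ge_1_of_chain:
  fixes x :: "nat \<Rightarrow> 'a" and Cl :: "nat \<Rightarrow> 'a set"
  assumes d: "Metric_space X d" and c: "0 < c" and K: "0 < K"
    and x: "\<And>i. x i \<in> Cl i" and Cl: "\<And>i. Cl i \<subseteq> X"
    and disj: "\<And>i j. i \<noteq> j \<Longrightarrow> Cl i \<inter> Cl j = {}"
    and out: "\<And>i z. z \<in> X \<Longrightarrow> z \<notin> Cl i \<Longrightarrow> c \<le> d (x i) z"
    and low: "\<And>i j. c * \<bar>real i - real j\<bar> \<le> d (x i) (x j)"
    and upp: "\<And>i j z. z \<in> Cl j \<Longrightarrow> d (x i) z \<le> K * (\<bar>real i - real j\<bar> + 1)"
  shows "1 \<le> dim_ARC X d"
  unfolding dim_ARC_def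
proof (rule Inf_greatest, clarify)
  fix \<alpha> \<rho>
  assume rho: "Metric_space X \<rho>" and reg: "ahlfors_regular X \<rho> \<alpha>" and qs: "quasisymmetric X d \<rho>"
  interpret d: Metric_space X d by (rule d)
  interpret rho: Metric_space X \<rho> by (rule rho)
  obtain \<theta> \<theta>' where h: "homeomorphism {0::real..} {0..} \<theta> \<theta>'"
    and q: "\<And>x y z. x \<in> X \<Longrightarrow> y \<in> X \<Longrightarrow> z \<in> X \<Longrightarrow> x \<noteq> z \<Longrightarrow> \<rho> x y / \<rho> x z \<le> \<theta> (d x y / d x z)"
    using qs unfolding quasisymmetric_def by blast
  note \<theta>0 = homeomorphism_halfline(1)[OF h] and \<theta>s = homeomorphism_halfline(2)[OF h]
    and \<theta>e = homeomorphism_halfline(3)[OF h]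
  have \<theta>mono: "\<theta> s \<le> \<theta> t" if "0 \<le> s" "s \<le> t" for s t
    using \<theta>s[of s t] that by (cases "s = t") auto
  \<comment> \<open>Quasisymmetry without quotients: a ratio of \<open>d\<close>-distances at most
    \<open>t\<close> forces a ratio of \<open>\<rho>\<close>-distances at most
    \<open>\<theta> t\<close>.\<close>
  have qq: "\<rho> p y \<le> \<theta> t * \<rho> p z"
    if "p \<in> X" "y \<in> X" "z \<in> X" "p \<noteq> z" "d p y \<le> t * d p z" for p y z t
  proof -
    have "0 < \<rho> p z" "0 < d p z" using that rho.mdist_pos_eq d.mdist_pos_eq by auto
    moreover have "d p y / d p z \<le> t" using \<open>0 < d p z\<close> that by (simp add: divide_le_eq)
    ultimately have "\<rho> p y / \<rho> p z \<le> \<theta> t"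
      using q[OF that(1-4)] \<theta>mono[of "d p y / d p z" t] by auto
    then show ?thesis using \<open>0 < \<rho> p z\<close> by (simp add: divide_le_eq)
  qed
  have xX: "x i \<in> X" for i using x Cl by blast
  have xne: "x i \<noteq> x j" if "i \<noteq> j" for i j using disj[OF that] x[of i] x[of j] by force
  obtain C where C: "C > 0"
    and reg': "\<And>y r. y \<in> X \<Longrightarrow> r > 0 \<Longrightarrow> ennreal r \<le> mdiam \<rho> X \<Longrightarrow>
        ennreal (r powr \<alpha> / C) \<le> hausdorff_measure X \<rho> \<alpha> (rho.mball y r) \<and>
        hausdorff_measure X \<rho> \<alpha> (rho.mball y r) \<le> ennreal (C * r powr \<alpha>)"
    using reg unfolding ahlfors_regular_def by blast
  define r where "r i = \<rho> (x i) (x (Suc i))" for i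
  have rpos: "r i > 0" for i unfolding r_def using rho.mdist_pos_eq[of "x i" "x (Suc i)"] xX xne[of i "Suc i"] by auto
  have dstep: "d (x i) (x (Suc i)) \<le> 2 * K" for i using upp[OF x[of "Suc i"], of i] by simp
  \<comment> \<open>A step of the chain is at most \<open>2 * K\<close> and leaving a unit cell
    costs at least \<open>c\<close>, so \<open>2 * K / c\<close> bounds the ratio of the two in
    \<open>d\<close>.\<close>
  define M where "M = \<theta> (2 * K / c)"
  have rM: "r i \<le> M * \<rho> (x i) z" if "z \<in> X" "z \<notin> Cl i" for i z
    unfolding r_def M_def
  proof (rule qq)
    show "x i \<noteq> z" using x that by blast
    have "2 * K \<le> 2 * K / c * d (x i) z" using out[OF that] c K by (simp add: field_simps)
    then show "d (x i) (x (Suc i)) \<le> 2 * K / c * d (x i) z" using dstep[of i] by linarith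
  qed (use xX that in auto)
  have "x 1 \<notin> Cl 0" using disj[of 0 1] x[of 1] by auto
  from rM[OF xX this] have M1: "M \<ge> 1" using rpos[of 0] by (simp add: r_def)
  \<comment> \<open>Half of the distance that \<open>rM\<close> guarantees: the ball of radius
    \<open>s i\<close> stays in its unit cell and keeps distance at least \<open>s i\<close> from
    the other balls.\<close>
  define s where "s i = r i / (2 * M)" for i
  have spos: "s i > 0" for i using rpos[of i] M1 by (simp add: s_def)
  have far: "2 * s i \<le> \<rho> (x i) z" if "z \<in> X" "z \<notin> Cl i" for i z
    using rM[OF that] M1 by (simp add: s_def field_simps)
  have BCl: "rho.mball (x i) (s i) \<subseteq> Cl i" for i
    using far[of _ i] spos[of i] by (fastforce simp: rho.in_mball)
  have sdiam: "ennreal (s i) \<le> mdiam \<rho> X" for i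
  proof -
    have "s i \<le> r i" using rpos[of i] M1 by (simp add: s_def field_simps)
    then show ?thesis using le_mdiam[OF xX[of i] xX[of "Suc i"], of \<rho>]
      by (metis ennreal_leI order_trans r_def)
  qed
  \<comment> \<open>For \<open>\<alpha> < 1\<close> the left side is unbounded as
    \<open>\<epsilon>\<close> tends to 0 while the right side is fixed, which is the contradiction
    sought.\<close>
  have key: "\<epsilon> powr (\<alpha> - 1) \<le> C * C * (4 * M * M) powr \<alpha>" if \<epsilon>: "\<epsilon> > 0" and \<alpha>1: "\<alpha> < 1" for \<epsilon>
  proof -
    \<comment> \<open>The denominator \<open>M + 1\<close> compensates for the bound
      \<open>(M + 1) * D\<close> on distances from points of the chain to its ends.\<close>
    obtain \<eta> where \<eta>: "\<eta> > 0" "\<theta> \<eta> = \<epsilon> / (M + 1)" using \<theta>e[of "\<epsilon> / (M + 1)"] \<epsilon> M1 by auto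
    \<comment> \<open>A chain so long that one step is at most \<open>\<eta>\<close> times the
      distance guaranteed for \<open>n / 2\<close> steps.\<close>
    obtain n :: nat where n: "4 * K / (c * \<eta>) < n" using reals_Archimedean2 by blast
    then have n0: "n > 0" using c K \<eta> by (metis divide_pos_pos mult_pos_pos less_trans of_nat_0_less_iff zero_less_numeral)
    have n\<eta>: "4 * K \<le> \<eta> * c * n" using n c \<eta> by (simp add: field_simps)
    define D where "D = \<rho> (x 0) (x n)"
    have Dpos: "D > 0" unfolding D_def using rho.mdist_pos_eq[of "x 0" "x n"] xX xne[of 0 n] n0 by auto
    have inD: "\<rho> (x 0) z \<le> M * D" if "z \<in> Cl i" "i \<le> n" for z i
      unfolding M_def D_def
    proof (rule qq)
      have "d (x 0) z \<le> K * (real i + 1)" using upp[OF that(1), of 0] by simp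
      also have "\<dots> \<le> K * (2 * n)" using that n0 K by (intro mult_left_mono) auto
      also have "\<dots> = 2 * K / c * (c * n)" using c by simp
      also have "\<dots> \<le> 2 * K / c * d (x 0) (x n)" using low[of 0 n] c K by (intro mult_left_mono) auto
      finally show "d (x 0) z \<le> 2 * K / c * d (x 0) (x n)" .
      show "x 0 \<noteq> x n" using xne n0 by simp
    qed (use that Cl xX in auto)
    \<comment> \<open>Ahlfors regularity speaks only of radii up to the diameter; a point
      \<open>x N\<close> far beyond the chain makes the diameter at least
      \<open>2 * M * D\<close>.\<close>
    obtain \<zeta> where \<zeta>: "\<zeta> > 0" "\<theta> \<zeta> = 1 / (2 * M)" using \<theta>e[of "1 / (2 * M)"] M1 by auto
    obtain N :: nat where N: "K * (n + 1) / (c * \<zeta>) < N" using reals_Archimedean2 by blast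
    have "0 < K * (n + 1) / (c * \<zeta>)" using K c \<zeta> by (intro divide_pos_pos mult_pos_pos) auto
    then have N0: "N > 0" using N by (metis less_trans of_nat_0_less_iff)
    have "D \<le> 1 / (2 * M) * \<rho> (x 0) (x N)"
      unfolding D_def \<zeta>(2)[symmetric]
    proof (rule qq)
      have "d (x 0) (x n) \<le> K * (n + 1)" using upp[OF x[of n], of 0] by (simp add: add.commute)
      also have "\<dots> \<le> \<zeta> * (c * N)" using N c \<zeta> by (simp add: field_simps)
      also have "\<dots> \<le> \<zeta> * d (x 0) (x N)" using low[of 0 N] \<zeta> by (intro mult_left_mono) auto
      finally show "d (x 0) (x n) \<le> \<zeta> * d (x 0) (x N)" .
      show "x 0 \<noteq> x N" using xne N0 by simp
    qed (use xX in auto)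
    then have "2 * M * D \<le> \<rho> (x 0) (x N)" using M1 by (simp add: field_simps)
    then have diam: "ennreal (2 * M * D) \<le> mdiam \<rho> X"
      using le_mdiam[OF xX[of 0] xX[of N], of \<rho>] by (meson ennreal_leI order_trans)
    define S where "S = Min (s ` {..<n})"
    have "S \<in> s ` {..<n}" unfolding S_def using n0 by (intro Min_in) auto
    then have S: "S > 0" "\<And>i. i < n \<Longrightarrow> S \<le> s i"
      using spos by (auto simp: S_def)
    have "(\<Sum>i<n. hausdorff_measure X \<rho> \<alpha> (rho.mball (x i) (s i)))
        \<le> hausdorff_measure X \<rho> \<alpha> (rho.mball (x 0) (2 * M * D))"
    proof (rule hausdorff_measure_superadditive[OF _ _ S(1)])
      show "rho.mball (x i) (s i) \<subseteq> rho.mball (x 0) (2 * M * D)" if "i < n" for i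
      proof
        fix z assume z: "z \<in> rho.mball (x i) (s i)"
        then have "z \<in> Cl i" using BCl by blast
        then have "\<rho> (x 0) z \<le> M * D" using inD that by simp
        also have "\<dots> < 2 * M * D" using M1 Dpos by simp
        finally show "z \<in> rho.mball (x 0) (2 * M * D)" using z xX by (auto simp: rho.in_mball)
      qed
      show "S \<le> \<rho> u v" if "i < n" "j < n" "i \<noteq> j"
        "u \<in> rho.mball (x i) (s i)" "v \<in> rho.mball (x j) (s j)" for i j u v
      proof -
        have "v \<notin> Cl i" using BCl[of j] that(5) disj[OF that(3)] by blast
        then have "2 * s i \<le> \<rho> (x i) v" using far that by (auto simp: rho.in_mball)
        also have "\<dots> \<le> \<rho> (x i) u + \<rho> u v"
          using rho.triangle[of "x i" u v] that xX by (auto simp: rho.in_mball)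
        finally show ?thesis using that S(2)[OF that(1)] by (auto simp: rho.in_mball)
      qed
    qed
    also have "\<dots> \<le> ennreal (C * (2 * M * D) powr \<alpha>)"
      using reg'[OF xX[of 0] _ diam] M1 Dpos by simp
    finally have H: "(\<Sum>i<n. hausdorff_measure X \<rho> \<alpha> (rho.mball (x i) (s i))) \<le> ennreal (C * (2 * M * D) powr \<alpha>)" .
    have "ennreal (\<Sum>i<n. s i powr \<alpha> / C) = (\<Sum>i<n. ennreal (s i powr \<alpha> / C))"
      by (rule sum_ennreal[symmetric]) (use C in auto)
    also have "\<dots> \<le> (\<Sum>i<n. hausdorff_measure X \<rho> \<alpha> (rho.mball (x i) (s i)))"
      using reg'[OF xX spos sdiam] by (intro sum_mono) auto
    also note H
    finally have L: "ennreal (\<Sum>i<n. s i powr \<alpha> / C) \<le> ennreal (C * (2 * M * D) powr \<alpha>)" .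
    have "0 \<le> C * (2 * M * D) powr \<alpha>" using C by simp
    from iffD1[OF ennreal_le_iff[OF this] L]
    have "(\<Sum>i<n. s i powr \<alpha> / C) \<le> C * (2 * M * D) powr \<alpha>" .
    then have "(\<Sum>i<n. s i powr \<alpha>) / C \<le> C * (2 * M * D) powr \<alpha>"
      by (simp only: sum_divide_distrib)
    then have "(\<Sum>i<n. s i powr \<alpha>) \<le> C * C * (2 * M * D) powr \<alpha>"
      using C by (simp only: pos_divide_le_eq mult_ac)
    moreover have "s i powr \<alpha> = r i powr \<alpha> / (2 * M) powr \<alpha>" for i
      unfolding s_def by (rule powr_divide)
    ultimately have "(\<Sum>i<n. r i powr \<alpha>) \<le> C * C * (2 * M * D) powr \<alpha> * (2 * M) powr \<alpha>"
      using M1 by (simp add: sum_divide_distrib[symmetric] divide_le_eq)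
    also have "\<dots> = C * C * ((2 * M * D) * (2 * M)) powr \<alpha>"
      by (simp only: powr_mult mult_ac)
    also have "(2 * M * D) * (2 * M) = (4 * M * M) * D" by simp
    also have "((4 * M * M) * D) powr \<alpha> = (4 * M * M) powr \<alpha> * D powr \<alpha>"
      by (rule powr_mult)
    finally have up: "(\<Sum>i<n. r i powr \<alpha>) \<le> C * C * (4 * M * M) powr \<alpha> * D powr \<alpha>" by (simp add: mult_ac)
    have small: "r i \<le> \<epsilon> * D" if "i < n" for i
    proof -
      have D1: "\<rho> (x i) (x 0) \<le> M * D" using inD[OF x[of i]] that by (simp add: rho.commute)
      have D2: "\<rho> (x i) (x n) \<le> (M + 1) * D"
        using rho.triangle[OF xX[of i] xX[of 0] xX[of n]] D1 by (simp add: D_def algebra_simps)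
      have "r i \<le> \<theta> \<eta> * \<rho> (x i) (x j)" if j: "i \<noteq> j" "2 * \<bar>real i - real j\<bar> \<ge> n" for j
        unfolding r_def
      proof (rule qq)
        have "d (x i) (x (Suc i)) \<le> 2 * K" by (rule dstep)
        also have "\<dots> \<le> \<eta> * c * (n / 2)" using n\<eta> by simp
        also have "\<dots> \<le> \<eta> * c * \<bar>real i - real j\<bar>" using j \<eta> c by (intro mult_left_mono) auto
        also have "\<dots> \<le> \<eta> * d (x i) (x j)" using low[of i j] \<eta> by (simp add: mult.assoc)
        finally show "d (x i) (x (Suc i)) \<le> \<eta> * d (x i) (x j)" .
      qed (use xX xne j in auto)
      \<comment> \<open>At least one end of the chain is \<open>n / 2\<close> or more steps away
        from \<open>x i\<close>.\<close>
      moreover have "(i \<noteq> 0 \<and> 2 * \<bar>real i - real 0\<bar> \<ge> n) \<or> (i \<noteq> n \<and> 2 * \<bar>real i - real n\<bar> \<ge> n)"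
        using that by auto
      ultimately have "r i \<le> \<theta> \<eta> * max (\<rho> (x i) (x 0)) (\<rho> (x i) (x n))"
        using \<eta> \<epsilon> M1 by (smt (verit) divide_nonneg_nonneg mult_left_mono)
      also have "\<dots> \<le> \<theta> \<eta> * ((M + 1) * D)"
        using D1 D2 Dpos \<eta> \<epsilon> M1 by (intro mult_left_mono) (auto simp: algebra_simps)
      also have "\<dots> = \<epsilon> * D" using \<eta> M1 by simp
      finally show ?thesis .
    qed
    have chain: "\<rho> (x 0) (x m) \<le> (\<Sum>i<m. r i)" for m
    proof (induction m)
      case 0 then show ?case using xX[of 0] by simp
    next
      case (Suc m)
      then show ?case using rho.triangle[OF xX[of 0] xX[of m] xX[of "Suc m"]] by (simp add: r_def)
    qed
    \<comment> \<open>The \<open>r i\<close> add up to at least \<open>D\<close>, and each is at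
      most \<open>\<epsilon> * D\<close>; as \<open>\<alpha> - 1\<close> is negative, this bounds
      the sum of the \<open>r i powr \<alpha>\<close> from below.\<close>
    have "\<epsilon> powr (\<alpha> - 1) * D powr \<alpha> = D * (\<epsilon> * D) powr (\<alpha> - 1)"
      using Dpos \<epsilon> by (simp add: powr_mult powr_diff)
    also have "\<dots> \<le> (\<Sum>i<n. r i) * (\<epsilon> * D) powr (\<alpha> - 1)"
      using chain[of n] by (intro mult_right_mono) (auto simp: D_def)
    also have "\<dots> = (\<Sum>i<n. r i * (\<epsilon> * D) powr (\<alpha> - 1))" by (rule sum_distrib_right)
    also have "\<dots> \<le> (\<Sum>i<n. r i powr \<alpha>)"
    proof (rule sum_mono)
      fix i assume "i \<in> {..<n}"
      then have "(\<epsilon> * D) powr (\<alpha> - 1) \<le> r i powr (\<alpha> - 1)"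
        using \<alpha>1 small[of i] rpos[of i] by (intro powr_mono2') auto
      then have "r i * (\<epsilon> * D) powr (\<alpha> - 1) \<le> r i * r i powr (\<alpha> - 1)"
        using rpos[of i] by (intro mult_left_mono) auto
      also have "\<dots> = r i powr \<alpha>" using rpos[of i] by (simp add: powr_diff)
      finally show "r i * (\<epsilon> * D) powr (\<alpha> - 1) \<le> r i powr \<alpha>" .
    qed
    also note up
    finally show ?thesis using Dpos by simp
  qed
  have "1 \<le> \<alpha>"
  proof (rule ccontr)
    assume "\<not> 1 \<le> \<alpha>"
    then have \<alpha>1: "\<alpha> < 1" by simp
    \<comment> \<open>One more than the bound in \<open>key\<close>; the \<open>\<epsilon>\<close>
      chosen below makes the left side equal to \<open>Q\<close>.\<close>
    define Q where "Q = C * C * (4 * M * M) powr \<alpha> + 1"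
    have "C * C * (4 * M * M) powr \<alpha> \<ge> 0" by simp
    then have Q: "Q > 0" unfolding Q_def by linarith
    have "(Q powr (1 / (\<alpha> - 1))) powr (\<alpha> - 1) = Q"
      using Q \<alpha>1 by (simp add: powr_powr)
    then show False using key[OF _ \<alpha>1, of "Q powr (1 / (\<alpha> - 1))"] Q by (simp add: Q_def)
  qed
  then show "1 \<le> ereal \<alpha>" by (simp add: one_ereal_def)
qed

section \<open>Dyadic index spaces\<close>

lemma summable_on_abs_bound:
  fixes f g :: "'b \<Rightarrow> real"
  assumes "f summable_on A" "\<And>x. x \<in> A \<Longrightarrow> \<bar>g x\<bar> \<le> f x"
  shows "g summable_on A"
proof (rule abs_summable_summable)
  show "(\<lambda>x. norm (g x)) summable_on A"
    by (rule summable_on_comparison_test[OF assms(1)]) (use assms(2) in auto)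
qed

text \<open>The space of infinite branches of a forest of binary trees, one tree for each natural
  number: \<open>c n x\<close> numbers the vertices of generation \<open>n\<close>, and halving
  leads to the parent. That every branch carries a point (\<open>c_ex\<close>) will give
  completeness.\<close>

locale dyadic =
  fixes X :: "'a set" and c :: "nat \<Rightarrow> 'a \<Rightarrow> nat" and \<mu> :: "'a measure"
  assumes c_div: "x \<in> X \<Longrightarrow> c (Suc n) x div 2 = c n x"
    and c_inj: "x \<in> X \<Longrightarrow> y \<in> X \<Longrightarrow> (\<And>n. c n x = c n y) \<Longrightarrow> x = y"
    and c_ex: "(\<And>n. h (Suc n) div 2 = h n) \<Longrightarrow> \<exists>x\<in>X. \<forall>n. c n x = h n"
    and space_mu: "space \<mu> = X"
    and sets_mu: "sets \<mu> = sigma_sets X {{x\<in>X. c n x = k} |n k. True}"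
    and emeasure_cell': "emeasure \<mu> {x\<in>X. c n x = k} = ennreal (1 / 2 ^ n)"
begin

section \<open>Cells, blocks and locally square integrable functions\<close>

definition cell :: "nat \<Rightarrow> nat \<Rightarrow> 'a set" where "cell n k = {x\<in>X. c n x = k}"

lemma in_cell [simp]: "x \<in> cell n k \<longleftrightarrow> x \<in> X \<and> c n x = k"
  by (simp add: cell_def)

lemma c_le:
  assumes "x \<in> X" "m \<le> n"
  shows "c m x = c n x div 2 ^ (n - m)"
  using assms(2)
proof (induction n rule: dec_induct)
  case (step n)
  have "c m x = (c (Suc n) x div 2) div 2 ^ (n - m)" using step c_div[OF assms(1)] by simp
  also have "\<dots> = c (Suc n) x div 2 ^ (Suc n - m)"
    using step by (simp add: div_mult2_eq Suc_diff_le)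
  finally show ?case .
qed simp

lemma c_eq_le: "x \<in> X \<Longrightarrow> y \<in> X \<Longrightarrow> c n x = c n y \<Longrightarrow> m \<le> n \<Longrightarrow> c m x = c m y"
  by (simp add: c_le)

lemma cell_nonempty: "\<exists>x. x \<in> cell n k"
proof -
  \<comment> \<open>The ancestors of cell \<open>k\<close> up to level \<open>n\<close>, then always
    the left child.\<close>
  define h where "h m = (if m \<le> n then k div 2 ^ (n - m) else k * 2 ^ (m - n))" for m
  have "h (Suc m) div 2 = h m" for m
  proof -
    consider "Suc m \<le> n" | "m = n" | "m > n" by linarith
    then show ?thesis
    proof cases
      case 1
      then have "n - m = Suc (n - Suc m)" by simp
      then show ?thesis using 1 by (simp add: h_def div_mult2_eq[symmetric] mult.commute)
    next
      case 3
      then have "Suc m - n = Suc (m - n)" by simp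
      then show ?thesis using 3 by (simp add: h_def)
    qed (simp add: h_def)
  qed
  then obtain x where "x \<in> X" "\<forall>m. c m x = h m" using c_ex by blast
  then have "x \<in> cell n k" by (simp add: h_def)
  then show ?thesis by blast
qed

lemma X_nonempty: "X \<noteq> {}" using cell_nonempty[of 0 0] by auto

lemma cell_sets [measurable, simp]: "cell n k \<in> sets \<mu>"
  unfolding sets_mu by (rule sigma_sets.Basic) (auto simp: cell_def)

lemma X_sets [measurable, simp]: "X \<in> sets \<mu>"
  using sets.top[of \<mu>] space_mu by simp

lemma c_measurable [measurable]: "c n \<in> measurable \<mu> (count_space UNIV)"
proof (rule measurableI)
  fix A :: "nat set"
  have "c n -` A \<inter> space \<mu> = (\<Union>k\<in>A. cell n k)" by (auto simp: space_mu)
  also have "\<dots> \<in> sets \<mu>" by (intro sets.countable_UN'') auto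
  finally show "c n -` A \<inter> space \<mu> \<in> sets \<mu>" .
qed simp

lemma emeasure_cell: "emeasure \<mu> (cell n k) = ennreal (1 / 2 ^ n)"
  using emeasure_cell' by (simp add: cell_def)

lemma measure_cell: "measure \<mu> (cell n k) = 1 / 2 ^ n"
  by (simp add: measure_def emeasure_cell)

text \<open>Level \<open>0\<close> of the index encodes a pair of neighbouring unit cells (only one cell for \<open>k = 0\<close>, where
  \<open>k - 1 = 0\<close>), and level \<open>n + 1\<close> encodes the cells of level \<open>n\<close>.\<close>

definition blk :: "nat \<times> nat \<Rightarrow> 'a set" where
  "blk p = (case p of (0, k) \<Rightarrow> cell 0 k \<union> cell 0 (k - 1) | (Suc n, k) \<Rightarrow> cell n k)"

text \<open>The weights of the levels \<open>0, \<dots>, n + 1\<close> act on a Haar component of level \<open>n\<close> as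
  \<open>1 + 7 * (8 ^ 0 + \<dots> + 8 ^ n) = 8 ^ (n + 1)\<close>.\<close>

definition wt :: "nat \<times> nat \<Rightarrow> real" where
  "wt p = (case p of (0, k) \<Rightarrow> 1 / 2 | (Suc n, k) \<Rightarrow> 7 * 8 ^ n)"

lemma blk_simps: "blk (0, k) = cell 0 k \<union> cell 0 (k - 1)" "blk (Suc n, k) = cell n k"
  by (simp_all add: blk_def)

lemma wt_simps: "wt (0, k) = 1 / 2" "wt (Suc n, k) = 7 * 8 ^ n"
  by (simp_all add: wt_def)

lemma wt_pos: "0 < wt p" and wt_nonneg: "0 \<le> wt p"
  by (auto simp: wt_def split: prod.split nat.split)

lemma blk_sets [measurable, simp]: "blk p \<in> sets \<mu>"
  by (auto simp: blk_def split: prod.split nat.split)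

lemma blk_sub: "blk p \<subseteq> X"
  by (auto simp: blk_def split: prod.split nat.split)

lemma blk_cover: "\<exists>i j. blk p \<subseteq> cell 0 i \<union> cell 0 j"
proof (cases p)
  case (Pair n k)
  show ?thesis
  proof (cases n)
    case 0 then show ?thesis using Pair by (auto simp: blk_simps)
  next
    case (Suc m)
    then have "blk p \<subseteq> cell 0 (k div 2 ^ m)" using Pair by (auto simp: blk_simps c_le[of _ 0 m])
    then show ?thesis by blast
  qed
qed

lemma cell_fmeasurable: "cell n k \<in> fmeasurable \<mu>"
  by (rule fmeasurableI) (simp_all add: emeasure_cell)

lemma blk_fmeasurable: "blk p \<in> fmeasurable \<mu>"
  by (auto simp: blk_def cell_fmeasurable split: prod.split nat.split intro: fmeasurable.Un)

definition vol :: "nat \<times> nat \<Rightarrow> real" where "vol p = measure \<mu> (blk p)"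

lemma vol_Suc: "vol (Suc n, k) = 1 / 2 ^ n" by (simp add: vol_def blk_simps measure_cell)

lemma vol_pos: "0 < vol p"
proof (cases p)
  case (Pair n k)
  show ?thesis
  proof (cases n)
    case 0
    have "measure \<mu> (cell 0 k) \<le> measure \<mu> (blk p)"
      using Pair 0 blk_fmeasurable[of p] by (intro measure_mono_fmeasurable) (auto simp: blk_simps)
    then show ?thesis by (simp add: vol_def measure_cell)
  next
    case (Suc m) then show ?thesis using Pair by (simp add: vol_Suc)
  qed
qed

definition I :: "'a set \<Rightarrow> ('a \<Rightarrow> real) \<Rightarrow> real" where
  "I S u = (LINT x|\<mu>. indicator S x * u x)"

text \<open>Constants lie in the form domain although the whole space has infinite measure, so
  square integrability is asked over each unit cell only.\<close>

definition lloc :: "('a \<Rightarrow> real) \<Rightarrow> bool" where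
  "lloc u \<longleftrightarrow> u \<in> borel_measurable \<mu> \<and> (\<forall>k. integrable \<mu> (\<lambda>x. indicator (cell 0 k) x * (u x)\<^sup>2))"

lemma lloc_meas: "lloc u \<Longrightarrow> u \<in> borel_measurable \<mu>" by (simp add: lloc_def)

text \<open>Two unit cells, because a block of level 0 may straddle two of them.\<close>

definition bset :: "'a set \<Rightarrow> bool" where
  "bset S \<longleftrightarrow> S \<in> sets \<mu> \<and> (\<exists>i j. S \<subseteq> cell 0 i \<union> cell 0 j)"

lemma bset_blk [simp]: "bset (blk p)" using blk_cover by (simp add: bset_def)

lemma bset_cell [simp]: "bset (cell n k)" using bset_blk[of "(Suc n, k)"] by (simp add: blk_simps)

lemma bset_sets: "bset S \<Longrightarrow> S \<in> sets \<mu>" by (simp add: bset_def)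

lemma bset_fmeasurable: "bset S \<Longrightarrow> S \<in> fmeasurable \<mu>"
  unfolding bset_def by (meson cell_fmeasurable fmeasurable.Un fmeasurableI2)

lemma bset_integrable_indicator: "bset S \<Longrightarrow> integrable \<mu> (indicator S :: 'a \<Rightarrow> real)"
  using bset_fmeasurable[of S] by (auto simp: fmeasurable_def)

lemma integrable_sq:
  assumes "lloc u" "bset S"
  shows "integrable \<mu> (\<lambda>x. indicator S x * (u x)\<^sup>2)"
proof -
  obtain i j where S: "S \<subseteq> cell 0 i \<union> cell 0 j" "S \<in> sets \<mu>" using assms(2) by (auto simp: bset_def)
  have int: "integrable \<mu> (\<lambda>x. indicator (cell 0 i) x * (u x)\<^sup>2 + indicator (cell 0 j) x * (u x)\<^sup>2)"
    using assms(1) by (auto simp: lloc_def)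
  have meas: "(\<lambda>x. indicator S x * (u x)\<^sup>2) \<in> borel_measurable \<mu>"
    using S lloc_meas[OF assms(1)] by measurable
  have "norm (indicator S x * (u x)\<^sup>2)
      \<le> norm (indicator (cell 0 i) x * (u x)\<^sup>2 + indicator (cell 0 j) x * (u x)\<^sup>2)" for x
    using S(1) by (auto simp: indicator_def simp del: in_cell)
  then show ?thesis
    by (intro Bochner_Integration.integrable_bound[OF int meas] AE_I2)
qed

lemma integrable_prod:
  assumes "lloc u" "lloc v" "bset S"
  shows "integrable \<mu> (\<lambda>x. indicator S x * (u x * v x))"
proof -
  have "integrable \<mu> (\<lambda>x. indicator S x * (u x)\<^sup>2 + indicator S x * (v x)\<^sup>2)"
    using assms integrable_sq by auto
  moreover have "(\<lambda>x. indicator S x * (u x * v x)) \<in> borel_measurable \<mu>"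
    using bset_sets[OF assms(3)] lloc_meas[OF assms(1)] lloc_meas[OF assms(2)] by measurable
  moreover have "\<bar>a * b\<bar> \<le> a\<^sup>2 + b\<^sup>2" for a b :: real
  proof -
    have "2 * \<bar>a * b\<bar> \<le> a\<^sup>2 + b\<^sup>2" using sum_squares_bound[of "\<bar>a\<bar>" "\<bar>b\<bar>"] by (simp add: abs_mult)
    then show ?thesis by simp
  qed
  ultimately show ?thesis
    by (elim Bochner_Integration.integrable_bound) (auto simp: indicator_def)
qed

lemma lloc_const [simp]: "lloc (\<lambda>x. a)"
  using bset_integrable_indicator[OF bset_cell[of 0]] by (auto simp: lloc_def)

lemma integrable_one:
  assumes "lloc u" "bset S"
  shows "integrable \<mu> (\<lambda>x. indicator S x * u x)"
  using integrable_prod[OF assms(1) lloc_const[of 1] assms(2)] by simp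

lemma lloc_add [simp]:
  assumes "lloc u" "lloc v" shows "lloc (\<lambda>x. u x + v x)"
  unfolding lloc_def
proof (intro conjI allI)
  show "(\<lambda>x. u x + v x) \<in> borel_measurable \<mu>"
    using lloc_meas[OF assms(1)] lloc_meas[OF assms(2)] by measurable
  fix k
  have "integrable \<mu> (\<lambda>x. indicator (cell 0 k) x * (u x)\<^sup>2 + 2 * (indicator (cell 0 k) x * (u x * v x))
      + indicator (cell 0 k) x * (v x)\<^sup>2)"
    by (intro Bochner_Integration.integrable_add integrable_mult_right integrable_sq integrable_prod assms bset_cell)
  then show "integrable \<mu> (\<lambda>x. indicator (cell 0 k) x * (u x + v x)\<^sup>2)"
    by (simp add: power2_eq_square algebra_simps)
qed

lemma lloc_scale [simp]:
  assumes "lloc u" shows "lloc (\<lambda>x. a * u x)"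
proof -
  have "integrable \<mu> (\<lambda>x. a\<^sup>2 * (indicator (cell 0 k) x * (u x)\<^sup>2))" for k
    by (intro integrable_mult_right integrable_sq assms bset_cell)
  then show ?thesis using assms unfolding lloc_def
    by (auto simp: power_mult_distrib mult_ac)
qed

lemma lloc_diff [simp]:
  assumes "lloc u" "lloc v" shows "lloc (\<lambda>x. u x - v x)"
  using lloc_add[OF assms(1) lloc_scale[OF assms(2), of "-1"]] by simp

lemma I_add: "lloc u \<Longrightarrow> lloc v \<Longrightarrow> bset S \<Longrightarrow> I S (\<lambda>x. u x + v x) = I S u + I S v"
  unfolding I_def by (simp add: distrib_left integrable_one)

lemma I_diff: "lloc u \<Longrightarrow> lloc v \<Longrightarrow> bset S \<Longrightarrow> I S (\<lambda>x. u x - v x) = I S u - I S v"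
  unfolding I_def by (simp add: right_diff_distrib integrable_one)

lemma I_scale: "I S (\<lambda>x. a * u x) = a * I S u"
proof -
  have "(\<lambda>x. indicator S x * (a * u x)) = (\<lambda>x. a * (indicator S x * u x))" by (auto simp: mult_ac)
  then show ?thesis by (simp add: I_def)
qed

lemma I_cong: "(\<And>x. x \<in> S \<Longrightarrow> u x = v x) \<Longrightarrow> I S u = I S v"
  unfolding I_def by (intro Bochner_Integration.integral_cong) (auto simp: indicator_def)

lemma I_const: "bset S \<Longrightarrow> I S (\<lambda>x. a) = a * measure \<mu> S"
  unfolding I_def using bset_fmeasurable[of S] bset_sets[of S] sets.sets_into_space[of S \<mu>]
  by (simp add: Int_absorb2)

lemma I_nonneg: "(\<And>x. x \<in> S \<Longrightarrow> 0 \<le> u x) \<Longrightarrow> 0 \<le> I S u"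
  unfolding I_def by (intro Bochner_Integration.integral_nonneg) (auto simp: indicator_def)

lemma I_sq_mono:
  assumes "lloc u" "lloc v" "bset S" "\<And>x. x \<in> S \<Longrightarrow> \<bar>u x\<bar> \<le> \<bar>v x\<bar>"
  shows "I S (\<lambda>x. (u x)\<^sup>2) \<le> I S (\<lambda>x. (v x)\<^sup>2)"
  unfolding I_def
proof (rule integral_mono)
  show "indicator S x * (u x)\<^sup>2 \<le> indicator S x * (v x)\<^sup>2" for x
    using assms(4)[of x] by (auto simp: indicator_def abs_le_square_iff)
qed (intro integrable_sq assms)+

lemma I_prod_add:
  "lloc u \<Longrightarrow> lloc v \<Longrightarrow> lloc w \<Longrightarrow> bset S \<Longrightarrow>
    I S (\<lambda>x. (u x + v x) * w x) = I S (\<lambda>x. u x * w x) + I S (\<lambda>x. v x * w x)"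
  unfolding I_def
  by (subst Bochner_Integration.integral_add[symmetric]) (simp_all only: integrable_prod distrib_left distrib_right)

section \<open>Covariances over the blocks\<close>

definition cov :: "nat \<times> nat \<Rightarrow> ('a \<Rightarrow> real) \<Rightarrow> ('a \<Rightarrow> real) \<Rightarrow> real" where
  "cov p u v = I (blk p) (\<lambda>x. u x * v x) - I (blk p) u * I (blk p) v / vol p"

lemma cov_sym: "cov p u v = cov p v u"
  by (simp add: cov_def mult.commute)

lemma cov_add: "lloc u \<Longrightarrow> lloc v \<Longrightarrow> lloc w \<Longrightarrow> cov p (\<lambda>x. u x + v x) w = cov p u w + cov p v w"
  unfolding cov_def by (simp only: I_prod_add I_add bset_blk) (simp add: add_divide_distrib distrib_right)

lemma cov_scale: "cov p (\<lambda>x. a * u x) v = a * cov p u v"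
  unfolding cov_def by (simp add: I_scale mult.assoc right_diff_distrib)

lemma cov_diff: "lloc u \<Longrightarrow> lloc v \<Longrightarrow> lloc w \<Longrightarrow> cov p (\<lambda>x. u x - v x) w = cov p u w - cov p v w"
  using cov_add[of u "\<lambda>x. -1 * v x" w p] cov_scale[of p "-1" v w] lloc_scale[of v "-1"] by simp

lemma cov_cong:
  assumes "\<And>x. x \<in> blk p \<Longrightarrow> u x = u' x" "\<And>x. x \<in> blk p \<Longrightarrow> v x = v' x"
  shows "cov p u v = cov p u' v'"
proof -
  have "I (blk p) (\<lambda>x. u x * v x) = I (blk p) (\<lambda>x. u' x * v' x)" by (rule I_cong) (simp add: assms)
  moreover have "I (blk p) u = I (blk p) u'" "I (blk p) v = I (blk p) v'" by (intro I_cong assms; assumption)+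
  ultimately show ?thesis by (simp add: cov_def)
qed

lemma cov_const: "lloc v \<Longrightarrow> cov p (\<lambda>x. a) v = 0"
  using vol_pos[of p] I_scale[of "blk p" a v] by (simp add: cov_def I_const vol_def)

lemma cov_shift: "lloc u \<Longrightarrow> lloc v \<Longrightarrow> cov p (\<lambda>x. u x + a) v = cov p u v"
  by (simp add: cov_add cov_const)

text \<open>Steiner's identity for an unnormalised measure: mean square about \<open>a\<close>
  equals variance plus squared deviation of the mean. Hence the mean is the best constant.\<close>

lemma I_sq_shift:
  assumes "lloc u"
  shows "I (blk p) (\<lambda>x. (u x - a)\<^sup>2) = cov p u u + (I (blk p) u - a * vol p)\<^sup>2 / vol p"
proof -
  have eq: "(\<lambda>x. (u x - a)\<^sup>2) = (\<lambda>x. (u x + (- a)) * (u x + (- a)))"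
    by (simp add: power2_eq_square)
  have sq: "(I (blk p) u - a * vol p)\<^sup>2 / vol p
      = I (blk p) u * I (blk p) u / vol p - 2 * a * I (blk p) u + a * a * vol p"
    using vol_pos[of p] by (simp add: field_simps power2_eq_square)
  have "I (blk p) (\<lambda>x. (u x + (- a)) * (u x + (- a)))    = I (blk p) (\<lambda>x. u x * (u x + (- a))) + I (blk p) (\<lambda>x. (- a) * (u x + (- a)))"
    by (intro I_prod_add assms lloc_add lloc_const bset_blk)
  also have "I (blk p) (\<lambda>x. u x * (u x + (- a))) = I (blk p) (\<lambda>x. (u x + (- a)) * u x)"
    by (simp add: mult.commute)
  also have "\<dots> = I (blk p) (\<lambda>x. u x * u x) + I (blk p) (\<lambda>x. (- a) * u x)"
    by (intro I_prod_add assms lloc_add lloc_const bset_blk)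
  also have "I (blk p) (\<lambda>x. (- a) * u x) = - a * I (blk p) u" by (rule I_scale)
  also have "I (blk p) (\<lambda>x. (- a) * (u x + (- a))) = - a * I (blk p) (\<lambda>x. u x + (- a))" by (rule I_scale)
  also have "I (blk p) (\<lambda>x. u x + (- a)) = I (blk p) u + (- a) * vol p"
    using I_add[OF assms lloc_const[of "- a"] bset_blk] I_const[OF bset_blk, of p "- a"] by (simp add: vol_def)
  finally show ?thesis
    unfolding eq sq by (simp add: cov_def algebra_simps)
qed

lemma cov_le_sq: "lloc u \<Longrightarrow> cov p u u \<le> I (blk p) (\<lambda>x. (u x - a)\<^sup>2)"
  using vol_pos[of p] by (simp add: I_sq_shift)

lemma cov_eq_sq: "lloc u \<Longrightarrow> cov p u u = I (blk p) (\<lambda>x. (u x - I (blk p) u / vol p)\<^sup>2)"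
  using vol_pos[of p] by (simp add: I_sq_shift)

lemma cov_nonneg: "lloc u \<Longrightarrow> 0 \<le> cov p u u"
  by (simp add: cov_eq_sq I_nonneg)

lemma cov_square_add:
  assumes "lloc u" "lloc v"
  shows "cov p (\<lambda>x. u x + v x) (\<lambda>x. u x + v x) = cov p u u + 2 * cov p u v + cov p v v"
proof -
  have "cov p (\<lambda>x. u x + v x) (\<lambda>x. u x + v x) = cov p u (\<lambda>x. u x + v x) + cov p v (\<lambda>x. u x + v x)"
    by (intro cov_add assms lloc_add)
  also have "cov p u (\<lambda>x. u x + v x) = cov p u u + cov p v u"
    by (subst cov_sym) (intro cov_add assms)
  also have "cov p v (\<lambda>x. u x + v x) = cov p u v + cov p v v"
    by (subst cov_sym) (intro cov_add assms)
  finally show ?thesis by (simp add: cov_sym[of p v u])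
qed

lemma cov_square_diff:
  assumes "lloc u" "lloc v"
  shows "cov p (\<lambda>x. u x - v x) (\<lambda>x. u x - v x) = cov p u u - 2 * cov p u v + cov p v v"
proof -
  have "cov p (\<lambda>x. u x - v x) (\<lambda>x. u x - v x) = cov p u (\<lambda>x. u x - v x) - cov p v (\<lambda>x. u x - v x)"
    by (intro cov_diff assms lloc_diff)
  also have "cov p u (\<lambda>x. u x - v x) = cov p u u - cov p v u"
    by (subst cov_sym) (intro cov_diff assms)
  also have "cov p v (\<lambda>x. u x - v x) = cov p u v - cov p v v"
    by (subst cov_sym) (intro cov_diff assms)
  finally show ?thesis by (simp add: cov_sym[of p v u])
qed

lemma abs_cov_le:
  assumes "lloc u" "lloc v"
  shows "\<bar>cov p u v\<bar> \<le> (cov p u u + cov p v v) / 2"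
proof -
  have "0 \<le> a + 2 * b + d \<Longrightarrow> 0 \<le> a - 2 * b + d \<Longrightarrow> \<bar>b\<bar> \<le> (a + d) / 2" for a b d :: real
    by (simp add: abs_le_iff)
  then show ?thesis
    using cov_nonneg[OF lloc_add[OF assms], of p] cov_nonneg[OF lloc_diff[OF assms], of p]
    unfolding cov_square_add[OF assms] cov_square_diff[OF assms] by blast
qed

lemma cov_add_le:
  assumes "lloc u" "lloc v"
  shows "cov p (\<lambda>x. u x + v x) (\<lambda>x. u x + v x) \<le> 2 * cov p u u + 2 * cov p v v"
proof -
  have "\<bar>b\<bar> \<le> (a + d) / 2 \<Longrightarrow> a + 2 * b + d \<le> 2 * a + 2 * d" for a b d :: real
    by (simp add: abs_le_iff)
  then show ?thesis
    using abs_cov_le[OF assms, of p] unfolding cov_square_add[OF assms] by blast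
qed

lemma I_square_le:
  assumes "lloc u"
  shows "(I (blk p) u)\<^sup>2 \<le> vol p * I (blk p) (\<lambda>x. (u x)\<^sup>2)"
  using cov_nonneg[OF assms, of p] vol_pos[of p] by (simp add: cov_def power2_eq_square field_simps)

text \<open>The variance of \<open>f (u x)\<close> is at most its mean square about
  \<open>f m\<close>, with \<open>m\<close> the mean of \<open>u\<close>, and there \<open>f\<close>
  contracts. The Markov property follows block by block.\<close>

lemma cov_contraction:
  assumes "lloc u" "lloc (\<lambda>x. f (u x))" and f: "\<And>a b. \<bar>f a - f b\<bar> \<le> \<bar>a - b\<bar>"
  shows "cov p (\<lambda>x. f (u x)) (\<lambda>x. f (u x)) \<le> cov p u u"
proof -
  define m where "m = I (blk p) u / vol p"
  have "cov p (\<lambda>x. f (u x)) (\<lambda>x. f (u x)) \<le> I (blk p) (\<lambda>x. (f (u x) - f m)\<^sup>2)"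
    by (rule cov_le_sq[OF assms(2)])
  also have "\<dots> \<le> I (blk p) (\<lambda>x. (u x - m)\<^sup>2)"
  proof (rule I_sq_mono)
    show "\<bar>f (u x) - f m\<bar> \<le> \<bar>u x - m\<bar>" for x by (rule f)
  qed (intro lloc_diff assms lloc_const bset_blk)+
  also have "\<dots> = cov p u u" unfolding m_def by (rule cov_eq_sq[OF assms(1), symmetric])
  finally show ?thesis .
qed

section \<open>The form\<close>

lemma I_mono_set:
  assumes "lloc w" "bset S" "bset T" "S \<subseteq> T"
  shows "I S (\<lambda>x. (w x)\<^sup>2) \<le> I T (\<lambda>x. (w x)\<^sup>2)"
  unfolding I_def
proof (rule integral_mono)
  show "indicator S x * (w x)\<^sup>2 \<le> indicator T x * (w x)\<^sup>2" for x
    using assms(4) by (auto simp: indicator_def)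
qed (intro integrable_sq assms)+

lemma I_Un:
  assumes "lloc w" "bset S" "bset T" "S \<inter> T = {}"
  shows "I (S \<union> T) w = I S w + I T w"
proof -
  have "indicator (S \<union> T) x * w x = indicator S x * w x + indicator T x * w x" for x
    using assms(4) by (cases "x \<in> S"; cases "x \<in> T") auto
  then show ?thesis
    unfolding I_def using integrable_one[OF assms(1,2)] integrable_one[OF assms(1,3)]
    by (simp add: Bochner_Integration.integral_add)
qed

lemma lloc_sq_integral_Un:
  assumes "lloc w" "bset S" "bset T" "S \<inter> T = {}"
  shows "I (S \<union> T) (\<lambda>x. (w x)\<^sup>2) = I S (\<lambda>x. (w x)\<^sup>2) + I T (\<lambda>x. (w x)\<^sup>2)"
proof -
  have "indicator (S \<union> T) x * (w x)\<^sup>2 = indicator S x * (w x)\<^sup>2 + indicator T x * (w x)\<^sup>2" for x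
    using assms(4) by (cases "x \<in> S"; cases "x \<in> T") auto
  then show ?thesis
    unfolding I_def using integrable_sq[OF assms(1,2)] integrable_sq[OF assms(1,3)]
    by (simp add: Bochner_Integration.integral_add)
qed

lemma I_abs_le:
  assumes "lloc w" "bset S" "\<And>x. x \<in> S \<Longrightarrow> \<bar>w x\<bar> \<le> B"
  shows "\<bar>I S w\<bar> \<le> B * measure \<mu> S"
proof -
  have "I S w \<le> I S (\<lambda>x. B)"
    unfolding I_def
    by (rule integral_mono[OF integrable_one[OF assms(1,2)] integrable_one[OF lloc_const assms(2)]])
      (use assms(3) in \<open>fastforce simp: indicator_def\<close>)
  moreover have "I S (\<lambda>x. - B) \<le> I S w"
    unfolding I_def
    by (rule integral_mono[OF integrable_one[OF lloc_const assms(2)] integrable_one[OF assms(1,2)]])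
      (use assms(3) in \<open>fastforce simp: indicator_def\<close>)
  ultimately show ?thesis using I_const[OF assms(2), of B] I_const[OF assms(2), of "- B"] by simp
qed

lemma lloc_bounded:
  assumes m: "u \<in> borel_measurable \<mu>" and b: "\<And>k. \<exists>B. \<forall>x\<in>cell 0 k. \<bar>u x\<bar> \<le> B"
  shows "lloc u"
  unfolding lloc_def
proof (intro conjI m allI)
  fix k
  obtain B where B: "\<And>x. x \<in> cell 0 k \<Longrightarrow> \<bar>u x\<bar> \<le> B" using b by blast
  have int: "integrable \<mu> (\<lambda>x. B\<^sup>2 * indicator (cell 0 k) x)"
    by (intro integrable_mult_right bset_integrable_indicator bset_cell)
  have meas: "(\<lambda>x. indicator (cell 0 k) x * (u x)\<^sup>2) \<in> borel_measurable \<mu>"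
    using m by measurable
  have "norm (indicator (cell 0 k) x * (u x)\<^sup>2) \<le> norm (B\<^sup>2 * indicator (cell 0 k) x)" for x
  proof (cases "x \<in> cell 0 k")
    case True
    then have "\<bar>u x\<bar> \<le> \<bar>B\<bar>" using B[OF True] by simp
    then show ?thesis using True by (simp add: abs_le_square_iff del: in_cell)
  qed (simp del: in_cell)
  then show "integrable \<mu> (\<lambda>x. indicator (cell 0 k) x * (u x)\<^sup>2)"
    by (intro Bochner_Integration.integrable_bound[OF int meas] AE_I2)
qed

text \<open>Lipschitz continuity for the tree metric inside each unit cell; points of different unit
  cells share no index and are not compared.\<close>

definition dyadic_lipschitz :: "real \<Rightarrow> ('a \<Rightarrow> real) \<Rightarrow> bool" where
  "dyadic_lipschitz M u \<longleftrightarrow> (\<forall>x\<in>X. \<forall>y\<in>X. \<forall>n. c n x = c n y \<longrightarrow> \<bar>u x - u y\<bar> \<le> M / 2 ^ n)"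

lemma dyadic_lipschitzD: "dyadic_lipschitz M u \<Longrightarrow> x \<in> X \<Longrightarrow> y \<in> X \<Longrightarrow> c n x = c n y \<Longrightarrow> \<bar>u x - u y\<bar> \<le> M / 2 ^ n"
  unfolding dyadic_lipschitz_def by blast

text \<open>Measurability comes from step functions: \<open>u\<close> is the pointwise limit of its
  values at the sample points \<open>z n k\<close> of the level \<open>n\<close> cells.\<close>

lemma dyadic_lipschitz_lloc:
  assumes "dyadic_lipschitz M u" shows "lloc u"
proof (rule lloc_bounded)
  define z where "z n k = (SOME x. x \<in> cell n k)" for n k
  have z: "z n k \<in> cell n k" for n k unfolding z_def by (rule someI_ex[OF cell_nonempty])
  have "(\<lambda>n. u (z n (c n x))) \<longlonglongrightarrow> u x" if "x \<in> X" for x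
  proof -
    have le: "\<bar>u (z n (c n x)) - u x\<bar> \<le> M / 2 ^ n" for n
      using z[of n "c n x"] that by (intro dyadic_lipschitzD[OF assms]) auto
    have l0: "(\<lambda>n. M / 2 ^ n) \<longlonglongrightarrow> 0" by (rule LIMSEQ_divide_realpow_zero) simp
    have "(\<lambda>n. u (z n (c n x)) - u x) \<longlonglongrightarrow> 0"
      by (rule Lim_null_comparison[OF _ l0]) (use le in auto)
    then show ?thesis by (rule LIM_zero_cancel)
  qed
  then have lim: "(\<lambda>n. u (z n (c n x))) \<longlonglongrightarrow> u x" if "x \<in> space \<mu>" for x
    using that unfolding space_mu .
  have "(\<lambda>k. u (z n k)) \<in> measurable (count_space UNIV) borel" for n by simp
  from measurable_compose[OF c_measurable this]
  have "(\<lambda>x. u (z n (c n x))) \<in> borel_measurable \<mu>" for n .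
  from borel_measurable_LIMSEQ_real[OF lim this]
  show "u \<in> borel_measurable \<mu>" .
  show "\<exists>B. \<forall>x\<in>cell 0 k. \<bar>u x\<bar> \<le> B" for k
  proof (intro exI ballI)
    fix x assume "x \<in> cell 0 k"
    then have "\<bar>u x - u (z 0 k)\<bar> \<le> M / 2 ^ 0" using z[of 0 k] by (intro dyadic_lipschitzD[OF assms]) auto
    then show "\<bar>u x\<bar> \<le> \<bar>u (z 0 k)\<bar> + M" by simp
  qed
qed

definition E :: "('a \<Rightarrow> real) \<Rightarrow> ('a \<Rightarrow> real) \<Rightarrow> real" where
  "E u v = (\<Sum>\<^sub>\<infinity>p. wt p * cov p u v)"

definition fin_energy :: "('a \<Rightarrow> real) \<Rightarrow> bool" where
  "fin_energy u \<longleftrightarrow> lloc u \<and> (\<lambda>p. wt p * cov p u u) summable_on UNIV"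

text \<open>Finite energy controls only classes of functions modulo null sets; the Lipschitz condition, with an
  unspecified constant, selects the continuous representative.\<close>

definition F :: "('a \<Rightarrow> real) set" where
  "F = {u. (\<forall>x. x \<notin> X \<longrightarrow> u x = 0) \<and> (\<exists>M. dyadic_lipschitz M u) \<and> fin_energy u}"

lemma fin_energyD: "fin_energy u \<Longrightarrow> lloc u" "fin_energy u \<Longrightarrow> (\<lambda>p. wt p * cov p u u) summable_on UNIV"
  by (auto simp: fin_energy_def)

lemma F_fin_energy: "u \<in> F \<Longrightarrow> fin_energy u" by (simp add: F_def)

lemma F_lloc: "u \<in> F \<Longrightarrow> lloc u" using F_fin_energy fin_energyD by blast

lemma fin_energy_cov_summable:
  assumes "fin_energy u" "fin_energy v"
  shows "(\<lambda>p. wt p * cov p u v) summable_on UNIV"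
proof (rule summable_on_abs_bound)
  show "(\<lambda>p. wt p * cov p u u + wt p * cov p v v) summable_on UNIV"
    using assms by (intro summable_on_add) (auto simp: fin_energy_def)
  fix p
  have l: "lloc u" "lloc v" using assms fin_energyD by auto
  have "\<bar>cov p u v\<bar> \<le> cov p u u + cov p v v"
    using abs_cov_le[OF l, of p] cov_nonneg[OF l(1), of p] cov_nonneg[OF l(2), of p] by simp
  then show "\<bar>wt p * cov p u v\<bar> \<le> wt p * cov p u u + wt p * cov p v v"
    using mult_left_mono[OF _ wt_nonneg[of p]] wt_nonneg[of p] by (simp add: abs_mult distrib_left[symmetric])
qed

lemma fin_energy_add:
  assumes "fin_energy u" "fin_energy v"
  shows "fin_energy (\<lambda>x. u x + v x)"
proof -
  have l: "lloc u" "lloc v" using assms fin_energyD by auto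
  have "(\<lambda>p. 2 * (wt p * cov p u u) + 2 * (wt p * cov p v v)) summable_on UNIV"
    using assms by (intro summable_on_add summable_on_cmult_right) (auto simp: fin_energy_def)
  then have "(\<lambda>p. wt p * cov p (\<lambda>x. u x + v x) (\<lambda>x. u x + v x)) summable_on UNIV"
  proof (rule summable_on_comparison_test)
    fix p
    have "wt p * cov p (\<lambda>x. u x + v x) (\<lambda>x. u x + v x) \<le> wt p * (2 * cov p u u + 2 * cov p v v)"
      by (intro mult_left_mono cov_add_le l wt_nonneg)
    then show "wt p * cov p (\<lambda>x. u x + v x) (\<lambda>x. u x + v x) \<le> 2 * (wt p * cov p u u) + 2 * (wt p * cov p v v)"
      by (simp add: distrib_left)
    show "0 \<le> wt p * cov p (\<lambda>x. u x + v x) (\<lambda>x. u x + v x)"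
      by (intro mult_nonneg_nonneg wt_nonneg cov_nonneg lloc_add l)
  qed
  then show ?thesis using l by (simp add: fin_energy_def)
qed

lemma cov_scale2: "cov p (\<lambda>x. a * u x) (\<lambda>x. a * u x) = a\<^sup>2 * cov p u u"
  unfolding cov_scale cov_sym[of p u "\<lambda>x. a * u x"] by (simp add: power2_eq_square)

lemma fin_energy_scale: "fin_energy u \<Longrightarrow> fin_energy (\<lambda>x. a * u x)"
  using summable_on_cmult_right[of "\<lambda>p. wt p * cov p u u" UNIV "a\<^sup>2"]
  unfolding fin_energy_def cov_scale2 by (simp add: mult_ac)

lemma E_sym: "E u v = E v u"
  unfolding E_def by (simp add: cov_sym)

lemma E_add: "fin_energy u \<Longrightarrow> fin_energy v \<Longrightarrow> fin_energy w \<Longrightarrow> E (\<lambda>x. u x + v x) w = E u w + E v w"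
  unfolding E_def by (subst infsum_add[symmetric])
    (auto intro!: fin_energy_cov_summable infsum_cong simp: cov_add fin_energyD distrib_left)

lemma E_scale: "E (\<lambda>x. a * u x) v = a * E u v"
  unfolding E_def cov_scale by (subst infsum_cmult_right'[symmetric]) (simp add: mult_ac)

lemma E_term_nonneg: "lloc u \<Longrightarrow> 0 \<le> wt p * cov p u u"
  by (intro mult_nonneg_nonneg wt_nonneg cov_nonneg)

lemma E_nonneg: "lloc u \<Longrightarrow> 0 \<le> E u u"
  unfolding E_def by (intro infsum_nonneg E_term_nonneg)

lemma E_ge_sum: "fin_energy u \<Longrightarrow> finite P \<Longrightarrow> (\<Sum>p\<in>P. wt p * cov p u u) \<le> E u u"
  unfolding E_def by (intro finite_sum_le_infsum) (auto simp: fin_energyD E_term_nonneg)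

lemma E_ge_term: "fin_energy u \<Longrightarrow> wt p * cov p u u \<le> E u u"
  using E_ge_sum[of u "{p}"] by simp

lemma F_add: "u \<in> F \<Longrightarrow> v \<in> F \<Longrightarrow> (\<lambda>x. u x + v x) \<in> F"
proof -
  assume u: "u \<in> F" and v: "v \<in> F"
  then obtain M N where MN: "dyadic_lipschitz M u" "dyadic_lipschitz N v" by (auto simp: F_def)
  have "dyadic_lipschitz (M + N) (\<lambda>x. u x + v x)"
    unfolding dyadic_lipschitz_def
  proof (intro ballI allI impI)
    fix x y n assume xy: "x \<in> X" "y \<in> X" "c n x = c n y"
    show "\<bar>u x + v x - (u y + v y)\<bar> \<le> (M + N) / 2 ^ n"
      using dyadic_lipschitzD[OF MN(1) xy] dyadic_lipschitzD[OF MN(2) xy] by (simp add: add_divide_distrib)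
  qed
  then show ?thesis using u v fin_energy_add by (auto simp: F_def)
qed

lemma F_scale: "u \<in> F \<Longrightarrow> (\<lambda>x. a * u x) \<in> F"
proof -
  assume u: "u \<in> F"
  then obtain M where M: "dyadic_lipschitz M u" by (auto simp: F_def)
  have "dyadic_lipschitz (\<bar>a\<bar> * M) (\<lambda>x. a * u x)"
    unfolding dyadic_lipschitz_def
  proof (intro ballI allI impI)
    fix x y n assume xy: "x \<in> X" "y \<in> X" "c n x = c n y"
    have "\<bar>a * u x - a * u y\<bar> = \<bar>a\<bar> * \<bar>u x - u y\<bar>" by (simp add: abs_mult[symmetric] algebra_simps)
    also have "\<dots> \<le> \<bar>a\<bar> * (M / 2 ^ n)" by (intro mult_left_mono dyadic_lipschitzD[OF M xy]) simp
    finally show "\<bar>a * u x - a * u y\<bar> \<le> \<bar>a\<bar> * M / 2 ^ n" by simp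
  qed
  then show ?thesis using u fin_energy_scale by (auto simp: F_def)
qed

lemma F_diff: "u \<in> F \<Longrightarrow> v \<in> F \<Longrightarrow> (\<lambda>x. u x - v x) \<in> F"
  using F_add[of u "\<lambda>x. -1 * v x"] F_scale[of v "-1"] by simp

section \<open>Pointwise bounds by the energy\<close>

definition A :: "nat \<Rightarrow> ('a \<Rightarrow> real) \<Rightarrow> 'a \<Rightarrow> real" where
  "A n u x = 2 ^ n * I (cell n (c n x)) u"

lemma A_close:
  assumes "dyadic_lipschitz M u" "x \<in> X" shows "\<bar>A n u x - u x\<bar> \<le> M / 2 ^ n"
proof -
  have l: "lloc u" using dyadic_lipschitz_lloc assms by blast
  let ?C = "cell n (c n x)"
  have "\<bar>I ?C (\<lambda>y. u y - u x)\<bar> \<le> (M / 2 ^ n) * measure \<mu> ?C"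
    using assms by (intro I_abs_le lloc_diff l lloc_const bset_cell dyadic_lipschitzD[OF assms(1)]) auto
  also have "I ?C (\<lambda>y. u y - u x) = I ?C u - u x / 2 ^ n"
    using I_diff[OF l lloc_const bset_cell] I_const[OF bset_cell] by (simp add: measure_cell)
  finally have "2 ^ n * \<bar>I ?C u - u x / 2 ^ n\<bar> \<le> M / 2 ^ n"
    by (simp add: measure_cell field_simps)
  also have "2 ^ n * \<bar>I ?C u - u x / 2 ^ n\<bar> = \<bar>2 ^ n * (I ?C u - u x / 2 ^ n)\<bar>" by (simp add: abs_mult)
  also have "2 ^ n * (I ?C u - u x / 2 ^ n) = A n u x - u x" by (simp add: A_def right_diff_distrib)
  finally show ?thesis .
qed

text \<open>The variance of \<open>u\<close> on a level \<open>m\<close> cell is at most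
  \<open>E u u / (7 * 8 ^ m)\<close>. The squared jump to the mean over one half is at most
  \<open>2 ^ Suc m\<close> times that, which is \<open>2 / 7 * E u u / 4 ^ m\<close>: the averages
  converge geometrically.\<close>

lemma A_step:
  assumes u: "fin_energy u" and x: "x \<in> X"
  shows "\<bar>A (Suc m) u x - A m u x\<bar> \<le> sqrt (E u u) / 2 ^ m"
proof -
  have l: "lloc u" using u fin_energyD by blast
  define a where "a = A m u x"
  define C where "C = cell m (c m x)"
  define C' where "C' = cell (Suc m) (c (Suc m) x)"
  have C: "C = blk (Suc m, c m x)" and C': "C' = blk (Suc (Suc m), c (Suc m) x)"
    by (simp_all add: C_def C'_def blk_simps)
  have sub: "C' \<subseteq> C"
    using c_eq_le[OF _ x, of _ "Suc m" m] by (auto simp: C_def C'_def)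
  have lw: "lloc (\<lambda>y. u y - a)" using l by simp
  have "I C' (\<lambda>y. u y - a) = I C' u - a / 2 ^ Suc m"
    using I_diff[OF l lloc_const, of C' a] I_const[of C' a] by (simp add: C'_def measure_cell)
  then have d: "A (Suc m) u x - A m u x = 2 ^ Suc m * I C' (\<lambda>y. u y - a)"
    by (simp add: A_def[of "Suc m"] a_def[symmetric] C'_def right_diff_distrib)
  have "(I C' (\<lambda>y. u y - a))\<^sup>2 \<le> 1 / 2 ^ Suc m * I C' (\<lambda>y. (u y - a)\<^sup>2)"
    using I_square_le[OF lw, of "(Suc (Suc m), c (Suc m) x)"] by (simp add: C' vol_Suc del: power_Suc)
  also have "\<dots> \<le> 1 / 2 ^ Suc m * I C (\<lambda>y. (u y - a)\<^sup>2)"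
    by (intro mult_left_mono I_mono_set lw sub) (simp_all add: C_def C'_def)
  also have "I C (\<lambda>y. (u y - a)\<^sup>2) = cov (Suc m, c m x) u u"
    unfolding C cov_eq_sq[OF l] a_def A_def by (simp add: vol_Suc blk_simps mult.commute)
  also have "1 / 2 ^ Suc m * cov (Suc m, c m x) u u \<le> 1 / 2 ^ Suc m * (E u u / (7 * 8 ^ m))"
    using E_ge_term[OF u, of "(Suc m, c m x)"]
    by (intro mult_left_mono) (simp_all add: wt_simps field_simps)
  finally have "(2 ^ Suc m)\<^sup>2 * (I C' (\<lambda>y. u y - a))\<^sup>2 \<le> (2 ^ Suc m)\<^sup>2 * (1 / 2 ^ Suc m * (E u u / (7 * 8 ^ m)))"
    by (intro mult_left_mono) simp_all
  also have "\<dots> = 2 / 7 * (E u u / (2 ^ m)\<^sup>2)"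
  proof -
    have "(8::real) ^ m = 2 ^ m * 2 ^ m * 2 ^ m" by (simp add: power_mult_distrib[symmetric])
    moreover have "(2 * p)\<^sup>2 * (1 / (2 * p) * (e / (7 * (p * p * p)))) = 2 / 7 * (e / p\<^sup>2)" if "p > 0" for p e :: real
      using that by (simp add: power2_eq_square field_simps)
    ultimately show ?thesis by simp
  qed
  also have "\<dots> \<le> 1 * (E u u / (2 ^ m)\<^sup>2)"
    by (intro mult_right_mono) (simp_all add: E_nonneg l)
  finally have "(A (Suc m) u x - A m u x)\<^sup>2 \<le> E u u / (2 ^ m)\<^sup>2" unfolding d by (simp add: power_mult_distrib)
  then have "sqrt ((A (Suc m) u x - A m u x)\<^sup>2) \<le> sqrt (E u u / (2 ^ m)\<^sup>2)" by (rule real_sqrt_le_mono)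
  then show ?thesis by (simp add: real_sqrt_divide)
qed

text \<open>The geometric series of \<open>A_step\<close>. The Lipschitz constant of
  \<open>u\<close> identifies the limit of the averages with \<open>u x\<close> and does not enter
  the bound.\<close>

lemma A_near:
  assumes u: "u \<in> F" and x: "x \<in> X"
  shows "\<bar>u x - A n u x\<bar> \<le> 2 * sqrt (E u u) / 2 ^ n"
proof -
  obtain M where M: "dyadic_lipschitz M u" using u by (auto simp: F_def)
  let ?s = "sqrt (E u u)"
  have "\<bar>A (n + j) u x - A n u x\<bar> \<le> ?s * (2 / 2 ^ n - 2 / 2 ^ (n + j))" for j
  proof (induction j)
    case (Suc j)
    have "\<bar>A (Suc (n + j)) u x - A (n + j) u x\<bar> \<le> ?s / 2 ^ (n + j)"
      by (rule A_step[OF F_fin_energy[OF u] x])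
    then have "\<bar>A (n + Suc j) u x - A n u x\<bar> \<le> ?s / 2 ^ (n + j) + ?s * (2 / 2 ^ n - 2 / 2 ^ (n + j))"
      using Suc by simp
    also have "\<dots> = ?s * (2 / 2 ^ n - 2 / 2 ^ (n + Suc j))" by (simp add: algebra_simps)
    finally show ?case .
  qed simp
  moreover have "?s * (2 / 2 ^ n - 2 / 2 ^ (n + j)) \<le> 2 * ?s / 2 ^ n" for j
  proof -
    have "?s * (2 / 2 ^ n - 2 / 2 ^ (n + j)) \<le> ?s * (2 / 2 ^ n)"
      using E_nonneg[OF F_lloc[OF u]] by (intro mult_left_mono) simp_all
    then show ?thesis by (simp add: mult.commute)
  qed
  ultimately have b: "\<bar>A (n + j) u x - A n u x\<bar> \<le> 2 * ?s / 2 ^ n" for j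
    using order_trans by blast
  have "(\<lambda>j. M / 2 ^ j) \<longlonglongrightarrow> 0" by (rule LIMSEQ_divide_realpow_zero) simp
  then have "(\<lambda>j. A j u x - u x) \<longlonglongrightarrow> 0"
    by (rule Lim_null_comparison[rotated]) (use A_close[OF M x] in auto)
  then have "(\<lambda>j. A j u x) \<longlonglongrightarrow> u x" by (rule LIM_zero_cancel)
  then have "(\<lambda>j. \<bar>A (n + j) u x - A n u x\<bar>) \<longlonglongrightarrow> \<bar>u x - A n u x\<bar>"
    by (intro tendsto_intros) (use LIMSEQ_ignore_initial_segment[of "\<lambda>j. A j u x" "u x" n] in \<open>simp add: add.commute\<close>)
  then show ?thesis by (rule LIMSEQ_le_const2) (use b in auto)
qed

lemma A_cong: "c n x = c n y \<Longrightarrow> A n u x = A n u y" by (simp add: A_def)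

text \<open>The unspecified constant in \<open>F\<close> is replaced by one that depends on the
  energy alone, so limits of sequences with bounded energy stay Lipschitz.\<close>

lemma dyadic_lipschitz_energy:
  assumes u: "u \<in> F" shows "dyadic_lipschitz (4 * sqrt (E u u)) u"
  unfolding dyadic_lipschitz_def
proof (intro ballI allI impI)
  fix x y n assume xy: "x \<in> X" "y \<in> X" "c n x = c n y"
  have "\<bar>s - a\<bar> \<le> 2 * e / k \<Longrightarrow> \<bar>t - a\<bar> \<le> 2 * e / k \<Longrightarrow> \<bar>s - t\<bar> \<le> 4 * e / k" for s t a e k :: real
    by simp
  then show "\<bar>u x - u y\<bar> \<le> 4 * sqrt (E u u) / 2 ^ n"
    using A_near[OF u xy(1), of n] A_near[OF u xy(2), of n] unfolding A_cong[OF xy(3)] .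
qed

text \<open>Both unit cells have measure 1, so by Cauchy-Schwarz the variance on their union
  dominates the variance of the two means.\<close>

lemma cov_pair_ge:
  assumes l: "lloc u"
  shows "(I (cell 0 (Suc k)) u - I (cell 0 k) u)\<^sup>2 / 2 \<le> cov (0, Suc k) u u"
proof -
  define a where "a = I (blk (0, Suc k)) u / vol (0, Suc k)"
  have lw: "lloc (\<lambda>x. u x - a)" using l by simp
  have one: "(I (cell 0 j) u - a)\<^sup>2 \<le> I (cell 0 j) (\<lambda>x. (u x - a)\<^sup>2)" for j
    using I_square_le[OF lw, of "(Suc 0, j)"] I_diff[OF l lloc_const, of "cell 0 j" a]
      I_const[of "cell 0 j" a] by (simp add: vol_Suc blk_simps measure_cell)
  have "cov (0, Suc k) u u = I (cell 0 (Suc k) \<union> cell 0 k) (\<lambda>x. (u x - a)\<^sup>2)"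
    unfolding cov_eq_sq[OF l] a_def by (simp add: blk_simps)
  also have "\<dots> = I (cell 0 (Suc k)) (\<lambda>x. (u x - a)\<^sup>2) + I (cell 0 k) (\<lambda>x. (u x - a)\<^sup>2)"
    by (intro lloc_sq_integral_Un lw bset_cell) auto
  finally have "(I (cell 0 (Suc k)) u - a)\<^sup>2 + (I (cell 0 k) u - a)\<^sup>2 \<le> cov (0, Suc k) u u"
    using one[of "Suc k"] one[of k] by simp
  moreover have "(s - t)\<^sup>2 / 2 \<le> (s - a)\<^sup>2 + (t - a)\<^sup>2" for s t :: real
  proof -
    have "2 * ((s - a)\<^sup>2 + (t - a)\<^sup>2) - (s - t)\<^sup>2 = ((s - a) + (t - a))\<^sup>2"
      by (simp add: power2_eq_square algebra_simps)
    also have "0 \<le> \<dots>" by simp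
    finally show ?thesis by simp
  qed
  ultimately show ?thesis using order_trans by blast
qed

text \<open>The unit cells act as resistors in series, each of conductance at least
  \<open>1 / 4\<close> (the weight \<open>1 / 2\<close> times the factor \<open>1 / 2\<close> of
  \<open>cov_pair_ge\<close>). Telescoping and Cauchy-Schwarz make the squared difference grow
  linearly in \<open>d\<close>.\<close>

lemma unit_mean_diff:
  assumes u: "fin_energy u"
  shows "\<bar>I (cell 0 (i + d)) u - I (cell 0 i) u\<bar> \<le> 2 * sqrt (d * E u u)"
proof -
  have l: "lloc u" using u fin_energyD by blast
  define b where "b k = I (cell 0 (Suc (i + k))) u - I (cell 0 (i + k)) u" for k
  have tel: "(\<Sum>k<d. b k) = I (cell 0 (i + d)) u - I (cell 0 i) u"
    by (induction d) (simp_all add: b_def)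
  have "(\<Sum>k<d. (b k)\<^sup>2 / 4) \<le> (\<Sum>k<d. wt (0, Suc (i + k)) * cov (0, Suc (i + k)) u u)"
    by (rule sum_mono) (use cov_pair_ge[OF l] in \<open>simp add: wt_simps b_def\<close>)
  also have "\<dots> = (\<Sum>p\<in>(\<lambda>k. (0, Suc (i + k))) ` {..<d}. wt p * cov p u u)"
    by (subst sum.reindex) (auto simp: inj_on_def)
  also have "\<dots> \<le> E u u" by (intro E_ge_sum u) simp
  finally have 1: "(\<Sum>k<d. (b k)\<^sup>2) \<le> 4 * E u u" by (simp add: sum_divide_distrib[symmetric])
  have "(\<Sum>k<d. b k * 1)\<^sup>2 \<le> (\<Sum>k<d. (b k)\<^sup>2) * (\<Sum>k<d. 1\<^sup>2)" by (rule Cauchy_Schwarz_ineq_sum)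
  also have "\<dots> \<le> 4 * E u u * d" using 1 by (simp add: mult_right_mono)
  finally have "(\<Sum>k<d. b k)\<^sup>2 \<le> 4 * (d * E u u)" by (simp add: mult_ac)
  then have "sqrt ((\<Sum>k<d. b k)\<^sup>2) \<le> sqrt (4 * (d * E u u))" by (rule real_sqrt_le_mono)
  then show ?thesis unfolding tel by (simp add: real_sqrt_mult)
qed

section \<open>The resistance metric\<close>

text \<open>The summand 1 keeps different unit cells at distance at least 2, so that
  \<open>rho x y \<le> 1 / 2 ^ n\<close> characterises common cells at level 0 too.
  \<open>LEAST\<close> picks the last common level.\<close>

definition rho :: "'a \<Rightarrow> 'a \<Rightarrow> real" where
  "rho x y = (if x \<notin> X \<or> y \<notin> X \<or> x = y then 0
     else if c 0 x \<noteq> c 0 y then \<bar>real (c 0 x) - real (c 0 y)\<bar> + 1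
     else 1 / 2 ^ (LEAST n. c (Suc n) x \<noteq> c (Suc n) y))"

lemma rho_level:
  assumes "x \<in> X" "y \<in> X" "x \<noteq> y" "c 0 x = c 0 y"
  shows "\<exists>n. c n x = c n y \<and> c (Suc n) x \<noteq> c (Suc n) y \<and> rho x y = 1 / 2 ^ n"
proof -
  define n where "n = (LEAST n. c (Suc n) x \<noteq> c (Suc n) y)"
  obtain m where m: "c m x \<noteq> c m y" using c_inj assms by blast
  then obtain m' where "m = Suc m'" using assms(4) by (cases m) auto
  then have n: "c (Suc n) x \<noteq> c (Suc n) y"
    using m unfolding n_def by (intro LeastI[of "\<lambda>n. c (Suc n) x \<noteq> c (Suc n) y" m']) simp
  moreover have "c n x = c n y"
  proof (cases n)
    case (Suc k)
    then have "k < (LEAST n. c (Suc n) x \<noteq> c (Suc n) y)" by (simp add: n_def)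
    from not_less_Least[OF this] show ?thesis using Suc by simp
  qed (use assms in simp)
  ultimately show ?thesis using assms by (intro exI[of _ n]) (simp add: rho_def n_def)
qed

lemma rho_unit: "x \<in> X \<Longrightarrow> y \<in> X \<Longrightarrow> c 0 x \<noteq> c 0 y \<Longrightarrow> rho x y = \<bar>real (c 0 x) - real (c 0 y)\<bar> + 1"
  by (auto simp: rho_def)

lemma rho_ge_2: "x \<in> X \<Longrightarrow> y \<in> X \<Longrightarrow> c 0 x \<noteq> c 0 y \<Longrightarrow> rho x y \<ge> 2"
  by (simp add: rho_unit)

lemma rho_le_iff:
  assumes xy: "x \<in> X" "y \<in> X"
  shows "rho x y \<le> 1 / 2 ^ n \<longleftrightarrow> c n x = c n y"
proof -
  have le1: "1 / 2 ^ n \<le> (1::real)" by simp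
  consider "x = y" | "c 0 x \<noteq> c 0 y" | "x \<noteq> y" "c 0 x = c 0 y" by blast
  then show ?thesis
  proof cases
    case 1 then show ?thesis by (simp add: rho_def)
  next
    case 2
    then have "c n x \<noteq> c n y" using c_eq_le[OF xy, of n 0] by auto
    moreover have "\<not> rho x y \<le> 1 / 2 ^ n" using rho_ge_2[OF xy 2] le1 by linarith
    ultimately show ?thesis by simp
  next
    case 3
    obtain N where N: "c N x = c N y" "c (Suc N) x \<noteq> c (Suc N) y" "rho x y = 1 / 2 ^ N"
      using rho_level[OF xy 3] by blast
    have "c n x = c n y \<longleftrightarrow> n \<le> N"
      using c_eq_le[OF xy, of N n] c_eq_le[OF xy, of n "Suc N"] N by (meson not_less_eq_eq)
    moreover have "(1::real) / 2 ^ N \<le> 1 / 2 ^ n \<longleftrightarrow> n \<le> N"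
      by (simp add: field_simps)
    ultimately show ?thesis using N by simp
  qed
qed

lemma rho_ge:
  assumes xy: "x \<in> X" "y \<in> X" "c (Suc n) x \<noteq> c (Suc n) y"
  shows "1 / 2 ^ n \<le> rho x y"
proof (cases "c 0 x = c 0 y")
  case False
  have "1 / 2 ^ n \<le> (1::real)" by simp
  then show ?thesis using rho_ge_2[OF xy(1,2) False] by linarith
next
  case True
  have "x \<noteq> y" using xy by auto
  then obtain N where N: "c N x = c N y" "rho x y = 1 / 2 ^ N"
    using rho_level[OF xy(1,2) _ True] by blast
  have "N \<le> n" using c_eq_le[OF xy(1,2) N(1), of "Suc n"] xy(3) by (meson not_less_eq_eq)
  then have "1 / 2 ^ n \<le> (1::real) / 2 ^ N" by (intro divide_left_mono power_increasing) simp_all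
  then show ?thesis using N by simp
qed

lemma rho_nonneg: "0 \<le> rho x y" by (auto simp: rho_def)

lemma rho_pos: "x \<in> X \<Longrightarrow> y \<in> X \<Longrightarrow> x \<noteq> y \<Longrightarrow> 0 < rho x y"
  by (auto simp: rho_def)

lemma rho_le_1: "x \<in> X \<Longrightarrow> y \<in> X \<Longrightarrow> c 0 x = c 0 y \<Longrightarrow> rho x y \<le> 1"
  using rho_le_iff[of x y 0] by simp

lemma rho_sym: "rho x y = rho y x"
proof -
  have "(\<lambda>n. c (Suc n) x \<noteq> c (Suc n) y) = (\<lambda>n. c (Suc n) y \<noteq> c (Suc n) x)" by auto
  then have L: "(LEAST n. c (Suc n) x \<noteq> c (Suc n) y) = (LEAST n. c (Suc n) y \<noteq> c (Suc n) x)" by simp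
  show ?thesis
    unfolding rho_def L by (simp add: abs_minus_commute)
qed

lemma Metric_space_rho: "Metric_space X rho"
proof
  show "0 \<le> rho x y" for x y by (rule rho_nonneg)
  show "rho x y = rho y x" for x y by (rule rho_sym)
  show "(rho x y = 0) = (x = y)" if "x \<in> X" "y \<in> X" for x y
    using that rho_pos[of x y] by (cases "x = y") (simp add: rho_def, simp)
  fix x y z assume X: "x \<in> X" "y \<in> X" "z \<in> X"
  note nn = rho_nonneg[of x y] rho_nonneg[of y z]
  show "rho x z \<le> rho x y + rho y z"
  proof (cases "c 0 x = c 0 z")
    case False
    then show ?thesis
      using nn X by (cases "c 0 x = c 0 y"; cases "c 0 y = c 0 z") (auto simp: rho_unit)
  next
    case True
    show ?thesis
    proof (cases "x = z")
      case True then show ?thesis using nn by (simp add: rho_def)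
    next
      case False
      then obtain N where N: "c (Suc N) x \<noteq> c (Suc N) z" "rho x z = 1 / 2 ^ N"
        using rho_level[OF X(1,3) False True] by blast
      \<comment> \<open>Ultrametric argument: if \<open>x\<close> and \<open>z\<close> have
        separated at level \<open>N + 1\<close>, then \<open>y\<close> is separated there from one
        of them.\<close>
      then have "1 / 2 ^ N \<le> rho x y \<or> 1 / 2 ^ N \<le> rho y z"
        using rho_ge[OF X(1,2), of N] rho_ge[OF X(2,3), of N] by metis
      then show ?thesis using nn N by linarith
    qed
  qed
qed

definition g :: "'a \<Rightarrow> 'a \<Rightarrow> real" where "g x y = min (rho x y) ((rho x y)\<^sup>2)"

lemma g_nonneg: "0 \<le> g x y" using rho_nonneg by (simp add: g_def)

lemma g_pos: "x \<in> X \<Longrightarrow> y \<in> X \<Longrightarrow> x \<noteq> y \<Longrightarrow> 0 < g x y"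
  using rho_pos[of x y] by (simp add: g_def)

lemma g_level:
  assumes "x \<in> X" "y \<in> X" "rho x y = 1 / 2 ^ n" shows "g x y = (1 / 2 ^ n)\<^sup>2"
proof -
  have "(1 / 2 ^ n)\<^sup>2 \<le> (1 / 2 ^ n :: real)"
    unfolding power2_eq_square by (rule mult_left_le) simp_all
  then show ?thesis using assms by (simp add: g_def min_def)
qed

lemma g_unit:
  assumes "x \<in> X" "y \<in> X" "c 0 x \<noteq> c 0 y" shows "g x y = rho x y"
proof -
  have "rho x y * 1 \<le> rho x y * rho x y" using rho_ge_2[OF assms] by (intro mult_left_mono) auto
  then show ?thesis by (simp add: g_def power2_eq_square)
qed

text \<open>Inside a unit cell this is the Lipschitz bound by the energy. Between unit cells two
  local corrections of size \<open>2 * sqrt (E u u)\<close> are added to the walk along the chain,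
  and 2 + 4 makes the constant 6. The estimate bounds the conductance from below and later yields
  pointwise convergence.\<close>

lemma morrey:
  assumes u: "u \<in> F" and xy: "x \<in> X" "y \<in> X"
  shows "\<bar>u x - u y\<bar> \<le> 6 * sqrt (E u u * g x y)"
proof -
  let ?s = "sqrt (E u u)"
  have E0: "E u u \<ge> 0" by (rule E_nonneg[OF F_lloc[OF u]])
  consider "x = y" | "c 0 x \<noteq> c 0 y" | "x \<noteq> y" "c 0 x = c 0 y" by blast
  then show ?thesis
  proof cases
    case 1 then show ?thesis using E0 g_nonneg by simp
  next
    case 3
    obtain n where n: "c n x = c n y" "rho x y = 1 / 2 ^ n" using rho_level[OF xy 3] by blast
    have "\<bar>u x - u y\<bar> \<le> 4 * ?s / 2 ^ n" by (rule dyadic_lipschitzD[OF dyadic_lipschitz_energy[OF u] xy n(1)])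
    also have "\<dots> = 4 * (?s * (1 / 2 ^ n))" by simp
    also have "\<dots> \<le> 6 * (?s * (1 / 2 ^ n))" using E0 by (intro mult_right_mono) simp_all
    also have "?s * (1 / 2 ^ n) = sqrt (E u u * g x y)"
      unfolding g_level[OF xy n(2)] real_sqrt_mult real_sqrt_abs by simp
    finally show ?thesis .
  next
    case 2
    define d where "d = (if c 0 x \<le> c 0 y then c 0 y - c 0 x else c 0 x - c 0 y)"
    have rho: "rho x y = real d + 1" using rho_unit[OF xy 2] by (auto simp: d_def)
    have "\<bar>A 0 u x - A 0 u y\<bar> \<le> 2 * sqrt (d * E u u)"
    proof (cases "c 0 x \<le> c 0 y")
      case True
      then show ?thesis using unit_mean_diff[OF F_fin_energy[OF u], of "c 0 x" d]
        by (simp add: A_def d_def abs_minus_commute)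
    next
      case False
      then show ?thesis using unit_mean_diff[OF F_fin_energy[OF u], of "c 0 y" d]
        by (simp add: A_def d_def)
    qed
    moreover have "\<bar>u x - A 0 u x\<bar> \<le> 2 * ?s" "\<bar>u y - A 0 u y\<bar> \<le> 2 * ?s"
      using A_near[OF u xy(1), of 0] A_near[OF u xy(2), of 0] by simp_all
    moreover have "\<bar>a - a'\<bar> \<le> q \<Longrightarrow> \<bar>s - a\<bar> \<le> r \<Longrightarrow> \<bar>t - a'\<bar> \<le> r \<Longrightarrow> \<bar>s - t\<bar> \<le> q + 2 * r"
      for a a' q r s t :: real by linarith
    ultimately have "\<bar>u x - u y\<bar> \<le> 2 * sqrt (d * E u u) + 2 * (2 * ?s)" by blast
    \<comment> \<open>Here \<open>g x y = d + 1\<close>, which dominates both \<open>d\<close> and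
      1.\<close>
    moreover have "sqrt (d * E u u) \<le> sqrt (E u u * g x y)" "?s \<le> sqrt (E u u * g x y)"
      using E0 unfolding g_unit[OF xy 2] rho by (auto simp: algebra_simps)
    ultimately show ?thesis by linarith
  qed
qed

section \<open>Test functions for the upper bound of the conductance\<close>

lemma cov_const_on_blk:
  assumes "\<And>x. x \<in> blk p \<Longrightarrow> u x = a" shows "cov p u u = 0"
proof -
  have "cov p u u = cov p (\<lambda>x. a) (\<lambda>x. a)" by (rule cov_cong) (simp_all add: assms)
  then show ?thesis by (simp add: cov_const)
qed

lemma finite_support_energy:
  assumes l: "lloc u" and P: "finite P" "\<And>p. p \<notin> P \<Longrightarrow> cov p u u = 0"
  shows "fin_energy u" and "E u u = (\<Sum>p\<in>P. wt p * cov p u u)"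
proof -
  have "(\<lambda>p. wt p * cov p u u) summable_on UNIV \<longleftrightarrow> (\<lambda>p. wt p * cov p u u) summable_on P"
    by (rule summable_on_cong_neutral) (use P in auto)
  then show "fin_energy u" using l P by (simp add: fin_energy_def)
  have "E u u = (\<Sum>\<^sub>\<infinity>p\<in>P. wt p * cov p u u)"
    unfolding E_def by (rule infsum_cong_neutral) (use P in auto)
  then show "E u u = (\<Sum>p\<in>P. wt p * cov p u u)" using P by simp
qed

lemma I_sq_le_measure:
  assumes "lloc w" "bset S" "bset T" "\<And>x. x \<in> S \<Longrightarrow> (w x)\<^sup>2 \<le> B * indicator T x" "0 \<le> B"
  shows "I S (\<lambda>x. (w x)\<^sup>2) \<le> B * measure \<mu> T"
proof -
  have "I S (\<lambda>x. (w x)\<^sup>2) \<le> I T (\<lambda>x. B)"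
    unfolding I_def
  proof (rule integral_mono)
    show "integrable \<mu> (\<lambda>x. indicator S x * (w x)\<^sup>2)" by (intro integrable_sq assms)
    show "integrable \<mu> (\<lambda>x. indicator T x * B)" by (intro integrable_one lloc_const assms)
    show "indicator S x * (w x)\<^sup>2 \<le> indicator T x * B" for x
      using assms(4)[of x] assms(5) by (cases "x \<in> S") (auto simp: mult.commute)
  qed
  then show ?thesis using I_const[OF assms(3)] by simp
qed

text \<open>Only the proper ancestors of the cell and the two blocks of level 0 at its unit cell see
  the indicator; their weights add up to \<open>8 ^ Suc n\<close>, and each covariance is at most
  the measure \<open>1 / 2 ^ Suc n\<close> of the cell.\<close>

lemma bump:
  fixes n :: nat
  assumes x: "x \<in> X"
  defines "v \<equiv> indicator (cell (Suc n) (c (Suc n) x)) :: 'a \<Rightarrow> real"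
  shows "v \<in> F" and "E v v \<le> 4 * 4 ^ n"
proof -
  let ?C = "cell (Suc n) (c (Suc n) x)"
  have dyadic_lipschitz: "dyadic_lipschitz (2 ^ Suc n) v"
    unfolding dyadic_lipschitz_def
  proof (intro ballI allI impI)
    fix y z m assume yz: "y \<in> X" "z \<in> X" "c m y = c m z"
    show "\<bar>v y - v z\<bar> \<le> 2 ^ Suc n / 2 ^ m"
    proof (cases "Suc n \<le> m")
      case True
      then have "v y = v z" using c_eq_le[OF yz True] yz by (simp add: v_def indicator_def)
      then show ?thesis by simp
    next
      case False
      then have "(2::real) ^ m \<le> 2 ^ Suc n" by (intro power_increasing) auto
      then have "1 \<le> (2::real) ^ Suc n / 2 ^ m" by simp
      moreover have "\<bar>v y - v z\<bar> \<le> 1" by (simp add: v_def indicator_def)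
      ultimately show ?thesis by linarith
    qed
  qed
  then have l: "lloc v" by (rule dyadic_lipschitz_lloc)
  define Q where "Q = (\<lambda>m. (Suc m, c m x)) ` {..n}"
  define P where "P = {(0, c 0 x), (0, Suc (c 0 x))} \<union> Q"
  have zero: "cov p v v = 0" if "p \<notin> P" for p
  proof (cases p)
    case (Pair m k)
    show ?thesis
    proof (cases m)
      case 0
      then have "k \<noteq> c 0 x" "k \<noteq> Suc (c 0 x)" using that Pair by (auto simp: P_def)
      then have "v y = 0" if "y \<in> blk p" for y
        using that Pair 0 c_eq_le[OF x, of y "Suc n" 0] by (auto simp: v_def blk_simps indicator_def)
      then show ?thesis by (rule cov_const_on_blk)
    next
      case (Suc m')
      show ?thesis
      proof (cases "m' \<le> n")
        case True
        then have "k \<noteq> c m' x" using that Pair Suc by (auto simp: P_def Q_def)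
        then have "v y = 0" if "y \<in> blk p" for y
          using that Pair Suc True c_eq_le[OF x, of y "Suc n" m'] by (auto simp: v_def blk_simps indicator_def)
        then show ?thesis by (rule cov_const_on_blk)
      next
        case False
        obtain z where z: "z \<in> cell m' k" using cell_nonempty by blast
        have "v y = v z" if "y \<in> blk p" for y
          using that z Pair Suc False c_eq_le[of y z m' "Suc n"] by (auto simp: v_def blk_simps indicator_def)
        then show ?thesis by (rule cov_const_on_blk)
      qed
    qed
  qed
  have P: "finite P" by (simp add: P_def Q_def)
  have fs: "fin_energy v" "E v v = (\<Sum>p\<in>P. wt p * cov p v v)"
    by (rule finite_support_energy[OF l P]; rule zero; assumption)+
  show "v \<in> F" using dyadic_lipschitz fs(1) by (auto simp: F_def v_def)
  have cv: "cov p v v \<le> 1 / 2 ^ Suc n" for p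
  proof -
    have "cov p v v \<le> I (blk p) (\<lambda>x. (v x - 0)\<^sup>2)" by (rule cov_le_sq[OF l])
    also have "\<dots> \<le> 1 * measure \<mu> ?C"
    proof (rule I_sq_le_measure)
      show "lloc (\<lambda>x. v x - 0)" using l by simp
      show "(v y - 0)\<^sup>2 \<le> 1 * indicator ?C y" for y by (simp add: v_def indicator_def)
    qed simp_all
    finally show ?thesis by (simp add: measure_cell)
  qed
  have "E v v \<le> (\<Sum>p\<in>P. wt p * (1 / 2 ^ Suc n))"
    unfolding fs(2) by (intro sum_mono mult_left_mono wt_nonneg cv)
  also have "\<dots> = (\<Sum>p\<in>P. wt p) / 2 ^ Suc n" by (simp add: sum_divide_distrib)
  also have "(\<Sum>p\<in>P. wt p) = 1 + (\<Sum>p\<in>Q. wt p)"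
    unfolding P_def by (subst sum.union_disjoint) (auto simp: Q_def wt_simps)
  also have "(\<Sum>p\<in>Q. wt p) = (\<Sum>m\<le>n. 7 * 8 ^ m)"
    unfolding Q_def by (subst sum.reindex) (auto simp: inj_on_def wt_simps)
  also have "1 + (\<Sum>m\<le>n. 7 * 8 ^ m) = (8::real) ^ Suc n" by (induction n) simp_all
  also have "(8::real) ^ Suc n / 2 ^ Suc n = (8 / 2) ^ Suc n" by (rule power_divide[symmetric])
  also have "\<dots> = 4 * 4 ^ n" by simp
  finally show "E v v \<le> 4 * 4 ^ n" .
qed

text \<open>Only blocks of level 0 see a function of the unit cell. Measured against the constant
  \<open>\<phi> k\<close>, block \<open>k\<close> can deviate only on unit cell
  \<open>k - 1\<close>, which has measure 1.\<close>

lemma unit_function_energy: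
  fixes \<phi> :: "nat \<Rightarrow> real" and \<delta> :: real
  assumes K: "finite K" "\<And>k. k \<notin> K \<Longrightarrow> \<phi> k = \<phi> (k - 1)" and \<delta>: "\<And>k. \<bar>\<phi> k - \<phi> (k - 1)\<bar> \<le> \<delta>"
  defines "v \<equiv> (\<lambda>z. if z \<in> X then \<phi> (c 0 z) else 0)"
  shows "v \<in> F" and "E v v \<le> card K * \<delta>\<^sup>2 / 2"
proof -
  have dyadic_lipschitz: "dyadic_lipschitz 0 v"
    unfolding dyadic_lipschitz_def by (auto simp: v_def dest: c_eq_le[of _ _ _ 0])
  then have l: "lloc v" by (rule dyadic_lipschitz_lloc)
  define P where "P = Pair (0::nat) ` K"
  have zero: "cov p v v = 0" if "p \<notin> P" for p
  proof (cases p)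
    case (Pair m k)
    show ?thesis
    proof (cases m)
      case 0
      then have "k \<notin> K" using that Pair by (auto simp: P_def)
      then have "v y = \<phi> k" if "y \<in> blk p" for y
        using that Pair 0 K(2)[of k] by (auto simp: v_def blk_simps)
      then show ?thesis by (rule cov_const_on_blk)
    next
      case (Suc m')
      obtain z where z: "z \<in> cell m' k" using cell_nonempty by blast
      have "v y = v z" if "y \<in> blk p" for y
        using that z Pair Suc c_eq_le[of y z m' 0] by (auto simp: v_def blk_simps)
      then show ?thesis by (rule cov_const_on_blk)
    qed
  qed
  have P: "finite P" using K by (simp add: P_def)
  have fs: "fin_energy v" "E v v = (\<Sum>p\<in>P. wt p * cov p v v)"
    by (rule finite_support_energy[OF l P]; rule zero; assumption)+
  show "v \<in> F" using dyadic_lipschitz fs(1) by (auto simp: F_def v_def)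
  have cv: "cov (0, k) v v \<le> \<delta>\<^sup>2" for k
  proof -
    have "cov (0, k) v v \<le> I (blk (0, k)) (\<lambda>x. (v x - \<phi> k)\<^sup>2)" by (rule cov_le_sq[OF l])
    also have "\<dots> \<le> \<delta>\<^sup>2 * measure \<mu> (cell 0 (k - 1))"
    proof (rule I_sq_le_measure)
      show "(v x - \<phi> k)\<^sup>2 \<le> \<delta>\<^sup>2 * indicator (cell 0 (k - 1)) x" if "x \<in> blk (0, k)" for x
      proof (cases "c 0 x = k - 1")
        case True
        have "\<bar>\<phi> (k - 1) - \<phi> k\<bar> \<le> \<bar>\<delta>\<bar>" using \<delta>[of k] by simp
        then have "(\<phi> (k - 1) - \<phi> k)\<^sup>2 \<le> \<delta>\<^sup>2" by (simp add: abs_le_square_iff)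
        then show ?thesis using that True by (auto simp: v_def blk_simps)
      next
        case False
        then show ?thesis using that by (auto simp: v_def blk_simps)
      qed
    qed (use l in auto)
    finally show ?thesis by (simp add: measure_cell)
  qed
  have "E v v \<le> (\<Sum>p\<in>P. 1 / 2 * \<delta>\<^sup>2)"
    unfolding fs(2) by (intro sum_mono) (auto simp: P_def wt_simps cv)
  also have "\<dots> = card P * (1 / 2 * \<delta>\<^sup>2)" by simp
  also have "card P = card K" unfolding P_def by (intro card_image) (auto simp: inj_on_def)
  finally show "E v v \<le> card K * \<delta>\<^sup>2 / 2" by simp
qed

lemma one_F: "indicator X \<in> F" and E_one: "E (indicator X) (indicator X) = 0"
proof -
  have "(\<lambda>z. if z \<in> X then 1 else 0) = (indicator X :: 'a \<Rightarrow> real)" by (auto simp: indicator_def)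
  then show "indicator X \<in> F"
    using unit_function_energy(1)[of "{}" "\<lambda>k. 1" 0] by (simp cong: if_cong)
  have "cov p (indicator X) (indicator X) = 0" for p
    by (rule cov_const_on_blk[of _ _ 1]) (use blk_sub[of p] in \<open>auto simp: indicator_def\<close>)
  then show "E (indicator X) (indicator X) = 0" by (simp add: E_def)
qed

lemma exists_test:
  assumes xy: "x \<in> X" "y \<in> X" "x \<noteq> y"
  shows "\<exists>v\<in>F. v x = 1 \<and> v y = 0 \<and> E v v \<le> 4 / g x y"
proof (cases "c 0 x = c 0 y")
  case True
  obtain n where n: "c (Suc n) x \<noteq> c (Suc n) y" "rho x y = 1 / 2 ^ n"
    using rho_level[OF xy True] by blast
  have "4 / g x y = 4 * 4 ^ n"
    unfolding g_level[OF xy(1,2) n(2)] by (simp add: power_divide power_mult_distrib[symmetric] power2_eq_square)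
  then show ?thesis using bump[OF xy(1), of n] xy n by (intro bexI[OF _ bump(1)[OF xy(1), of n]]) auto
next
  case False
  define i j where "i = c 0 x" and "j = c 0 y"
  define D where "D = \<bar>real i - real j\<bar>"
  have D1: "D \<ge> 1" using False by (auto simp: D_def i_def j_def)
  \<comment> \<open>Linear interpolation between the two unit cells, constant outside:
    \<open>D\<close> steps of height \<open>1 / D\<close>, the potential of a series
    circuit.\<close>
  define \<phi> where "\<phi> k = max 0 (min 1 ((real k - real j) / (real i - real j)))" for k :: nat
  have cl: "\<bar>max 0 (min 1 a) - max 0 (min 1 b)\<bar> \<le> \<bar>a - b\<bar>" for a b :: real by linarith
  define K where "K = {min i j<..max i j}"
  have cK: "card K = D" by (auto simp: K_def D_def)
  have 1: "\<phi> k = \<phi> (k - 1)" if k: "k \<notin> K" for k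
  proof (cases "k = 0")
    case False
    have "k \<le> min i j \<or> k > max i j" using k by (auto simp: K_def)
    then show ?thesis using False \<open>D \<ge> 1\<close>
      by (cases "i < j") (auto simp: \<phi>_def D_def of_nat_diff divide_simps)
  qed simp
  have 2: "\<bar>\<phi> k - \<phi> (k - 1)\<bar> \<le> 1 / D" for k
  proof -
    have "\<bar>\<phi> k - \<phi> (k - 1)\<bar> \<le> \<bar>(real k - real j) / (real i - real j) - (real (k - 1) - real j) / (real i - real j)\<bar>"
      unfolding \<phi>_def by (rule cl)
    also have "\<dots> = \<bar>real k - real (k - 1)\<bar> / D"
      by (simp add: D_def diff_divide_distrib[symmetric] abs_divide)
    also have "\<dots> \<le> 1 / D" using D1 by (intro divide_right_mono) auto
    finally show ?thesis .
  qed
  have K: "finite K" by (simp add: K_def)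
  note uf = unit_function_energy[of K \<phi> "1 / D", OF K 1 2]
  have "card K * (1 / D)\<^sup>2 / 2 = 1 / (2 * D)" unfolding cK using D1 by (simp add: power2_eq_square)
  also have "\<dots> \<le> 4 / (D + 1)" using D1 by (simp add: field_simps)
  also have "D + 1 = g x y" using g_unit[OF xy(1,2) False] rho_unit[OF xy(1,2) False] by (simp add: D_def i_def j_def)
  finally have "card K * (1 / D)\<^sup>2 / 2 \<le> 4 / g x y" .
  moreover have "\<phi> (c 0 x) = 1" "\<phi> (c 0 y) = 0" using D1 by (auto simp: \<phi>_def i_def[symmetric] j_def[symmetric] D_def)
  ultimately show ?thesis using uf(2) xy by (intro bexI[OF _ uf(1)]) auto
qed

abbreviation G :: "'a \<Rightarrow> 'a \<Rightarrow> real" where "G \<equiv> effective_conductance X E F"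
abbreviation R :: "'a \<Rightarrow> 'a \<Rightarrow> real" where "R \<equiv> resistance_metric X E F"

text \<open>The 36 is the square of the constant in \<open>morrey\<close>; the upper bound is the
  energy of the function from \<open>exists_test\<close>.\<close>

lemma G_bounds:
  assumes xy: "x \<in> X" "y \<in> X" "x \<noteq> y"
  shows "1 / (36 * g x y) \<le> G x y" and "G x y \<le> 4 / g x y"
proof -
  let ?S = "{E u u |u. u \<in> F \<and> u x = 1 \<and> u y = 0}"
  obtain v where v: "v \<in> F" "v x = 1" "v y = 0" "E v v \<le> 4 / g x y" using exists_test[OF xy] by blast
  have gp: "g x y > 0" by (rule g_pos[OF xy])
  show "1 / (36 * g x y) \<le> G x y"
    unfolding effective_conductance_def
  proof (rule cInf_greatest)
    show "?S \<noteq> {}" using v by blast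
    fix e assume "e \<in> ?S"
    then obtain u where u: "u \<in> F" "u x = 1" "u y = 0" "e = E u u" by blast
    have "1 \<le> 6 * sqrt (E u u * g x y)" using morrey[OF u(1) xy(1,2)] u by simp
    then have "1\<^sup>2 \<le> (6 * sqrt (E u u * g x y))\<^sup>2" by (intro power_mono) auto
    also have "\<dots> = 36 * (E u u * g x y)"
      using E_nonneg[OF F_lloc[OF u(1)]] gp by (simp add: power_mult_distrib)
    finally show "1 / (36 * g x y) \<le> e" using gp u(4) by (simp add: field_simps)
  qed
  have "G x y \<le> E v v"
    unfolding effective_conductance_def
    by (rule cInf_lower) (use v E_nonneg F_lloc in \<open>auto intro!: bdd_belowI[of _ 0]\<close>)
  then show "G x y \<le> 4 / g x y" using v by linarith
qed

lemma R_bounds: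
  assumes xy: "x \<in> X" "y \<in> X"
  shows "g x y / 4 \<le> R x y" and "R x y \<le> 36 * g x y"
proof -
  have "g x y / 4 \<le> R x y \<and> R x y \<le> 36 * g x y"
  proof (cases "x = y")
    case True
    then show ?thesis by (simp add: g_def rho_def resistance_metric_def)
  next
    case False
    have gp: "g x y > 0" by (rule g_pos[OF xy False])
    have Gp: "G x y > 0" using G_bounds(1)[OF xy False] gp by (meson divide_pos_pos less_le_trans mult_pos_pos zero_less_one zero_less_numeral)
    have R: "R x y = 1 / G x y" using xy False by (simp add: resistance_metric_def)
    show ?thesis unfolding R using G_bounds[OF xy False] gp Gp by (simp add: field_simps)
  qed
  then show "g x y / 4 \<le> R x y" "R x y \<le> 36 * g x y" by auto
qed

section \<open>Completeness of the form domain\<close>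

lemma cov_tendsto:
  assumes wm: "\<And>m. lloc (wm m)" and w: "lloc w"
    and lim: "\<And>x. x \<in> blk p \<Longrightarrow> (\<lambda>m. wm m x) \<longlonglongrightarrow> w x"
    and B: "\<And>m x. x \<in> blk p \<Longrightarrow> \<bar>wm m x\<bar> \<le> B"
  shows "(\<lambda>m. cov p (wm m) (wm m)) \<longlonglongrightarrow> cov p w w"
proof -
  have meas: "wm m \<in> borel_measurable \<mu>" "w \<in> borel_measurable \<mu>" for m
    using wm w lloc_meas by auto
  have 1: "(\<lambda>m. I (blk p) (wm m)) \<longlonglongrightarrow> I (blk p) w"
    unfolding I_def
  proof (rule integral_dominated_convergence[where w = "\<lambda>x. indicator (blk p) x * B"])
    show "integrable \<mu> (\<lambda>x. indicator (blk p) x * B)" by (intro integrable_one lloc_const bset_blk)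
    show "AE x in \<mu>. (\<lambda>m. indicator (blk p) x * wm m x) \<longlonglongrightarrow> indicator (blk p) x * w x"
    proof (intro AE_I2)
      fix x show "(\<lambda>m. indicator (blk p) x * wm m x) \<longlonglongrightarrow> indicator (blk p) x * w x"
        using lim[of x] by (cases "x \<in> blk p") simp_all
    qed
    show "AE x in \<mu>. norm (indicator (blk p) x * wm m x) \<le> indicator (blk p) x * B" for m
      using B by (intro AE_I2) (auto simp: indicator_def)
  qed (use meas in measurable)
  have 2: "(\<lambda>m. I (blk p) (\<lambda>x. wm m x * wm m x)) \<longlonglongrightarrow> I (blk p) (\<lambda>x. w x * w x)"
    unfolding I_def
  proof (rule integral_dominated_convergence[where w = "\<lambda>x. indicator (blk p) x * (B * B)"])
    show "integrable \<mu> (\<lambda>x. indicator (blk p) x * (B * B))" by (intro integrable_one lloc_const bset_blk)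
    show "AE x in \<mu>. (\<lambda>m. indicator (blk p) x * (wm m x * wm m x)) \<longlonglongrightarrow> indicator (blk p) x * (w x * w x)"
    proof (intro AE_I2)
      fix x show "(\<lambda>m. indicator (blk p) x * (wm m x * wm m x)) \<longlonglongrightarrow> indicator (blk p) x * (w x * w x)"
        using tendsto_mult[OF lim lim, of x] by (cases "x \<in> blk p") simp_all
    qed
    show "AE x in \<mu>. norm (indicator (blk p) x * (wm m x * wm m x)) \<le> indicator (blk p) x * (B * B)" for m
    proof (intro AE_I2)
      fix x show "norm (indicator (blk p) x * (wm m x * wm m x)) \<le> indicator (blk p) x * (B * B)"
      proof (cases "x \<in> blk p")
        case True
        have "\<bar>wm m x\<bar> * \<bar>wm m x\<bar> \<le> B * B" using B[OF True, of m] by (intro mult_mono) auto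
        then show ?thesis using True by (simp add: abs_mult)
      qed simp
    qed
  qed (use meas in measurable)
  show ?thesis unfolding cov_def by (intro tendsto_intros 1 2) (use vol_pos[of p] in simp)
qed

lemma E_shift:
  assumes "u \<in> F"
  shows "E (\<lambda>x. u x + a * indicator X x) (\<lambda>x. u x + a * indicator X x) = E u u"
proof -
  have l: "lloc u" "lloc (\<lambda>x. u x + a)" using F_lloc[OF assms] by auto
  have "cov p (\<lambda>x. u x + a * indicator X x) (\<lambda>x. u x + a * indicator X x) = cov p u u" for p
  proof -
    have "cov p (\<lambda>x. u x + a * indicator X x) (\<lambda>x. u x + a * indicator X x)
        = cov p (\<lambda>x. u x + a) (\<lambda>x. u x + a)"
      by (rule cov_cong) (use blk_sub[of p] in auto)
    also have "\<dots> = cov p u (\<lambda>x. u x + a)" by (intro cov_shift l)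
    also have "\<dots> = cov p (\<lambda>x. u x + a) u" by (rule cov_sym)
    also have "\<dots> = cov p u u" by (intro cov_shift l)
    finally show ?thesis .
  qed
  then show ?thesis by (simp add: E_def)
qed

lemma g_bounded_on_blk: "x0 \<in> X \<Longrightarrow> \<exists>B\<ge>0. \<forall>x\<in>blk p. g x x0 \<le> B"
proof -
  assume x0: "x0 \<in> X"
  obtain i j where ij: "blk p \<subseteq> cell 0 i \<union> cell 0 j" using blk_cover by blast
  have "g x x0 \<le> real i + real j + real (c 0 x0) + 1" if "x \<in> blk p" for x
  proof -
    have x: "x \<in> X" "c 0 x = i \<or> c 0 x = j" using that ij by auto
    have "g x x0 \<le> rho x x0" by (simp add: g_def)
    also have "\<dots> \<le> real i + real j + real (c 0 x0) + 1"
    proof (cases "c 0 x = c 0 x0")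
      case True then show ?thesis using rho_le_1[OF x(1) x0] by simp
    next
      case False then show ?thesis using rho_unit[OF x(1) x0] x(2) by auto
    qed
    finally show ?thesis .
  qed
  then show ?thesis by (intro exI[of _ "real i + real j + real (c 0 x0) + 1"]) auto
qed

lemma F_complete:
  assumes s: "\<And>n. s n \<in> F"
    and Cauchy: "\<And>e. e > 0 \<Longrightarrow> \<exists>N. \<forall>m\<ge>N. \<forall>n\<ge>N. E (\<lambda>x. s m x - s n x) (\<lambda>x. s m x - s n x) < e"
  shows "\<exists>u\<in>F. (\<lambda>n. E (\<lambda>x. s n x - u x) (\<lambda>x. s n x - u x)) \<longlonglongrightarrow> 0"
proof -
  obtain x0 where x0: "x0 \<in> X" using X_nonempty by blast
  define D where "D m n x = s m x - s n x" for m n x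
  have D: "D m n \<in> F" for m n unfolding D_def[abs_def] by (rule F_diff[OF s s])
  have CD: "\<exists>N. \<forall>m\<ge>N. \<forall>n\<ge>N. E (D m n) (D m n) < e" if "e > 0" for e
    unfolding D_def[abs_def] by (rule Cauchy[OF that])
  \<comment> \<open>Energy sees no constants, so the sequence is normalised at \<open>x0\<close>;
    then \<open>morrey\<close> makes it Cauchy at every point.\<close>
  define t where "t n x = s n x - s n x0" for n x
  have tD: "t m x - t n x = D m n x - D m n x0" for m n x by (simp add: t_def D_def)
  have tb: "\<bar>t m x - t n x\<bar> \<le> 6 * sqrt (E (D m n) (D m n) * g x x0)" if "x \<in> X" for m n x
    unfolding tD by (rule morrey[OF D that x0])
  have "convergent (\<lambda>n. t n x)" if x: "x \<in> X" for x
  proof (rule real_Cauchy_convergent, rule CauchyI)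
    fix e :: real assume e: "e > 0"
    define \<delta> where "\<delta> = (e / 12)\<^sup>2 / (g x x0 + 1)"
    have gp: "g x x0 + 1 > 0" using g_nonneg[of x x0] by simp
    have "\<delta> > 0" using e gp by (simp add: \<delta>_def)
    then obtain N where N: "\<forall>m\<ge>N. \<forall>n\<ge>N. E (D m n) (D m n) < \<delta>" using CD by blast
    show "\<exists>M. \<forall>m\<ge>M. \<forall>n\<ge>M. norm (t m x - t n x) < e"
    proof (intro exI[of _ N] allI impI)
      fix m n assume mn: "m \<ge> N" "n \<ge> N"
      have "E (D m n) (D m n) * g x x0 \<le> \<delta> * (g x x0 + 1)"
        using N mn g_nonneg[of x x0] \<open>\<delta> > 0\<close> by (intro mult_mono) (auto intro: less_imp_le)
      also have "\<dots> = (e / 12)\<^sup>2" using gp by (simp add: \<delta>_def)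
      finally have "sqrt (E (D m n) (D m n) * g x x0) \<le> sqrt ((e / 12)\<^sup>2)" by (rule real_sqrt_le_mono)
      also have "\<dots> = e / 12" using e by simp
      finally show "norm (t m x - t n x) < e" using tb[OF x, of m n] e by simp
    qed
  qed
  then have "\<exists>l. (\<lambda>n. t n x) \<longlonglongrightarrow> l" if "x \<in> X" for x
    using that unfolding convergent_def by blast
  then obtain l where l: "\<And>x. x \<in> X \<Longrightarrow> (\<lambda>n. t n x) \<longlonglongrightarrow> l x" by metis
  define u where "u x = (if x \<in> X then l x else 0)" for x
  have ul: "(\<lambda>n. t n x) \<longlonglongrightarrow> u x" if "x \<in> X" for x using l that by (simp add: u_def)
  \<comment> \<open>Lower semicontinuity of the energy: a bound on the differences with all late
    members passes to the pointwise limit.\<close>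
  have key: "u \<in> F \<and> E (\<lambda>x. s n x - u x) (\<lambda>x. s n x - u x) \<le> e"
    if e: "e > 0" and N: "\<And>m. m \<ge> N \<Longrightarrow> E (D n m) (D n m) \<le> e" for n N e
  proof -
    \<comment> \<open>The added constant \<open>- s n x0\<close> turns \<open>s n - u\<close> into
      the limit of \<open>t n x - t (m + N) x\<close> in \<open>m\<close> without changing the
      energy.\<close>
    define w where "w x = (s n x - u x) + (- s n x0) * indicator X x" for x
    have w_on: "w x = t n x - u x" if "x \<in> X" for x using that by (simp add: w_def t_def)
    have w_off: "w x = 0" if "x \<notin> X" for x using that s[of n] by (simp add: w_def u_def F_def)
    define wm where "wm m x = t n x - t (m + N) x" for m x
    have wm_alt: "wm m = (\<lambda>x. D n (m + N) x + (- D n (m + N) x0))" for m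
      by (rule ext) (simp add: wm_def tD)
    have lwm: "lloc (wm m)" for m unfolding wm_alt by (intro lloc_add lloc_const F_lloc[OF D])
    have lim: "(\<lambda>m. wm m x) \<longlonglongrightarrow> w x" if "x \<in> X" for x
      unfolding wm_def w_on[OF that]
      by (intro tendsto_diff tendsto_const LIMSEQ_ignore_initial_segment ul that)
    have Ewm: "E (D n (m + N)) (D n (m + N)) \<le> e" for m by (rule N) simp
    \<comment> \<open>The Lipschitz constants of the \<open>wm m\<close> are bounded by the energy
      uniformly in \<open>m\<close>, so the limit stays in the domain.\<close>
    have "dyadic_lipschitz (4 * sqrt e) w"
      unfolding dyadic_lipschitz_def
    proof (intro ballI allI impI)
      fix x y k assume xy: "x \<in> X" "y \<in> X" "c k x = c k y"
      have "\<bar>wm m x - wm m y\<bar> \<le> 4 * sqrt e / 2 ^ k" for m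
      proof -
        have "\<bar>wm m x - wm m y\<bar> \<le> 4 * sqrt (E (D n (m + N)) (D n (m + N))) / 2 ^ k"
          unfolding wm_alt using dyadic_lipschitzD[OF dyadic_lipschitz_energy[OF D] xy, of n "m + N"] by simp
        also have "\<dots> \<le> 4 * sqrt e / 2 ^ k"
          using Ewm[of m] by (intro divide_right_mono mult_left_mono real_sqrt_le_mono) auto
        finally show ?thesis .
      qed
      moreover have "(\<lambda>m. \<bar>wm m x - wm m y\<bar>) \<longlonglongrightarrow> \<bar>w x - w y\<bar>"
        by (intro tendsto_rabs tendsto_diff lim xy)
      ultimately show "\<bar>w x - w y\<bar> \<le> 4 * sqrt e / 2 ^ k"
        by (intro LIMSEQ_le_const2[of _ _ "4 * sqrt e / 2 ^ k"]) auto
    qed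
    note dyadic_lipschitz = this
    then have lw: "lloc w" by (rule dyadic_lipschitz_lloc)
    have cl: "(\<lambda>m. cov p (wm m) (wm m)) \<longlonglongrightarrow> cov p w w" for p
    proof -
      obtain B where B: "B \<ge> 0" "\<forall>x\<in>blk p. g x x0 \<le> B" using g_bounded_on_blk[OF x0] by blast
      show ?thesis
      proof (rule cov_tendsto[OF lwm lw])
        show "(\<lambda>m. wm m x) \<longlonglongrightarrow> w x" if "x \<in> blk p" for x using lim that blk_sub by blast
        fix m x assume x: "x \<in> blk p"
        then have "x \<in> X" using blk_sub by blast
        then have "\<bar>wm m x\<bar> \<le> 6 * sqrt (E (D n (m + N)) (D n (m + N)) * g x x0)"
          unfolding wm_def by (rule tb)
        also have "\<dots> \<le> 6 * sqrt (e * B)"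
          using Ewm[of m] B x g_nonneg e by (intro mult_left_mono real_sqrt_le_mono mult_mono) auto
        finally show "\<bar>wm m x\<bar> \<le> 6 * sqrt (e * B)" .
      qed
    qed
    have cwm: "cov p (wm m) (wm m) = cov p (D n (m + N)) (D n (m + N))" for p m
    proof -
      have lD: "lloc (D n (m + N))" by (rule F_lloc[OF D])
      have "cov p (wm m) (wm m) = cov p (D n (m + N)) (wm m)"
        unfolding wm_alt by (intro cov_shift lD lloc_add lloc_const)
      also have "\<dots> = cov p (wm m) (D n (m + N))" by (rule cov_sym)
      also have "\<dots> = cov p (D n (m + N)) (D n (m + N))"
        unfolding wm_alt by (intro cov_shift lD)
      finally show ?thesis .
    qed
    \<comment> \<open>Finitely many blocks at a time, so that the limit in \<open>m\<close> can be
      taken inside the sum.\<close>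
    have part: "(\<Sum>p\<in>P. wt p * cov p w w) \<le> e" if P: "finite P" for P
    proof (rule LIMSEQ_le_const2)
      show "(\<lambda>m. \<Sum>p\<in>P. wt p * cov p (wm m) (wm m)) \<longlonglongrightarrow> (\<Sum>p\<in>P. wt p * cov p w w)"
        by (intro tendsto_sum tendsto_mult tendsto_const cl)
      have "(\<Sum>p\<in>P. wt p * cov p (wm m) (wm m)) \<le> e" for m
        unfolding cwm using E_ge_sum[OF F_fin_energy[OF D] P, of n "m + N"] Ewm[of m] by (rule order_trans)
      then show "\<exists>M. \<forall>m\<ge>M. (\<Sum>p\<in>P. wt p * cov p (wm m) (wm m)) \<le> e" by blast
    qed
    have sw: "(\<lambda>p. wt p * cov p w w) summable_on UNIV"
      by (rule nonneg_bdd_above_summable_on) (use E_term_nonneg[OF lw] part in \<open>auto intro!: bdd_aboveI[of _ e]\<close>)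
    have Ew: "E w w \<le> e"
      unfolding E_def by (rule infsum_le_finite_sums[OF sw]) (use part in auto)
    have wF: "w \<in> F" using dyadic_lipschitz w_off sw lw by (auto simp: F_def fin_energy_def)
    have eq: "(\<lambda>x. s n x - u x) = (\<lambda>x. w x + s n x0 * indicator X x)" by (rule ext) (simp add: w_def)
    have "E (\<lambda>x. s n x - u x) (\<lambda>x. s n x - u x) \<le> e"
      unfolding eq E_shift[OF wF] by (rule Ew)
    moreover have "(\<lambda>x. s n x - u x) \<in> F"
      unfolding eq by (intro F_add F_scale wF one_F)
    from F_diff[OF s[of n] this] have "u \<in> F" by simp
    ultimately show ?thesis by blast
  qed
  show ?thesis
  proof (intro bexI)
    obtain N where "\<forall>m\<ge>N. \<forall>n\<ge>N. E (D m n) (D m n) < 1" using CD[of 1] by auto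
    then show uF: "u \<in> F" using key[of 1 N N] by (auto intro: less_imp_le)
    show "(\<lambda>n. E (\<lambda>x. s n x - u x) (\<lambda>x. s n x - u x)) \<longlonglongrightarrow> 0"
    proof (rule LIMSEQ_I)
      fix r :: real assume r: "r > 0"
      then obtain N where N: "\<forall>m\<ge>N. \<forall>n\<ge>N. E (D m n) (D m n) < r / 2" using CD[of "r / 2"] by auto
      show "\<exists>no. \<forall>n\<ge>no. norm (E (\<lambda>x. s n x - u x) (\<lambda>x. s n x - u x) - 0) < r"
      proof (intro exI[of _ N] allI impI)
        fix n assume "n \<ge> N"
        then have "E (\<lambda>x. s n x - u x) (\<lambda>x. s n x - u x) \<le> r / 2"
          using key[of "r / 2" N n] N r by (auto intro: less_imp_le)
        moreover have "0 \<le> E (\<lambda>x. s n x - u x) (\<lambda>x. s n x - u x)"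
          by (intro E_nonneg F_lloc F_diff s uF)
        ultimately show "norm (E (\<lambda>x. s n x - u x) (\<lambda>x. s n x - u x) - 0) < r" using r by simp
      qed
    qed
  qed
qed

lemma clamp_le: "\<bar>max 0 (min 1 a) - max 0 (min 1 b)\<bar> \<le> \<bar>a - b\<bar>" for a b :: real
  by linarith

lemma F_clamp:
  assumes u: "u \<in> F"
  defines "v \<equiv> (\<lambda>x. max 0 (min 1 (u x)))"
  shows "v \<in> F" and "E v v \<le> E u u"
proof -
  obtain M where M: "dyadic_lipschitz M u" using u by (auto simp: F_def)
  have hv: "dyadic_lipschitz M v"
    unfolding dyadic_lipschitz_def v_def using dyadic_lipschitzD[OF M] clamp_le by (blast intro: order_trans)
  then have lv: "lloc v" by (rule dyadic_lipschitz_lloc)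
  have cv: "cov p v v \<le> cov p u u" for p
    unfolding v_def by (rule cov_contraction[OF F_lloc[OF u] lv[unfolded v_def] clamp_le])
  then have le: "wt p * cov p v v \<le> wt p * cov p u u" for p by (intro mult_left_mono wt_nonneg)
  have su: "(\<lambda>p. wt p * cov p u u) summable_on UNIV" using F_fin_energy[OF u] by (rule fin_energyD)
  have sv: "(\<lambda>p. wt p * cov p v v) summable_on UNIV"
    by (rule summable_on_comparison_test[OF su]) (use le E_term_nonneg[OF lv] in auto)
  show "v \<in> F" using u hv lv sv by (auto simp: F_def fin_energy_def v_def)
  show "E v v \<le> E u u" unfolding E_def by (rule infsum_mono[OF sv su le])
qed

lemma E_zero_iff:
  assumes u: "u \<in> F" shows "E u u = 0 \<longleftrightarrow> (\<exists>a. \<forall>x\<in>X. u x = a)"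
proof
  assume E0: "E u u = 0"
  obtain x0 where x0: "x0 \<in> X" using X_nonempty by blast
  have "u x = u x0" if "x \<in> X" for x using morrey[OF u that x0] E0 by simp
  then show "\<exists>a. \<forall>x\<in>X. u x = a" by blast
next
  assume "\<exists>a. \<forall>x\<in>X. u x = a"
  then obtain a where "\<And>x. x \<in> X \<Longrightarrow> u x = a" by blast
  then have "cov p u u = 0" for p using blk_sub[of p] by (intro cov_const_on_blk[of _ _ a]) auto
  then show "E u u = 0" by (simp add: E_def)
qed

lemma resistance_form: "resistance_form X E F"
  unfolding resistance_form_def
proof (intro conjI ballI allI impI)
  show "u x = 0" if "u \<in> F" "x \<notin> X" for u x using that by (simp add: F_def)
  show "(\<lambda>x. 0) \<in> F" using F_scale[OF one_F, of 0] by simp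
  show "(\<lambda>x. u x + v x) \<in> F" if "u \<in> F" "v \<in> F" for u v by (rule F_add[OF that])
  show "(\<lambda>x. a * u x) \<in> F" if "u \<in> F" for u a by (rule F_scale[OF that])
  show "E u v = E v u" for u v by (rule E_sym)
  show "E (\<lambda>x. u x + v x) w = E u w + E v w" if "u \<in> F" "v \<in> F" "w \<in> F" for u v w
    by (intro E_add F_fin_energy that)
  show "E (\<lambda>x. a * u x) v = a * E u v" for a u v by (rule E_scale)
  show "0 \<le> E u u" if "u \<in> F" for u by (rule E_nonneg[OF F_lloc[OF that]])
  show "indicator X \<in> F" by (rule one_F)
  show "E u u = 0 \<longleftrightarrow> (\<exists>a. \<forall>x\<in>X. u x = a)" if "u \<in> F" for u by (rule E_zero_iff[OF that])
  show "\<exists>u\<in>F. (\<lambda>n. E (\<lambda>x. s n x - u x) (\<lambda>x. s n x - u x)) \<longlonglongrightarrow> 0"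
    if "(\<forall>n. s n \<in> F) \<and> (\<forall>\<epsilon>>0. \<exists>N. \<forall>m\<ge>N. \<forall>n\<ge>N. E (\<lambda>x. s m x - s n x) (\<lambda>x. s m x - s n x) < \<epsilon>)" for s
    using that by (intro F_complete) blast+
  show "\<exists>u\<in>F. u x \<noteq> u y" if "x \<in> X" "y \<in> X" "x \<noteq> y" for x y
  proof -
    obtain v where "v \<in> F" "v x = 1" "v y = 0" using exists_test[OF \<open>x \<in> X\<close> \<open>y \<in> X\<close> \<open>x \<noteq> y\<close>] by blast
    then show ?thesis by (intro bexI[of _ v]) simp_all
  qed
  show "0 < effective_conductance X E F x y" if "x \<in> X" "y \<in> X" "x \<noteq> y" for x y
  proof -
    have "0 < 1 / (36 * g x y)" using g_pos[OF that] by simp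
    then show ?thesis using G_bounds(1)[OF that] by linarith
  qed
  show "(\<lambda>x. max 0 (min 1 (u x))) \<in> F" if "u \<in> F" for u by (rule F_clamp[OF that])
  show "E (\<lambda>x. max 0 (min 1 (u x))) (\<lambda>x. max 0 (min 1 (u x))) \<le> E u u" if "u \<in> F" for u
    by (rule F_clamp[OF that])
qed

end

section \<open>Topology, completeness and volume doubling\<close>

lemma continuous_map_realI:
  assumes "\<And>x e. x \<in> topspace T \<Longrightarrow> e > 0 \<Longrightarrow> \<exists>U. openin T U \<and> x \<in> U \<and> (\<forall>y\<in>U. \<bar>f y - f x\<bar> < e)"
  shows "continuous_map T euclideanreal f"
  unfolding continuous_map_def
proof (intro conjI allI impI)
  show "f \<in> topspace T \<rightarrow> topspace euclideanreal" by simp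
  fix V :: "real set" assume "openin euclideanreal V"
  then have V: "open V" by simp
  show "openin T {x \<in> topspace T. f x \<in> V}"
  proof (subst openin_subopen, intro ballI)
    fix x assume x: "x \<in> {x \<in> topspace T. f x \<in> V}"
    then obtain e where e: "e > 0" "ball (f x) e \<subseteq> V" using V open_contains_ball by blast
    obtain U where U: "openin T U" "x \<in> U" "\<forall>y\<in>U. \<bar>f y - f x\<bar> < e" using assms[OF _ e(1)] x by blast
    have "U \<subseteq> {x \<in> topspace T. f x \<in> V}"
      using U e openin_subset[OF U(1)] by (fastforce simp: dist_real_def abs_minus_commute)
    then show "\<exists>U. openin T U \<and> x \<in> U \<and> U \<subseteq> {x \<in> topspace T. f x \<in> V}" using U by blast
  qed
qed

lemma ex_power_between:
  fixes r q :: real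
  assumes "0 < r" "r \<le> 1" "1 < q"
  shows "\<exists>n. 1 / q ^ Suc n < r \<and> r \<le> 1 / q ^ n"
proof -
  define P where "P m \<longleftrightarrow> 1 / q ^ m < r" for m :: nat
  have "\<exists>m. P m"
  proof -
    obtain m where "1 / r < q ^ m" using real_arch_pow[OF assms(3)] by blast
    then have "1 / q ^ m < r" using assms by (simp add: field_simps)
    then show ?thesis unfolding P_def by blast
  qed
  define m where "m = (LEAST m. P m)"
  have Pm: "P m" unfolding m_def by (rule LeastI_ex) fact
  have "\<not> P 0" using assms by (simp add: P_def)
  then obtain n where n: "m = Suc n" using Pm by (cases m) auto
  have "\<not> P n" unfolding m_def[symmetric] by (rule not_less_Least) (simp add: m_def[symmetric] n)
  then show ?thesis using Pm n by (auto simp: P_def not_less)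
qed

context dyadic
begin

lemma Metric_space_R: "Metric_space X R"
  by (intro resistance.Metric_space_R resistance.intro resistance_form)

sublocale RM: Metric_space X R by (rule Metric_space_R)
sublocale rho: Metric_space X rho by (rule Metric_space_rho)

text \<open>The inverse of \<open>\<lambda>t. min t (t\<^sup>2)\<close> on the half-line; it turns
  radii for \<open>g\<close> into radii for \<open>rho\<close>.\<close>

definition phi :: "real \<Rightarrow> real" where "phi t = max t (sqrt t)"

lemma phi_mono: "s \<le> t \<Longrightarrow> phi s \<le> phi t"
  unfolding phi_def by (intro max.mono real_sqrt_le_mono)

lemma phi_pos: "0 < t \<Longrightarrow> 0 < phi t" by (simp add: phi_def max_def)

lemma phi_scale: "1 \<le> l \<Longrightarrow> 0 \<le> t \<Longrightarrow> phi (l * t) \<le> l * phi t"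
proof -
  assume l: "1 \<le> l" and t: "0 \<le> t"
  have "sqrt (l * t) \<le> l * sqrt t"
    using l t sqrt_le_D[of l "l"] by (simp add: real_sqrt_mult mult_right_mono real_le_lsqrt power2_eq_square mult_left_mono)
  moreover have "l * t \<le> l * max t (sqrt t)" "l * sqrt t \<le> l * max t (sqrt t)"
    using l by (auto intro!: mult_left_mono)
  ultimately show ?thesis unfolding phi_def by simp
qed

lemma g_less_iff:
  assumes "0 < t" shows "g x y < t \<longleftrightarrow> rho x y < phi t"
proof -
  have r: "rho x y \<ge> 0" by (rule rho_nonneg)
  have sq: "(rho x y)\<^sup>2 < t \<longleftrightarrow> rho x y < sqrt t"
    using r assms by (metis real_sqrt_abs abs_of_nonneg real_sqrt_less_iff)
  show ?thesis unfolding g_def phi_def min_less_iff_disj less_max_iff_disj sq ..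
qed

lemma phi_g: "phi (g x y) = rho x y"
proof (cases "rho x y \<le> 1")
  case True
  then have "(rho x y)\<^sup>2 \<le> rho x y" using rho_nonneg[of x y] by (simp add: power2_eq_square mult_left_le)
  moreover from this have "g x y = (rho x y)\<^sup>2" by (simp add: g_def)
  ultimately show ?thesis using rho_nonneg[of x y] by (simp add: phi_def max_def)
next
  case False
  then have "rho x y * 1 \<le> rho x y * rho x y" by (intro mult_left_mono) auto
  then have g: "g x y = rho x y" by (simp add: g_def power2_eq_square)
  have "sqrt (rho x y) \<le> rho x y" using False by (intro real_le_lsqrt) (auto simp: power2_eq_square)
  then show ?thesis unfolding g phi_def by simp
qed

lemma R_ball_supset: "0 < r \<Longrightarrow> rho.mball x (phi (r / 36)) \<subseteq> RM.mball x r"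
  using R_bounds(2)[of x] g_less_iff[of "r / 36" x] by (force simp: RM.in_mball rho.in_mball)

lemma R_ball_subset: "0 < r \<Longrightarrow> RM.mball x r \<subseteq> rho.mball x (phi (4 * r))"
  using R_bounds(1)[of x] g_less_iff[of "4 * r" x] by (force simp: RM.in_mball rho.in_mball)

lemma rho_ball_supset_cell: "x \<in> X \<Longrightarrow> 1 / 2 ^ n < r \<Longrightarrow> cell n (c n x) \<subseteq> rho.mball x r"
  using rho_le_iff[of x _ n] by (force simp: rho.in_mball)

lemma rho_ball_subset_cell: "x \<in> X \<Longrightarrow> r \<le> 1 / 2 ^ n \<Longrightarrow> rho.mball x r \<subseteq> cell n (c n x)"
  using rho_le_iff[of x _ n] by (force simp: rho.in_mball)

text \<open>Balls of \<open>R\<close> and cells are contained in each other at suitable scales, so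
  the cells form a base. Continuity, measurability and convergence can now be checked on
  cells.\<close>

lemma openin_R_iff:
  "openin RM.mtopology U \<longleftrightarrow> U \<subseteq> X \<and> (\<forall>x\<in>U. \<exists>n. cell n (c n x) \<subseteq> U)"
proof -
  have "(\<exists>r>0. RM.mball x r \<subseteq> U) \<longleftrightarrow> (\<exists>n. cell n (c n x) \<subseteq> U)" if x: "x \<in> X" for x
  proof
    assume "\<exists>r>0. RM.mball x r \<subseteq> U"
    then obtain r where r: "r > 0" "RM.mball x r \<subseteq> U" by blast
    obtain n where "1 / 2 ^ n < phi (r / 36)"
      using real_arch_pow_inv[of "phi (r / 36)" "1 / 2"] phi_pos[of "r / 36"] r by (auto simp: power_one_over)
    then show "\<exists>n. cell n (c n x) \<subseteq> U"
      using rho_ball_supset_cell[OF x] R_ball_supset[OF r(1), of x] r by blast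
  next
    assume "\<exists>n. cell n (c n x) \<subseteq> U"
    then obtain n where n: "cell n (c n x) \<subseteq> U" by blast
    \<comment> \<open>The radius \<open>1 / 4 ^ Suc n\<close> cancels the factor 4 of
      \<open>R_ball_subset\<close>, and the root of \<open>1 / 4 ^ n\<close> is
      \<open>1 / 2 ^ n\<close>.\<close>
    have "phi (4 * (1 / 4 ^ Suc n)) \<le> 1 / 2 ^ n"
    proof -
      have "sqrt (1 / 4 ^ n) = 1 / 2 ^ n"
        by (intro real_sqrt_unique) (simp_all add: power_divide power2_eq_square power_mult_distrib[symmetric])
      moreover have "1 / 4 ^ n \<le> (1 / 2 ^ n :: real)" by (intro divide_left_mono power_mono) simp_all
      ultimately show ?thesis by (simp add: phi_def)
    qed
    then have "RM.mball x (1 / 4 ^ Suc n) \<subseteq> U"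
      using R_ball_subset[of "1 / 4 ^ Suc n" x] rho_ball_subset_cell[OF x] n by (simp del: power_Suc) blast
    then show "\<exists>r>0. RM.mball x r \<subseteq> U" by (intro exI[of _ "1 / 4 ^ Suc n"]) (simp del: power_Suc)
  qed
  then show ?thesis unfolding RM.openin_mtopology by blast
qed

lemma openin_cell: "openin RM.mtopology (cell n k)"
  unfolding openin_R_iff by auto

text \<open>There are only countably many cells, so each open set is a countable union of
  them.\<close>

lemma borel_measure_on_R: "borel_measure_on X R \<mu>"
  unfolding borel_measure_on_def
proof
  show "space \<mu> = X" by (rule space_mu)
  have cells: "{{x \<in> X. c n x = k} |n k. True} = {cell n k | n k. True}" by (simp add: cell_def)
  show "sets \<mu> = sigma_sets X {U. openin RM.mtopology U}"
    unfolding sets_mu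
  proof (rule sigma_sets_eqI)
    show "a \<in> sigma_sets X {U. openin RM.mtopology U}" if "a \<in> {{x \<in> X. c n x = k} |n k. True}" for a
      using that openin_cell unfolding cells by blast
    fix U assume "U \<in> {U. openin RM.mtopology U}"
    then have U: "U \<subseteq> X" "\<forall>x\<in>U. \<exists>n. cell n (c n x) \<subseteq> U" by (auto simp: openin_R_iff)
    have eq: "U = (\<Union>(n, k)\<in>{(n, k). cell n k \<subseteq> U}. cell n k)"
    proof (intro equalityI subsetI)
      fix x assume x: "x \<in> U"
      then obtain n where "cell n (c n x) \<subseteq> U" using U by blast
      moreover have "x \<in> cell n (c n x)" using x U by auto
      ultimately show "x \<in> (\<Union>(n, k)\<in>{(n, k). cell n k \<subseteq> U}. cell n k)" by blast
    qed auto
    have "(\<Union>(n, k)\<in>{(n, k). cell n k \<subseteq> U}. cell n k) \<in> sets \<mu>"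
      by (intro sets.countable_UN') auto
    then show "U \<in> sigma_sets X {{x \<in> X. c n x = k} |n k. True}"
      using eq sets_mu by simp
  qed
qed

lemma R_ball_sets: "RM.mball x r \<in> sets \<mu>"
  using borel_measure_on_R RM.openin_mball unfolding borel_measure_on_def by auto

lemma singleton_eq: "x \<in> X \<Longrightarrow> {x} = (\<Inter>n. cell n (c n x))"
  using c_inj by auto

text \<open>Takes care of the sets of diameter 0 among the covering sets of a Hausdorff
  measure.\<close>

lemma emeasure_singleton: "x \<in> X \<Longrightarrow> {x} \<in> sets \<mu> \<and> emeasure \<mu> {x} = 0"
proof
  assume x: "x \<in> X"
  show s: "{x} \<in> sets \<mu>" unfolding singleton_eq[OF x] by (intro sets.countable_INT) auto
  have "emeasure \<mu> {x} \<le> ennreal (1 / 2 ^ n)" for n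
    unfolding emeasure_cell[of n "c n x", symmetric] using x by (intro emeasure_mono) auto
  moreover have "(\<lambda>n. ennreal (1 / 2 ^ n)) \<longlonglongrightarrow> ennreal 0"
    by (intro tendsto_ennrealI LIMSEQ_divide_realpow_zero) simp
  ultimately have "emeasure \<mu> {x} \<le> ennreal 0" by (intro LIMSEQ_le_const) auto
  then show "emeasure \<mu> {x} = 0" by simp
qed

text \<open>One cell if \<open>r \<le> 1\<close>, and the unit cells with index within the integer
  part of \<open>r\<close> otherwise. The same count bounds \<open>\<mu>\<close> and the Hausdorff
  measure from above.\<close>

lemma rho_ball_covered:
  assumes x: "x \<in> X" and r: "0 < r"
  shows "\<exists>m K. finite K \<and> rho.mball x r \<subseteq> (\<Union>k\<in>K. cell m k) \<and> real (card K) / 2 ^ m \<le> 3 * r"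
proof (cases "r \<le> 1")
  case True
  then obtain n where n: "1 / 2 ^ Suc n < r" "r \<le> 1 / 2 ^ n" using ex_power_between[OF r, of 2] by auto
  have "rho.mball x r \<subseteq> (\<Union>k\<in>{c n x}. cell n k)" using rho_ball_subset_cell[OF x n(2)] by simp
  moreover have "real (card {c n x}) / 2 ^ n \<le> 3 * r" using n r by simp
  ultimately show ?thesis by (intro exI[of _ n] exI[of _ "{c n x}"]) auto
next
  case False
  define i N where "i = c 0 x" and "N = nat \<lfloor>r\<rfloor>"
  have N: "real N \<le> r" "r < real N + 1" using False by (auto simp: N_def)
  define K where "K = {i - N..i + N}"
  have sub: "rho.mball x r \<subseteq> (\<Union>k\<in>K. cell 0 k)"
  proof
    fix y assume "y \<in> rho.mball x r"
    then have y: "y \<in> X" "rho x y < r" by (auto simp: rho.in_mball)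
    have "\<bar>real i - real (c 0 y)\<bar> < real N + 1"
      using rho_unit[OF x y(1)] y N by (cases "c 0 x = c 0 y") (auto simp: i_def)
    then have "c 0 y \<in> K" by (auto simp: K_def)
    then show "y \<in> (\<Union>k\<in>K. cell 0 k)" using y by auto
  qed
  have "card K \<le> 2 * N + 1" by (simp add: K_def)
  then have "real (card K) \<le> 3 * r" using N False by linarith
  then show ?thesis using sub by (intro exI[of _ 0] exI[of _ K]) (auto simp: K_def)
qed

lemma emeasure_cells_le: "finite K \<Longrightarrow> emeasure \<mu> (\<Union>k\<in>K. cell m k) \<le> ennreal (real (card K) / 2 ^ m)"
proof -
  assume K: "finite K"
  have "emeasure \<mu> (\<Union>k\<in>K. cell m k) \<le> (\<Sum>k\<in>K. emeasure \<mu> (cell m k))"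
    by (intro emeasure_subadditive_finite K) auto
  also have "\<dots> = ennreal (\<Sum>k\<in>K. 1 / 2 ^ m)" unfolding emeasure_cell by (rule sum_ennreal) simp
  finally show ?thesis by simp
qed

lemma rho_ball_sets: "rho.mball x r \<in> sets \<mu>"
proof (cases "x \<in> X \<and> 0 < r")
  case True
  have "openin RM.mtopology (rho.mball x r)"
    unfolding openin_R_iff
  proof (intro conjI ballI)
    fix y assume y: "y \<in> rho.mball x r"
    then obtain e where e: "e > 0" "rho.mball y e \<subseteq> rho.mball x r"
      using rho.openin_mball[of x r] unfolding rho.openin_mtopology by blast
    obtain n where n: "1 / 2 ^ n < e"
      using real_arch_pow_inv[of e "1 / 2"] e by (auto simp: power_one_over)
    have "y \<in> X" using y by (simp add: rho.in_mball)
    from rho_ball_supset_cell[OF this n] e(2)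
    show "\<exists>n. cell n (c n y) \<subseteq> rho.mball x r" by blast
  qed (rule rho.mball_subset_mspace)
  then show ?thesis using borel_measure_on_R unfolding borel_measure_on_def by auto
next
  case False
  then have "rho.mball x r = {}" by (auto simp: rho.mball_eq_empty)
  then show ?thesis by simp
qed

lemma rho_ball_emeasure:
  assumes x: "x \<in> X" and r: "0 < r"
  shows "emeasure \<mu> (rho.mball x r) \<le> ennreal (3 * r)" and "ennreal (r / 2) \<le> emeasure \<mu> (rho.mball x r)"
proof -
  obtain m K where K: "finite K" "rho.mball x r \<subseteq> (\<Union>k\<in>K. cell m k)" "real (card K) / 2 ^ m \<le> 3 * r"
    using rho_ball_covered[OF x r] by blast
  have "emeasure \<mu> (rho.mball x r) \<le> emeasure \<mu> (\<Union>k\<in>K. cell m k)"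
    by (intro emeasure_mono K sets.finite_UN) auto
  also have "\<dots> \<le> ennreal (real (card K) / 2 ^ m)" by (rule emeasure_cells_le[OF K(1)])
  also have "\<dots> \<le> ennreal (3 * r)" by (intro ennreal_leI K)
  finally show "emeasure \<mu> (rho.mball x r) \<le> ennreal (3 * r)" .
  show "ennreal (r / 2) \<le> emeasure \<mu> (rho.mball x r)"
  proof (cases "r \<le> 1")
    case True
    then obtain n where n: "1 / 2 ^ Suc n < r" "r \<le> 1 / 2 ^ n" using ex_power_between[OF r, of 2] by auto
    have "ennreal (r / 2) \<le> emeasure \<mu> (cell (Suc n) (c (Suc n) x))"
      unfolding emeasure_cell using n by (intro ennreal_leI) simp
    also have "\<dots> \<le> emeasure \<mu> (rho.mball x r)"
      by (intro emeasure_mono rho_ball_supset_cell x n rho_ball_sets)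
    finally show ?thesis .
  next
    case False
    define i N where "i = c 0 x" and "N = nat \<lceil>r\<rceil> - 1"
    have N: "real N < r" "r \<le> real N + 1" "1 \<le> N" using False unfolding N_def by linarith+
    \<comment> \<open>Only unit cells from \<open>i\<close> to the right are used, since near index
      0 there may be too few on the left; \<open>N < r\<close> keeps them inside the ball.\<close>
    define J where "J = {i..<i + N}"
    have sub: "(\<Union>k\<in>J. cell 0 k) \<subseteq> rho.mball x r"
    proof
      fix y assume "y \<in> (\<Union>k\<in>J. cell 0 k)"
      then have y: "y \<in> X" "i \<le> c 0 y" "c 0 y < i + N" by (auto simp: J_def)
      have "rho x y < r"
      proof (cases "c 0 x = c 0 y")
        case True
        then show ?thesis using rho_le_1[OF x y(1)] False by simp
      next
        case ne: False
        have "real (c 0 y) + 1 \<le> real i + real N" using y(3) by linarith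
        then show ?thesis using rho_unit[OF x y(1) ne] y N by (simp add: i_def)
      qed
      then show "y \<in> rho.mball x r" using x y by (simp add: rho.in_mball)
    qed
    have "ennreal (r / 2) \<le> ennreal (real N)" using N by (intro ennreal_leI) linarith
    also have "\<dots> = (\<Sum>k\<in>J. emeasure \<mu> (cell 0 k))"
      unfolding emeasure_cell by (subst sum_ennreal) (simp_all add: J_def)
    also have "\<dots> = emeasure \<mu> (\<Union>k\<in>J. cell 0 k)"
      by (intro sum_emeasure) (auto simp: disjoint_family_on_def J_def)
    also have "\<dots> \<le> emeasure \<mu> (rho.mball x r)" by (intro emeasure_mono sub rho_ball_sets)
    finally show ?thesis .
  qed
qed

lemma volume_doubling: "volume_doubling X R \<mu>"
  unfolding volume_doubling_def
\<comment> \<open>\<open>1728 = 3 * 288 * 2\<close>: the factors 3 and \<open>1 / 2\<close> come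
  from \<open>rho_ball_emeasure\<close>, and \<open>8 * r = 288 * (r / 36)\<close> enters
  \<open>phi_scale\<close>.\<close>
proof (intro exI[of _ "1728"] ballI allI impI conjI)
  fix x and r :: real assume x: "x \<in> X" and r: "r > 0"
  have up: "emeasure \<mu> (RM.mball x (2 * r)) \<le> ennreal (3 * phi (8 * r))"
  proof -
    have "emeasure \<mu> (RM.mball x (2 * r)) \<le> emeasure \<mu> (rho.mball x (phi (4 * (2 * r))))"
      using r by (intro emeasure_mono R_ball_subset rho_ball_sets) simp
    also have "\<dots> \<le> ennreal (3 * phi (4 * (2 * r)))"
      using r by (intro rho_ball_emeasure x phi_pos) simp
    finally show ?thesis by simp
  qed
  have low: "ennreal (phi (s / 36) / 2) \<le> emeasure \<mu> (RM.mball x s)" if "s > 0" for s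
  proof -
    have "ennreal (phi (s / 36) / 2) \<le> emeasure \<mu> (rho.mball x (phi (s / 36)))"
      using that by (intro rho_ball_emeasure x phi_pos) simp
    also have "\<dots> \<le> emeasure \<mu> (RM.mball x s)"
      using that by (intro emeasure_mono R_ball_supset R_ball_sets)
    finally show ?thesis .
  qed
  have "0 < ennreal (phi ((2 * r) / 36) / 2)" using r phi_pos[of "(2 * r) / 36"] by simp
  also have "\<dots> \<le> emeasure \<mu> (RM.mball x (2 * r))" using r by (intro low) simp
  finally show "0 < emeasure \<mu> (RM.mball x (2 * r))" .
  show "emeasure \<mu> (RM.mball x (2 * r)) < \<infinity>" using up by (simp add: le_less_trans ennreal_less_top)
  have "3 * phi (8 * r) \<le> 3 * (288 * phi (r / 36))"
    using phi_scale[of 288 "r / 36"] r by (simp add: mult.commute)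
  then have "ennreal (3 * phi (8 * r)) \<le> ennreal (1728 * (phi (r / 36) / 2))" by (intro ennreal_leI) simp
  also have "\<dots> = ennreal 1728 * ennreal (phi (r / 36) / 2)"
    using phi_pos[of "r / 36"] r by (intro ennreal_mult) auto
  also have "\<dots> \<le> ennreal 1728 * emeasure \<mu> (RM.mball x r)" by (intro mult_left_mono low r) simp
  finally show "emeasure \<mu> (RM.mball x (2 * r)) \<le> ennreal 1728 * emeasure \<mu> (RM.mball x r)"
    using up by (rule order_trans[rotated])
qed

text \<open>A Cauchy sequence is eventually constant in each index; the eventual values form a
  branch, which carries a point by \<open>c_ex\<close>.\<close>

lemma mcomplete_R: "RM.mcomplete"
  unfolding RM.mcomplete_def
proof (intro allI impI)
  fix \<sigma> assume "RM.MCauchy \<sigma>"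
  then have \<sigma>X: "\<And>m. \<sigma> m \<in> X" and C: "\<And>e. e > 0 \<Longrightarrow> \<exists>N. \<forall>n n'. N \<le> n \<longrightarrow> N \<le> n' \<longrightarrow> R (\<sigma> n) (\<sigma> n') < e"
    unfolding RM.MCauchy_def by auto
  have "\<exists>M. \<forall>m\<ge>M. c n (\<sigma> m) = c n (\<sigma> M)" for n
  proof -
    have "openin RM.mtopology (cell n k)" for k by (rule openin_cell)
    define e where "e = (1::real) / 4 ^ Suc n"
    have e: "e > 0" by (simp add: e_def)
    have pe: "phi (4 * e) \<le> 1 / 2 ^ n"
    proof -
      have "sqrt (1 / 4 ^ n) = 1 / 2 ^ n"
        by (intro real_sqrt_unique) (simp_all add: power_divide power2_eq_square power_mult_distrib[symmetric])
      moreover have "1 / 4 ^ n \<le> (1 / 2 ^ n :: real)" by (intro divide_left_mono power_mono) simp_all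
      ultimately show ?thesis by (simp add: phi_def e_def)
    qed
    obtain N where N: "\<forall>m m'. N \<le> m \<longrightarrow> N \<le> m' \<longrightarrow> R (\<sigma> m) (\<sigma> m') < e" using C[OF e] by blast
    have "c n (\<sigma> m) = c n (\<sigma> N)" if "m \<ge> N" for m
    proof -
      have "\<sigma> m \<in> RM.mball (\<sigma> N) e" using N that \<sigma>X by (simp add: RM.in_mball)
      then have "\<sigma> m \<in> cell n (c n (\<sigma> N))"
        using R_ball_subset[OF e] rho_ball_subset_cell[OF \<sigma>X pe] by blast
      then show ?thesis by simp
    qed
    then show ?thesis by blast
  qed
  then obtain M where M: "\<And>n m. m \<ge> M n \<Longrightarrow> c n (\<sigma> m) = c n (\<sigma> (M n))" by metis
  define h where "h n = c n (\<sigma> (M n))" for n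
  have "h (Suc n) div 2 = h n" for n
  proof -
    define m where "m = max (M n) (M (Suc n))"
    have "h (Suc n) = c (Suc n) (\<sigma> m)" "h n = c n (\<sigma> m)"
      using M[of n m] M[of "Suc n" m] by (auto simp: h_def m_def)
    then show ?thesis using c_div[OF \<sigma>X] by simp
  qed
  then obtain x where x: "x \<in> X" "\<forall>n. c n x = h n" using c_ex by blast
  show "\<exists>x. limitin RM.mtopology \<sigma> x sequentially"
    unfolding limitin_def
  proof (intro exI[of _ x] conjI allI impI)
    show "x \<in> topspace RM.mtopology" using x by simp
    fix U assume "openin RM.mtopology U \<and> x \<in> U"
    then obtain n where "cell n (c n x) \<subseteq> U" unfolding openin_R_iff by blast
    then have "\<sigma> m \<in> U" if "m \<ge> M n" for m
      using M[OF that] x \<sigma>X by (auto simp: h_def)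
    then show "\<forall>\<^sub>F m in sequentially. \<sigma> m \<in> U" unfolding eventually_sequentially by blast
  qed
qed

text \<open>Finitely many unit cells contain finitely many cells of each level, hence are totally
  bounded, and completeness gives compactness. This provides compact supports for cut-off
  functions.\<close>

lemma compactin_closure:
  assumes "S \<subseteq> {x \<in> X. c 0 x \<le> N}"
  shows "compactin RM.mtopology (RM.mtopology closure_of S)"
proof -
  have "RM.mtotally_bounded {x \<in> X. c 0 x \<le> N}"
    unfolding RM.mtotally_bounded_def
  proof (intro allI impI)
    fix e :: real assume e: "e > 0"
    obtain n where n: "1 / 2 ^ n < phi (e / 36)"
      using real_arch_pow_inv[of "phi (e / 36)" "1 / 2"] phi_pos[of "e / 36"] e by (auto simp: power_one_over)
    define z where "z k = (SOME x. x \<in> cell n k)" for k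
    have z: "z k \<in> cell n k" for k unfolding z_def by (rule someI_ex[OF cell_nonempty])
    define K where "K = z ` {k. k < Suc N * 2 ^ n}"
    have div0: "c 0 x = c n x div 2 ^ n" if "x \<in> X" for x using c_le[OF that, of 0 n] by simp
    show "\<exists>K. finite K \<and> K \<subseteq> {x \<in> X. c 0 x \<le> N} \<and> {x \<in> X. c 0 x \<le> N} \<subseteq> (\<Union>x\<in>K. RM.mball x e)"
    proof (intro exI[of _ K] conjI)
      show "finite K" by (simp add: K_def)
      show "K \<subseteq> {x \<in> X. c 0 x \<le> N}"
      proof
        fix x assume "x \<in> K"
        then obtain k where k: "k < Suc N * 2 ^ n" "x = z k" by (auto simp: K_def)
        then have "c n x div 2 ^ n < Suc N" using z[of k] by (intro less_mult_imp_div_less) auto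
        then show "x \<in> {x \<in> X. c 0 x \<le> N}" using z[of k] k div0[of x] by simp
      qed
      show "{x \<in> X. c 0 x \<le> N} \<subseteq> (\<Union>x\<in>K. RM.mball x e)"
      proof
        fix x assume x: "x \<in> {x \<in> X. c 0 x \<le> N}"
        then have "c n x div 2 ^ n < Suc N" using div0[of x] by simp
        then have "c n x < Suc N * 2 ^ n" by (simp only: div_less_iff_less_mult zero_less_power zero_less_numeral)
        then have "z (c n x) \<in> K" by (simp add: K_def)
        moreover have "x \<in> RM.mball (z (c n x)) e"
        proof -
          have "z (c n x) \<in> X" "c n (z (c n x)) = c n x" using z[of "c n x"] by auto
          moreover from this have "x \<in> cell n (c n (z (c n x)))" using x by simp
          ultimately show ?thesis
            using rho_ball_supset_cell[OF _ n, of "z (c n x)"] R_ball_supset[OF e, of "z (c n x)"] by blast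
        qed
        ultimately show "x \<in> (\<Union>x\<in>K. RM.mball x e)" by blast
      qed
    qed
  qed
  then have "RM.mtotally_bounded S" using assms by (rule RM.mtotally_bounded_subset)
  then show ?thesis using RM.mtotally_bounded_eq_compact_closure_of[OF mcomplete_R] by blast
qed

lemma continuous_F:
  assumes "u \<in> F" shows "continuous_map RM.mtopology euclideanreal u"
proof (rule continuous_map_realI)
  fix x e assume x: "x \<in> topspace RM.mtopology" and e: "(e::real) > 0"
  obtain M where M: "dyadic_lipschitz M u" using assms by (auto simp: F_def)
  have "(\<lambda>n. M / 2 ^ n) \<longlonglongrightarrow> 0" by (rule LIMSEQ_divide_realpow_zero) simp
  from LIMSEQ_D[OF this e] obtain n where n: "norm (M / 2 ^ n - 0) < e" by blast
  then have "M / 2 ^ n < e" using abs_ge_self[of "M / 2 ^ n"] by simp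
  then have "\<bar>u y - u x\<bar> < e" if "y \<in> cell n (c n x)" for y
    using dyadic_lipschitzD[OF M, of y x n] that x by simp
  then show "\<exists>U. openin RM.mtopology U \<and> x \<in> U \<and> (\<forall>y\<in>U. \<bar>u y - u x\<bar> < e)"
    using openin_cell x by (intro exI[of _ "cell n (c n x)"]) auto
qed

section \<open>Conformal dimension\<close>

lemma diam_power_1: "diam_power d 1 S = (if S = {} then 0 else ennreal (enn2real (mdiam d S)))"
  by (simp add: diam_power_def)

lemma mdiam_cell_le: "mdiam rho (cell n k) \<le> ennreal (1 / 2 ^ n)"
  unfolding mdiam_def using rho_le_iff by (intro SUP_least ennreal_leI) auto

lemma diam_power_cell_le: "diam_power rho 1 (cell n k) \<le> ennreal (1 / 2 ^ n)"
proof -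
  have "enn2real (mdiam rho (cell n k)) \<le> 1 / 2 ^ n"
    using enn2real_mono[OF mdiam_cell_le[of n k]] by simp
  then show ?thesis unfolding diam_power_1 by (auto intro: ennreal_leI)
qed

text \<open>Covering sets may fail to be measurable, but in the tree metric a set of diameter
  \<open>D\<close> with \<open>0 < D \<le> 1\<close> lies in a single cell of measure below
  \<open>2 * D\<close>.\<close>

lemma measurable_hull:
  assumes S: "S \<subseteq> X" "mdiam rho S \<le> ennreal 1"
  shows "\<exists>T\<in>sets \<mu>. S \<subseteq> T \<and> emeasure \<mu> T \<le> 2 * diam_power rho 1 S"
proof (cases "S = {}")
  case True then show ?thesis by (intro bexI[of _ "{}"]) auto
next
  case False
  then obtain x where x: "x \<in> S" by blast
  then have xX: "x \<in> X" using S by blast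
  define D where "D = enn2real (mdiam rho S)"
  have mD: "mdiam rho S = ennreal D" and D0: "D \<ge> 0"
    unfolding D_def using S(2) by (auto simp: ennreal_enn2real_if top_unique)
  have D1: "D \<le> 1" using S(2) unfolding mD by simp
  have le: "rho x y \<le> D" if "y \<in> S" for y
    using le_mdiam[OF x that, of rho] D0 unfolding mD by simp
  have dp: "diam_power rho 1 S = ennreal D" using False by (simp add: diam_power_1 D_def)
  show ?thesis
  proof (cases "D = 0")
    case True
    have "S \<subseteq> {x}" using le rho_pos[OF xX] S(1) True by (metis insert_iff linorder_not_less subset_iff)
    then show ?thesis using emeasure_singleton[OF xX] by (intro bexI[of _ "{x}"]) auto
  next
    case False
    then obtain n where n: "1 / 2 ^ Suc n < D" "D \<le> 1 / 2 ^ n" using ex_power_between[of D 2] D0 D1 by auto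
    have "S \<subseteq> cell n (c n x)"
    proof
      fix y assume y: "y \<in> S"
      then have "rho x y \<le> 1 / 2 ^ n" "y \<in> X" using le[OF y] n S by auto
      then show "y \<in> cell n (c n x)" using rho_le_iff[OF xX, of y n] by simp
    qed
    moreover have "emeasure \<mu> (cell n (c n x)) \<le> 2 * diam_power rho 1 S"
    proof -
      have "emeasure \<mu> (cell n (c n x)) \<le> ennreal (2 * D)"
        unfolding emeasure_cell using n by (intro ennreal_leI) simp
      also have "\<dots> = 2 * ennreal D" using D0 by (simp add: ennreal_mult)
      finally show ?thesis unfolding dp .
    qed
    ultimately show ?thesis by (intro bexI[of _ "cell n (c n x)"]) auto
  qed
qed

text \<open>The mass distribution principle. Covers by sets of diameter at most 1 suffice, because
  the Hausdorff measure dominates the premeasure at every scale.\<close>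

lemma mass_distribution:
  assumes t: "0 \<le> t" "ennreal (2 * t) \<le> emeasure \<mu> B"
  shows "ennreal t \<le> hausdorff_measure X rho 1 B"
proof -
  have "ennreal t \<le> hausdorff_pre X rho 1 1 B"
    unfolding hausdorff_pre_def
  proof (rule INF_greatest)
    fix C :: "nat \<Rightarrow> 'a set"
    assume "C \<in> {C. (\<forall>i. C i \<subseteq> X) \<and> B \<subseteq> (\<Union>i. C i) \<and> (\<forall>i. mdiam rho (C i) \<le> ennreal 1)}"
    then have C: "\<And>i. C i \<subseteq> X" "B \<subseteq> (\<Union>i. C i)" "\<And>i. mdiam rho (C i) \<le> ennreal 1" by auto
    have "\<forall>i. \<exists>T\<in>sets \<mu>. C i \<subseteq> T \<and> emeasure \<mu> T \<le> 2 * diam_power rho 1 (C i)"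
      using measurable_hull C by blast
    then obtain T where T: "\<And>i. T i \<in> sets \<mu>" "\<And>i. C i \<subseteq> T i" "\<And>i. emeasure \<mu> (T i) \<le> 2 * diam_power rho 1 (C i)"
      by metis
    have "B \<subseteq> (\<Union>i. T i)" using order_trans[OF C(2) UN_mono[OF order_refl T(2)]] .
    moreover have "(\<Union>i. T i) \<in> sets \<mu>" using T(1) by (intro sets.countable_UN) blast
    ultimately have "emeasure \<mu> B \<le> emeasure \<mu> (\<Union>i. T i)" by (rule emeasure_mono)
    also have "\<dots> \<le> (\<Sum>i. emeasure \<mu> (T i))"
      by (intro emeasure_subadditive_countably) (use T in auto)
    also have "\<dots> \<le> (\<Sum>i. 2 * diam_power rho 1 (C i))" by (intro suminf_le T) auto
    finally have "emeasure \<mu> B \<le> 2 * (\<Sum>i. diam_power rho 1 (C i))" by simp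
    then have "2 * ennreal t \<le> 2 * (\<Sum>i. diam_power rho 1 (C i))"
      using t by (simp add: ennreal_mult)
    then show "ennreal t \<le> (\<Sum>i. diam_power rho 1 (C i))"
      by (subst (asm) ennreal_mult_le_mult_iff) auto
  qed
  also have "\<dots> \<le> hausdorff_measure X rho 1 B"
    unfolding hausdorff_measure_def by (intro SUP_upper) auto
  finally show ?thesis .
qed

text \<open>Subdividing each cell into \<open>2 ^ j\<close> subcells makes the diameters small
  without raising the total of the bounds \<open>1 / 2 ^ n\<close>.\<close>

lemma hausdorff_cells_le:
  assumes K: "finite K" "B \<subseteq> (\<Union>k\<in>K. cell m k)"
  shows "hausdorff_measure X rho 1 B \<le> ennreal (real (card K) / 2 ^ m)"
  unfolding hausdorff_measure_def
proof (rule SUP_least)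
  fix \<delta> :: real assume "\<delta> \<in> {0<..}"
  then obtain j where j: "1 / 2 ^ j < \<delta>"
    using real_arch_pow_inv[of \<delta> "1 / 2"] by (auto simp: power_one_over)
  define n where "n = m + j"
  have n: "1 / 2 ^ n \<le> \<delta>"
  proof -
    have "1 / 2 ^ n \<le> (1 / 2 ^ j :: real)" by (intro divide_left_mono power_increasing) (simp_all add: n_def)
    then show ?thesis using j by linarith
  qed
  define K' where "K' = (\<Union>k\<in>K. {k * 2 ^ j..<Suc k * 2 ^ j})"
  have fK': "finite K'" using K by (simp add: K'_def)
  have "card K' \<le> (\<Sum>k\<in>K. card {k * 2 ^ j..<Suc k * 2 ^ j})"
    unfolding K'_def by (intro card_UN_le K)
  also have "\<dots> = card K * 2 ^ j" by simp
  finally have "real (card K') \<le> real (card K) * 2 ^ j"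
    by (metis of_nat_le_iff of_nat_mult of_nat_numeral of_nat_power)
  then have cK': "real (card K') / 2 ^ n \<le> real (card K) / 2 ^ m"
    by (simp add: n_def power_add field_simps)
  define C where "C i = (if i \<in> K' then cell n i else {})" for i
  have "hausdorff_pre X rho 1 \<delta> B \<le> (\<Sum>i. diam_power rho 1 (C i))"
    unfolding hausdorff_pre_def
  proof (rule INF_lower, intro CollectI conjI allI)
    show "C i \<subseteq> X" for i by (auto simp: C_def)
    show "mdiam rho (C i) \<le> ennreal \<delta>" for i
      using order_trans[OF mdiam_cell_le[of n i] ennreal_leI[OF n]] by (simp add: C_def mdiam_def bot_ennreal)
    show "B \<subseteq> (\<Union>i. C i)"
    proof
      fix x assume "x \<in> B"
      then obtain k where k: "k \<in> K" "x \<in> cell m k" using K by blast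
      have "k = c n x div 2 ^ j" using c_le[of x m n] k by (simp add: n_def)
      moreover have "c n x div 2 ^ j * 2 ^ j \<le> c n x" "c n x < Suc (c n x div 2 ^ j) * 2 ^ j"
        using dividend_less_div_times[of "2 ^ j" "c n x"] by (simp_all add: add.commute)
      ultimately have "c n x \<in> K'"
        unfolding K'_def using k by (intro UN_I[of "c n x div 2 ^ j"]) auto
      then have "x \<in> C (c n x)" using k by (simp add: C_def)
      then show "x \<in> (\<Union>i. C i)" by blast
    qed
  qed
  also have "\<dots> = (\<Sum>i\<in>K'. diam_power rho 1 (C i))"
    by (intro suminf_finite fK') (simp add: C_def diam_power_def)
  also have "\<dots> \<le> (\<Sum>i\<in>K'. ennreal (1 / 2 ^ n))"
    by (intro sum_mono) (simp add: C_def diam_power_cell_le)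
  also have "\<dots> = ennreal (\<Sum>i\<in>K'. 1 / 2 ^ n)" by (rule sum_ennreal) simp
  also have "\<dots> \<le> ennreal (real (card K) / 2 ^ m)" using cK' by (intro ennreal_leI) simp
  finally show "hausdorff_pre X rho 1 \<delta> B \<le> ennreal (real (card K) / 2 ^ m)" .
qed

lemma ahlfors_regular_rho: "ahlfors_regular X rho 1"
  unfolding ahlfors_regular_def
proof (intro exI[of _ 4] conjI ballI allI impI)
  fix x and r :: real assume x: "x \<in> X" and r: "r > 0"
  have "ennreal (r / 4) \<le> hausdorff_measure X rho 1 (rho.mball x r)"
    using rho_ball_emeasure(2)[OF x r] r by (intro mass_distribution) auto
  then show "ennreal (r powr 1 / 4) \<le> hausdorff_measure X rho 1 (rho.mball x r)" using r by simp
  obtain m K where K: "finite K" "rho.mball x r \<subseteq> (\<Union>k\<in>K. cell m k)" "real (card K) / 2 ^ m \<le> 3 * r"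
    using rho_ball_covered[OF x r] by blast
  have "hausdorff_measure X rho 1 (rho.mball x r) \<le> ennreal (real (card K) / 2 ^ m)"
    by (rule hausdorff_cells_le[OF K(1,2)])
  also have "\<dots> \<le> ennreal (4 * r powr 1)" using K r by (intro ennreal_leI) simp
  finally show "hausdorff_measure X rho 1 (rho.mball x r) \<le> ennreal (4 * r powr 1)" .
qed simp

lemma phi_mult: "0 \<le> s \<Longrightarrow> 0 \<le> t \<Longrightarrow> phi (s * t) \<le> phi s * phi t"
proof -
  assume st: "0 \<le> s" "0 \<le> t"
  have "s * t \<le> phi s * phi t" unfolding phi_def using st by (intro mult_mono) auto
  moreover have "sqrt s * sqrt t \<le> phi s * phi t" unfolding phi_def using st by (intro mult_mono) auto
  ultimately show ?thesis by (simp add: phi_def[of "s * t"] real_sqrt_mult)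
qed

lemma homeomorphism_phi: "homeomorphism {0..} {0..} (\<lambda>t. phi (144 * t)) (\<lambda>s. min s (s\<^sup>2) / 144)"
proof
  show "continuous_on {0..} (\<lambda>t. phi (144 * t))" unfolding phi_def by (intro continuous_intros)
  show "continuous_on {0..} (\<lambda>s::real. min s (s\<^sup>2) / 144)" by (intro continuous_intros) auto
  show "(\<lambda>t. phi (144 * t)) ` {0..} \<subseteq> {0..}" by (auto simp: phi_def le_max_iff_disj)
  show "(\<lambda>s::real. min s (s\<^sup>2) / 144) ` {0..} \<subseteq> {0..}" by auto
  have root: "phi (min s (s\<^sup>2)) = s" if s: "s \<ge> 0" for s
  proof (cases "s \<le> 1")
    case True
    then have "s\<^sup>2 \<le> s" using s by (simp add: power2_eq_square mult_left_le)
    then show ?thesis using s by (simp add: phi_def max_def min_absorb2)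
  next
    case False
    then have "s * 1 \<le> s * s" by (intro mult_left_mono) auto
    moreover from this have "sqrt s \<le> s" using False by (intro real_le_lsqrt) (auto simp: power2_eq_square)
    ultimately show ?thesis by (simp add: phi_def power2_eq_square min_absorb1 max_absorb1)
  qed
  show "phi (144 * (min s (s\<^sup>2) / 144)) = s" if "s \<in> {0..}" for s using root that by simp
  show "min (phi (144 * t)) ((phi (144 * t))\<^sup>2) / 144 = t" if "t \<in> {0..}" for t
  proof -
    have "min (phi u) ((phi u)\<^sup>2) = u" if u: "u \<ge> 0" for u
    proof (cases "u \<le> 1")
      case True
      then have "u \<le> sqrt u" using u by (intro real_le_rsqrt) (simp add: power2_eq_square mult_left_le)
      then show ?thesis using u by (simp add: phi_def max_absorb2 min_absorb2)
    next
      case False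
      then have "u * 1 \<le> u * u" by (intro mult_left_mono) auto
      moreover from this have "sqrt u \<le> u" using False by (intro real_le_lsqrt) (auto simp: power2_eq_square)
      ultimately show ?thesis by (simp add: phi_def power2_eq_square min_absorb1 max_absorb1)
    qed
    then show ?thesis using that by simp
  qed
qed

text \<open>\<open>144 = 4 * 36\<close> is the quotient of the two constants in
  \<open>R_bounds\<close>; that \<open>phi\<close> is submultiplicative turns a ratio of values of
  \<open>g\<close> into a ratio of values of \<open>rho\<close>.\<close>

lemma quasisymmetric_R_rho: "quasisymmetric X R rho"
  unfolding quasisymmetric_def
proof (intro exI conjI ballI impI)
  show "homeomorphism {0..} {0..} (\<lambda>t. phi (144 * t)) (\<lambda>s. min s (s\<^sup>2) / 144)" by (rule homeomorphism_phi)
  fix x y z assume X: "x \<in> X" "y \<in> X" "z \<in> X" and ne: "x \<noteq> z"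
  have Rp: "R x z > 0" using RM.mdist_pos_eq[OF X(1,3)] ne by simp
  have gp: "g x z > 0" by (rule g_pos[OF X(1,3) ne])
  have R0: "R x y \<ge> 0" by simp
  have "g x y \<le> 4 * R x y" using R_bounds(1)[OF X(1,2)] by simp
  also have "\<dots> \<le> 4 * R x y * (36 * g x z / R x z)"
  proof -
    have "1 \<le> 36 * g x z / R x z" using R_bounds(2)[OF X(1,3)] Rp by simp
    then show ?thesis using mult_left_mono[of 1 "36 * g x z / R x z" "4 * R x y"] R0 by simp
  qed
  also have "\<dots> = 144 * (R x y / R x z) * g x z" by simp
  finally have "rho x y \<le> phi (144 * (R x y / R x z) * g x z)" using phi_mono phi_g by metis
  also have "\<dots> \<le> phi (144 * (R x y / R x z)) * phi (g x z)"
    using Rp gp by (intro phi_mult) auto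
  finally show "rho x y / rho x z \<le> phi (144 * (R x y / R x z))"
    unfolding phi_g using rho_pos[OF X(1,3) ne] by (simp add: divide_le_eq)
qed

text \<open>The metric \<open>rho\<close> itself attains 1; one point from each unit cell forms the
  chain for the lower bound.\<close>

lemma dim_ARC_R: "dim_ARC X R = 1"
proof (rule antisym)
  show "dim_ARC X R \<le> 1"
    unfolding dim_ARC_def one_ereal_def
    by (rule Inf_lower) (use ahlfors_regular_rho quasisymmetric_R_rho Metric_space_rho in blast)
  define x where "x k = (SOME x. x \<in> cell 0 k)" for k
  have x: "x k \<in> cell 0 k" for k unfolding x_def by (rule someI_ex[OF cell_nonempty])
  show "1 \<le> dim_ARC X R"
  proof (rule dim_ARC_ge_1_of_chain[OF Metric_space_R, of "1 / 4" 36 x "cell 0"])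
    have gu: "g (x i) z = \<bar>real i - real j\<bar> + 1" if "i \<noteq> j" "z \<in> cell 0 j" for i j z
      using g_unit[of "x i" z] rho_unit[of "x i" z] x[of i] that by simp
    show "1 / 4 \<le> R (x i) z" if "z \<in> X" "z \<notin> cell 0 i" for i z
      using R_bounds(1)[of "x i" z] gu[of i "c 0 z" z] x[of i] that by simp
    show "1 / 4 * \<bar>real i - real j\<bar> \<le> R (x i) (x j)" for i j
      using R_bounds(1)[of "x i" "x j"] gu[of i j "x j"] x[of i] x[of j]
      by (cases "i = j") auto
    show "R (x i) z \<le> 36 * (\<bar>real i - real j\<bar> + 1)" if "z \<in> cell 0 j" for i j z
    proof (cases "i = j")
      case True
      have "g (x i) z \<le> rho (x i) z" by (simp add: g_def)
      also have "\<dots> \<le> 1" using rho_le_1[of "x i" z] x[of i] that True by simp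
      finally show ?thesis using R_bounds(2)[of "x i" z] x[of i] that True by simp
    next
      case False
      then show ?thesis using R_bounds(2)[of "x i" z] gu[of i j z] x[of i] that by simp
    qed
  qed (use x in auto)
qed

end

section \<open>The form on square integrable functions\<close>

lemma L2_measurable: "L2 M f \<Longrightarrow> f \<in> borel_measurable M" by (simp add: L2_def)

lemma L2_square_integrable: "L2 M f \<Longrightarrow> integrable M (\<lambda>x. (f x)\<^sup>2)" by (simp add: L2_def)

lemma abs_mult_le_squares: "\<bar>a * b\<bar> \<le> (a\<^sup>2 + b\<^sup>2) / 2" for a b :: real
  using sum_squares_bound[of "\<bar>a\<bar>" "\<bar>b\<bar>"] by (simp add: abs_mult)

lemma L2_mult_integrable:
  assumes "L2 M f" "L2 M g" shows "integrable M (\<lambda>x. f x * g x)"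
proof (rule Bochner_Integration.integrable_bound)
  show "integrable M (\<lambda>x. ((f x)\<^sup>2 + (g x)\<^sup>2) / 2)"
    using assms by (intro integrable_divide Bochner_Integration.integrable_add) (auto simp: L2_def)
  show "(\<lambda>x. f x * g x) \<in> borel_measurable M" using assms by (auto simp: L2_def)
  show "AE x in M. norm (f x * g x) \<le> norm (((f x)\<^sup>2 + (g x)\<^sup>2) / 2)"
    using abs_mult_le_squares by (intro AE_I2) (simp add: abs_of_nonneg)
qed

lemma L2_scale: "L2 M f \<Longrightarrow> L2 M (\<lambda>x. a * f x)"
  by (auto simp: L2_def power_mult_distrib)

lemma L2_add:
  assumes "L2 M f" "L2 M g" shows "L2 M (\<lambda>x. f x + g x)"
proof -
  have "integrable M (\<lambda>x. (f x)\<^sup>2 + 2 * (f x * g x) + (g x)\<^sup>2)"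
    using assms L2_mult_integrable[OF assms]
    by (intro Bochner_Integration.integrable_add integrable_mult_right) (auto simp: L2_def)
  moreover have "(\<lambda>x. f x + g x) \<in> borel_measurable M"
    using assms by (intro borel_measurable_add) (auto simp: L2_def)
  ultimately show ?thesis by (simp add: L2_def power2_sum algebra_simps)
qed

lemma L2_diff: "L2 M f \<Longrightarrow> L2 M g \<Longrightarrow> L2 M (\<lambda>x. f x - g x)"
  using L2_add[of M f "\<lambda>x. -1 * g x"] L2_scale[of M g "-1"] by simp

lemma L2_zero [simp]: "L2 M (\<lambda>x. 0)" by (simp add: L2_def)

lemma L2_square_add_le:
  assumes "L2 M f" "L2 M g"
  shows "(LINT x|M. (f x + g x)\<^sup>2) \<le> 2 * (LINT x|M. (f x)\<^sup>2) + 2 * (LINT x|M. (g x)\<^sup>2)"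
proof -
  have i: "integrable M (\<lambda>x. (f x)\<^sup>2)" "integrable M (\<lambda>x. (g x)\<^sup>2)" using assms by (auto simp: L2_def)
  have "(LINT x|M. (f x + g x)\<^sup>2) \<le> (LINT x|M. 2 * (f x)\<^sup>2 + 2 * (g x)\<^sup>2)"
  proof (rule integral_mono)
    show "integrable M (\<lambda>x. (f x + g x)\<^sup>2)" using L2_add[OF assms] by (simp add: L2_def)
    show "integrable M (\<lambda>x. 2 * (f x)\<^sup>2 + 2 * (g x)\<^sup>2)" using i by simp
    show "(f x + g x)\<^sup>2 \<le> 2 * (f x)\<^sup>2 + 2 * (g x)\<^sup>2" for x
      using sum_squares_bound[of "f x" "g x"] by (simp add: power2_sum)
  qed
  then show ?thesis using i by simp
qed

lemma summable_mult_of_squares: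
  fixes a b :: "nat \<Rightarrow> real"
  assumes "summable (\<lambda>k. (a k)\<^sup>2)" "summable (\<lambda>k. (b k)\<^sup>2)"
  shows "summable (\<lambda>k. a k * b k)"
proof (rule summable_comparison_test')
  show "summable (\<lambda>k. ((a k)\<^sup>2 + (b k)\<^sup>2) / 2)" by (intro summable_divide summable_add assms)
  show "norm (a k * b k) \<le> ((a k)\<^sup>2 + (b k)\<^sup>2) / 2" if "k \<ge> 0" for k
    using abs_mult_le_squares by simp
qed

context dyadic
begin

definition nsq :: "('a \<Rightarrow> real) \<Rightarrow> real" where "nsq f = (LINT x|\<mu>. (f x)\<^sup>2)"
definition ip :: "('a \<Rightarrow> real) \<Rightarrow> ('a \<Rightarrow> real) \<Rightarrow> real" where "ip f h = (LINT x|\<mu>. f x * h x)"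

lemma nsq_nonneg: "0 \<le> nsq f" by (simp add: nsq_def)

lemma ip_self: "ip f f = nsq f" by (simp add: ip_def nsq_def power2_eq_square)

lemma ip_sym: "ip f h = ip h f" by (simp add: ip_def mult.commute)

lemma ip_add: "L2 \<mu> f \<Longrightarrow> L2 \<mu> h \<Longrightarrow> L2 \<mu> w \<Longrightarrow> ip (\<lambda>x. f x + h x) w = ip f w + ip h w"
  unfolding ip_def distrib_right by (intro Bochner_Integration.integral_add L2_mult_integrable)

lemma ip_diff: "L2 \<mu> f \<Longrightarrow> L2 \<mu> h \<Longrightarrow> L2 \<mu> w \<Longrightarrow> ip (\<lambda>x. f x - h x) w = ip f w - ip h w"
  unfolding ip_def left_diff_distrib by (intro Bochner_Integration.integral_diff L2_mult_integrable)

lemma ip_scale: "ip (\<lambda>x. a * f x) h = a * ip f h"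
  unfolding ip_def mult.assoc by simp

lemma nsq_scale: "nsq (\<lambda>x. a * f x) = a\<^sup>2 * nsq f"
  unfolding nsq_def power_mult_distrib by simp

lemma nsq_add_le: "L2 \<mu> f \<Longrightarrow> L2 \<mu> h \<Longrightarrow> nsq (\<lambda>x. f x + h x) \<le> 2 * nsq f + 2 * nsq h"
  unfolding nsq_def by (rule L2_square_add_le)

lemma nsq_diff_le: "L2 \<mu> f \<Longrightarrow> L2 \<mu> h \<Longrightarrow> nsq (\<lambda>x. f x - h x) \<le> 2 * nsq f + 2 * nsq h"
  using nsq_add_le[of f "\<lambda>x. -1 * h x"] L2_scale[of \<mu> h "-1"] nsq_scale[of "-1" h] by simp

lemma ip_le: "L2 \<mu> f \<Longrightarrow> L2 \<mu> h \<Longrightarrow> \<bar>ip f h\<bar> \<le> (nsq f + nsq h) / 2"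
proof -
  assume fh: "L2 \<mu> f" "L2 \<mu> h"
  have "\<bar>ip f h\<bar> \<le> (LINT x|\<mu>. \<bar>f x * h x\<bar>)" unfolding ip_def by (rule integral_abs_bound)
  also have "\<dots> \<le> (LINT x|\<mu>. ((f x)\<^sup>2 + (h x)\<^sup>2) / 2)"
    using fh by (intro integral_mono abs_mult_le_squares integrable_abs L2_mult_integrable)
      (auto simp: L2_def)
  also have "\<dots> = (nsq f + nsq h) / 2" using fh by (simp add: nsq_def L2_def)
  finally show ?thesis .
qed

lemma L2_lloc:
  assumes f: "L2 \<mu> f" shows "lloc f"
  unfolding lloc_def
proof (intro conjI allI)
  show m: "f \<in> borel_measurable \<mu>" using f by (rule L2_measurable)
  fix k
  show "integrable \<mu> (\<lambda>x. indicator (cell 0 k) x * (f x)\<^sup>2)"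
    by (rule Bochner_Integration.integrable_bound[OF L2_square_integrable[OF f]])
      (use m in \<open>auto simp: indicator_def intro!: AE_I2\<close>)
qed

lemma cells_sums:
  assumes h: "integrable \<mu> h"
  shows "(\<lambda>k. I (cell n k) h) sums (LINT x|\<mu>. h x)"
proof -
  define q where "q k x = indicator (cell n k) x * h x" for k x
  have q: "integrable \<mu> (q k)" for k
  proof -
    have "q k = (\<lambda>x. h x * indicator (cell n k) x)" by (auto simp: q_def)
    then show ?thesis using integrable_real_mult_indicator[OF cell_sets h] by simp
  qed
  have fin: "q k x = 0" if "k \<notin> {c n x}" for k x using that by (auto simp: q_def)
  have qs: "(\<Sum>k. q k x) = h x" if "x \<in> space \<mu>" for x
  proof -
    have "(\<Sum>k. q k x) = (\<Sum>k\<in>{c n x}. q k x)" by (rule suminf_finite) (use fin in auto)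
    also have "\<dots> = h x" using that by (simp add: q_def space_mu)
    finally show ?thesis .
  qed
  have "(\<lambda>k. integral\<^sup>L \<mu> (q k)) sums (LINT x|\<mu>. (\<Sum>k. q k x))"
  proof (rule sums_integral[OF q])
    show "AE x in \<mu>. summable (\<lambda>k. norm (q k x))"
      using fin by (intro AE_I2 summable_finite[of "{c n x}" for x]) auto
    show "summable (\<lambda>k. LINT x|\<mu>. norm (q k x))"
    proof (rule bounded_imp_summable)
      show "0 \<le> (LINT x|\<mu>. norm (q k x))" for k by simp
      fix N
      have "(\<Sum>k\<le>N. LINT x|\<mu>. norm (q k x)) = (LINT x|\<mu>. (\<Sum>k\<le>N. norm (q k x)))"
        using q by (intro Bochner_Integration.integral_sum[symmetric]) auto
      also have "\<dots> \<le> (LINT x|\<mu>. norm (h x))"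
      proof (rule integral_mono)
        show "integrable \<mu> (\<lambda>x. \<Sum>k\<le>N. norm (q k x))" using q by auto
        show "integrable \<mu> (\<lambda>x. norm (h x))" using h by auto
        fix x
        have "(\<Sum>k\<le>N. norm (q k x)) = (\<Sum>k\<in>{..N} \<inter> {c n x}. norm (q k x))"
          by (rule sum.mono_neutral_right) (use fin in auto)
        also have "\<dots> \<le> (\<Sum>k\<in>{c n x}. norm (q k x))" by (rule sum_mono2) auto
        also have "\<dots> \<le> norm (h x)" by (auto simp: q_def indicator_def)
        finally show "(\<Sum>k\<le>N. norm (q k x)) \<le> norm (h x)" .
      qed
      finally show "(\<Sum>k\<le>N. LINT x|\<mu>. norm (q k x)) \<le> (LINT x|\<mu>. norm (h x))" .
    qed
  qed
  moreover have "(LINT x|\<mu>. (\<Sum>k. q k x)) = (LINT x|\<mu>. h x)"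
    by (rule Bochner_Integration.integral_cong) (use qs in auto)
  moreover have "I (cell n k) h = integral\<^sup>L \<mu> (q k)" for k by (simp add: I_def q_def[abs_def])
  ultimately show ?thesis by simp
qed

section \<open>Step functions and cell means\<close>

definition lev :: "nat \<Rightarrow> (nat \<Rightarrow> real) \<Rightarrow> 'a \<Rightarrow> real" where
  "lev n a x = indicator X x * a (c n x)"

lemma lev_in: "x \<in> X \<Longrightarrow> lev n a x = a (c n x)" by (simp add: lev_def)
lemma lev_out: "x \<notin> X \<Longrightarrow> lev n a x = 0" by (simp add: lev_def)

lemma lev_measurable [measurable]: "lev n a \<in> borel_measurable \<mu>"
proof -
  have "a \<in> measurable (count_space UNIV) borel" by simp
  from measurable_compose[OF c_measurable this] have "(\<lambda>x. a (c n x)) \<in> borel_measurable \<mu>" .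
  then show ?thesis unfolding lev_def by measurable
qed

lemma lev_L2:
  assumes a: "summable (\<lambda>k. (a k)\<^sup>2)"
  shows "L2 \<mu> (lev n a)" and "nsq (lev n a) = (\<Sum>k. (a k)\<^sup>2) / 2 ^ n"
proof -
  define q where "q k x = indicator (cell n k) x * (a k)\<^sup>2" for k x
  have q: "integrable \<mu> (q k)" for k
    unfolding q_def by (rule integrable_one[OF lloc_const bset_cell])
  have iq: "integral\<^sup>L \<mu> (q k) = (a k)\<^sup>2 / 2 ^ n" for k
    using I_const[OF bset_cell, of n k "(a k)\<^sup>2"] unfolding I_def q_def measure_cell by simp
  have fin: "q k x = 0" if "k \<notin> {c n x}" for k x using that by (auto simp: q_def)
  have qs: "(\<Sum>k. q k x) = (lev n a x)\<^sup>2" for x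
  proof -
    have "(\<Sum>k. q k x) = (\<Sum>k\<in>{c n x}. q k x)" by (rule suminf_finite) (use fin in auto)
    then show ?thesis by (simp add: q_def lev_def indicator_def)
  qed
  have 1: "AE x in \<mu>. summable (\<lambda>k. norm (q k x))"
    using fin by (intro AE_I2 summable_finite[of "{c n x}" for x]) auto
  have "(\<lambda>x. norm (q k x)) = q k" for k by (auto simp: q_def)
  then have 2: "summable (\<lambda>k. LINT x|\<mu>. norm (q k x))" using a iq by (simp add: summable_divide)
  have "integrable \<mu> (\<lambda>x. \<Sum>k. q k x)" by (rule integrable_suminf[OF q 1 2])
  then show "L2 \<mu> (lev n a)" unfolding L2_def qs by simp
  have "(LINT x|\<mu>. (\<Sum>k. q k x)) = (\<Sum>k. integral\<^sup>L \<mu> (q k))" by (rule integral_suminf[OF q 1 2])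
  then show "nsq (lev n a) = (\<Sum>k. (a k)\<^sup>2) / 2 ^ n"
    unfolding nsq_def qs iq using suminf_divide[OF a] by simp
qed

definition cell_avg :: "nat \<Rightarrow> ('a \<Rightarrow> real) \<Rightarrow> nat \<Rightarrow> real" where
  "cell_avg n f k = 2 ^ n * I (cell n k) f"

text \<open>Conditional expectation onto the functions that are constant on the cells of level
  \<open>n\<close>.\<close>

definition cell_mean :: "nat \<Rightarrow> ('a \<Rightarrow> real) \<Rightarrow> 'a \<Rightarrow> real" where "cell_mean n f = lev n (cell_avg n f)"

lemma cell_avg_square_le:
  assumes "lloc f" shows "(cell_avg n f k)\<^sup>2 \<le> 2 ^ n * I (cell n k) (\<lambda>x. (f x)\<^sup>2)"
proof -
  have "(I (cell n k) f)\<^sup>2 \<le> 1 / 2 ^ n * I (cell n k) (\<lambda>x. (f x)\<^sup>2)"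
    using I_square_le[OF assms, of "(Suc n, k)"] by (simp add: blk_simps vol_Suc)
  then have "(2 ^ n)\<^sup>2 * (I (cell n k) f)\<^sup>2 \<le> (2 ^ n)\<^sup>2 * (1 / 2 ^ n * I (cell n k) (\<lambda>x. (f x)\<^sup>2))"
    by (rule mult_left_mono) simp
  moreover have "(2 ^ n)\<^sup>2 * (1 / 2 ^ n * J) = 2 ^ n * J" for J :: real by (simp add: power2_eq_square)
  ultimately show ?thesis by (simp add: cell_avg_def power_mult_distrib)
qed

lemma cell_avg_summable:
  assumes f: "L2 \<mu> f"
  shows "summable (\<lambda>k. (cell_avg n f k)\<^sup>2)" and "(\<Sum>k. (cell_avg n f k)\<^sup>2) \<le> 2 ^ n * nsq f"
proof -
  have s: "(\<lambda>k. 2 ^ n * I (cell n k) (\<lambda>x. (f x)\<^sup>2)) sums (2 ^ n * nsq f)"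
    unfolding nsq_def by (intro sums_mult cells_sums L2_square_integrable f)
  show 1: "summable (\<lambda>k. (cell_avg n f k)\<^sup>2)"
    by (rule summable_comparison_test'[OF sums_summable[OF s]])
      (use cell_avg_square_le[OF L2_lloc[OF f]] in simp)
  show "(\<Sum>k. (cell_avg n f k)\<^sup>2) \<le> 2 ^ n * nsq f"
    using suminf_le[OF cell_avg_square_le[OF L2_lloc[OF f], of n] 1 sums_summable[OF s]] sums_unique[OF s] by simp
qed

lemma cell_mean_L2: "L2 \<mu> f \<Longrightarrow> L2 \<mu> (cell_mean n f)"
  unfolding cell_mean_def by (intro lev_L2 cell_avg_summable)

lemma cell_mean_nsq_le: "L2 \<mu> f \<Longrightarrow> nsq (cell_mean n f) \<le> nsq f"
  unfolding cell_mean_def using cell_avg_summable[of f n] lev_L2(2)[of "cell_avg n f" n]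
  by (simp add: divide_le_eq mult.commute)

lemma lev_ip_sums:
  assumes a: "summable (\<lambda>k. (a k)\<^sup>2)" and v: "L2 \<mu> v"
  shows "(\<lambda>k. a k * I (cell n k) v) sums ip (lev n a) v"
proof -
  have "I (cell n k) (\<lambda>x. lev n a x * v x) = a k * I (cell n k) v" for k
  proof -
    have "I (cell n k) (\<lambda>x. lev n a x * v x) = I (cell n k) (\<lambda>x. a k * v x)"
      by (rule I_cong) (simp add: lev_def)
    then show ?thesis by (simp add: I_scale)
  qed
  then show ?thesis
    using cells_sums[OF L2_mult_integrable[OF lev_L2(1)[OF a] v], of n n] by (simp add: ip_def)
qed

text \<open>Summed over one level, the covariances form the bilinear form of the projection
  complementary to the cell means.\<close>

lemma cov_level_sums:
  assumes "L2 \<mu> u" "L2 \<mu> v"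
  shows "(\<lambda>k. cov (Suc m, k) u v) sums ip (\<lambda>x. u x - cell_mean m u x) v"
proof -
  have "cov (Suc m, k) u v = I (cell m k) (\<lambda>x. u x * v x) - cell_avg m u k * I (cell m k) v" for k
    by (simp add: cov_def blk_simps vol_Suc cell_avg_def)
  moreover have "(\<lambda>k. I (cell m k) (\<lambda>x. u x * v x) - cell_avg m u k * I (cell m k) v) sums (ip u v - ip (cell_mean m u) v)"
    unfolding cell_mean_def ip_def[of u]
    by (intro sums_diff cells_sums L2_mult_integrable lev_ip_sums cell_avg_summable assms)
  ultimately show ?thesis using ip_diff[OF assms(1) cell_mean_L2[OF assms(1)] assms(2)] by simp
qed

text \<open>A step of the lazy random walk on the natural numbers; truncated subtraction makes the
  walk stay at 0 instead of leaving, a reflecting boundary.\<close>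

definition nbr_avg :: "(nat \<Rightarrow> real) \<Rightarrow> nat \<Rightarrow> real" where
  "nbr_avg b k = (b (k - 1) + 2 * b k + b (Suc k)) / 4"

definition nbr_mean :: "('a \<Rightarrow> real) \<Rightarrow> 'a \<Rightarrow> real" where "nbr_mean f = lev 0 (nbr_avg (cell_avg 0 f))"

lemma square_sum3_le: "((a + 2 * b + d) / 4)\<^sup>2 \<le> a\<^sup>2 + b\<^sup>2 + d\<^sup>2" for a b d :: real
proof -
  have "a\<^sup>2 + b\<^sup>2 + d\<^sup>2 - ((a + 2 * b + d) / 4)\<^sup>2
     = (12 * a\<^sup>2 + 8 * b\<^sup>2 + 12 * d\<^sup>2 + 2 * (a - b)\<^sup>2 + 2 * (b - d)\<^sup>2 + (a - d)\<^sup>2) / 16"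
    by (simp add: power2_eq_square field_simps)
  also have "0 \<le> \<dots>" by simp
  finally show ?thesis by simp
qed

lemma summable_pred: "summable f \<Longrightarrow> summable (\<lambda>k. f (k - 1))" for f :: "nat \<Rightarrow> real"
  using summable_Suc_iff[of "\<lambda>k. f (k - 1)"] by simp

lemma nbr_avg_summable:
  assumes "summable (\<lambda>k. (b k)\<^sup>2)" shows "summable (\<lambda>k. (nbr_avg b k)\<^sup>2)"
proof (rule summable_comparison_test')
  show "summable (\<lambda>k. (b (k - 1))\<^sup>2 + (b k)\<^sup>2 + (b (Suc k))\<^sup>2)"
    by (intro summable_add assms summable_pred[OF assms] summable_Suc_iff[THEN iffD2])
  show "norm ((nbr_avg b k)\<^sup>2) \<le> (b (k - 1))\<^sup>2 + (b k)\<^sup>2 + (b (Suc k))\<^sup>2" if "k \<ge> 0" for k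
    unfolding nbr_avg_def using square_sum3_le by simp
qed

lemma nbr_mean_L2: "L2 \<mu> f \<Longrightarrow> L2 \<mu> (nbr_mean f)"
  unfolding nbr_mean_def by (intro lev_L2 nbr_avg_summable cell_avg_summable)

text \<open>Consecutive blocks overlap, so each unit cell lies in exactly two of them. This produces
  the factor 2, which the weight \<open>1 / 2\<close> cancels.\<close>

lemma cov_pair_sums:
  assumes u: "L2 \<mu> u" and v: "L2 \<mu> v"
  shows "(\<lambda>k. cov (0, k) u v) sums (2 * ip (\<lambda>x. u x - nbr_mean u x) v)"
proof -
  define m n s where "m k = I (cell 0 k) u" and "n k = I (cell 0 k) v"
    and "s k = I (cell 0 k) (\<lambda>x. u x * v x)" for k
  have lu: "lloc u" and lv: "lloc v" using u v L2_lloc by auto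
  have m_cell_avg: "m = cell_avg 0 u" and n_cell_avg: "n = cell_avg 0 v" by (auto simp: m_def n_def cell_avg_def)
  have m2: "summable (\<lambda>k. (m k)\<^sup>2)" and n2: "summable (\<lambda>k. (n k)\<^sup>2)"
    unfolding m_cell_avg n_cell_avg by (intro cell_avg_summable u v)+
  have m2': "summable (\<lambda>k. (m (Suc k))\<^sup>2)" and n2': "summable (\<lambda>k. (n (Suc k))\<^sup>2)"
    using m2 n2 by (simp_all add: summable_Suc_iff[of "\<lambda>k. (m k)\<^sup>2"] summable_Suc_iff[of "\<lambda>k. (n k)\<^sup>2"])
  have S: "s sums ip u v" unfolding s_def ip_def by (intro cells_sums L2_mult_integrable u v)
  define T U V where "T = (\<Sum>k. m k * n k)" and "U = (\<Sum>k. m (Suc k) * n k)" and "V = (\<Sum>k. m k * n (Suc k))"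
  have T: "(\<lambda>k. m k * n k) sums T" and U: "(\<lambda>k. m (Suc k) * n k) sums U" and V: "(\<lambda>k. m k * n (Suc k)) sums V"
    unfolding T_def U_def V_def by (intro summable_sums summable_mult_of_squares m2 n2 m2' n2')+
  have S': "(\<lambda>k. s (Suc k)) sums (ip u v - s 0)" using S by (simp add: sums_Suc_iff)
  have T': "(\<lambda>k. m (Suc k) * n (Suc k)) sums (T - m 0 * n 0)" using T by (simp add: sums_Suc_iff[of "\<lambda>k. m k * n k"])
  \<comment> \<open>Block \<open>(0, 0)\<close> is a single unit cell of volume 1, unlike all other
    blocks of level 0; it is the second block for unit cell 0.\<close>
  have c0: "cov (0, 0) u v = s 0 - m 0 * n 0"
    by (simp add: cov_def blk_simps vol_def measure_cell m_def n_def s_def)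
  have disj: "cell 0 (Suc k) \<inter> cell 0 k = {}" for k by auto
  have volS: "vol (0, Suc k) = 2" for k
    unfolding vol_def blk_simps
    by (subst measure_Un3) (auto simp: cell_fmeasurable disj measure_cell)
  have cS: "cov (0, Suc k) u v
      = s (Suc k) + s k - (m (Suc k) * n (Suc k) + m (Suc k) * n k + m k * n (Suc k) + m k * n k) / 2" for k
  proof -
    have unit_of: "I (cell 0 (Suc k) \<union> cell 0 k) w = I (cell 0 (Suc k)) w + I (cell 0 k) w" if "lloc w" for w
      by (intro I_Un that bset_cell disj)
    have un2: "I (cell 0 (Suc k) \<union> cell 0 k) (\<lambda>x. u x * v x) = s (Suc k) + s k"
    proof -
      have "indicator (cell 0 (Suc k) \<union> cell 0 k) x * (u x * v x)
          = indicator (cell 0 (Suc k)) x * (u x * v x) + indicator (cell 0 k) x * (u x * v x)" for x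
        using disj by (cases "x \<in> cell 0 k"; cases "x \<in> cell 0 (Suc k)") auto
      then show ?thesis unfolding s_def I_def
        using integrable_prod[OF lu lv bset_cell, of 0 "Suc k"] integrable_prod[OF lu lv bset_cell, of 0 k] by simp
    qed
    show ?thesis
      unfolding cov_def volS unfolding blk_simps diff_Suc_1 unit_of[OF lu] unit_of[OF lv] un2
      by (simp add: m_def n_def field_simps)
  qed
  have "(\<lambda>k. cov (0, Suc k) u v) sums ((ip u v - s 0) + ip u v - ((T - m 0 * n 0) + U + V + T) / 2)"
    unfolding cS by (intro sums_diff sums_add sums_divide S S' T T' U V)
  then have 1: "(\<lambda>k. cov (0, k) u v) sums ((ip u v - s 0) + ip u v - ((T - m 0 * n 0) + U + V + T) / 2 + cov (0, 0) u v)"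
    by (rule iffD1[OF sums_Suc_iff])
  \<comment> \<open>At \<open>k = 0\<close> the predecessor is 0 again, which contributes the extra
    \<open>m 0 * n 0\<close>: the reflection at the boundary.\<close>
  have P: "(\<lambda>k. m (k - 1) * n k) sums (V + m 0 * n 0)"
    using V sums_Suc_iff[of "\<lambda>k. m (k - 1) * n k"] by simp
  have "(\<lambda>k. (m (k - 1) * n k + 2 * (m k * n k) + m (Suc k) * n k) / 4) sums ((V + m 0 * n 0 + 2 * T + U) / 4)"
    by (intro sums_divide sums_add sums_mult P T U)
  moreover have "(m (k - 1) * n k + 2 * (m k * n k) + m (Suc k) * n k) / 4 = nbr_avg (cell_avg 0 u) k * I (cell 0 k) v" for k
    unfolding nbr_avg_def m_cell_avg[symmetric] n_def by (simp add: field_simps)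
  ultimately have "ip (nbr_mean u) v = (V + m 0 * n 0 + 2 * T + U) / 4"
    using lev_ip_sums[OF nbr_avg_summable[OF cell_avg_summable(1)[OF u]] v, of 0 0] sums_unique2
    unfolding nbr_mean_def by force
  then have "2 * ip (\<lambda>x. u x - nbr_mean u x) v = (ip u v - s 0) + ip u v - ((T - m 0 * n 0) + U + V + T) / 2 + cov (0, 0) u v"
    unfolding ip_diff[OF u nbr_mean_L2[OF u] v] c0 by (simp add: field_simps)
  then show ?thesis using 1 by simp
qed

text \<open>Row 0 is the coupling of unit cells and row \<open>m + 1\<close> belongs to the cells of
  level \<open>m\<close>, in the numbering of the blocks.\<close>

definition energy_row :: "('a \<Rightarrow> real) \<Rightarrow> ('a \<Rightarrow> real) \<Rightarrow> nat \<Rightarrow> real" where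
  "energy_row u v m = (case m of 0 \<Rightarrow> ip (\<lambda>x. u x - nbr_mean u x) v | Suc m \<Rightarrow> 7 * 8 ^ m * ip (\<lambda>x. u x - cell_mean m u x) v)"

lemma energy_row_sums:
  assumes "L2 \<mu> u" "L2 \<mu> v" shows "(\<lambda>k. wt (m, k) * cov (m, k) u v) sums energy_row u v m"
proof (cases m)
  case 0
  then show ?thesis using sums_mult[OF cov_pair_sums[OF assms], of "1 / 2"] by (simp add: energy_row_def wt_simps)
next
  case (Suc m')
  then show ?thesis using sums_mult[OF cov_level_sums[OF assms], of "7 * 8 ^ m'"] by (simp add: energy_row_def wt_simps)
qed

text \<open>Absolute convergence permits summing row by row. For Haar components and functions of
  the unit cell only finitely many rows are nonzero, which reduces \<open>E\<close> to inner
  products.\<close>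

lemma E_rows:
  assumes u: "fin_energy u" "L2 \<mu> u" and v: "fin_energy v" "L2 \<mu> v"
    and zero: "\<And>m. m > n \<Longrightarrow> energy_row u v m = 0"
  shows "E u v = (\<Sum>m\<le>n. energy_row u v m)"
proof -
  have s: "(\<lambda>p. wt p * cov p u v) summable_on Sigma UNIV (\<lambda>_. UNIV)"
    using fin_energy_cov_summable[OF u(1) v(1)] by simp
  have "(\<Sum>\<^sub>\<infinity>k. wt (m, k) * cov (m, k) u v) = energy_row u v m" for m
  proof -
    have "(\<lambda>k. wt (m, k) * cov (m, k) u v) summable_on UNIV"
      by (rule summable_on_SigmaD1[where f = "\<lambda>p k. wt (p, k) * cov (p, k) u v" and A = UNIV and B = "\<lambda>_. UNIV"])
        (use s in \<open>simp_all add: case_prod_unfold\<close>)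
    then have "((\<lambda>k. wt (m, k) * cov (m, k) u v) has_sum (\<Sum>\<^sub>\<infinity>k. wt (m, k) * cov (m, k) u v)) UNIV" by simp
    from has_sum_imp_sums[OF this] energy_row_sums[OF u(2) v(2)] show ?thesis by (rule sums_unique2)
  qed
  then have "E u v = infsum (energy_row u v) UNIV"
    unfolding E_def using infsum_Sigma_banach[OF s] by simp
  also have "\<dots> = infsum (energy_row u v) {..n}" by (rule infsum_cong_neutral) (use zero in auto)
  finally show ?thesis by simp
qed

lemma fin_energy_rows:
  assumes u: "L2 \<mu> u" and zero: "\<And>m. m > n \<Longrightarrow> energy_row u u m = 0"
  shows "fin_energy u"
proof -
  have l: "lloc u" by (rule L2_lloc[OF u])
  have "(\<lambda>p. wt p * cov p u u) summable_on Sigma UNIV (\<lambda>_. UNIV)"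
  proof (rule summable_on_SigmaI)
    show "((\<lambda>k. wt (m, k) * cov (m, k) u u) has_sum energy_row u u m) UNIV" for m
      by (intro sums_nonneg_imp_has_sum energy_row_sums u E_term_nonneg l)
    have "energy_row u u summable_on {..n} \<longleftrightarrow> energy_row u u summable_on UNIV"
      by (rule summable_on_cong_neutral) (use zero in auto)
    then show "energy_row u u summable_on UNIV" by simp
    show "0 \<le> wt (x, y) * cov (x, y) u u" for x y by (rule E_term_nonneg[OF l])
  qed
  then show ?thesis using l by (simp add: fin_energy_def)
qed

end

section \<open>Superpositions and the Dirichlet form domain\<close>

text \<open>Cauchy-Schwarz for the measure with masses \<open>\<bar>a j\<bar>\<close>; integrated,
  it bounds the norm of a superposition by the norms of its terms.\<close>

lemma suminf_Cauchy_Schwarz: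
  fixes a h :: "nat \<Rightarrow> real"
  assumes a: "summable (\<lambda>j. \<bar>a j\<bar>)" and ah: "summable (\<lambda>j. \<bar>a j\<bar> * (h j)\<^sup>2)"
  shows "summable (\<lambda>j. \<bar>a j * h j\<bar>)"
    and "(\<Sum>j. a j * h j)\<^sup>2 \<le> (\<Sum>j. \<bar>a j\<bar>) * (\<Sum>j. \<bar>a j\<bar> * (h j)\<^sup>2)"
proof -
  show s: "summable (\<lambda>j. \<bar>a j * h j\<bar>)"
  proof (rule summable_comparison_test')
    show "summable (\<lambda>j. \<bar>a j\<bar> + \<bar>a j\<bar> * (h j)\<^sup>2)" by (intro summable_add a ah)
    fix j :: nat
    have "\<bar>h j\<bar> \<le> 1 + (h j)\<^sup>2" using abs_mult_le_squares[of 1 "h j"] zero_le_power2[of "h j"] by simp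
    from mult_left_mono[OF this abs_ge_zero[of "a j"]]
    show "norm \<bar>a j * h j\<bar> \<le> \<bar>a j\<bar> + \<bar>a j\<bar> * (h j)\<^sup>2" by (simp add: abs_mult distrib_left)
  qed
  have fin: "(\<Sum>j<n. a j * h j)\<^sup>2 \<le> (\<Sum>j. \<bar>a j\<bar>) * (\<Sum>j. \<bar>a j\<bar> * (h j)\<^sup>2)" for n
  proof -
    have "\<bar>\<Sum>j<n. a j * h j\<bar> \<le> (\<Sum>j<n. \<bar>a j * h j\<bar>)" by (rule sum_abs)
    also have "\<dots> = (\<Sum>j<n. sqrt \<bar>a j\<bar> * (sqrt \<bar>a j\<bar> * \<bar>h j\<bar>))"
      by (intro sum.cong) (simp_all add: abs_mult flip: mult.assoc)
    finally have "(\<Sum>j<n. a j * h j)\<^sup>2 \<le> (\<Sum>j<n. sqrt \<bar>a j\<bar> * (sqrt \<bar>a j\<bar> * \<bar>h j\<bar>))\<^sup>2"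
      by (simp add: abs_le_square_iff[symmetric] sum_nonneg)
    also have "\<dots> \<le> (\<Sum>j<n. (sqrt \<bar>a j\<bar>)\<^sup>2) * (\<Sum>j<n. (sqrt \<bar>a j\<bar> * \<bar>h j\<bar>)\<^sup>2)"
      by (rule Cauchy_Schwarz_ineq_sum)
    also have "\<dots> = (\<Sum>j<n. \<bar>a j\<bar>) * (\<Sum>j<n. \<bar>a j\<bar> * (h j)\<^sup>2)" by (simp add: power_mult_distrib)
    also have "\<dots> \<le> (\<Sum>j. \<bar>a j\<bar>) * (\<Sum>j. \<bar>a j\<bar> * (h j)\<^sup>2)"
      by (intro mult_mono sum_le_suminf a ah sum_nonneg suminf_nonneg) auto
    finally show ?thesis .
  qed
  have "(\<lambda>n. (\<Sum>j<n. a j * h j)\<^sup>2) \<longlonglongrightarrow> (\<Sum>j. a j * h j)\<^sup>2"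
    by (intro tendsto_power summable_LIMSEQ summable_rabs_cancel[OF s])
  then show "(\<Sum>j. a j * h j)\<^sup>2 \<le> (\<Sum>j. \<bar>a j\<bar>) * (\<Sum>j. \<bar>a j\<bar> * (h j)\<^sup>2)"
    by (rule LIMSEQ_le_const2) (use fin in auto)
qed

context dyadic
begin

sublocale RF: resistance X E F by (rule resistance.intro[OF resistance_form])

section \<open>Superpositions in \<open>L2\<close> and in energy\<close>

definition mix :: "(nat \<Rightarrow> real) \<Rightarrow> (nat \<Rightarrow> 'a \<Rightarrow> real) \<Rightarrow> 'a \<Rightarrow> real" where
  "mix a h x = (\<Sum>j. a j * h j x)"

lemma mix_L2:
  assumes h: "\<And>j. L2 \<mu> (h j)" and a: "summable (\<lambda>j. \<bar>a j\<bar>)"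
    and p: "\<And>x. x \<in> X \<Longrightarrow> summable (\<lambda>j. \<bar>a j\<bar> * (h j x)\<^sup>2)"
    and n: "summable (\<lambda>j. \<bar>a j\<bar> * nsq (h j))"
  shows "L2 \<mu> (mix a h)" and "nsq (mix a h) \<le> (\<Sum>j. \<bar>a j\<bar>) * (\<Sum>j. \<bar>a j\<bar> * nsq (h j))"
    and "L2 \<mu> v \<Longrightarrow> (\<lambda>j. a j * ip (h j) v) sums ip (mix a h) v"
proof -
  have hm: "h j \<in> borel_measurable \<mu>" for j by (rule L2_measurable[OF h])
  have wm: "mix a h \<in> borel_measurable \<mu>" unfolding mix_def using hm by measurable
  have int: "integrable \<mu> (\<lambda>x. \<bar>a j\<bar> * (h j x)\<^sup>2)" for j
    by (intro integrable_mult_right L2_square_integrable h)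
  have ae: "AE x in \<mu>. summable (\<lambda>j. norm (\<bar>a j\<bar> * (h j x)\<^sup>2))"
    using p by (intro AE_I2) (simp add: space_mu abs_mult)
  have sn: "summable (\<lambda>j. LINT x|\<mu>. norm (\<bar>a j\<bar> * (h j x)\<^sup>2))"
    using n by (simp add: nsq_def abs_mult)
  have S: "integrable \<mu> (\<lambda>x. \<Sum>j. \<bar>a j\<bar> * (h j x)\<^sup>2)" by (rule integrable_suminf[OF int ae sn])
  have SI: "(LINT x|\<mu>. (\<Sum>j. \<bar>a j\<bar> * (h j x)\<^sup>2)) = (\<Sum>j. \<bar>a j\<bar> * nsq (h j))"
    using integral_suminf[OF int ae sn] by (simp add: nsq_def)
  have le: "(mix a h x)\<^sup>2 \<le> (\<Sum>j. \<bar>a j\<bar>) * (\<Sum>j. \<bar>a j\<bar> * (h j x)\<^sup>2)" if "x \<in> X" for x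
    unfolding mix_def by (rule suminf_Cauchy_Schwarz[OF a p[OF that]])
  have i2: "integrable \<mu> (\<lambda>x. (mix a h x)\<^sup>2)"
  proof (rule Bochner_Integration.integrable_bound[OF integrable_mult_right[OF S, of "\<Sum>j. \<bar>a j\<bar>"]])
    show "(\<lambda>x. (mix a h x)\<^sup>2) \<in> borel_measurable \<mu>" using wm by measurable
    show "AE x in \<mu>. norm ((mix a h x)\<^sup>2) \<le> norm ((\<Sum>j. \<bar>a j\<bar>) * (\<Sum>j. \<bar>a j\<bar> * (h j x)\<^sup>2))"
    proof (rule AE_I2)
      fix x assume "x \<in> space \<mu>"
      then have "(mix a h x)\<^sup>2 \<le> (\<Sum>j. \<bar>a j\<bar>) * (\<Sum>j. \<bar>a j\<bar> * (h j x)\<^sup>2)" using le by (simp add: space_mu)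
      then show "norm ((mix a h x)\<^sup>2) \<le> norm ((\<Sum>j. \<bar>a j\<bar>) * (\<Sum>j. \<bar>a j\<bar> * (h j x)\<^sup>2))" by simp
    qed
  qed
  then show wL: "L2 \<mu> (mix a h)" using wm by (simp add: L2_def)
  have "nsq (mix a h) \<le> (LINT x|\<mu>. (\<Sum>j. \<bar>a j\<bar>) * (\<Sum>j. \<bar>a j\<bar> * (h j x)\<^sup>2))"
    unfolding nsq_def
    by (rule integral_mono[OF i2 integrable_mult_right[OF S]]) (use le in \<open>simp add: space_mu\<close>)
  then show "nsq (mix a h) \<le> (\<Sum>j. \<bar>a j\<bar>) * (\<Sum>j. \<bar>a j\<bar> * nsq (h j))" by (simp add: SI)
  assume v: "L2 \<mu> v"
  have hv: "integrable \<mu> (\<lambda>x. a j * h j x * v x)" for j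
    using L2_mult_integrable[OF h v, of j] by (simp add: mult.assoc)
  have sm: "summable (\<lambda>j. \<bar>a j * h j x\<bar>)" if "x \<in> X" for x by (rule suminf_Cauchy_Schwarz[OF a p[OF that]])
  have ae2: "AE x in \<mu>. summable (\<lambda>j. norm (a j * h j x * v x))"
    using sm by (intro AE_I2) (simp add: space_mu abs_mult summable_mult2)
  have sn2: "summable (\<lambda>j. LINT x|\<mu>. norm (a j * h j x * v x))"
  proof (rule summable_comparison_test')
    show "summable (\<lambda>j. (\<bar>a j\<bar> * nsq (h j) + \<bar>a j\<bar> * nsq v) / 2)"
      by (intro summable_divide summable_add n summable_mult2 a)
    fix j :: nat
    have "(LINT x|\<mu>. norm (a j * h j x * v x)) \<le> (LINT x|\<mu>. \<bar>a j\<bar> * (((h j x)\<^sup>2 + (v x)\<^sup>2) / 2))"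
    proof (rule integral_mono)
      show "integrable \<mu> (\<lambda>x. norm (a j * h j x * v x))" by (rule integrable_norm[OF hv])
      show "integrable \<mu> (\<lambda>x. \<bar>a j\<bar> * (((h j x)\<^sup>2 + (v x)\<^sup>2) / 2))"
        using L2_square_integrable[OF h] L2_square_integrable[OF v] by auto
      show "norm (a j * h j x * v x) \<le> \<bar>a j\<bar> * (((h j x)\<^sup>2 + (v x)\<^sup>2) / 2)" for x
        using mult_left_mono[OF abs_mult_le_squares[of "h j x" "v x"] abs_ge_zero[of "a j"]]
        by (simp add: abs_mult mult.assoc)
    qed
    also have "\<dots> = (\<bar>a j\<bar> * nsq (h j) + \<bar>a j\<bar> * nsq v) / 2"
      using L2_square_integrable[OF h] L2_square_integrable[OF v] by (simp add: nsq_def algebra_simps)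
    finally show "norm (LINT x|\<mu>. norm (a j * h j x * v x)) \<le> (\<bar>a j\<bar> * nsq (h j) + \<bar>a j\<bar> * nsq v) / 2"
      by simp
  qed
  have "(\<lambda>j. LINT x|\<mu>. a j * h j x * v x) sums (LINT x|\<mu>. (\<Sum>j. a j * h j x * v x))"
    by (rule sums_integral[OF hv ae2 sn2])
  moreover have "(LINT x|\<mu>. a j * h j x * v x) = a j * ip (h j) v" for j
    by (simp add: ip_def mult.assoc)
  moreover have "(LINT x|\<mu>. (\<Sum>j. a j * h j x * v x)) = ip (mix a h) v"
    unfolding ip_def mix_def
  proof (rule Bochner_Integration.integral_cong[OF refl])
    fix x assume "x \<in> space \<mu>"
    then have "summable (\<lambda>j. a j * h j x)" using sm by (simp add: space_mu summable_rabs_cancel)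
    then show "(\<Sum>j. a j * h j x * v x) = (\<Sum>j. a j * h j x) * v x" by (rule suminf_mult2[symmetric])
  qed
  ultimately show "(\<lambda>j. a j * ip (h j) v) sums ip (mix a h) v" by simp
qed

lemma E_norm_add:
  assumes "u \<in> F" "v \<in> F"
  shows "sqrt (E (\<lambda>x. u x + v x) (\<lambda>x. u x + v x)) \<le> sqrt (E u u) + sqrt (E v v)"
proof (rule real_le_lsqrt)
  have "E (\<lambda>x. u x + v x) (\<lambda>x. u x + v x) = E u u + 2 * E u v + E v v"
    using RF.E_square_add_scale[OF assms, of 1] by simp
  also have "\<dots> \<le> E u u + 2 * (sqrt (E u u) * sqrt (E v v)) + E v v"
    using RF.E_Cauchy_Schwarz[OF assms] by simp
  also have "\<dots> = (sqrt (E u u) + sqrt (E v v))\<^sup>2"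
    using RF.E_nonneg[OF assms(1)] RF.E_nonneg[OF assms(2)] by (simp add: power2_sum)
  finally show "E (\<lambda>x. u x + v x) (\<lambda>x. u x + v x) \<le> (sqrt (E u u) + sqrt (E v v))\<^sup>2" .
qed (use assms RF.E_nonneg in auto)

lemma zero_F: "(\<lambda>x. 0) \<in> F" using F_scale[OF one_F, of 0] by simp

lemma E_zero_left: "E (\<lambda>x. 0) v = 0" using E_scale[of 0 v v] by simp

text \<open>The sums start at an arbitrary \<open>m\<close>, so that they cover partial sums as well
  as the differences in the Cauchy criterion.\<close>

lemma F_sum:
  fixes m n :: nat
  assumes "\<And>j. h j \<in> F"
  shows "(\<lambda>x. \<Sum>j\<in>{m..<m+n}. a j * h j x) \<in> F"
    and "sqrt (E (\<lambda>x. \<Sum>j\<in>{m..<m+n}. a j * h j x) (\<lambda>x. \<Sum>j\<in>{m..<m+n}. a j * h j x))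
      \<le> (\<Sum>j\<in>{m..<m+n}. \<bar>a j\<bar> * sqrt (E (h j) (h j)))"
    and "v \<in> F \<Longrightarrow> E (\<lambda>x. \<Sum>j\<in>{m..<m+n}. a j * h j x) v = (\<Sum>j\<in>{m..<m+n}. a j * E (h j) v)"
proof (induction n)
  case 0
  { case 1 show ?case using zero_F by simp }
  { case 2 show ?case by (simp add: E_zero_left) }
  { case 3 show ?case by (simp add: E_zero_left) }
next
  case (Suc n)
  let ?u = "\<lambda>x. \<Sum>j\<in>{m..<m+n}. a j * h j x" and ?v = "\<lambda>x. a (m+n) * h (m+n) x"
  have eq: "(\<lambda>x. \<Sum>j\<in>{m..<m+Suc n}. a j * h j x) = (\<lambda>x. ?u x + ?v x)" by simp
  have v: "?v \<in> F" by (intro F_scale assms)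
  { case 1 show ?case unfolding eq by (intro F_add Suc.IH(1) v) }
  { case 2
    have "E ?v ?v = (a (m+n))\<^sup>2 * E (h (m+n)) (h (m+n))"
      unfolding E_scale using E_sym[of "h (m+n)" ?v] E_scale[of "a (m+n)" "h (m+n)" "h (m+n)"]
      by (simp add: power2_eq_square)
    then have "sqrt (E ?v ?v) = \<bar>a (m+n)\<bar> * sqrt (E (h (m+n)) (h (m+n)))" by (simp add: real_sqrt_mult)
    then show ?case unfolding eq
      using E_norm_add[OF Suc.IH(1) v] Suc.IH(2) by simp }
  { case 3
    show ?case unfolding eq
      using E_add[OF F_fin_energy[OF Suc.IH(1)] F_fin_energy[OF v] F_fin_energy[OF 3]] Suc.IH(3)[OF 3] E_scale
      by simp }
qed

text \<open>Completeness provides a limit of the partial sums in energy, determined only up to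
  constants; \<open>morrey\<close> shows that it differs from the pointwise sum by a constant on
  \<open>X\<close>.\<close>

lemma mix_F:
  assumes h: "\<And>j. h j \<in> F" and b: "\<And>j x. x \<in> X \<Longrightarrow> \<bar>h j x\<bar> \<le> W j"
    and e: "\<And>j. sqrt (E (h j) (h j)) \<le> W j" and s: "summable (\<lambda>j. \<bar>a j\<bar> * W j)"
  shows "mix a h \<in> F" and "v \<in> F \<Longrightarrow> (\<lambda>j. a j * E (h j) v) sums E (mix a h) v"
proof -
  define w where "w n x = (\<Sum>j\<in>{0..<n}. a j * h j x)" for n x
  have wF: "w n \<in> F" for n using F_sum(1)[OF h, where m = 0 and n = n and a = a] by (simp add: w_def[abs_def])
  have off: "h j x = 0" if "x \<notin> X" for j x using h[of j] that by (simp add: F_def)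
  have pt: "summable (\<lambda>j. a j * h j x)" for x
  proof (cases "x \<in> X")
    case True
    then show ?thesis using b[OF True]
      by (intro summable_comparison_test'[OF s]) (simp add: abs_mult mult_left_mono)
  qed (simp add: off)
  have wl: "(\<lambda>n. w n x) \<longlonglongrightarrow> mix a h x" for x
    using summable_LIMSEQ[OF pt[of x]] by (simp add: w_def mix_def atLeast0LessThan)
  have We: "0 \<le> W j" for j using order_trans[OF real_sqrt_ge_zero[OF RF.E_nonneg[OF h]] e] .
  have diff: "sqrt (E (\<lambda>x. w m x - w n x) (\<lambda>x. w m x - w n x)) \<le> (\<Sum>j\<in>{N..<max m n}. \<bar>a j\<bar> * W j)"
    if mn: "N \<le> m" "N \<le> n" for m n N
  proof -
    have main: "sqrt (E (\<lambda>x. w (i + d) x - w i x) (\<lambda>x. w (i + d) x - w i x)) \<le> (\<Sum>j\<in>{N..<i+d}. \<bar>a j\<bar> * W j)"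
      if "N \<le> i" for i d
    proof -
      have eq: "(\<lambda>x. w (i + d) x - w i x) = (\<lambda>x. \<Sum>j\<in>{i..<i+d}. a j * h j x)"
        unfolding w_def by (rule ext) (subst sum.atLeastLessThan_concat[symmetric, of 0 i "i + d"], auto)
      have "sqrt (E (\<lambda>x. w (i + d) x - w i x) (\<lambda>x. w (i + d) x - w i x)) \<le> (\<Sum>j\<in>{i..<i+d}. \<bar>a j\<bar> * sqrt (E (h j) (h j)))"
        unfolding eq by (rule F_sum(2)[OF h])
      also have "\<dots> \<le> (\<Sum>j\<in>{i..<i+d}. \<bar>a j\<bar> * W j)" by (intro sum_mono mult_left_mono e) simp
      also have "\<dots> \<le> (\<Sum>j\<in>{N..<i+d}. \<bar>a j\<bar> * W j)" using that We by (intro sum_mono2) auto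
      finally show ?thesis .
    qed
    show ?thesis
    proof (cases "n \<le> m")
      case True then show ?thesis using main[OF mn(2), of "m - n"] by (simp add: max_def)
    next
      case False
      have "E (\<lambda>x. w m x - w n x) (\<lambda>x. w m x - w n x) = E (\<lambda>x. w n x - w m x) (\<lambda>x. w n x - w m x)"
        using RF.E_square_diff[OF wF wF, of m n] RF.E_square_diff[OF wF wF, of n m] E_sym[of "w m" "w n"] by simp
      then show ?thesis using main[OF mn(1), of "n - m"] False by (simp add: max_def)
    qed
  qed
  have "\<exists>N. \<forall>m\<ge>N. \<forall>n\<ge>N. E (\<lambda>x. w m x - w n x) (\<lambda>x. w m x - w n x) < \<epsilon>" if \<epsilon>: "\<epsilon> > 0" for \<epsilon>
  proof -
    obtain N where N: "\<And>i k. i \<ge> N \<Longrightarrow> norm (\<Sum>j\<in>{i..<k}. \<bar>a j\<bar> * W j) < sqrt \<epsilon>"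
      using s \<epsilon> unfolding summable_Cauchy by (meson real_sqrt_gt_zero)
    show ?thesis
    proof (intro exI[of _ N] allI impI)
      fix m n assume mn: "N \<le> m" "N \<le> n"
      have "sqrt (E (\<lambda>x. w m x - w n x) (\<lambda>x. w m x - w n x)) < sqrt \<epsilon>"
        by (rule le_less_trans[OF diff[OF mn] le_less_trans[OF abs_ge_self
              N[OF order_refl, of "max m n", unfolded real_norm_def]]])
      then show "E (\<lambda>x. w m x - w n x) (\<lambda>x. w m x - w n x) < \<epsilon>" by simp
    qed
  qed
  from F_complete[OF wF this] obtain u where u: "u \<in> F"
    and ul: "(\<lambda>n. E (\<lambda>x. w n x - u x) (\<lambda>x. w n x - u x)) \<longlonglongrightarrow> 0" by blast
  obtain x0 where x0: "x0 \<in> X" using X_nonempty by blast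
  have eqx: "mix a h x - u x = mix a h x0 - u x0" if x: "x \<in> X" for x
  proof -
    have "(\<lambda>n. 6 * sqrt (E (\<lambda>x. w n x - u x) (\<lambda>x. w n x - u x) * g x x0)) \<longlonglongrightarrow> 6 * sqrt (0 * g x x0)"
      by (rule tendsto_mult[OF tendsto_const tendsto_real_sqrt[OF tendsto_mult[OF ul tendsto_const]]])
    then have z: "(\<lambda>n. 6 * sqrt (E (\<lambda>x. w n x - u x) (\<lambda>x. w n x - u x) * g x x0)) \<longlonglongrightarrow> 0" by (simp only: mult_zero_left real_sqrt_zero mult_zero_right)
    have "norm ((w n x - u x) - (w n x0 - u x0)) \<le> 6 * sqrt (E (\<lambda>x. w n x - u x) (\<lambda>x. w n x - u x) * g x x0)" for n
      using morrey[OF F_diff[OF wF u] x x0] by simp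
    then have "(\<lambda>n. (w n x - u x) - (w n x0 - u x0)) \<longlonglongrightarrow> 0"
      by (intro Lim_null_comparison[OF _ z] always_eventually allI)
    moreover have "(\<lambda>n. (w n x - u x) - (w n x0 - u x0)) \<longlonglongrightarrow> (mix a h x - u x) - (mix a h x0 - u x0)"
      by (intro tendsto_diff wl tendsto_const)
    ultimately have "0 = (mix a h x - u x) - (mix a h x0 - u x0)" by (rule LIMSEQ_unique)
    then show ?thesis by simp
  qed
  define k where "k = mix a h x0 - u x0"
  have eq: "mix a h = (\<lambda>x. u x + k * indicator X x)"
  proof
    fix x show "mix a h x = u x + k * indicator X x"
    proof (cases "x \<in> X")
      case True then show ?thesis using eqx[OF True] by (simp add: k_def)
    next
      case False then show ?thesis using u by (simp add: mix_def off F_def)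
    qed
  qed
  show mF: "mix a h \<in> F" unfolding eq by (intro F_add F_scale u one_F)
  assume v: "v \<in> F"
  have d: "E (\<lambda>x. w n x - mix a h x) (\<lambda>x. w n x - mix a h x) = E (\<lambda>x. w n x - u x) (\<lambda>x. w n x - u x)" for n
  proof -
    have "(\<lambda>x. w n x - mix a h x) = (\<lambda>x. (w n x - u x) + (- k) * indicator X x)" unfolding eq by (rule ext) simp
    then show ?thesis using E_shift[OF F_diff[OF wF u], of n "- k"] by simp
  qed
  have "(\<lambda>n. sqrt (E (\<lambda>x. w n x - u x) (\<lambda>x. w n x - u x)) * sqrt (E v v)) \<longlonglongrightarrow> sqrt 0 * sqrt (E v v)"
    by (rule tendsto_mult[OF tendsto_real_sqrt[OF ul] tendsto_const])
  then have z: "(\<lambda>n. sqrt (E (\<lambda>x. w n x - u x) (\<lambda>x. w n x - u x)) * sqrt (E v v)) \<longlonglongrightarrow> 0" by (simp only: mult_zero_left real_sqrt_zero)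
  have "norm (E (w n) v - E (mix a h) v) \<le> sqrt (E (\<lambda>x. w n x - u x) (\<lambda>x. w n x - u x)) * sqrt (E v v)" for n
    using RF.E_Cauchy_Schwarz[OF F_diff[OF wF mF] v, of n] RF.E_diff[OF wF mF v, of n] unfolding d by simp
  then have "(\<lambda>n. E (w n) v - E (mix a h) v) \<longlonglongrightarrow> 0"
    by (intro Lim_null_comparison[OF _ z] always_eventually allI)
  then have "(\<lambda>n. E (w n) v) \<longlonglongrightarrow> E (mix a h) v" by (rule LIM_zero_cancel)
  moreover have "E (w n) v = (\<Sum>j<n. a j * E (h j) v)" for n
    using F_sum(3)[OF h v, where m = 0 and n = n and a = a] by (simp add: w_def[abs_def] atLeast0LessThan)
  ultimately show "(\<lambda>j. a j * E (h j) v) sums E (mix a h) v" by (simp add: sums_def)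
qed

section \<open>Cut-offs and the domain of the Dirichlet form\<close>

definition far_part :: "nat \<Rightarrow> ('a \<Rightarrow> real) \<Rightarrow> 'a \<Rightarrow> real" where
  "far_part N u x = indicator {x\<in>X. N < c 0 x} x * u x"

lemma far_part_nsq_tendsto: "L2 \<mu> u \<Longrightarrow> (\<lambda>N. nsq (far_part N u)) \<longlonglongrightarrow> 0"
proof -
  assume u: "L2 \<mu> u"
  have um: "u \<in> borel_measurable \<mu>" by (rule L2_measurable[OF u])
  have "(\<lambda>N. LINT x|\<mu>. (far_part N u x)\<^sup>2) \<longlonglongrightarrow> (LINT x|\<mu>. 0)"
  proof (rule integral_dominated_convergence[OF _ _ L2_square_integrable[OF u]])
    show "(\<lambda>x. (far_part N u x)\<^sup>2) \<in> borel_measurable \<mu>" for N unfolding far_part_def using um by measurable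
    show "AE x in \<mu>. (\<lambda>N. (far_part N u x)\<^sup>2) \<longlonglongrightarrow> 0"
    proof (intro AE_I2)
      fix x
      have "\<forall>\<^sub>F N in sequentially. (far_part N u x)\<^sup>2 = 0"
        using eventually_ge_at_top[of "c 0 x"] by eventually_elim (simp add: far_part_def)
      then show "(\<lambda>N. (far_part N u x)\<^sup>2) \<longlonglongrightarrow> 0" by (rule tendsto_eventually)
    qed
    show "AE x in \<mu>. norm ((far_part N u x)\<^sup>2) \<le> (u x)\<^sup>2" for N
      by (intro AE_I2) (simp add: far_part_def indicator_def)
  qed simp
  then show ?thesis by (simp add: nsq_def)
qed

lemma far_part_L2: "L2 \<mu> u \<Longrightarrow> L2 \<mu> (far_part N u)"
proof -
  assume u: "L2 \<mu> u"
  then have um: "u \<in> borel_measurable \<mu>" by (rule L2_measurable)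
  have m: "far_part N u \<in> borel_measurable \<mu>" unfolding far_part_def using um by measurable
  have "integrable \<mu> (\<lambda>x. (far_part N u x)\<^sup>2)"
    by (rule Bochner_Integration.integrable_bound[OF L2_square_integrable[OF u]])
      (use m in \<open>simp, auto simp: far_part_def indicator_def\<close>)
  then show ?thesis using m by (simp add: L2_def)
qed

text \<open>The smallest index of a unit cell that the block meets, so that a block with
  \<open>N < unit_of p\<close> lies entirely beyond unit cell \<open>N\<close>.\<close>

definition unit_of :: "nat \<times> nat \<Rightarrow> nat" where
  "unit_of p = (case p of (0, k) \<Rightarrow> k - 1 | (Suc m, k) \<Rightarrow> k div 2 ^ m)"

text \<open>Cutting between unit cells \<open>N\<close> and \<open>N + 1\<close> crosses the single
  block \<open>(0, Suc N)\<close>, where the covariance is at most the squared norm of the far part.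
  All other blocks keep their covariance or lose it entirely.\<close>

lemma far_part_F:
  assumes u: "u \<in> F" "L2 \<mu> u"
  shows "far_part N u \<in> F"
    and "\<And>P0. finite P0 \<Longrightarrow> (\<And>p. p \<in> P0 \<Longrightarrow> unit_of p \<le> N) \<Longrightarrow>
      E (far_part N u) (far_part N u) \<le> E u u - (\<Sum>p\<in>P0. wt p * cov p u u) + nsq (far_part N u)"
proof -
  obtain M where M: "dyadic_lipschitz M u" using u by (auto simp: F_def)
  have M0: "0 \<le> M"
  proof -
    obtain x where "x \<in> X" using X_nonempty by blast
    then show ?thesis using dyadic_lipschitzD[OF M, of x x 0] by simp
  qed
  have hv: "dyadic_lipschitz M (far_part N u)"
    unfolding dyadic_lipschitz_def
  proof (intro ballI allI impI)
    fix x y n assume xy: "x \<in> X" "y \<in> X" "c n x = c n y"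
    have "c 0 x = c 0 y" using c_eq_le[OF xy(1,2,3), of 0] by simp
    then show "\<bar>far_part N u x - far_part N u y\<bar> \<le> M / 2 ^ n"
      using dyadic_lipschitzD[OF M xy] M0 xy by (simp add: far_part_def indicator_def)
  qed
  have lu: "lloc u" and lv: "lloc (far_part N u)" using F_lloc[OF u(1)] dyadic_lipschitz_lloc[OF hv] by auto
  have cv: "cov p (far_part N u) (far_part N u) \<le> (if N < unit_of p then cov p u u else 0)
      + (if p = (0, Suc N) then nsq (far_part N u) else 0)" for p
  proof (cases "p = (0, Suc N)")
    case True
    have "cov p (far_part N u) (far_part N u) \<le> I (blk p) (\<lambda>x. (far_part N u x - 0)\<^sup>2)" by (rule cov_le_sq[OF lv])
    also have "\<dots> \<le> nsq (far_part N u)"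
      unfolding I_def nsq_def
      by (rule integral_mono)
        (use integrable_sq[OF lv bset_blk] L2_square_integrable[OF far_part_L2[OF u(2)]] in \<open>auto simp: indicator_def\<close>)
    finally show ?thesis using True cov_nonneg[OF lu, of p] by auto
  next
    case False
    have "cov p (far_part N u) (far_part N u) = (if N < unit_of p then cov p u u else 0)"
    proof (cases "N < unit_of p")
      case True
      have "far_part N u x = u x" if "x \<in> blk p" for x
        using that True c_le[of x 0] unfolding blk_def unit_of_def far_part_def
        by (auto split: prod.splits nat.splits)
      then show ?thesis using True by (simp cong: cov_cong)
    next
      case nl: False
      have "far_part N u x = 0" if "x \<in> blk p" for x
        using that nl False c_le[of x 0] unfolding blk_def unit_of_def far_part_def
        by (auto split: prod.splits nat.splits)
      then show ?thesis using nl cov_const_on_blk[of p "far_part N u" 0] by simp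
    qed
    then show ?thesis using False by simp
  qed
  have part: "(\<Sum>p\<in>P. wt p * cov p (far_part N u) (far_part N u)) \<le> E u u - (\<Sum>p\<in>P0. wt p * cov p u u) + nsq (far_part N u)"
    if P: "finite P" and P0: "finite P0" "\<And>p. p \<in> P0 \<Longrightarrow> unit_of p \<le> N" for P P0
  proof -
    let ?Q = "{p\<in>P. N < unit_of p}"
    have "(\<Sum>p\<in>P. wt p * cov p (far_part N u) (far_part N u))
        \<le> (\<Sum>p\<in>P. (if N < unit_of p then wt p * cov p u u else 0) + (if p = (0, Suc N) then nsq (far_part N u) else 0))"
    proof (rule sum_mono)
      fix p
      have "wt p * cov p (far_part N u) (far_part N u) \<le> wt p * ((if N < unit_of p then cov p u u else 0)
          + (if p = (0, Suc N) then nsq (far_part N u) else 0))"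
        by (intro mult_left_mono cv wt_nonneg)
      also have "\<dots> \<le> (if N < unit_of p then wt p * cov p u u else 0) + (if p = (0, Suc N) then nsq (far_part N u) else 0)"
        using nsq_nonneg[of "far_part N u"] by (auto simp: wt_simps distrib_left)
      finally show "wt p * cov p (far_part N u) (far_part N u)
        \<le> (if N < unit_of p then wt p * cov p u u else 0) + (if p = (0, Suc N) then nsq (far_part N u) else 0)" .
    qed
    also have "\<dots> = (\<Sum>p\<in>?Q. wt p * cov p u u) + (\<Sum>p\<in>P. if p = (0, Suc N) then nsq (far_part N u) else 0)"
      using P by (simp add: sum.distrib sum.inter_filter)
    also have "(\<Sum>p\<in>P. if p = (0, Suc N) then nsq (far_part N u) else 0) \<le> nsq (far_part N u)"
      using P nsq_nonneg by (simp add: sum.delta)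
    also have "(\<Sum>p\<in>?Q. wt p * cov p u u) \<le> E u u - (\<Sum>p\<in>P0. wt p * cov p u u)"
    proof -
      have "?Q \<inter> P0 = {}" using P0(2) by fastforce
      then have "(\<Sum>p\<in>?Q. wt p * cov p u u) + (\<Sum>p\<in>P0. wt p * cov p u u) = (\<Sum>p\<in>?Q \<union> P0. wt p * cov p u u)"
        using P P0 by (subst sum.union_disjoint) auto
      also have "\<dots> \<le> E u u" using P P0 by (intro E_ge_sum F_fin_energy u) auto
      finally show ?thesis by simp
    qed
    finally show ?thesis by simp
  qed
  have sv: "(\<lambda>p. wt p * cov p (far_part N u) (far_part N u)) summable_on UNIV"
    by (rule nonneg_bdd_above_summable_on)
      (use E_term_nonneg[OF lv] part[of _ "{}"] in \<open>auto intro!: bdd_aboveI[of _ "E u u + nsq (far_part N u)"]\<close>)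
  show "far_part N u \<in> F" using hv lv sv by (auto simp: F_def fin_energy_def far_part_def)
  show "E (far_part N u) (far_part N u) \<le> E u u - (\<Sum>p\<in>P0. wt p * cov p u u) + nsq (far_part N u)"
    if "finite P0" "\<And>p. p \<in> P0 \<Longrightarrow> unit_of p \<le> N" for P0
    unfolding E_def[of "far_part N u"] by (rule infsum_le_finite_sums[OF sv]) (use part[OF _ that] in auto)
qed

lemma far_part_E_tendsto:
  assumes u: "u \<in> F" "L2 \<mu> u"
  shows "(\<lambda>N. E (far_part N u) (far_part N u)) \<longlonglongrightarrow> 0"
proof (rule LIMSEQ_I)
  fix r :: real assume r: "r > 0"
  have su: "(\<lambda>p. wt p * cov p u u) summable_on UNIV" using F_fin_energy[OF u(1)] by (rule fin_energyD)
  \<comment> \<open>A finite set \<open>P0\<close> of blocks carries all but \<open>r / 2\<close> of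
    the energy; once \<open>N\<close> is beyond them, only that rest and the norm of the far part
    remain in the bound.\<close>
  have "E u u = (SUP P\<in>{P. finite P \<and> P \<subseteq> UNIV}. \<Sum>p\<in>P. wt p * cov p u u)"
    unfolding E_def by (rule infsum_nonneg_is_SUPREMUM_real[OF su]) (rule E_term_nonneg[OF F_lloc[OF u(1)]])
  moreover have "E u u - r / 2 < E u u" using r by simp
  ultimately have "E u u - r / 2 < (SUP P\<in>{P. finite P \<and> P \<subseteq> UNIV}. \<Sum>p\<in>P. wt p * cov p u u)" by simp
  then obtain P0 where P0: "finite P0" "E u u - r / 2 < (\<Sum>p\<in>P0. wt p * cov p u u)"
    using E_ge_sum[OF F_fin_energy[OF u(1)]]
    by (subst (asm) less_cSUP_iff) (auto intro!: bdd_aboveI[of _ "E u u"])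
  obtain N1 where N1: "\<And>p. p \<in> P0 \<Longrightarrow> unit_of p \<le> N1"
    using P0(1) by (metis Max_ge finite_imageI imageI)
  obtain N2 where N2: "\<And>n. n \<ge> N2 \<Longrightarrow> norm (nsq (far_part n u) - 0) < r / 2"
    using LIMSEQ_D[OF far_part_nsq_tendsto[OF u(2)], of "r / 2"] r by auto
  show "\<exists>no. \<forall>n\<ge>no. norm (E (far_part n u) (far_part n u) - 0) < r"
  proof (intro exI[of _ "max N1 N2"] allI impI)
    fix n assume n: "max N1 N2 \<le> n"
    have "E (far_part n u) (far_part n u) \<le> E u u - (\<Sum>p\<in>P0. wt p * cov p u u) + nsq (far_part n u)"
      by (rule far_part_F(2)[OF u P0(1)]) (use N1 n in force)
    moreover have "nsq (far_part n u) < r / 2" using N2[of n] n nsq_nonneg by simp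
    moreover have "0 \<le> E (far_part n u) (far_part n u)" by (rule RF.E_nonneg[OF far_part_F(1)[OF u]])
    ultimately show "norm (E (far_part n u) (far_part n u) - 0) < r" using P0(2) by simp
  qed
qed

text \<open>The cut-offs to finitely many unit cells have compact support and converge in the norm
  of the form, so the closure reaches every square integrable member of \<open>F\<close>.\<close>

lemma D_mu_eq: "D_mu X E F \<mu> = {u \<in> F. L2 \<mu> u}"
proof (intro equalityI subsetI)
  show "u \<in> {u \<in> F. L2 \<mu> u}" if "u \<in> D_mu X E F \<mu>" for u using that by (simp add: D_mu_def)
  fix u assume "u \<in> {u \<in> F. L2 \<mu> u}"
  then have u: "u \<in> F" "L2 \<mu> u" by auto
  define s where "s N x = u x - far_part N u x" for N x
  have s_alt: "s N x = indicator {x\<in>X. c 0 x \<le> N} x * u x" for N x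
    using u(1) by (auto simp: s_def far_part_def F_def indicator_def)
  have sF: "s N \<in> F" and sL: "L2 \<mu> (s N)" for N
    unfolding s_def[abs_def] by (intro F_diff L2_diff far_part_F far_part_L2 u)+
  have sC: "s N \<in> C0 X R" for N
    unfolding C0_def using continuous_F[OF sF[of N]]
    by (auto simp: s_alt[of N] intro!: compactin_closure[of _ N] split: split_indicator_asm)
  have eq: "(\<lambda>x. s N x - u x) = (\<lambda>x. -1 * far_part N u x)" for N by (rule ext) (simp add: s_def)
  have "E (\<lambda>x. s N x - u x) (\<lambda>x. s N x - u x) = E (far_part N u) (far_part N u)" for N
    unfolding eq E_scale E_sym[of "far_part N u" "\<lambda>x. -1 * far_part N u x"] by simp
  moreover have "(LINT x|\<mu>. (s N x - u x)\<^sup>2) = nsq (far_part N u)" for N by (simp add: s_def nsq_def)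
  moreover have "(\<lambda>N. E (far_part N u) (far_part N u) + nsq (far_part N u)) \<longlonglongrightarrow> 0 + 0"
    by (intro tendsto_add far_part_E_tendsto far_part_nsq_tendsto u)
  ultimately have "(\<lambda>N. E (\<lambda>x. s N x - u x) (\<lambda>x. s N x - u x) + (LINT x|\<mu>. (s N x - u x)\<^sup>2)) \<longlonglongrightarrow> 0" by simp
  then show "u \<in> D_mu X E F \<mu>"
    using u sF sC sL unfolding D_mu_def by blast
qed

section \<open>Haar components and cell averages\<close>

lemma ip_cong: "(\<And>x. x \<in> X \<Longrightarrow> u x = v x) \<Longrightarrow> ip u w = ip v w"
  unfolding ip_def by (rule Bochner_Integration.integral_cong) (auto simp: space_mu)

lemma I_lev:
  assumes "n \<le> m" shows "I (cell m k) (lev n a) = a (k div 2 ^ (m - n)) / 2 ^ m"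
proof -
  have "I (cell m k) (lev n a) = I (cell m k) (\<lambda>x. a (k div 2 ^ (m - n)))"
    using assms by (intro I_cong) (auto simp: lev_def c_le)
  then show ?thesis using I_const[OF bset_cell] by (simp add: measure_cell)
qed

lemma cell_avg_lev: "n \<le> m \<Longrightarrow> cell_avg m (lev n a) k = a (k div 2 ^ (m - n))"
  by (simp add: cell_avg_def I_lev)

lemma cell_mean_lev: "n \<le> m \<Longrightarrow> cell_mean m (lev n a) = lev n a"
proof
  fix x assume "n \<le> m"
  then show "cell_mean m (lev n a) x = lev n a x"
    unfolding cell_mean_def by (cases "x \<in> X") (simp_all add: lev_in lev_out cell_avg_lev c_le)
qed

lemma cell_split: "cell m k = cell (Suc m) (2 * k) \<union> cell (Suc m) (2 * k + 1)"
proof (intro equalityI subsetI)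
  fix x assume "x \<in> cell m k"
  then have "x \<in> X" "c (Suc m) x div 2 = k" using c_div[of x m] by auto
  then show "x \<in> cell (Suc m) (2 * k) \<union> cell (Suc m) (2 * k + 1)" by auto
next
  fix x assume "x \<in> cell (Suc m) (2 * k) \<union> cell (Suc m) (2 * k + 1)"
  then show "x \<in> cell m k" using c_div[of x m] by auto
qed

text \<open>Tower property, by descending from level \<open>n\<close>: each cell is the disjoint
  union of its two children.\<close>

lemma I_cell_mean:
  assumes f: "L2 \<mu> f" and "m \<le> n" shows "I (cell m k) (cell_mean n f) = I (cell m k) f"
  using assms(2)
proof (induction arbitrary: k rule: inc_induct)
  case base
  then show ?case by (simp add: cell_mean_def I_lev cell_avg_def)
next
  case (step m)
  have spl: "I (cell m k) w = I (cell (Suc m) (2 * k)) w + I (cell (Suc m) (2 * k + 1)) w" if "lloc w" for w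
    unfolding cell_split[of m k] by (rule I_Un[OF that]) auto
  show ?case
    unfolding spl[OF L2_lloc[OF f]] spl[OF L2_lloc[OF cell_mean_L2[OF f]]] step.IH ..
qed

lemma cell_avg_diff: "lloc u \<Longrightarrow> lloc v \<Longrightarrow> cell_avg n (\<lambda>x. u x - v x) k = cell_avg n u k - cell_avg n v k"
  unfolding cell_avg_def by (simp add: I_diff right_diff_distrib)

lemma cell_avg_add: "lloc u \<Longrightarrow> lloc v \<Longrightarrow> cell_avg n (\<lambda>x. u x + v x) k = cell_avg n u k + cell_avg n v k"
  unfolding cell_avg_def by (simp add: I_add distrib_left)

lemma cell_mean_diff: "lloc u \<Longrightarrow> lloc v \<Longrightarrow> cell_mean n (\<lambda>x. u x - v x) x = cell_mean n u x - cell_mean n v x"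
  unfolding cell_mean_def lev_def by (simp add: cell_avg_diff right_diff_distrib)

lemma cell_mean_add: "lloc u \<Longrightarrow> lloc v \<Longrightarrow> cell_mean n (\<lambda>x. u x + v x) x = cell_mean n u x + cell_mean n v x"
  unfolding cell_mean_def lev_def by (simp add: cell_avg_add distrib_left)

lemma cell_mean_scale: "cell_mean n (\<lambda>x. a * u x) x = a * cell_mean n u x"
  unfolding cell_mean_def lev_def cell_avg_def by (simp add: I_scale)

text \<open>From \<open>\<bar>a\<bar> \<le> 1 + a\<^sup>2\<close> on a cell of measure at most 1:
  crude, but linear in \<open>nsq f\<close> and uniform in the cell.\<close>

lemma I_cell_bound:
  assumes f: "L2 \<mu> f" shows "\<bar>I (cell n k) f\<bar> \<le> 1 + nsq f"
proof -
  have "\<bar>I (cell n k) f\<bar> \<le> (LINT x|\<mu>. \<bar>indicator (cell n k) x * f x\<bar>)"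
    unfolding I_def by (rule integral_abs_bound)
  also have "\<dots> \<le> (LINT x|\<mu>. indicator (cell n k) x * 1 + (f x)\<^sup>2)"
  proof (rule integral_mono)
    show "integrable \<mu> (\<lambda>x. \<bar>indicator (cell n k) x * f x\<bar>)"
      by (intro integrable_abs integrable_one L2_lloc f bset_cell)
    show "integrable \<mu> (\<lambda>x. indicator (cell n k) x * 1 + (f x)\<^sup>2)"
      by (intro Bochner_Integration.integrable_add integrable_one lloc_const bset_cell L2_square_integrable f)
    show "\<bar>indicator (cell n k) x * f x\<bar> \<le> indicator (cell n k) x * 1 + (f x)\<^sup>2" for x
      using abs_mult_le_squares[of 1 "f x"] zero_le_power2[of "f x"]
      by (cases "x \<in> cell n k") (simp_all del: in_cell)
  qed
  also have "\<dots> = I (cell n k) (\<lambda>x. 1) + nsq f"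
    unfolding I_def nsq_def
    by (intro Bochner_Integration.integral_add integrable_one lloc_const bset_cell L2_square_integrable f)
  also have "\<dots> \<le> 1 + nsq f" using I_const[OF bset_cell, of n k 1] by (simp add: measure_cell)
  finally show ?thesis .
qed

lemma cell_mean_bound:
  assumes f: "L2 \<mu> f" shows "\<bar>cell_mean n f x\<bar> \<le> 2 ^ n * (1 + nsq f)"
proof (cases "x \<in> X")
  case True
  then show ?thesis using mult_left_mono[OF I_cell_bound[OF f, of n "c n x"], of "2 ^ n"]
    by (simp add: cell_mean_def lev_in cell_avg_def abs_mult)
qed (use nsq_nonneg[of f] in \<open>simp add: cell_mean_def lev_out\<close>)

definition haar_part :: "nat \<Rightarrow> ('a \<Rightarrow> real) \<Rightarrow> 'a \<Rightarrow> real" where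
  "haar_part n f x = cell_mean (Suc n) f x - cell_mean n f x"

lemma haar_part_L2: "L2 \<mu> f \<Longrightarrow> L2 \<mu> (haar_part n f)"
  unfolding haar_part_def[abs_def] by (intro L2_diff cell_mean_L2)

lemma haar_part_nsq_le: "L2 \<mu> f \<Longrightarrow> nsq (haar_part n f) \<le> 4 * nsq f"
  using nsq_diff_le[OF cell_mean_L2 cell_mean_L2, of f f "Suc n" n] cell_mean_nsq_le[of f n] cell_mean_nsq_le[of f "Suc n"]
  by (simp add: haar_part_def[abs_def])

lemma haar_part_bound: "L2 \<mu> f \<Longrightarrow> \<bar>haar_part n f x\<bar> \<le> 3 * 2 ^ n * (1 + nsq f)"
  using cell_mean_bound[of f n x] cell_mean_bound[of f "Suc n" x] by (simp add: haar_part_def algebra_simps)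

lemma cell_avg_haar_part: "L2 \<mu> f \<Longrightarrow> m \<le> n \<Longrightarrow> cell_avg m (haar_part n f) k = 0"
  unfolding haar_part_def[abs_def] by (simp add: cell_avg_diff L2_lloc cell_mean_L2) (simp add: cell_avg_def I_cell_mean)

lemma cell_mean_haar_part: "L2 \<mu> f \<Longrightarrow> n < m \<Longrightarrow> cell_mean m (haar_part n f) x = haar_part n f x"
  unfolding haar_part_def[abs_def] by (simp add: cell_mean_diff L2_lloc cell_mean_L2) (simp add: cell_mean_def cell_mean_lev[unfolded cell_mean_def])

text \<open>A Haar component of level \<open>n\<close> has mean 0 on cells of level at most
  \<open>n\<close> and is constant on finer cells. So rows 0 to \<open>n + 1\<close> act as
  multiples of the identity and later rows vanish.\<close>

lemma energy_row_haar_part: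
  assumes f: "L2 \<mu> f"
  shows "energy_row (haar_part n f) v 0 = ip (haar_part n f) v"
    and "m \<le> n \<Longrightarrow> energy_row (haar_part n f) v (Suc m) = 7 * 8 ^ m * ip (haar_part n f) v"
    and "n < m \<Longrightarrow> energy_row (haar_part n f) v (Suc m) = 0"
proof -
  have "nbr_mean (haar_part n f) x = 0" for x using cell_avg_haar_part[OF f, of 0 n] by (simp add: nbr_mean_def lev_def nbr_avg_def)
  then show "energy_row (haar_part n f) v 0 = ip (haar_part n f) v" by (simp add: energy_row_def)
  show "energy_row (haar_part n f) v (Suc m) = 7 * 8 ^ m * ip (haar_part n f) v" if "m \<le> n"
    using cell_avg_haar_part[OF f that] by (simp add: energy_row_def cell_mean_def lev_def)
  show "energy_row (haar_part n f) v (Suc m) = 0" if "n < m"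
    using cell_mean_haar_part[OF f that] by (simp add: energy_row_def ip_def)
qed

lemma geometric_8: "1 + (\<Sum>m\<le>n. 7 * 8 ^ m) = (8::real) ^ Suc n"
  by (induction n) simp_all

text \<open>A weak eigenfunction: the factors of the rows add up by \<open>geometric_8\<close> to
  the eigenvalue \<open>8 ^ Suc n\<close>.\<close>

lemma haar_part_F:
  assumes f: "L2 \<mu> f"
  shows "haar_part n f \<in> F" and "v \<in> F \<Longrightarrow> L2 \<mu> v \<Longrightarrow> E (haar_part n f) v = 8 ^ Suc n * ip (haar_part n f) v"
proof -
  have z: "energy_row (haar_part n f) v m = 0" if "m > Suc n" for m v
    using that energy_row_haar_part(3)[OF f, of n "m - 1" v] by (cases m) auto
  have fe: "fin_energy (haar_part n f)" by (rule fin_energy_rows[OF haar_part_L2[OF f] z])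
  \<comment> \<open>Values differ by at most \<open>6 * 2 ^ n * (1 + nsq f)\<close>, and not at all
    within a cell of level \<open>n + 1\<close>; the factor \<open>2 ^ Suc n\<close> pays for the
    coarser levels.\<close>
  have "dyadic_lipschitz (2 ^ Suc n * (6 * 2 ^ n * (1 + nsq f))) (haar_part n f)"
    unfolding dyadic_lipschitz_def
  proof (intro ballI allI impI)
    fix x y m assume xy: "x \<in> X" "y \<in> X" "c m x = c m y"
    let ?B = "6 * 2 ^ n * (1 + nsq f)"
    have B: "0 \<le> ?B" using nsq_nonneg[of f] by simp
    show "\<bar>haar_part n f x - haar_part n f y\<bar> \<le> 2 ^ Suc n * ?B / 2 ^ m"
    proof (cases "Suc n \<le> m")
      case True
      then have "c (Suc n) x = c (Suc n) y" "c n x = c n y" using c_eq_le[OF xy] by auto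
      then have "haar_part n f x = haar_part n f y" using xy by (simp add: haar_part_def cell_mean_def lev_in)
      moreover have "0 \<le> 2 ^ Suc n * ?B / 2 ^ m" by (intro divide_nonneg_nonneg mult_nonneg_nonneg B) simp_all
      ultimately show ?thesis by simp
    next
      case False
      then have "(2::real) ^ m \<le> 2 ^ Suc n" by (intro power_increasing) auto
      then have "1 \<le> (2::real) ^ Suc n / 2 ^ m" by simp
      from mult_right_mono[OF this B] have "?B \<le> 2 ^ Suc n * ?B / 2 ^ m" by simp
      moreover have "\<bar>haar_part n f x - haar_part n f y\<bar> \<le> ?B"
        using haar_part_bound[OF f, of n x] haar_part_bound[OF f, of n y] by simp
      ultimately show ?thesis by linarith
    qed
  qed
  moreover have "haar_part n f x = 0" if "x \<notin> X" for x using that by (simp add: haar_part_def cell_mean_def lev_out)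
  ultimately show "haar_part n f \<in> F" using fe unfolding F_def by blast
  assume v: "v \<in> F" "L2 \<mu> v"
  have "E (haar_part n f) v = (\<Sum>m\<le>Suc n. energy_row (haar_part n f) v m)"
    by (rule E_rows[OF fe haar_part_L2[OF f] F_fin_energy[OF v(1)] v(2) z])
  also have "\<dots> = energy_row (haar_part n f) v 0 + (\<Sum>m\<le>n. energy_row (haar_part n f) v (Suc m))" by (rule sum.atMost_Suc_shift)
  also have "(\<Sum>m\<le>n. energy_row (haar_part n f) v (Suc m)) = (\<Sum>m\<le>n. 7 * 8 ^ m * ip (haar_part n f) v)"
    by (intro sum.cong) (simp_all add: energy_row_haar_part(2)[OF f])
  also have "energy_row (haar_part n f) v 0 + \<dots> = (1 + (\<Sum>m\<le>n. 7 * 8 ^ m)) * ip (haar_part n f) v"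
    by (simp add: energy_row_haar_part(1)[OF f] sum_distrib_right distrib_right)
  finally show "E (haar_part n f) v = 8 ^ Suc n * ip (haar_part n f) v" unfolding geometric_8 .
qed

section \<open>The graph Laplacian on the chain of unit cells\<close>

definition unit_lap :: "(nat \<Rightarrow> real) \<Rightarrow> nat \<Rightarrow> real" where "unit_lap b k = b k - nbr_avg b k"

definition unit_lap_pow :: "nat \<Rightarrow> ('a \<Rightarrow> real) \<Rightarrow> nat \<Rightarrow> real" where "unit_lap_pow n f = (unit_lap ^^ n) (cell_avg 0 f)"

lemma unit_lap_pow_0: "unit_lap_pow 0 f = cell_avg 0 f" by (simp add: unit_lap_pow_def)
lemma unit_lap_pow_Suc: "unit_lap_pow (Suc n) f = unit_lap (unit_lap_pow n f)" by (simp add: unit_lap_pow_def)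

lemma unit_lap_summable:
  assumes b: "summable (\<lambda>k. (b k)\<^sup>2)"
  shows "summable (\<lambda>k. (unit_lap b k)\<^sup>2)" and "(\<Sum>k. (unit_lap b k)\<^sup>2) \<le> 10 * (\<Sum>k. (b k)\<^sup>2)"
proof -
  let ?r = "\<lambda>k. 2 * (b k)\<^sup>2 + 2 * ((b (k - 1))\<^sup>2 + (b k)\<^sup>2 + (b (Suc k))\<^sup>2)"
  have le: "(unit_lap b k)\<^sup>2 \<le> ?r k" for k
  proof -
    have "(unit_lap b k)\<^sup>2 \<le> 2 * (b k)\<^sup>2 + 2 * (nbr_avg b k)\<^sup>2"
    proof -
      have "2 * (b k)\<^sup>2 + 2 * (nbr_avg b k)\<^sup>2 - (b k - nbr_avg b k)\<^sup>2 = (b k + nbr_avg b k)\<^sup>2"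
        by (simp add: power2_eq_square algebra_simps)
      also have "0 \<le> \<dots>" by simp
      finally show ?thesis by (simp add: unit_lap_def)
    qed
    also have "(nbr_avg b k)\<^sup>2 \<le> (b (k - 1))\<^sup>2 + (b k)\<^sup>2 + (b (Suc k))\<^sup>2"
      unfolding nbr_avg_def by (rule square_sum3_le)
    finally show ?thesis by simp
  qed
  have bS: "summable (\<lambda>k. (b (Suc k))\<^sup>2)" using b summable_Suc_iff[of "\<lambda>k. (b k)\<^sup>2"] by simp
  have bP: "summable (\<lambda>k. (b (k - 1))\<^sup>2)" by (rule summable_pred[OF b])
  have S: "summable ?r" by (intro summable_add summable_mult b bS bP)
  show 1: "summable (\<lambda>k. (unit_lap b k)\<^sup>2)" by (rule summable_comparison_test'[OF S]) (use le in simp)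
  \<comment> \<open>One shift repeats \<open>b 0\<close> and the other drops it; the two boundary
    terms cancel, and the total is 8 times the sum of squares, rounded up to 10.\<close>
  have b0: "(b 0)\<^sup>2 \<le> (\<Sum>k. (b k)\<^sup>2)" using sum_le_suminf[OF b, of "{0}"] by simp
  have sS: "(\<Sum>k. (b (Suc k))\<^sup>2) = (\<Sum>k. (b k)\<^sup>2) - (b 0)\<^sup>2" using suminf_split_head[OF b] by simp
  have sP: "(\<Sum>k. (b (k - 1))\<^sup>2) = (\<Sum>k. (b k)\<^sup>2) + (b 0)\<^sup>2" using suminf_split_head[OF bP] by simp
  have "(\<Sum>k. (unit_lap b k)\<^sup>2) \<le> suminf ?r" by (rule suminf_le[OF le 1 S])
  also have "\<dots> = 2 * (\<Sum>k. (b k)\<^sup>2) + 2 * ((\<Sum>k. (b (k - 1))\<^sup>2) + (\<Sum>k. (b k)\<^sup>2) + (\<Sum>k. (b (Suc k))\<^sup>2))"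
    by (rule sums_unique[symmetric]) (intro sums_add sums_mult summable_sums b bS bP)
  finally show "(\<Sum>k. (unit_lap b k)\<^sup>2) \<le> 10 * (\<Sum>k. (b k)\<^sup>2)"
    using order_trans[OF zero_le_power2 b0] unfolding sS sP by simp
qed

lemma unit_lap_pow_summable:
  assumes f: "L2 \<mu> f"
  shows "summable (\<lambda>k. (unit_lap_pow n f k)\<^sup>2)" and "(\<Sum>k. (unit_lap_pow n f k)\<^sup>2) \<le> 10 ^ n * nsq f"
proof (induction n)
  case 0
  { case 1 show ?case unfolding unit_lap_pow_0 by (rule cell_avg_summable[OF f]) }
  { case 2 show ?case unfolding unit_lap_pow_0 using cell_avg_summable(2)[OF f, of 0] by simp }
next
  case (Suc n)
  { case 1 show ?case unfolding unit_lap_pow_Suc by (rule unit_lap_summable[OF Suc.IH(1)]) }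
  { case 2 show ?case unfolding unit_lap_pow_Suc using unit_lap_summable(2)[OF Suc.IH(1)] Suc.IH(2) by simp }
qed

lemma unit_lap_bound: "(\<And>k. \<bar>b k\<bar> \<le> S) \<Longrightarrow> \<bar>unit_lap b k\<bar> \<le> 2 * S"
proof -
  assume b: "\<And>k. \<bar>b k\<bar> \<le> S"
  have "\<bar>x\<bar> \<le> S \<Longrightarrow> \<bar>y\<bar> \<le> S \<Longrightarrow> \<bar>z\<bar> \<le> S \<Longrightarrow> \<bar>x - (y + 2 * x + z) / 4\<bar> \<le> 2 * S" for x y z :: real
    by (simp only: abs_le_iff add_divide_distrib) linarith
  then show ?thesis unfolding unit_lap_def nbr_avg_def using b by blast
qed

lemma unit_lap_pow_bound:
  assumes f: "L2 \<mu> f" shows "\<bar>unit_lap_pow n f k\<bar> \<le> 2 ^ n * (1 + nsq f)"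
proof (induction n arbitrary: k)
  case 0 then show ?case unfolding unit_lap_pow_0 cell_avg_def using I_cell_bound[OF f, of 0 k] by simp
next
  case (Suc n) then show ?case unfolding unit_lap_pow_Suc using unit_lap_bound[of "unit_lap_pow n f" "2 ^ n * (1 + nsq f)" k] by simp
qed

lemma cell_avg_lev_0: "cell_avg 0 (lev 0 b) = b" by (rule ext) (simp add: cell_avg_lev)

text \<open>A function of the unit cell is its own cell mean at every level, so only row 0 is left,
  and that row is the graph Laplacian.\<close>

lemma unit_F:
  assumes b: "summable (\<lambda>k. (b k)\<^sup>2)"
  shows "lev 0 b \<in> F" and "v \<in> F \<Longrightarrow> L2 \<mu> v \<Longrightarrow> E (lev 0 b) v = ip (lev 0 (unit_lap b)) v"
proof -
  have z: "energy_row (lev 0 b) v m = 0" if "m > 0" for m v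
    using that by (cases m) (simp_all add: energy_row_def cell_mean_lev ip_def)
  have fe: "fin_energy (lev 0 b)" by (rule fin_energy_rows[OF lev_L2(1)[OF b] z])
  have "dyadic_lipschitz 0 (lev 0 b)"
    unfolding dyadic_lipschitz_def by (auto simp: lev_in dest: c_eq_le[of _ _ _ 0])
  then show "lev 0 b \<in> F" using fe lev_out unfolding F_def by blast
  assume v: "v \<in> F" "L2 \<mu> v"
  have "E (lev 0 b) v = (\<Sum>m\<le>0. energy_row (lev 0 b) v m)"
    by (rule E_rows[OF fe lev_L2(1)[OF b] F_fin_energy[OF v(1)] v(2) z])
  also have "\<dots> = ip (\<lambda>x. lev 0 b x - nbr_mean (lev 0 b) x) v" by (simp add: energy_row_def)
  also have "\<dots> = ip (lev 0 (unit_lap b)) v"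
    by (rule ip_cong) (simp add: nbr_mean_def cell_avg_lev_0 lev_in unit_lap_def)
  finally show "E (lev 0 b) v = ip (lev 0 (unit_lap b)) v" .
qed

section \<open>Mean square convergence of the cell means\<close>

definition approx :: "('a \<Rightarrow> real) \<Rightarrow> bool" where
  "approx f \<longleftrightarrow> L2 \<mu> f \<and> (\<lambda>n. nsq (\<lambda>x. cell_mean n f x - f x)) \<longlonglongrightarrow> 0"

lemma approx_L2: "approx f \<Longrightarrow> L2 \<mu> f" by (simp add: approx_def)

lemma approx_add:
  assumes u: "approx u" and v: "approx v" shows "approx (\<lambda>x. u x + v x)"
proof -
  have L: "L2 \<mu> u" "L2 \<mu> v" using assms approx_L2 by auto
  have le: "nsq (\<lambda>x. cell_mean n (\<lambda>x. u x + v x) x - (u x + v x))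
      \<le> 2 * nsq (\<lambda>x. cell_mean n u x - u x) + 2 * nsq (\<lambda>x. cell_mean n v x - v x)" for n
  proof -
    have "(\<lambda>x. cell_mean n (\<lambda>x. u x + v x) x - (u x + v x)) = (\<lambda>x. (cell_mean n u x - u x) + (cell_mean n v x - v x))"
      using L by (simp add: cell_mean_add L2_lloc algebra_simps)
    then show ?thesis using nsq_add_le[of "\<lambda>x. cell_mean n u x - u x" "\<lambda>x. cell_mean n v x - v x"] L by (simp add: L2_diff cell_mean_L2)
  qed
  have "(\<lambda>n. 2 * nsq (\<lambda>x. cell_mean n u x - u x) + 2 * nsq (\<lambda>x. cell_mean n v x - v x)) \<longlonglongrightarrow> 2 * 0 + 2 * 0"
    using u v unfolding approx_def by (intro tendsto_intros) auto
  then have z: "(\<lambda>n. 2 * nsq (\<lambda>x. cell_mean n u x - u x) + 2 * nsq (\<lambda>x. cell_mean n v x - v x)) \<longlonglongrightarrow> 0" by simp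
  have "(\<lambda>n. nsq (\<lambda>x. cell_mean n (\<lambda>x. u x + v x) x - (u x + v x))) \<longlonglongrightarrow> 0"
    by (rule Lim_null_comparison[OF _ z]) (use le nsq_nonneg in auto)
  then show ?thesis using L by (simp add: approx_def L2_add)
qed

lemma approx_scale:
  assumes u: "approx u" shows "approx (\<lambda>x. a * u x)"
proof -
  have "(\<lambda>x. cell_mean n (\<lambda>x. a * u x) x - a * u x) = (\<lambda>x. a * (cell_mean n u x - u x))" for n
    by (simp add: cell_mean_scale right_diff_distrib)
  moreover have "(\<lambda>n. a\<^sup>2 * nsq (\<lambda>x. cell_mean n u x - u x)) \<longlonglongrightarrow> a\<^sup>2 * 0"
    using u unfolding approx_def by (intro tendsto_intros) auto
  ultimately show ?thesis using approx_L2[OF u] by (simp add: approx_def L2_scale nsq_scale)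
qed

lemma approx_diff: "approx u \<Longrightarrow> approx v \<Longrightarrow> approx (\<lambda>x. u x - v x)"
  using approx_add[of u "\<lambda>x. -1 * v x"] approx_scale[of v "-1"] by simp

text \<open>Cell means are contractions, so the squared error of \<open>f\<close> is at most 8 times
  its squared distance to \<open>h N\<close> plus twice the error of \<open>h N\<close>.\<close>

lemma approx_closed:
  assumes f: "L2 \<mu> f" and h: "\<And>N. approx (h N)" and lim: "(\<lambda>N. nsq (\<lambda>x. f x - h N x)) \<longlonglongrightarrow> 0"
  shows "approx f"
  unfolding approx_def
proof (intro conjI f LIMSEQ_I)
  fix r :: real assume r: "r > 0"
  obtain N where "norm (nsq (\<lambda>x. f x - h N x) - 0) < r / 32"
    using LIMSEQ_D[OF lim, of "r / 32"] r by auto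
  then have N: "nsq (\<lambda>x. f x - h N x) < r / 32" by simp
  obtain M where M: "\<And>n. n \<ge> M \<Longrightarrow> norm (nsq (\<lambda>x. cell_mean n (h N) x - h N x) - 0) < r / 8"
    using LIMSEQ_D[of "\<lambda>n. nsq (\<lambda>x. cell_mean n (h N) x - h N x)" 0 "r / 8"] h[of N] r by (auto simp: approx_def)
  have hL: "L2 \<mu> (h N)" by (rule approx_L2[OF h])
  show "\<exists>no. \<forall>n\<ge>no. norm (nsq (\<lambda>x. cell_mean n f x - f x) - 0) < r"
  proof (intro exI[of _ M] allI impI)
    fix n assume n: "n \<ge> M"
    let ?d = "\<lambda>x. f x - h N x"
    have dL: "L2 \<mu> ?d" by (intro L2_diff f hL)
    have eq: "(\<lambda>x. cell_mean n f x - f x) = (\<lambda>x. (cell_mean n ?d x - ?d x) + (cell_mean n (h N) x - h N x))"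
      using f hL by (simp add: cell_mean_diff L2_lloc)
    have "nsq (\<lambda>x. cell_mean n f x - f x) \<le> 2 * nsq (\<lambda>x. cell_mean n ?d x - ?d x) + 2 * nsq (\<lambda>x. cell_mean n (h N) x - h N x)"
      unfolding eq by (intro nsq_add_le L2_diff cell_mean_L2 dL hL)
    also have "nsq (\<lambda>x. cell_mean n ?d x - ?d x) \<le> 2 * nsq (cell_mean n ?d) + 2 * nsq ?d"
      by (intro nsq_diff_le cell_mean_L2 dL)
    also have "nsq (cell_mean n ?d) \<le> nsq ?d" by (rule cell_mean_nsq_le[OF dL])
    finally have "nsq (\<lambda>x. cell_mean n f x - f x) \<le> 8 * nsq ?d + 2 * nsq (\<lambda>x. cell_mean n (h N) x - h N x)" by simp
    also have "\<dots> < r" using N M[OF n] nsq_nonneg[of "\<lambda>x. cell_mean n (h N) x - h N x"] r by simp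
    finally show "norm (nsq (\<lambda>x. cell_mean n f x - f x) - 0) < r" using nsq_nonneg by simp
  qed
qed

lemma approx_zero: "approx (\<lambda>x. 0)"
proof -
  have "cell_mean n (\<lambda>x. 0) x = 0" for n x using cell_mean_scale[of n 0 "\<lambda>x. 0"] by simp
  then show ?thesis by (simp add: approx_def nsq_def)
qed

lemma approx_cell: "approx (indicator (cell m k))"
proof -
  let ?a = "\<lambda>j. of_bool (j = k) :: real"
  have eq: "indicator (cell m k) = lev m ?a" by (rule ext) (simp add: lev_def indicator_def)
  have "summable (\<lambda>j. (?a j)\<^sup>2)" by (rule summable_finite[of "{k}"]) auto
  then have L: "L2 \<mu> (lev m ?a)" by (rule lev_L2)
  have "\<forall>\<^sub>F n in sequentially. nsq (\<lambda>x. cell_mean n (lev m ?a) x - lev m ?a x) = 0"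
    using eventually_ge_at_top[of m] by eventually_elim (simp add: cell_mean_lev nsq_def)
  then have "(\<lambda>n. nsq (\<lambda>x. cell_mean n (lev m ?a) x - lev m ?a x)) \<longlonglongrightarrow> 0" by (rule tendsto_eventually)
  then show ?thesis unfolding eq using L by (simp add: approx_def)
qed

lemma L2_indicator: "B \<in> sets \<mu> \<Longrightarrow> emeasure \<mu> B < \<infinity> \<Longrightarrow> L2 \<mu> (indicator B)"
proof -
  assume B: "B \<in> sets \<mu>" "emeasure \<mu> B < \<infinity>"
  have "(\<lambda>x. (indicator B x)\<^sup>2) = (indicator B :: 'a \<Rightarrow> real)" by (auto simp: indicator_def)
  then show ?thesis using B by (simp add: L2_def)
qed

lemma approx_indicator_seq:
  assumes S: "S \<in> sets \<mu>" "emeasure \<mu> S < \<infinity>" and T: "\<And>N. approx (indicator (T N))"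
    and sub: "\<And>N. T N \<subseteq> S" and m: "\<And>N. T N \<in> sets \<mu>"
    and ev: "\<And>x. x \<in> S \<Longrightarrow> \<forall>\<^sub>F N in sequentially. x \<in> T N"
  shows "approx (indicator S)"
proof (rule approx_closed[OF L2_indicator[OF S] T])
  have "(\<lambda>N. LINT x|\<mu>. (indicator S x - indicator (T N) x)\<^sup>2 :: real) \<longlonglongrightarrow> (LINT x|\<mu>. 0)"
  proof (rule integral_dominated_convergence[where w = "indicator S"])
    show "(\<lambda>x. (indicator S x - indicator (T N) x)\<^sup>2 :: real) \<in> borel_measurable \<mu>" for N
      using S m by measurable
    show "integrable \<mu> (indicator S :: 'a \<Rightarrow> real)" using S by simp
    show "AE x in \<mu>. (\<lambda>N. (indicator S x - indicator (T N) x)\<^sup>2 :: real) \<longlonglongrightarrow> 0"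
    proof (intro AE_I2)
      fix x
      have "\<forall>\<^sub>F N in sequentially. (indicator S x - indicator (T N) x)\<^sup>2 = (0 :: real)"
      proof (cases "x \<in> S")
        case True
        from ev[OF this] show ?thesis by eventually_elim (use True in simp)
      next
        case False
        then show ?thesis using sub by (auto simp: indicator_def intro!: always_eventually)
      qed
      then show "(\<lambda>N. (indicator S x - indicator (T N) x)\<^sup>2 :: real) \<longlonglongrightarrow> 0" by (rule tendsto_eventually)
    qed
    show "AE x in \<mu>. norm ((indicator S x - indicator (T N) x)\<^sup>2 :: real) \<le> indicator S x" for N
      using sub[of N] by (intro AE_I2) (auto simp: indicator_def)
  qed simp
  then show "(\<lambda>N. nsq (\<lambda>x. indicator S x - indicator (T N) x)) \<longlonglongrightarrow> 0" by (simp add: nsq_def)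
qed

lemma approx_Un:
  assumes "approx (indicator S)" "approx (indicator T)" "S \<inter> T = {}"
  shows "approx (indicator (S \<union> T))"
proof -
  have "indicator S x + indicator T x = (indicator (S \<union> T) x :: real)" for x
    using assms(3) by (cases "x \<in> S"; cases "x \<in> T") auto
  then have "(\<lambda>x. indicator S x + indicator T x) = (indicator (S \<union> T) :: 'a \<Rightarrow> real)" by (rule ext)
  then show ?thesis using approx_add[OF assms(1,2)] by simp
qed

text \<open>Two cells are nested or disjoint; with the empty set they form a generator stable under
  intersections, as the Dynkin argument requires.\<close>

lemma cell_Int: "cell m j \<inter> cell n k \<in> insert {} {cell n k |n k. True}"
proof (cases "cell m j \<inter> cell n k = {}")
  case False
  then obtain x where "x \<in> cell m j" "x \<in> cell n k" by blast
  then have x: "x \<in> X" "c m x = j" "c n x = k" by auto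
  have "cell m j \<inter> cell n k = cell (max m n) (c (max m n) x)"
  proof (intro equalityI subsetI)
    fix y assume "y \<in> cell m j \<inter> cell n k"
    then show "y \<in> cell (max m n) (c (max m n) x)" using x by (auto simp: max_def)
  next
    fix y assume y: "y \<in> cell (max m n) (c (max m n) x)"
    then show "y \<in> cell m j \<inter> cell n k"
      using c_eq_le[of y x "max m n" m] c_eq_le[of y x "max m n" n] x by auto
  qed
  then show ?thesis by blast
qed simp

lemma sets_mu_cells: "sets \<mu> = sigma_sets X (insert {} {cell n k |n k. True})"
proof -
  have "sigma_sets X {{x \<in> X. c n x = k} |n k. True} = sigma_sets X (insert {} {cell n k |n k. True})"
    unfolding cell_def[symmetric] by (rule sigma_sets_eqI) (auto intro: sigma_sets.Basic sigma_sets.Empty)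
  then show ?thesis using sets_mu by simp
qed

lemma cell_sets_fin: "B \<in> sets \<mu> \<Longrightarrow> emeasure \<mu> (B \<inter> cell n k) < \<infinity>"
proof -
  assume B: "B \<in> sets \<mu>"
  have "emeasure \<mu> (B \<inter> cell n k) \<le> emeasure \<mu> (cell n k)" by (intro emeasure_mono) auto
  also have "\<dots> < \<infinity>" by (simp add: emeasure_cell)
  finally show ?thesis .
qed

text \<open>Dynkin induction inside one unit cell, where finite measure makes a complement the
  difference of two square integrable indicators.\<close>

lemma approx_set_cell:
  assumes "B \<in> sets \<mu>" shows "approx (indicator (B \<inter> cell 0 k))"
proof -
  have "Int_stable (insert {} {cell n k |n k. True})"
    unfolding Int_stable_def
  proof (intro ballI)
    fix a b assume "a \<in> insert {} {cell n k |n k. True}" "b \<in> insert {} {cell n k |n k. True}"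
    then consider "a = {} \<or> b = {}" | m j n k where "a = cell m j" "b = cell n k" by blast
    then show "a \<inter> b \<in> insert {} {cell n k |n k. True}" by cases (auto simp only: cell_Int)
  qed
  moreover have "insert {} {cell n k |n k. True} \<subseteq> Pow X" by auto
  moreover have "B \<in> sigma_sets X (insert {} {cell n k |n k. True})" using assms sets_mu_cells by simp
  ultimately show ?thesis
  proof (induction rule: sigma_sets_induct_disjoint)
    case (basic B)
    then show ?case
    proof
      assume "B \<in> {cell n k |n k. True}"
      then obtain n j where "B = cell n j" by blast
      then consider "B \<inter> cell 0 k = {}" | n' k' where "B \<inter> cell 0 k = cell n' k'"
        using cell_Int[of n j 0 k] by blast
      then show ?thesis
      proof cases
        case 1 then show ?thesis using approx_zero by simp
      next
        case 2 then show ?thesis using approx_cell by simp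
      qed
    qed (use approx_zero in simp)
  next
    case empty show ?case using approx_zero by simp
  next
    case (compl B)
    have "(\<lambda>x. indicator (cell 0 k) x - indicator (B \<inter> cell 0 k) x) = (indicator ((X - B) \<inter> cell 0 k) :: 'a \<Rightarrow> real)"
      by (auto simp: indicator_def)
    then show ?case using approx_diff[OF approx_cell[of 0 k] compl.IH] by simp
  next
    case (union B)
    have BS: "B i \<in> sets \<mu>" for i unfolding sets_mu_cells using union.hyps(2) by (rule subsetD) (rule rangeI)
    define T where "T N = (\<Union>i<N. B i) \<inter> cell 0 k" for N
    have TA: "approx (indicator (T N))" for N
    proof (induction N)
      case 0 show ?case using approx_zero by (simp add: T_def)
    next
      case (Suc N)
      have "T (Suc N) = T N \<union> (B N \<inter> cell 0 k)" by (auto simp: T_def lessThan_Suc)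
      moreover have "B i \<inter> B N = {}" if "i < N" for i
        using disjoint_family_onD[OF union.hyps(1), of i N] that by simp
      then have "T N \<inter> (B N \<inter> cell 0 k) = {}" unfolding T_def by blast
      ultimately show ?case using approx_Un[OF Suc union.IH[of N]] by simp
    qed
    have mT: "T N \<in> sets \<mu>" for N unfolding T_def by (intro sets.Int sets.finite_UN BS) auto
    have mU: "(\<Union>i. B i) \<in> sets \<mu>" using BS by (intro sets.countable_UN) auto
    show ?case
    proof (rule approx_indicator_seq[where T = T])
      show "(\<Union>i. B i) \<inter> cell 0 k \<in> sets \<mu>" using mU by (intro sets.Int) simp_all
      show "emeasure \<mu> ((\<Union>i. B i) \<inter> cell 0 k) < \<infinity>" by (rule cell_sets_fin[OF mU])
      show "\<forall>\<^sub>F N in sequentially. x \<in> T N" if x: "x \<in> (\<Union>i. B i) \<inter> cell 0 k" for x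
      proof -
        obtain i where i: "x \<in> B i" using x by blast
        show ?thesis using eventually_gt_at_top[of i] by eventually_elim (use i x in \<open>auto simp: T_def\<close>)
      qed
      show "T N \<subseteq> (\<Union>i. B i) \<inter> cell 0 k" for N by (auto simp: T_def)
    qed (rule TA mT)+
  qed
qed

lemma approx_set:
  assumes B: "B \<in> sets \<mu>" "emeasure \<mu> B < \<infinity>" shows "approx (indicator B)"
proof -
  define T where "T N = (\<Union>k<N. B \<inter> cell 0 k)" for N
  have TA: "approx (indicator (T N))" for N
  proof (induction N)
    case 0 show ?case using approx_zero by (simp add: T_def)
  next
    case (Suc N)
    have "T (Suc N) = T N \<union> (B \<inter> cell 0 N)" by (auto simp: T_def lessThan_Suc)
    moreover have "T N \<inter> (B \<inter> cell 0 N) = {}" by (auto simp: T_def)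
    ultimately show ?case using approx_Un[OF Suc approx_set_cell[OF B(1), of N]] by simp
  qed
  show ?thesis
  proof (rule approx_indicator_seq[OF B TA])
    show "T N \<in> sets \<mu>" for N unfolding T_def using B by (intro sets.finite_UN sets.Int) auto
    show "\<forall>\<^sub>F N in sequentially. x \<in> T N" if "x \<in> B" for x
    proof -
      have x: "x \<in> X" using that sets.sets_into_space[OF B(1)] space_mu by auto
      show ?thesis using eventually_gt_at_top[of "c 0 x"] by eventually_elim (use that x in \<open>auto simp: T_def\<close>)
    qed
  qed (auto simp: T_def)
qed

lemma L2_dominated:
  assumes "L2 \<mu> v" "u \<in> borel_measurable \<mu>" "\<And>x. x \<in> X \<Longrightarrow> \<bar>u x\<bar> \<le> \<bar>v x\<bar>"
  shows "L2 \<mu> u"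
proof -
  have "integrable \<mu> (\<lambda>x. (u x)\<^sup>2)"
  proof (rule Bochner_Integration.integrable_bound[OF L2_square_integrable[OF assms(1)]])
    show "(\<lambda>x. (u x)\<^sup>2) \<in> borel_measurable \<mu>" using assms(2) by measurable
    show "AE x in \<mu>. norm ((u x)\<^sup>2) \<le> norm ((v x)\<^sup>2)"
      using assms(3) by (intro AE_I2) (simp add: space_mu abs_le_square_iff)
  qed
  then show ?thesis using assms(2) by (simp add: L2_def)
qed

lemma approx_nonneg:
  assumes "u \<in> borel_measurable \<mu>" "\<And>x. 0 \<le> u x"
  shows "L2 \<mu> u \<longrightarrow> approx u"
  using assms
proof (induction rule: borel_measurable_induct_real)
  case (set B)
  show ?case
  proof
    assume "L2 \<mu> (indicator B)"
    then have "integrable \<mu> (\<lambda>x. (indicator B x)\<^sup>2 :: real)" by (simp add: L2_def)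
    moreover have "(\<lambda>x. (indicator B x)\<^sup>2) = (indicator B :: 'a \<Rightarrow> real)" by (auto simp: indicator_def)
    ultimately have "integrable \<mu> (indicator B :: 'a \<Rightarrow> real)" by simp
    then have "emeasure \<mu> (B \<inter> space \<mu>) < \<infinity>" by (simp add: integrable_indicator_iff)
    then show "approx (indicator B)" using set sets.sets_into_space[OF set] by (intro approx_set) (simp_all add: Int_absorb2)
  qed
next
  case (mult u a)
  show ?case
  proof
    assume L: "L2 \<mu> (\<lambda>x. a * u x)"
    show "approx (\<lambda>x. a * u x)"
    proof (cases "a = 0")
      case True then show ?thesis using approx_zero by simp
    next
      case False
      then have "L2 \<mu> u" using L2_scale[OF L, of "1 / a"] by simp
      then show ?thesis using mult approx_scale by blast
    qed
  qed
next
  case (add u v)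
  show ?case
  proof
    assume L: "L2 \<mu> (\<lambda>x. v x + u x)"
    have "L2 \<mu> u" "L2 \<mu> v"
      using add by (auto intro!: L2_dominated[OF L])
    then show "approx (\<lambda>x. v x + u x)" using add approx_add by blast
  qed
next
  case (seq U)
  show ?case
  proof
    assume L: "L2 \<mu> u"
    have um: "u \<in> borel_measurable \<mu>" by (rule L2_measurable[OF L])
    have mono: "U i x \<le> U j x" if "i \<le> j" for i j x using incseqD[OF seq.hyps(3) that] by (simp add: le_fun_def)
    have Uu: "U i x \<le> u x" if "x \<in> X" for i x
    proof (rule LIMSEQ_le_const)
      show "(\<lambda>i. U i x) \<longlonglongrightarrow> u x" using seq.hyps(4) that by (simp add: space_mu)
      show "\<exists>N. \<forall>n\<ge>N. U i x \<le> U n x" using mono by blast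
    qed
    have U0: "0 \<le> U i x" for i x by (rule seq.hyps(2))
    have LU: "L2 \<mu> (U i)" for i
    proof (rule L2_dominated[OF L seq.hyps(1)])
      show "\<bar>U i x\<bar> \<le> \<bar>u x\<bar>" if "x \<in> X" for x using U0[of i x] Uu[OF that, of i] by simp
    qed
    then have AU: "approx (U i)" for i using seq.IH by blast
    have "(\<lambda>i. LINT x|\<mu>. (u x - U i x)\<^sup>2) \<longlonglongrightarrow> (LINT x|\<mu>. 0)"
    proof (rule integral_dominated_convergence[OF _ _ L2_square_integrable[OF L]])
      show "(\<lambda>x. (u x - U i x)\<^sup>2) \<in> borel_measurable \<mu>" for i using um seq.hyps(1)[of i] by measurable
      show "AE x in \<mu>. (\<lambda>i. (u x - U i x)\<^sup>2) \<longlonglongrightarrow> 0"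
      proof (intro AE_I2)
        fix x assume "x \<in> space \<mu>"
        then have "(\<lambda>i. (u x - U i x)\<^sup>2) \<longlonglongrightarrow> (u x - u x)\<^sup>2" by (intro tendsto_intros seq.hyps(4))
        then show "(\<lambda>i. (u x - U i x)\<^sup>2) \<longlonglongrightarrow> 0" by simp
      qed
      show "AE x in \<mu>. norm ((u x - U i x)\<^sup>2) \<le> (u x)\<^sup>2" for i
      proof (intro AE_I2)
        fix x assume "x \<in> space \<mu>"
        then have "\<bar>u x - U i x\<bar> \<le> \<bar>u x\<bar>" using U0[of i x] Uu[of x i] by (simp add: space_mu)
        then show "norm ((u x - U i x)\<^sup>2) \<le> (u x)\<^sup>2" by (simp add: abs_le_square_iff)
      qed
    qed simp
    then have "(\<lambda>i. nsq (\<lambda>x. u x - U i x)) \<longlonglongrightarrow> 0" by (simp add: nsq_def)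
    then show "approx u" by (rule approx_closed[OF L AU])
  qed
qed

text \<open>Mean square convergence of the martingale of cell means, reduced to
  \<open>approx_nonneg\<close> by positive and negative parts. It will yield the initial condition
  of the heat flow.\<close>

lemma approx_all:
  assumes f: "L2 \<mu> f" shows "approx f"
proof -
  have m: "f \<in> borel_measurable \<mu>" by (rule L2_measurable[OF f])
  have "L2 \<mu> (\<lambda>x. max 0 (f x))" "L2 \<mu> (\<lambda>x. max 0 (- f x))"
    using m by (auto intro!: L2_dominated[OF f])
  then have "approx (\<lambda>x. max 0 (f x))" "approx (\<lambda>x. max 0 (- f x))"
    using m by (auto intro!: approx_nonneg[rule_format])
  from approx_diff[OF this] have "approx (\<lambda>x. max 0 (f x) - max 0 (- f x))" .
  moreover have "(\<lambda>x. max 0 (f x) - max 0 (- f x)) = f" by (rule ext) simp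
  ultimately show ?thesis by simp
qed

end

section \<open>The heat semigroup\<close>

lemma mean_value_between:
  fixes \<phi> :: "real \<Rightarrow> real"
  assumes "\<And>x. min s t \<le> x \<Longrightarrow> x \<le> max s t \<Longrightarrow> (\<phi> has_real_derivative \<phi>' x) (at x)"
  shows "\<exists>z. min s t \<le> z \<and> z \<le> max s t \<and> \<phi> s - \<phi> t = (s - t) * \<phi>' z"
proof -
  consider "s = t" | "s < t" | "t < s" by linarith
  then show ?thesis
  proof cases
    case 2
    obtain z where "z > s" "z < t" "\<phi> t - \<phi> s = (t - s) * \<phi>' z"
      using MVT2[OF 2, of \<phi> \<phi>'] assms 2 by auto
    then show ?thesis using 2 by (intro exI[of _ z]) (auto simp: algebra_simps)
  next
    case 3
    obtain z where "z > t" "z < s" "\<phi> s - \<phi> t = (s - t) * \<phi>' z"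
      using MVT2[OF 3, of \<phi> \<phi>'] assms 3 by auto
    then show ?thesis using 3 by (intro exI[of _ z]) auto
  qed auto
qed

text \<open>Two applications of the mean value theorem; the factor \<open>1 / 2\<close> of Taylor's
  formula is given up. With \<open>min\<close> and \<open>max\<close>, \<open>s\<close> may lie on
  either side of \<open>t\<close>.\<close>

lemma linear_remainder:
  fixes \<phi> :: "real \<Rightarrow> real"
  assumes 1: "\<And>x. min s t \<le> x \<Longrightarrow> x \<le> max s t \<Longrightarrow> (\<phi> has_real_derivative \<phi>' x) (at x)"
    and 2: "\<And>x. min s t \<le> x \<Longrightarrow> x \<le> max s t \<Longrightarrow> (\<phi>' has_real_derivative \<phi>'' x) (at x)"
    and M: "\<And>x. min s t \<le> x \<Longrightarrow> x \<le> max s t \<Longrightarrow> \<bar>\<phi>'' x\<bar> \<le> M"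
  shows "\<bar>\<phi> s - \<phi> t - (s - t) * \<phi>' t\<bar> \<le> (s - t)\<^sup>2 * M"
proof -
  obtain z where z: "min s t \<le> z" "z \<le> max s t" "\<phi> s - \<phi> t = (s - t) * \<phi>' z"
    using mean_value_between[OF 1] by blast
  have "\<exists>y. min z t \<le> y \<and> y \<le> max z t \<and> \<phi>' z - \<phi>' t = (z - t) * \<phi>'' y"
    by (rule mean_value_between) (use 2 z in auto)
  then obtain y where y: "min z t \<le> y" "y \<le> max z t" "\<phi>' z - \<phi>' t = (z - t) * \<phi>'' y" by blast
  have yM: "\<bar>\<phi>'' y\<bar> \<le> M" using y z by (intro M) auto
  have "\<phi> s - \<phi> t - (s - t) * \<phi>' t = (s - t) * (\<phi>' z - \<phi>' t)" using z by (simp add: algebra_simps)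
  also have "\<dots> = (s - t) * ((z - t) * \<phi>'' y)" using y by simp
  finally have "\<bar>\<phi> s - \<phi> t - (s - t) * \<phi>' t\<bar> = \<bar>s - t\<bar> * (\<bar>z - t\<bar> * \<bar>\<phi>'' y\<bar>)" by (simp add: abs_mult)
  also have "\<dots> \<le> \<bar>s - t\<bar> * (\<bar>s - t\<bar> * M)"
    using z yM by (intro mult_left_mono mult_mono) auto
  finally show ?thesis by (simp add: power2_eq_square mult.assoc[symmetric] abs_mult[symmetric])
qed

text \<open>Consecutive terms have ratio \<open>q * exp (- (7 * 8 ^ Suc n * s))\<close>, which tends
  to 0. Any geometric growth is thus absorbed at positive times.\<close>

lemma summable_double_exponential:
  assumes s: "0 < s" and q: "0 \<le> (q::real)"
  shows "summable (\<lambda>n. q ^ n * exp (- (8 ^ Suc n * s)))"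
proof -
  obtain N :: nat where N: "2 * q \<le> N" using real_arch_simple by blast
  obtain N' :: nat where N': "real N / s \<le> N'" using real_arch_simple by blast
  show ?thesis
  proof (rule summable_ratio_test[of "1 / 2" N'])
    fix n assume n: "N' \<le> n"
    have "real n \<le> 2 ^ n" using of_nat_less_two_power[of n, where 'a = real] by simp
    also have "\<dots> \<le> 8 ^ n" by (intro power_mono) auto
    also have "\<dots> \<le> 7 * 8 ^ Suc n" by simp
    finally have "real N' \<le> 7 * 8 ^ Suc n" using n by linarith
    have "2 * q \<le> real N" by (rule N)
    also have "\<dots> \<le> real N' * s" using N' s by (simp add: divide_le_eq)
    also have "\<dots> \<le> 7 * 8 ^ Suc n * s" using \<open>real N' \<le> 7 * 8 ^ Suc n\<close> s by (intro mult_right_mono) auto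
    also have "\<dots> \<le> exp (7 * 8 ^ Suc n * s)" using exp_ge_add_one_self[of "7 * 8 ^ Suc n * s"] by linarith
    finally have "q * exp (- (7 * 8 ^ Suc n * s)) \<le> 1 / 2" by (simp add: exp_minus field_simps)
    then have "q ^ n * exp (- (8 ^ Suc n * s)) * (q * exp (- (7 * 8 ^ Suc n * s))) \<le> q ^ n * exp (- (8 ^ Suc n * s)) * (1 / 2)"
      using q by (intro mult_left_mono) auto
    moreover have "exp (- (8 ^ Suc (Suc n) * s)) = exp (- (8 ^ Suc n * s)) * exp (- (7 * 8 ^ Suc n * s))"
      by (simp add: exp_add[symmetric] algebra_simps)
    ultimately show "norm (q ^ Suc n * exp (- (8 ^ Suc (Suc n) * s))) \<le> 1 / 2 * norm (q ^ n * exp (- (8 ^ Suc n * s)))"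
      using q by (simp add: mult_ac abs_mult)
  qed simp
qed

lemma summable_power_fact: "summable (\<lambda>n. x ^ n / fact n)" for x :: real
  using summable_exp[of x] by (simp add: divide_inverse mult.commute)

context dyadic
begin

text \<open>One number bounds supremum, squared norm and energy norm. With \<open>1 \<le> W\<close>
  it is at most \<open>W\<^sup>2\<close>, so summability against \<open>W\<^sup>2\<close> makes a
  superposition converge pointwise, in \<open>L2\<close> and in energy at once.\<close>

definition tame :: "real \<Rightarrow> ('a \<Rightarrow> real) \<Rightarrow> bool" where
  "tame W u \<longleftrightarrow> 1 \<le> W \<and> u \<in> F \<and> L2 \<mu> u \<and> (\<forall>x. \<bar>u x\<bar> \<le> W) \<and> nsq u \<le> W \<and> sqrt (E u u) \<le> W"

lemma tame_mix:
  assumes h: "\<And>j. tame (W j) (h j)" and s: "summable (\<lambda>j. \<bar>a j\<bar> * (W j)\<^sup>2)"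
  shows "mix a h \<in> F" and "L2 \<mu> (mix a h)"
    and "nsq (mix a h) \<le> (\<Sum>j. \<bar>a j\<bar> * (W j)\<^sup>2)\<^sup>2"
    and "L2 \<mu> v \<Longrightarrow> (\<lambda>j. a j * ip (h j) v) sums ip (mix a h) v"
    and "v \<in> F \<Longrightarrow> (\<lambda>j. a j * E (h j) v) sums E (mix a h) v"
    and "summable (\<lambda>j. a j * h j x)"
proof -
  have hF: "h j \<in> F" and hL: "L2 \<mu> (h j)" and hb: "\<bar>h j x\<bar> \<le> W j" and hn: "nsq (h j) \<le> W j"
    and he: "sqrt (E (h j) (h j)) \<le> W j" and W1: "1 \<le> W j" for j x
    using h[of j] by (auto simp: tame_def)
  have W2: "W j \<le> (W j)\<^sup>2" "1 \<le> (W j)\<^sup>2" for j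
    using W1[of j] mult_left_mono[of 1 "W j" "W j"] mult_mono[of 1 "W j" 1 "W j"]
    by (simp_all add: power2_eq_square)
  have le: "\<bar>a j\<bar> * w \<le> \<bar>a j\<bar> * (W j)\<^sup>2" if "w \<le> (W j)\<^sup>2" for w j using that by (intro mult_left_mono) auto
  have s1: "summable (\<lambda>j. \<bar>a j\<bar>)"
    by (rule summable_comparison_test'[OF s]) (use le[of 1] W2 in auto)
  have sW: "summable (\<lambda>j. \<bar>a j\<bar> * W j)"
    by (rule summable_comparison_test'[OF s]) (use le[of "W j" j for j] W2 W1 in \<open>auto simp: abs_mult order_trans[OF zero_le_one]\<close>)
  have sh: "summable (\<lambda>j. \<bar>a j\<bar> * (h j x)\<^sup>2)" for x
  proof (rule summable_comparison_test'[OF s])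
    fix j :: nat
    have "\<bar>h j x\<bar> \<le> \<bar>W j\<bar>" using hb[of j x] by simp
    then have "(h j x)\<^sup>2 \<le> (W j)\<^sup>2" by (simp add: abs_le_square_iff)
    then show "norm (\<bar>a j\<bar> * (h j x)\<^sup>2) \<le> \<bar>a j\<bar> * (W j)\<^sup>2" using le by (simp add: abs_mult)
  qed
  have sn: "summable (\<lambda>j. \<bar>a j\<bar> * nsq (h j))"
    by (rule summable_comparison_test'[OF s])
      (use le[of "nsq (h j)" j for j] order_trans[OF hn W2(1)] nsq_nonneg in \<open>auto simp: abs_mult\<close>)
  show "mix a h \<in> F" by (rule mix_F(1)[OF hF hb he sW])
  show "L2 \<mu> (mix a h)" by (rule mix_L2(1)[OF hL s1 sh sn])
  show "L2 \<mu> v \<Longrightarrow> (\<lambda>j. a j * ip (h j) v) sums ip (mix a h) v" by (rule mix_L2(3)[OF hL s1 sh sn])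
  show "v \<in> F \<Longrightarrow> (\<lambda>j. a j * E (h j) v) sums E (mix a h) v" by (rule mix_F(2)[OF hF hb he sW])
  show "summable (\<lambda>j. a j * h j x)" by (rule summable_rabs_cancel[OF suminf_Cauchy_Schwarz(1)[OF s1 sh]])
  have "nsq (mix a h) \<le> (\<Sum>j. \<bar>a j\<bar>) * (\<Sum>j. \<bar>a j\<bar> * nsq (h j))" by (rule mix_L2(2)[OF hL s1 sh sn])
  also have "\<dots> \<le> (\<Sum>j. \<bar>a j\<bar> * (W j)\<^sup>2) * (\<Sum>j. \<bar>a j\<bar> * (W j)\<^sup>2)"
  proof (rule mult_mono)
    have "\<bar>a j\<bar> \<le> \<bar>a j\<bar> * (W j)\<^sup>2" for j using le[of 1 j] W2 by simp
    then show "(\<Sum>j. \<bar>a j\<bar>) \<le> (\<Sum>j. \<bar>a j\<bar> * (W j)\<^sup>2)" by (intro suminf_le s1 s)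
    have "\<bar>a j\<bar> * nsq (h j) \<le> \<bar>a j\<bar> * (W j)\<^sup>2" for j by (rule le[OF order_trans[OF hn W2(1)]])
    then show "(\<Sum>j. \<bar>a j\<bar> * nsq (h j)) \<le> (\<Sum>j. \<bar>a j\<bar> * (W j)\<^sup>2)" by (intro suminf_le sn s)
    show "0 \<le> (\<Sum>j. \<bar>a j\<bar> * (W j)\<^sup>2)" by (intro suminf_nonneg s) simp
    show "0 \<le> (\<Sum>j. \<bar>a j\<bar> * nsq (h j))" by (intro suminf_nonneg sn) (simp add: nsq_nonneg)
  qed
  finally show "nsq (mix a h) \<le> (\<Sum>j. \<bar>a j\<bar> * (W j)\<^sup>2)\<^sup>2" by (simp add: power2_eq_square)
qed

text \<open>A superposition is linear in its coefficients, so the error of the difference quotient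
  is again one, with coefficients of size at most \<open>\<bar>s - t\<bar> * M j\<close>.\<close>

lemma tame_mix_derivative:
  assumes h: "\<And>j. tame (W j) (h j)"
    and \<phi>: "\<And>s. 0 < s \<Longrightarrow> summable (\<lambda>j. \<bar>\<phi> s j\<bar> * (W j)\<^sup>2)" and \<phi>': "summable (\<lambda>j. \<bar>\<phi>' j\<bar> * (W j)\<^sup>2)"
    and M: "summable (\<lambda>j. M j * (W j)\<^sup>2)" and t: "0 < t" and d: "0 < d"
    and rem: "\<And>s j. 0 < s \<Longrightarrow> \<bar>s - t\<bar> < d \<Longrightarrow> \<bar>\<phi> s j - \<phi> t j - (s - t) * \<phi>' j\<bar> \<le> (s - t)\<^sup>2 * M j"
  shows "((\<lambda>s. nsq (\<lambda>x. (mix (\<phi> s) h x - mix (\<phi> t) h x) / (s - t) - mix \<phi>' h x)) \<longlongrightarrow> 0) (at t within {0<..})"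
proof -
  define S where "S = (\<Sum>j. M j * (W j)\<^sup>2)"
  have bound: "nsq (\<lambda>x. (mix (\<phi> s) h x - mix (\<phi> t) h x) / (s - t) - mix \<phi>' h x) \<le> ((s - t) * S)\<^sup>2"
    if s: "0 < s" "s \<noteq> t" "\<bar>s - t\<bar> < d" for s
  proof -
    define \<epsilon> where "\<epsilon> j = (\<phi> s j - \<phi> t j) / (s - t) - \<phi>' j" for j
    have \<epsilon>: "\<bar>\<epsilon> j\<bar> \<le> \<bar>s - t\<bar> * M j" for j
    proof -
      have "\<epsilon> j = (\<phi> s j - \<phi> t j - (s - t) * \<phi>' j) / (s - t)" using s by (simp add: \<epsilon>_def field_simps)
      then have "\<bar>\<epsilon> j\<bar> = \<bar>\<phi> s j - \<phi> t j - (s - t) * \<phi>' j\<bar> / \<bar>s - t\<bar>" by (simp add: abs_divide)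
      also have "\<dots> \<le> (s - t)\<^sup>2 * M j / \<bar>s - t\<bar>" by (intro divide_right_mono rem s) simp
      also have "(s - t)\<^sup>2 * M j / \<bar>s - t\<bar> = \<bar>s - t\<bar> * M j"
      proof -
        have "r\<^sup>2 * m / r = r * m" if "r > 0" for r m :: real using that by (simp add: power2_eq_square)
        from this[of "\<bar>s - t\<bar>" "M j"] show ?thesis using s by simp
      qed
      finally show ?thesis .
    qed
    have le: "\<bar>\<epsilon> j\<bar> * (W j)\<^sup>2 \<le> \<bar>s - t\<bar> * (M j * (W j)\<^sup>2)" for j
      using mult_right_mono[OF \<epsilon>[of j], of "(W j)\<^sup>2"] by (simp add: mult.assoc)
    have sM: "summable (\<lambda>j. \<bar>s - t\<bar> * (M j * (W j)\<^sup>2))" by (rule summable_mult[OF M])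
    have s\<epsilon>: "summable (\<lambda>j. \<bar>\<epsilon> j\<bar> * (W j)\<^sup>2)"
      by (rule summable_comparison_test'[OF sM]) (use le in \<open>simp add: abs_mult\<close>)
    have eq: "(\<lambda>x. (mix (\<phi> s) h x - mix (\<phi> t) h x) / (s - t) - mix \<phi>' h x) = mix \<epsilon> h"
    proof
      fix x
      note ss = tame_mix(6)[OF h \<phi>[OF s(1)], of x] tame_mix(6)[OF h \<phi>[OF t], of x] tame_mix(6)[OF h \<phi>', of x]
      have "(\<lambda>j. (\<phi> s j * h j x - \<phi> t j * h j x) / (s - t) - \<phi>' j * h j x)
          sums ((mix (\<phi> s) h x - mix (\<phi> t) h x) / (s - t) - mix \<phi>' h x)"
        unfolding mix_def by (intro sums_diff sums_divide summable_sums ss)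
      moreover have "(\<phi> s j * h j x - \<phi> t j * h j x) / (s - t) - \<phi>' j * h j x = \<epsilon> j * h j x" for j
        by (simp add: \<epsilon>_def left_diff_distrib)
      ultimately show "(mix (\<phi> s) h x - mix (\<phi> t) h x) / (s - t) - mix \<phi>' h x = mix \<epsilon> h x"
        unfolding mix_def by (simp add: sums_iff)
    qed
    have "nsq (mix \<epsilon> h) \<le> (\<Sum>j. \<bar>\<epsilon> j\<bar> * (W j)\<^sup>2)\<^sup>2" by (rule tame_mix(3)[OF h s\<epsilon>])
    also have "\<dots> \<le> (\<bar>s - t\<bar> * S)\<^sup>2"
    proof (rule power_mono)
      have "(\<Sum>j. \<bar>\<epsilon> j\<bar> * (W j)\<^sup>2) \<le> (\<Sum>j. \<bar>s - t\<bar> * (M j * (W j)\<^sup>2))" by (rule suminf_le[OF le s\<epsilon> sM])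
      then show "(\<Sum>j. \<bar>\<epsilon> j\<bar> * (W j)\<^sup>2) \<le> \<bar>s - t\<bar> * S" unfolding S_def using suminf_mult[OF M] by simp
      show "0 \<le> (\<Sum>j. \<bar>\<epsilon> j\<bar> * (W j)\<^sup>2)" by (intro suminf_nonneg s\<epsilon>) simp
    qed
    finally show ?thesis unfolding eq by (simp add: power_mult_distrib)
  qed
  have "((\<lambda>s. ((s - t) * S)\<^sup>2) \<longlongrightarrow> ((t - t) * S)\<^sup>2) (at t within {0<..})" by (intro tendsto_intros)
  then have z: "((\<lambda>s. ((s - t) * S)\<^sup>2) \<longlongrightarrow> 0) (at t within {0<..})" by simp
  have "\<forall>\<^sub>F s in at t within {0<..}. norm (nsq (\<lambda>x. (mix (\<phi> s) h x - mix (\<phi> t) h x) / (s - t) - mix \<phi>' h x)) \<le> ((s - t) * S)\<^sup>2"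
    unfolding eventually_at using d bound nsq_nonneg by (intro exI[of _ d]) (auto simp: dist_real_def)
  then show ?thesis by (rule Lim_null_comparison[OF _ z])
qed

text \<open>In \<open>Wd\<close> the factor \<open>8 ^ n\<close> comes from the eigenvalue of the
  Haar component, in \<open>Wl\<close> the factor \<open>10 ^ n\<close> from
  \<open>unit_lap_summable\<close>; 100 absorbs the remaining constants.\<close>

definition Wd :: "('a \<Rightarrow> real) \<Rightarrow> nat \<Rightarrow> real" where "Wd f n = 100 * (8 ^ n * (1 + nsq f))"
definition Wl :: "('a \<Rightarrow> real) \<Rightarrow> nat \<Rightarrow> real" where "Wl f n = 100 * (10 ^ n * (1 + nsq f))"

lemma sqrt_le_of_le: "1 \<le> (W::real) \<Longrightarrow> e \<le> W \<Longrightarrow> sqrt e \<le> W"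
proof -
  assume W: "1 \<le> W" "e \<le> W"
  then have "W * 1 \<le> W * W" by (intro mult_left_mono) auto
  then have "e \<le> W\<^sup>2" using W by (simp only: power2_eq_square)
  then show ?thesis using W by (intro real_le_lsqrt) auto
qed

lemma tame_haar_part:
  assumes f: "L2 \<mu> f" shows "tame (Wd f n) (haar_part n f)"
proof -
  have N: "0 \<le> nsq f" by (rule nsq_nonneg)
  have p: "(1::real) \<le> 8 ^ n" "(2::real) ^ n \<le> 8 ^ n" by (auto intro: power_mono)
  have 1: "1 * (1 + nsq f) \<le> 8 ^ n * (1 + nsq f)" using N p by (intro mult_right_mono) auto
  have "1 \<le> 8 ^ n * (1 + nsq f)" by (rule order_trans[OF _ 1]) (use N in simp)
  then have W1: "1 \<le> Wd f n" unfolding Wd_def by simp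
  have b: "\<bar>haar_part n f x\<bar> \<le> Wd f n" for x
  proof -
    have "2 ^ n * (1 + nsq f) \<le> 8 ^ n * (1 + nsq f)" using N p by (intro mult_right_mono) auto
    moreover have "\<bar>haar_part n f x\<bar> \<le> 3 * (2 ^ n * (1 + nsq f))" using haar_part_bound[OF f, of n x] by (simp only: mult.assoc)
    ultimately have "\<bar>haar_part n f x\<bar> \<le> 3 * (8 ^ n * (1 + nsq f))" by (meson mult_left_mono order_trans zero_le_numeral)
    then show ?thesis using \<open>1 \<le> 8 ^ n * (1 + nsq f)\<close> unfolding Wd_def by linarith
  qed
  have "nsq (haar_part n f) \<le> 100 * K" if "1 * (1 + nsq f) \<le> K" for K using haar_part_nsq_le[OF f, of n] N that by simp
  from this[OF 1] have n: "nsq (haar_part n f) \<le> Wd f n" unfolding Wd_def .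
  have "E (haar_part n f) (haar_part n f) = 8 ^ Suc n * nsq (haar_part n f)"
    using haar_part_F(2)[OF f haar_part_F(1)[OF f] haar_part_L2[OF f]] by (simp add: ip_self)
  also have "\<dots> \<le> 8 ^ Suc n * (4 * nsq f)" by (intro mult_left_mono haar_part_nsq_le f) simp
  also have "\<dots> \<le> Wd f n" unfolding Wd_def using N by (simp add: algebra_simps)
  finally have "sqrt (E (haar_part n f) (haar_part n f)) \<le> Wd f n" by (rule sqrt_le_of_le[OF W1])
  then show ?thesis using W1 b n haar_part_F(1)[OF f] haar_part_L2[OF f] by (simp add: tame_def)
qed

lemma tame_unit_lap_pow:
  assumes f: "L2 \<mu> f" shows "tame (Wl f n) (lev 0 (unit_lap_pow n f))"
proof -
  have N: "0 \<le> nsq f" by (rule nsq_nonneg)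
  have p: "(1::real) \<le> 10 ^ n" "(2::real) ^ n \<le> 10 ^ n" by (auto intro: power_mono)
  have 1: "1 * (1 + nsq f) \<le> 10 ^ n * (1 + nsq f)" using N p by (intro mult_right_mono) auto
  have "1 \<le> 10 ^ n * (1 + nsq f)" by (rule order_trans[OF _ 1]) (use N in simp)
  then have W1: "1 \<le> Wl f n" unfolding Wl_def by simp
  have 2: "2 ^ n * (1 + nsq f) \<le> 10 ^ n * (1 + nsq f)" using N p by (intro mult_right_mono) auto
  have b: "\<bar>lev 0 (unit_lap_pow n f) x\<bar> \<le> Wl f n" for x
  proof (cases "x \<in> X")
    case True
    have "\<bar>unit_lap_pow n f (c 0 x)\<bar> \<le> 10 ^ n * (1 + nsq f)" by (rule order_trans[OF unit_lap_pow_bound[OF f] 2])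
    then show ?thesis using True \<open>1 \<le> 10 ^ n * (1 + nsq f)\<close> unfolding Wl_def lev_in[OF True] by linarith
  qed (use W1 in \<open>simp add: lev_out\<close>)
  have s: "summable (\<lambda>k. (unit_lap_pow n f k)\<^sup>2)" for n by (rule unit_lap_pow_summable[OF f])
  have ns: "nsq (lev 0 (unit_lap_pow n f)) \<le> 10 ^ n * nsq f" for n
    using lev_L2(2)[OF s, of 0 n] unit_lap_pow_summable(2)[OF f, of n] by simp
  have L: "L2 \<mu> (lev 0 (unit_lap_pow n f))" for n by (rule lev_L2(1)[OF s])
  have n: "nsq (lev 0 (unit_lap_pow n f)) \<le> Wl f n"
  proof -
    have "0 \<le> 10 ^ n * nsq f" using N by simp
    moreover have "100 * (10 ^ n * (1 + nsq f)) = 100 * 10 ^ n + 100 * (10 ^ n * nsq f)" by (simp add: distrib_left)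
    ultimately show ?thesis using ns[of n] p(1) unfolding Wl_def by linarith
  qed
  have "E (lev 0 (unit_lap_pow n f)) (lev 0 (unit_lap_pow n f)) = ip (lev 0 (unit_lap_pow (Suc n) f)) (lev 0 (unit_lap_pow n f))"
    using unit_F(2)[OF s[of n] unit_F(1)[OF s[of n]] L[of n]] by (simp add: unit_lap_pow_Suc)
  also have "\<dots> \<le> (nsq (lev 0 (unit_lap_pow (Suc n) f)) + nsq (lev 0 (unit_lap_pow n f))) / 2"
    using ip_le[OF L L, of "Suc n" n] by simp
  also have "\<dots> \<le> Wl f n"
  proof -
    have half: "(b + a) / 2 \<le> 100 * P + 100 * Q" if "0 \<le> Q" "a \<le> Q" "b \<le> 10 * Q" "1 \<le> P" for a b P Q :: real
      using that by simp
    have eq: "100 * (10 ^ n * (1 + nsq f)) = 100 * 10 ^ n + 100 * (10 ^ n * nsq f)" by (simp add: distrib_left)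
    show ?thesis
      unfolding Wl_def eq
    proof (rule half)
      show "0 \<le> 10 ^ n * nsq f" using N by simp
      show "nsq (lev 0 (unit_lap_pow (Suc n) f)) \<le> 10 * (10 ^ n * nsq f)" using ns[of "Suc n"] by simp
    qed (use ns p in auto)
  qed
  finally have "sqrt (E (lev 0 (unit_lap_pow n f)) (lev 0 (unit_lap_pow n f))) \<le> Wl f n" by (rule sqrt_le_of_le[OF W1])
  then show ?thesis using W1 b n unit_F(1)[OF s] L by (simp add: tame_def)
qed

text \<open>\<open>pc\<close> holds the exponentials of the eigenvalues on the Haar components,
  \<open>qc\<close> the coefficients of the exponential series in the bounded operator
  \<open>unit_lap\<close>; \<open>pd\<close> and \<open>qd\<close> are their derivatives in
  time.\<close>

definition pc :: "real \<Rightarrow> nat \<Rightarrow> real" where "pc t n = exp (- (8 ^ Suc n * t))"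
definition qc :: "real \<Rightarrow> nat \<Rightarrow> real" where "qc t n = (- t) ^ n / fact n"
definition pd :: "real \<Rightarrow> nat \<Rightarrow> real" where "pd t n = - (8 ^ Suc n) * pc t n"
definition qd :: "real \<Rightarrow> nat \<Rightarrow> real" where "qd t n = (case n of 0 \<Rightarrow> 0 | Suc m \<Rightarrow> - qc t m)"

lemma Wd_sq: "(Wd f n)\<^sup>2 = 10000 * (1 + nsq f)\<^sup>2 * 64 ^ n"
proof -
  have "(8 ^ n * 8 ^ n :: real) = 64 ^ n" by (simp add: power_mult_distrib[symmetric])
  then show ?thesis by (simp add: Wd_def power2_eq_square)
qed

lemma Wl_sq: "(Wl f n)\<^sup>2 = 10000 * (1 + nsq f)\<^sup>2 * 100 ^ n"
proof -
  have "(10 ^ n * 10 ^ n :: real) = 100 ^ n" by (simp add: power_mult_distrib[symmetric])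
  then show ?thesis by (simp add: Wl_def power2_eq_square)
qed

lemma pc_summable: "0 < t \<Longrightarrow> summable (\<lambda>n. \<bar>pc t n\<bar> * (Wd f n)\<^sup>2)"
  using summable_mult[OF summable_double_exponential[of t 64], of "10000 * (1 + nsq f)\<^sup>2"]
  by (simp add: pc_def Wd_sq mult_ac)

lemma pd_summable: "0 < t \<Longrightarrow> summable (\<lambda>n. \<bar>pd t n\<bar> * (Wd f n)\<^sup>2)"
proof -
  assume t: "0 < t"
  have "(8::real) ^ n * 64 ^ n = 512 ^ n" for n by (simp add: power_mult_distrib[symmetric])
  then have "\<bar>pd t n\<bar> * (Wd f n)\<^sup>2 = 80000 * (1 + nsq f)\<^sup>2 * (512 ^ n * exp (- (8 ^ Suc n * t)))" for n
    by (simp add: pd_def pc_def Wd_sq abs_mult mult_ac)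
  then show ?thesis using summable_mult[OF summable_double_exponential[of t 512]] t by simp
qed

lemma abs_qc: "\<bar>qc t n\<bar> = \<bar>t\<bar> ^ n / fact n" by (simp add: qc_def power_abs)

lemma qc_summable: "summable (\<lambda>n. \<bar>qc t n\<bar> * (Wl f n)\<^sup>2)"
proof -
  have "\<bar>qc t n\<bar> * (Wl f n)\<^sup>2 = 10000 * (1 + nsq f)\<^sup>2 * ((100 * \<bar>t\<bar>) ^ n / fact n)" for n
    by (simp add: abs_qc Wl_sq power_mult_distrib)
  then show ?thesis by (simp only:) (intro summable_mult summable_power_fact)
qed

lemma qd_summable: "summable (\<lambda>n. \<bar>qd t n\<bar> * (Wl f n)\<^sup>2)"
proof -
  have "\<bar>qd t (Suc n)\<bar> * (Wl f (Suc n))\<^sup>2 = 100 * (\<bar>qc t n\<bar> * (Wl f n)\<^sup>2)" for n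
    by (simp add: qd_def Wl_sq)
  then have "summable (\<lambda>n. \<bar>qd t (Suc n)\<bar> * (Wl f (Suc n))\<^sup>2)"
    by (simp only:) (intro summable_mult qc_summable)
  then show ?thesis by (subst (asm) summable_Suc_iff)
qed

definition haar_flow :: "('a \<Rightarrow> real) \<Rightarrow> real \<Rightarrow> 'a \<Rightarrow> real" where "haar_flow f t = mix (pc t) (\<lambda>n. haar_part n f)"
definition unit_flow :: "('a \<Rightarrow> real) \<Rightarrow> real \<Rightarrow> 'a \<Rightarrow> real" where "unit_flow f t = mix (qc t) (\<lambda>n. lev 0 (unit_lap_pow n f))"
definition heat_flow :: "('a \<Rightarrow> real) \<Rightarrow> real \<Rightarrow> 'a \<Rightarrow> real" where "heat_flow f t x = haar_flow f t x + unit_flow f t x"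
definition heat_flow_deriv :: "('a \<Rightarrow> real) \<Rightarrow> real \<Rightarrow> 'a \<Rightarrow> real" where
  "heat_flow_deriv f t x = mix (pd t) (\<lambda>n. haar_part n f) x + mix (qd t) (\<lambda>n. lev 0 (unit_lap_pow n f)) x"

lemma haar_flow_FL: assumes "L2 \<mu> f" "0 < t" shows "haar_flow f t \<in> F" "L2 \<mu> (haar_flow f t)"
  unfolding haar_flow_def using tame_mix(1,2)[OF tame_haar_part[OF assms(1)] pc_summable[OF assms(2)]] by auto

lemma unit_flow_FL: assumes "L2 \<mu> f" shows "unit_flow f t \<in> F" "L2 \<mu> (unit_flow f t)"
  unfolding unit_flow_def using tame_mix(1,2)[OF tame_unit_lap_pow[OF assms(1)] qc_summable] by auto

lemma heat_flow_FL: assumes "L2 \<mu> f" "0 < t" shows "heat_flow f t \<in> F" "L2 \<mu> (heat_flow f t)"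
  unfolding heat_flow_def[abs_def] by (intro F_add L2_add haar_flow_FL unit_flow_FL assms)+

lemma heat_flow_deriv_L2:
  assumes "L2 \<mu> f" "0 < t"
  shows "L2 \<mu> (mix (pd t) (\<lambda>n. haar_part n f))" "L2 \<mu> (mix (qd t) (\<lambda>n. lev 0 (unit_lap_pow n f)))" "L2 \<mu> (heat_flow_deriv f t)"
proof -
  show 1: "L2 \<mu> (mix (pd t) (\<lambda>n. haar_part n f))" by (rule tame_mix(2)[OF tame_haar_part[OF assms(1)] pd_summable[OF assms(2)]])
  show 2: "L2 \<mu> (mix (qd t) (\<lambda>n. lev 0 (unit_lap_pow n f)))" by (rule tame_mix(2)[OF tame_unit_lap_pow[OF assms(1)] qd_summable])
  show "L2 \<mu> (heat_flow_deriv f t)" unfolding heat_flow_deriv_def[abs_def] by (rule L2_add[OF 1 2])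
qed

lemma weak_equation:
  assumes f: "L2 \<mu> f" and t: "0 < t" and v: "v \<in> F" "L2 \<mu> v"
  shows "ip (heat_flow_deriv f t) v + E (heat_flow f t) v = 0"
proof -
  let ?d = "\<lambda>n. haar_part n f" and ?l = "\<lambda>n. lev 0 (unit_lap_pow n f)"
  have "(\<lambda>n. pd t n * ip (?d n) v) sums ip (mix (pd t) ?d) v"
    by (rule tame_mix(4)[OF tame_haar_part[OF f] pd_summable[OF t] v(2)])
  moreover have "(\<lambda>n. pc t n * E (?d n) v) sums E (haar_flow f t) v"
    unfolding haar_flow_def by (rule tame_mix(5)[OF tame_haar_part[OF f] pc_summable[OF t] v(1)])
  ultimately have "(\<lambda>n. pd t n * ip (?d n) v + pc t n * E (?d n) v) sums (ip (mix (pd t) ?d) v + E (haar_flow f t) v)"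
    by (rule sums_add)
  moreover have "pd t n * ip (?d n) v + pc t n * E (?d n) v = 0" for n
    using haar_part_F(2)[OF f v, of n] by (simp add: pd_def)
  ultimately have 1: "ip (mix (pd t) ?d) v + E (haar_flow f t) v = 0" by (simp add: sums_iff)
  have "(\<lambda>n. qd t n * ip (?l n) v) sums ip (mix (qd t) ?l) v"
    by (rule tame_mix(4)[OF tame_unit_lap_pow[OF f] qd_summable v(2)])
  \<comment> \<open>As \<open>qd t 0 = 0\<close> the series may start at 1; the derivative of term
    \<open>n + 1\<close> then meets the energy of term \<open>n\<close>.\<close>
  then have "(\<lambda>n. qd t (Suc n) * ip (?l (Suc n)) v) sums ip (mix (qd t) ?l) v"
    using sums_Suc_iff[of "\<lambda>n. qd t n * ip (?l n) v"] by (simp add: qd_def)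
  moreover have "(\<lambda>n. qc t n * E (?l n) v) sums E (unit_flow f t) v"
    unfolding unit_flow_def by (rule tame_mix(5)[OF tame_unit_lap_pow[OF f] qc_summable v(1)])
  ultimately have "(\<lambda>n. qd t (Suc n) * ip (?l (Suc n)) v + qc t n * E (?l n) v) sums (ip (mix (qd t) ?l) v + E (unit_flow f t) v)"
    by (rule sums_add)
  moreover have "qd t (Suc n) * ip (?l (Suc n)) v + qc t n * E (?l n) v = 0" for n
    using unit_F(2)[OF unit_lap_pow_summable(1)[OF f] v, of n] by (simp add: qd_def unit_lap_pow_Suc)
  ultimately have 2: "ip (mix (qd t) ?l) v + E (unit_flow f t) v = 0" by (simp add: sums_iff)
  have "ip (heat_flow_deriv f t) v = ip (mix (pd t) ?d) v + ip (mix (qd t) ?l) v"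
    unfolding heat_flow_deriv_def[abs_def] by (rule ip_add[OF heat_flow_deriv_L2(1,2)[OF f t] v(2)])
  moreover have "E (heat_flow f t) v = E (haar_flow f t) v + E (unit_flow f t) v"
    unfolding heat_flow_def[abs_def] by (intro E_add F_fin_energy haar_flow_FL unit_flow_FL f t v)
  ultimately show ?thesis using 1 2 by simp
qed

lemma heat_flow_derivative:
  assumes f: "L2 \<mu> f" and t: "0 < t"
  shows "((\<lambda>s. nsq (\<lambda>x. (heat_flow f s x - heat_flow f t x) / (s - t) - heat_flow_deriv f t x)) \<longlongrightarrow> 0) (at t within {0<..})"
proof -
  let ?d = "\<lambda>n. haar_part n f" and ?l = "\<lambda>n. lev 0 (unit_lap_pow n f)"
  let ?a = "\<lambda>s x. (mix (pc s) ?d x - mix (pc t) ?d x) / (s - t) - mix (pd t) ?d x"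
  let ?b = "\<lambda>s x. (mix (qc s) ?l x - mix (qc t) ?l x) / (s - t) - mix (qd t) ?l x"
  have A1: "((\<lambda>s. nsq (?a s)) \<longlongrightarrow> 0) (at t within {0<..})"
  \<comment> \<open>Staying within \<open>t / 2\<close> of \<open>t\<close> keeps the time above
    \<open>t / 2\<close>, which bounds the second derivatives by a summable sequence.\<close>
  proof (rule tame_mix_derivative[OF tame_haar_part[OF f], where d = "t / 2" and M = "\<lambda>n. (8 ^ Suc n)\<^sup>2 * exp (- (8 ^ Suc n * (t / 2)))"])
    have "(8 ^ n)\<^sup>2 * 64 ^ n = (4096::real) ^ n" for n by (simp add: power_mult_distrib[symmetric] power2_eq_square)
    then have "(8 ^ Suc n)\<^sup>2 * exp (- (8 ^ Suc n * (t / 2))) * (Wd f n)\<^sup>2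
        = 640000 * (1 + nsq f)\<^sup>2 * (4096 ^ n * exp (- (8 ^ Suc n * (t / 2))))" for n
      by (simp add: Wd_sq power_mult_distrib mult_ac)
    then show "summable (\<lambda>n. (8 ^ Suc n)\<^sup>2 * exp (- (8 ^ Suc n * (t / 2))) * (Wd f n)\<^sup>2)"
      using t by (simp only:) (intro summable_mult summable_double_exponential, simp_all)
    fix s and n :: nat assume s: "0 < s" "\<bar>s - t\<bar> < t / 2"
    let ?L = "8 ^ Suc n :: real"
    have "\<bar>exp (- (?L * s)) - exp (- (?L * t)) - (s - t) * (- ?L * exp (- (?L * t)))\<bar> \<le> (s - t)\<^sup>2 * (?L\<^sup>2 * exp (- (?L * (t / 2))))"
    proof (rule linear_remainder[where \<phi> = "\<lambda>x. exp (- (?L * x))" and \<phi>' = "\<lambda>x. - ?L * exp (- (?L * x))" and \<phi>'' = "\<lambda>x. ?L\<^sup>2 * exp (- (?L * x))"])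
      fix x assume x: "min s t \<le> x"
      show "((\<lambda>x. exp (- (?L * x))) has_real_derivative - ?L * exp (- (?L * x))) (at x)"
        by (auto intro!: derivative_eq_intros)
      show "((\<lambda>x. - ?L * exp (- (?L * x))) has_real_derivative ?L\<^sup>2 * exp (- (?L * x))) (at x)"
        by (auto intro!: derivative_eq_intros simp: power2_eq_square)
      have "t / 2 \<le> x" using x s t by (auto simp: min_def split: if_splits)
      then have "exp (- (?L * x)) \<le> exp (- (?L * (t / 2)))" by simp
      then show "\<bar>?L\<^sup>2 * exp (- (?L * x))\<bar> \<le> ?L\<^sup>2 * exp (- (?L * (t / 2)))" by (simp add: abs_mult)
    qed
    then show "\<bar>pc s n - pc t n - (s - t) * pd t n\<bar> \<le> (s - t)\<^sup>2 * (?L\<^sup>2 * exp (- (?L * (t / 2))))"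
      by (simp only: pc_def pd_def)
  qed (use t pc_summable pd_summable in auto)
  have B1: "((\<lambda>s. nsq (?b s)) \<longlongrightarrow> 0) (at t within {0<..})"
  \<comment> \<open>For \<open>n < 2\<close> truncated subtraction makes the bound 1, while the
    second derivative is 0.\<close>
  proof (rule tame_mix_derivative[OF tame_unit_lap_pow[OF f], where d = 1 and M = "\<lambda>n. (t + 1) ^ (n - 2) / fact (n - 2)"])
    have "(t + 1) ^ (n + 2 - 2) / fact (n + 2 - 2) * (Wl f (n + 2))\<^sup>2 = 10 ^ 8 * (1 + nsq f)\<^sup>2 * ((100 * (t + 1)) ^ n / fact n)" for n
      unfolding power_mult_distrib[of 100 "t + 1"] by (simp add: Wl_sq power_add)
    then have "summable (\<lambda>n. (t + 1) ^ (n + 2 - 2) / fact (n + 2 - 2) * (Wl f (n + 2))\<^sup>2)"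
      by (simp only:) (intro summable_mult summable_power_fact)
    then show "summable (\<lambda>n. (t + 1) ^ (n - 2) / fact (n - 2) * (Wl f n)\<^sup>2)"
      by (subst (asm) summable_iff_shift)
    fix s and n :: nat assume s: "0 < s" "\<bar>s - t\<bar> < 1"
    define qdd where "qdd x = (if n < 2 then 0 else qc x (n - 2))" for x :: real
    have dq: "((\<lambda>x. qc x m) has_real_derivative qd x m) (at x)" for x m
    proof (cases m)
      case (Suc k)
      have "((\<lambda>x. (- x) ^ Suc k / fact (Suc k)) has_real_derivative - ((- x) ^ k / fact k)) (at x)"
        by (rule derivative_eq_intros refl | simp)+
      then show ?thesis using Suc by (simp add: qc_def[abs_def] qd_def)
    qed (simp add: qc_def[abs_def] qd_def)
    show "\<bar>qc s n - qc t n - (s - t) * qd t n\<bar> \<le> (s - t)\<^sup>2 * ((t + 1) ^ (n - 2) / fact (n - 2))"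
    proof (rule linear_remainder[where \<phi> = "\<lambda>x. qc x n" and \<phi>' = "\<lambda>x. qd x n" and \<phi>'' = qdd])
      fix x assume x: "min s t \<le> x" "x \<le> max s t"
      show "((\<lambda>x. qc x n) has_real_derivative qd x n) (at x)" by (rule dq)
      show "((\<lambda>x. qd x n) has_real_derivative qdd x) (at x)"
      proof (cases n)
        case (Suc m)
        have "((\<lambda>x. - qc x m) has_real_derivative - qd x m) (at x)" by (intro DERIV_minus dq)
        moreover have "- qd x m = qdd x" unfolding qd_def qdd_def Suc by (cases m) auto
        ultimately show ?thesis by (simp add: qd_def Suc)
      qed (simp add: qd_def qdd_def)
      have "\<bar>x\<bar> \<le> t + 1" using x s t by (auto simp: min_def max_def split: if_splits)
      then have "\<bar>x\<bar> ^ (n - 2) / fact (n - 2) \<le> (t + 1) ^ (n - 2) / fact (n - 2)"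
        by (intro divide_right_mono power_mono) auto
      moreover have "0 \<le> (t + 1) ^ (n - 2) / fact (n - 2)" using t by simp
      ultimately show "\<bar>qdd x\<bar> \<le> (t + 1) ^ (n - 2) / fact (n - 2)" by (simp add: qdd_def abs_qc)
    qed
  qed (use t qc_summable qd_summable in auto)
  have LA: "L2 \<mu> (?a s)" and LB: "L2 \<mu> (?b s)" if "0 < s" for s
    using L2_scale[OF L2_diff[OF haar_flow_FL(2)[OF f that] haar_flow_FL(2)[OF f t]], of "1 / (s - t)"]
      L2_scale[OF L2_diff[OF unit_flow_FL(2)[OF f, of s] unit_flow_FL(2)[OF f, of t]], of "1 / (s - t)"]
      heat_flow_deriv_L2(1,2)[OF f t] by (auto intro!: L2_diff simp: haar_flow_def unit_flow_def)
  have eq: "(heat_flow f s x - heat_flow f t x) / (s - t) - heat_flow_deriv f t x = ?a s x + ?b s x" for s x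
    by (simp add: heat_flow_def haar_flow_def unit_flow_def heat_flow_deriv_def diff_divide_distrib add_divide_distrib)
  have "((\<lambda>s. 2 * nsq (?a s) + 2 * nsq (?b s)) \<longlongrightarrow> 2 * 0 + 2 * 0) (at t within {0<..})"
    by (intro tendsto_intros A1 B1)
  then have z: "((\<lambda>s. 2 * nsq (?a s) + 2 * nsq (?b s)) \<longlongrightarrow> 0) (at t within {0<..})" by simp
  have "\<forall>\<^sub>F s in at t within {0<..}. norm (nsq (\<lambda>x. ?a s x + ?b s x)) \<le> 2 * nsq (?a s) + 2 * nsq (?b s)"
    unfolding eventually_at using nsq_add_le[OF LA LB] nsq_nonneg by (intro exI[of _ 1]) auto
  then show ?thesis unfolding eq by (rule Lim_null_comparison[OF _ z])
qed

end

section \<open>The heat kernel\<close>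

lemma series_close:
  fixes a b B :: "nat \<Rightarrow> real"
  assumes B: "summable B" and a: "\<And>n. \<bar>a n\<bar> \<le> B n" and b: "\<And>n. \<bar>b n\<bar> \<le> B n"
    and tail: "(\<Sum>n. B (n + N)) < e" and fin: "\<bar>(\<Sum>n<N. a n) - (\<Sum>n<N. b n)\<bar> < e"
  shows "\<bar>(\<Sum>n. a n) - (\<Sum>n. b n)\<bar> < 3 * e"
proof -
  have far_part: "\<bar>\<Sum>n. a (n + N)\<bar> \<le> (\<Sum>n. B (n + N)) \<and> (\<Sum>n. a n) = (\<Sum>n. a (n + N)) + (\<Sum>n<N. a n)"
    if a: "\<And>n. \<bar>a n\<bar> \<le> B n" for a :: "nat \<Rightarrow> real"
  proof
    have sa: "summable (\<lambda>n. \<bar>a n\<bar>)" by (rule summable_comparison_test'[OF B]) (use a in simp)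
    have "\<bar>\<Sum>n. a (n + N)\<bar> \<le> (\<Sum>n. \<bar>a (n + N)\<bar>)"
      by (rule summable_rabs) (use sa summable_iff_shift[of "\<lambda>n. \<bar>a n\<bar>" N] in simp)
    also have "\<dots> \<le> (\<Sum>n. B (n + N))"
      by (rule suminf_le) (use a sa B summable_iff_shift[of "\<lambda>n. \<bar>a n\<bar>" N] summable_iff_shift[of B N] in auto)
    finally show "\<bar>\<Sum>n. a (n + N)\<bar> \<le> (\<Sum>n. B (n + N))" .
    show "(\<Sum>n. a n) = (\<Sum>n. a (n + N)) + (\<Sum>n<N. a n)"
      by (rule suminf_split_initial_segment[OF summable_rabs_cancel[OF sa]])
  qed
  show ?thesis using far_part[OF a] far_part[OF b] tail fin by linarith
qed

lemma small_tail:
  fixes B :: "nat \<Rightarrow> real"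
  assumes "summable B" "0 < e" shows "\<exists>N. (\<Sum>n. B (n + N)) < e"
proof -
  obtain N where "\<And>n. n \<ge> N \<Longrightarrow> norm (\<Sum>i. B (i + n)) < e" using suminf_exist_split[OF assms(2,1)] by blast
  from this[of N] show ?thesis by (intro exI[of _ N]) simp
qed

lemma le_if_diff_square: "b - a = (s::real)\<^sup>2 \<Longrightarrow> a \<le> b" using zero_le_power2[of s] by linarith

context dyadic
begin

text \<open>Weights for an Abel summation: the exponentials preceded by 1 decrease to 0, so at
  positive times their differences \<open>kcoef\<close> are a probability distribution on the
  levels.\<close>

definition ecoef :: "real \<Rightarrow> nat \<Rightarrow> real" where "ecoef t m = (case m of 0 \<Rightarrow> 1 | Suc k \<Rightarrow> pc t k)"
definition kcoef :: "real \<Rightarrow> nat \<Rightarrow> real" where "kcoef t m = ecoef t m - ecoef t (Suc m)"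

lemma pc_pos: "0 < pc t n" by (simp add: pc_def)

lemma kcoef_nonneg: "0 \<le> t \<Longrightarrow> 0 \<le> kcoef t m"
  by (cases m) (simp_all add: kcoef_def ecoef_def pc_def mult_right_mono)

lemma kcoef_le: "kcoef t (Suc m) \<le> pc t m"
  using pc_pos[of t "Suc m"] by (simp add: kcoef_def ecoef_def)

lemma kcoef_sum: "(\<Sum>m<M. kcoef t m) = 1 - ecoef t M"
  by (induction M) (simp_all add: kcoef_def ecoef_def)

lemma pc_power_summable: "0 < t \<Longrightarrow> 0 \<le> q \<Longrightarrow> summable (\<lambda>m. pc t m * q ^ m)"
  using summable_double_exponential[of t q] by (simp add: pc_def mult.commute)

lemma ecoef_tendsto: "0 < t \<Longrightarrow> (\<lambda>M. ecoef t M) \<longlonglongrightarrow> 0"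
proof -
  assume t: "0 < t"
  have "pc t \<longlonglongrightarrow> 0" using summable_LIMSEQ_zero[OF pc_power_summable[OF t, of 1]] by simp
  then have "(\<lambda>M. ecoef t (Suc M)) \<longlonglongrightarrow> 0" by (simp add: ecoef_def)
  then show ?thesis by (rule LIMSEQ_imp_Suc)
qed

lemma kcoef_sums: "0 < t \<Longrightarrow> kcoef t sums 1"
  unfolding sums_def kcoef_sum using tendsto_diff[OF tendsto_const ecoef_tendsto, of t 1] by simp

lemma Hm_square_le:
  assumes f: "L2 \<mu> f" shows "(cell_mean m f x - f x)\<^sup>2 \<le> 2 * (1 + nsq f)\<^sup>2 * 4 ^ m + 2 * (f x)\<^sup>2"
proof -
  have "\<bar>cell_mean m f x\<bar> \<le> \<bar>2 ^ m * (1 + nsq f)\<bar>" using cell_mean_bound[OF f, of m x] by simp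
  then have "(cell_mean m f x)\<^sup>2 \<le> (2 ^ m * (1 + nsq f))\<^sup>2" by (simp add: abs_le_square_iff)
  also have "\<dots> = (1 + nsq f)\<^sup>2 * 4 ^ m" by (simp add: power_mult_distrib power2_eq_square mult_ac flip: power_mult_distrib)
  finally have 1: "(cell_mean m f x)\<^sup>2 \<le> (1 + nsq f)\<^sup>2 * 4 ^ m" .
  have eq0: "2 * (cell_mean m f x)\<^sup>2 + 2 * (f x)\<^sup>2 - (cell_mean m f x - f x)\<^sup>2 = (cell_mean m f x + f x)\<^sup>2"
    by (simp add: power2_eq_square algebra_simps)
  have "(cell_mean m f x - f x)\<^sup>2 \<le> 2 * (cell_mean m f x)\<^sup>2 + 2 * (f x)\<^sup>2"
    by (rule le_if_diff_square[OF eq0])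
  then show ?thesis using 1 by simp
qed

lemma nsq_Hm_le: "L2 \<mu> f \<Longrightarrow> nsq (\<lambda>x. cell_mean m f x - f x) \<le> 4 * nsq f"
  using nsq_diff_le[OF cell_mean_L2, of f f m] cell_mean_nsq_le[of f m] by simp

text \<open>Abel summation turns the Haar expansion of the flow into a convex combination of the differences
  between cell means and \<open>f\<close>.\<close>

lemma abel_mix:
  assumes f: "L2 \<mu> f" and t: "0 < t"
  defines "H \<equiv> (\<lambda>m x. cell_mean m f x - f x)"
  shows "mix (kcoef t) H x = haar_flow f t x + (cell_mean 0 f x - f x)"
    and "nsq (mix (kcoef t) H) \<le> (\<Sum>m. kcoef t m * nsq (H m))"
    and "summable (\<lambda>m. kcoef t m * nsq (H m))" and "L2 \<mu> (mix (kcoef t) H)"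
proof -
  have k0: "0 \<le> kcoef t m" for m using kcoef_nonneg t by simp
  have HL: "L2 \<mu> (H m)" for m unfolding H_def by (intro L2_diff cell_mean_L2 f)
  have sk: "summable (\<lambda>m. \<bar>kcoef t m\<bar>)" using kcoef_sums[OF t] k0 by (simp add: sums_iff)
  have sH: "summable (\<lambda>m. \<bar>kcoef t m\<bar> * (H m x)\<^sup>2)" for x
  proof -
    let ?C = "2 * (1 + nsq f)\<^sup>2" and ?D = "2 * (f x)\<^sup>2"
    have "summable (\<lambda>m. \<bar>kcoef t (Suc m)\<bar> * (H (Suc m) x)\<^sup>2)"
    proof (rule summable_comparison_test')
      show "summable (\<lambda>m. 4 * ?C * (pc t m * 4 ^ m) + ?D * (pc t m * 1 ^ m))"
        by (intro summable_add summable_mult pc_power_summable t) simp_all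
      fix m :: nat
      have "\<bar>kcoef t (Suc m)\<bar> * (H (Suc m) x)\<^sup>2 \<le> pc t m * (?C * 4 ^ Suc m + ?D)"
        using Hm_square_le[OF f, of "Suc m" x] kcoef_le[of t m] k0[of "Suc m"]
        unfolding H_def by (intro mult_mono) auto
      then show "norm (\<bar>kcoef t (Suc m)\<bar> * (H (Suc m) x)\<^sup>2) \<le> 4 * ?C * (pc t m * 4 ^ m) + ?D * (pc t m * 1 ^ m)"
        by (simp add: abs_mult algebra_simps)
    qed
    then show ?thesis by (subst (asm) summable_Suc_iff)
  qed
  have sn: "summable (\<lambda>m. \<bar>kcoef t m\<bar> * nsq (H m))"
  proof (rule summable_comparison_test')
    show "summable (\<lambda>m. \<bar>kcoef t m\<bar> * (4 * nsq f))" by (intro summable_mult2 sk)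
    show "norm (\<bar>kcoef t m\<bar> * nsq (H m)) \<le> \<bar>kcoef t m\<bar> * (4 * nsq f)" if "m \<ge> 0" for m
      using nsq_Hm_le[OF f, of m] nsq_nonneg[of "H m"] by (simp add: abs_mult H_def mult_left_mono)
  qed
  then show "summable (\<lambda>m. kcoef t m * nsq (H m))" using k0 by simp
  have "(\<Sum>m. \<bar>kcoef t m\<bar>) = 1" using kcoef_sums[OF t] k0 by (simp add: sums_iff)
  then show "nsq (mix (kcoef t) H) \<le> (\<Sum>m. kcoef t m * nsq (H m))"
    using mix_L2(2)[OF HL sk sH sn] k0 by simp
  show "L2 \<mu> (mix (kcoef t) H)" by (rule mix_L2(1)[OF HL sk sH sn])
  \<comment> \<open>Summation by parts; the boundary term vanishes in the limit because the
    exponentials decay faster than the bound on cell means grows.\<close>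
  have part: "(\<Sum>m<M. pc t m * haar_part m f x) + H 0 x = ecoef t M * H M x + (\<Sum>m<M. kcoef t m * H m x)" for M
    by (induction M) (simp_all add: ecoef_def kcoef_def H_def haar_part_def algebra_simps)
  have z: "(\<lambda>M. ecoef t M * H M x) \<longlonglongrightarrow> 0"
  proof (rule LIMSEQ_imp_Suc, rule Lim_null_comparison)
    let ?K = "2 * (1 + nsq f) + \<bar>f x\<bar>"
    show "(\<lambda>M. ?K * (pc t M * 2 ^ M)) \<longlonglongrightarrow> 0"
      using tendsto_mult_right_zero[OF summable_LIMSEQ_zero[OF pc_power_summable[OF t, of 2]], of ?K] by simp
    have "norm (ecoef t (Suc M) * H (Suc M) x) \<le> ?K * (pc t M * 2 ^ M)" for M
    proof -
      have "\<bar>H (Suc M) x\<bar> \<le> 2 ^ Suc M * (1 + nsq f) + \<bar>f x\<bar>"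
        using cell_mean_bound[OF f, of "Suc M" x] unfolding H_def by linarith
      also have "\<dots> \<le> 2 ^ Suc M * (1 + nsq f) + \<bar>f x\<bar> * 2 ^ M"
        using mult_left_mono[of 1 "2 ^ M" "\<bar>f x\<bar>"] by simp
      also have "\<dots> = ?K * 2 ^ M" by (simp add: algebra_simps)
      finally have "pc t M * \<bar>H (Suc M) x\<bar> \<le> pc t M * (?K * 2 ^ M)" using pc_pos[of t M] by (intro mult_left_mono) auto
      then show ?thesis using pc_pos[of t M] by (simp add: ecoef_def abs_mult mult_ac)
    qed
    then show "\<forall>\<^sub>F M in sequentially. norm (ecoef t (Suc M) * H (Suc M) x) \<le> ?K * (pc t M * 2 ^ M)" by simp
  qed
  have "(\<lambda>M. \<Sum>m<M. pc t m * haar_part m f x) \<longlonglongrightarrow> haar_flow f t x"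
    unfolding haar_flow_def mix_def by (rule summable_LIMSEQ[OF tame_mix(6)[OF tame_haar_part[OF f] pc_summable[OF t]]])
  then have "(\<lambda>M. (\<Sum>m<M. pc t m * haar_part m f x) + H 0 x - ecoef t M * H M x) \<longlonglongrightarrow> haar_flow f t x + H 0 x - 0"
    by (intro tendsto_diff tendsto_add tendsto_const z)
  then have "(\<lambda>m. kcoef t m * H m x) sums (haar_flow f t x + H 0 x)" unfolding part by (simp add: sums_def)
  then show "mix (kcoef t) H x = haar_flow f t x + (cell_mean 0 f x - f x)" by (simp add: mix_def sums_iff H_def)
qed

text \<open>As \<open>t\<close> tends to 0 the weights \<open>kcoef t\<close> escape to high levels,
  where the cell means are close to \<open>f\<close>, and \<open>unit_flow f t\<close> differs from
  \<open>cell_mean 0 f\<close> in norm by a multiple of \<open>t\<close>.\<close>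

lemma heat_flow_initial:
  assumes f: "L2 \<mu> f"
  shows "((\<lambda>t. nsq (\<lambda>x. heat_flow f t x - f x)) \<longlongrightarrow> 0) (at_right 0)"
proof -
  define H where "H m x = cell_mean m f x - f x" for m x
  define \<eta> where "\<eta> m = nsq (H m)" for m
  \<comment> \<open>The exponential series without its first term, that is
    \<open>unit_flow f t\<close> minus \<open>cell_mean 0 f\<close>.\<close>
  define b where "b t = mix (\<lambda>n. qc t n - of_bool (n = 0)) (\<lambda>n. lev 0 (unit_lap_pow n f))" for t
  define S where "S = (\<Sum>n. \<bar>qc 1 n\<bar> * (Wl f n)\<^sup>2)"
  have \<eta>0: "0 \<le> \<eta> m" and \<eta>4: "\<eta> m \<le> 4 * nsq f" for m
    using nsq_nonneg nsq_Hm_le[OF f] by (simp_all add: \<eta>_def H_def[abs_def])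
  have \<eta>l: "\<eta> \<longlonglongrightarrow> 0" using approx_all[OF f] by (simp add: approx_def \<eta>_def[abs_def] H_def[abs_def])
  have decomp: "heat_flow f t x - f x = mix (kcoef t) H x + b t x" and bL: "L2 \<mu> (b t)"
    and bn: "t < 1 \<Longrightarrow> nsq (b t) \<le> (t * S)\<^sup>2" if t: "0 < t" for t x
  proof -
    have sq: "summable (\<lambda>n. qc t n * lev 0 (unit_lap_pow n f) x)" for x by (rule tame_mix(6)[OF tame_unit_lap_pow[OF f] qc_summable])
    have s1: "(\<lambda>n. of_bool (n = 0) * lev 0 (unit_lap_pow n f) x) sums cell_mean 0 f x" for x
      using sums_finite[of "{0}" "\<lambda>n. of_bool (n = 0) * lev 0 (unit_lap_pow n f) x"] by (simp add: unit_lap_pow_0 cell_mean_def)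
    have bx: "b t x = unit_flow f t x - cell_mean 0 f x" for x
      using sums_diff[OF summable_sums[OF sq[of x]] s1[of x]]
      by (simp add: b_def mix_def unit_flow_def sums_iff left_diff_distrib)
    show "heat_flow f t x - f x = mix (kcoef t) H x + b t x"
      using abel_mix(1)[OF f t, of x] by (simp add: bx heat_flow_def H_def[abs_def])
    have "b t = (\<lambda>x. unit_flow f t x - cell_mean 0 f x)" by (rule ext) (rule bx)
    then show "L2 \<mu> (b t)" using L2_diff[OF unit_flow_FL(2)[OF f] cell_mean_L2[OF f]] by simp
    assume t1: "t < 1"
    have le: "\<bar>qc t n - of_bool (n = 0)\<bar> * (Wl f n)\<^sup>2 \<le> t * (\<bar>qc 1 n\<bar> * (Wl f n)\<^sup>2)" for n
    proof -
      have "\<bar>qc t n - of_bool (n = 0)\<bar> \<le> t * \<bar>qc 1 n\<bar>"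
      proof (cases n)
        case 0 then show ?thesis using t by (simp add: qc_def)
      next
        case (Suc k)
        have "t ^ k \<le> 1" using t t1 by (intro power_le_one) auto
        then have "t * t ^ k \<le> t * 1" using t by (intro mult_left_mono) auto
        then have "t ^ n / fact n \<le> t / fact n" using Suc by (intro divide_right_mono) auto
        then show ?thesis using Suc t by (simp add: abs_qc)
      qed
      from mult_right_mono[OF this, of "(Wl f n)\<^sup>2"] show ?thesis by (simp add: mult.assoc)
    qed
    have sS: "summable (\<lambda>n. t * (\<bar>qc 1 n\<bar> * (Wl f n)\<^sup>2))" by (intro summable_mult qc_summable)
    have sb: "summable (\<lambda>n. \<bar>qc t n - of_bool (n = 0)\<bar> * (Wl f n)\<^sup>2)"
      by (rule summable_comparison_test'[OF sS]) (use le in simp)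
    have "nsq (b t) \<le> (\<Sum>n. \<bar>qc t n - of_bool (n = 0)\<bar> * (Wl f n)\<^sup>2)\<^sup>2"
      unfolding b_def by (rule tame_mix(3)[OF tame_unit_lap_pow[OF f] sb])
    also have "\<dots> \<le> (t * S)\<^sup>2"
    proof (rule power_mono)
      show "(\<Sum>n. \<bar>qc t n - of_bool (n = 0)\<bar> * (Wl f n)\<^sup>2) \<le> t * S"
        using suminf_le[OF le sb sS] suminf_mult[OF qc_summable[of 1 f], of t] by (simp add: S_def)
    qed (intro suminf_nonneg sb, simp)
    finally show "nsq (b t) \<le> (t * S)\<^sup>2" .
  qed
  have K0: "((\<lambda>t. \<Sum>m. kcoef t m * \<eta> m) \<longlongrightarrow> 0) (at_right 0)"
  proof (rule tendstoI)
    fix r :: real assume r: "0 < r"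
    \<comment> \<open>From level \<open>M\<close> on the errors are uniformly small; the levels
      before have total weight \<open>1 - ecoef t M\<close>, which tends to 0 with
      \<open>t\<close>.\<close>
    obtain M where M: "\<And>m. m \<ge> M \<Longrightarrow> norm (\<eta> m - 0) < r / 2" using LIMSEQ_D[OF \<eta>l, of "r / 2"] r by auto
    have "((\<lambda>t. 4 * nsq f * (1 - ecoef t M)) \<longlongrightarrow> 4 * nsq f * (1 - ecoef 0 M)) (at_right 0)"
    proof (cases M)
      case (Suc k)
      show ?thesis unfolding Suc ecoef_def nat.case pc_def by (intro tendsto_intros)
    qed (simp add: ecoef_def)
    moreover have "ecoef 0 M = 1" by (cases M) (simp_all add: ecoef_def pc_def)
    ultimately have "((\<lambda>t. 4 * nsq f * (1 - ecoef t M)) \<longlongrightarrow> 0) (at_right 0)" by simp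
    from tendstoD[OF this, of "r / 2"] r
    have "\<forall>\<^sub>F t in at_right 0. dist (4 * nsq f * (1 - ecoef t M)) 0 < r / 2" by simp
    then show "\<forall>\<^sub>F t in at_right 0. dist (\<Sum>m. kcoef t m * \<eta> m) 0 < r"
      using eventually_at_right_less[of 0]
    proof eventually_elim
      case (elim t)
      have k0: "0 \<le> kcoef t m" for m using kcoef_nonneg elim by simp
      have s: "summable (\<lambda>m. kcoef t m * \<eta> m)"
        using abel_mix(3)[OF f, of t] elim by (simp add: \<eta>_def H_def[abs_def])
      have sk: "summable (kcoef t)" using kcoef_sums[OF elim(2)] by (simp add: sums_iff)
      have "(\<Sum>m. kcoef t m * \<eta> m) = (\<Sum>m. kcoef t (m + M) * \<eta> (m + M)) + (\<Sum>m<M. kcoef t m * \<eta> m)"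
        by (rule suminf_split_initial_segment[OF s])
      also have "(\<Sum>m<M. kcoef t m * \<eta> m) \<le> (\<Sum>m<M. kcoef t m * (4 * nsq f))"
        by (intro sum_mono mult_left_mono \<eta>4 k0)
      also have "\<dots> = 4 * nsq f * (1 - ecoef t M)"
        unfolding sum_distrib_right[symmetric] kcoef_sum by (simp add: mult.commute)
      also have "\<dots> < r / 2" using elim by (simp add: dist_real_def)
      also have "(\<Sum>m. kcoef t (m + M) * \<eta> (m + M)) \<le> (\<Sum>m. kcoef t (m + M) * (r / 2))"
      proof (rule suminf_le)
        show "kcoef t (m + M) * \<eta> (m + M) \<le> kcoef t (m + M) * (r / 2)" for m
          using M[of "m + M"] \<eta>0 by (intro mult_left_mono k0) auto
        show "summable (\<lambda>m. kcoef t (m + M) * \<eta> (m + M))" using s summable_iff_shift[of "\<lambda>m. kcoef t m * \<eta> m" M] by simp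
        show "summable (\<lambda>m. kcoef t (m + M) * (r / 2))" using sk summable_iff_shift[of "kcoef t" M] by (intro summable_mult2) simp
      qed
      also have "\<dots> = (\<Sum>m. kcoef t (m + M)) * (r / 2)"
        using sk summable_iff_shift[of "kcoef t" M] by (intro suminf_mult2[symmetric]) simp
      also have "(\<Sum>m. kcoef t (m + M)) \<le> 1"
      proof -
        have "(\<Sum>m. kcoef t m) = (\<Sum>m. kcoef t (m + M)) + (\<Sum>m<M. kcoef t m)"
          by (rule suminf_split_initial_segment[OF sk])
        moreover have "(\<Sum>m. kcoef t m) = 1" using kcoef_sums[OF elim(2)] by (simp add: sums_iff)
        moreover have "0 \<le> (\<Sum>m<M. kcoef t m)" by (intro sum_nonneg k0)
        ultimately show ?thesis by linarith
      qed
      finally have "(\<Sum>m. kcoef t m * \<eta> m) < r" using r by simp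
      moreover have "0 \<le> (\<Sum>m. kcoef t m * \<eta> m)" by (intro suminf_nonneg s mult_nonneg_nonneg k0 \<eta>0)
      ultimately show ?case by (simp add: dist_real_def)
    qed
  qed
  have "((\<lambda>t. 2 * (\<Sum>m. kcoef t m * \<eta> m) + 2 * (t * S)\<^sup>2) \<longlongrightarrow> 2 * 0 + 2 * (0 * S)\<^sup>2) (at_right 0)"
    by (intro tendsto_add tendsto_mult tendsto_const K0 tendsto_power tendsto_ident_at)
  then have z: "((\<lambda>t. 2 * (\<Sum>m. kcoef t m * \<eta> m) + 2 * (t * S)\<^sup>2) \<longlongrightarrow> 0) (at_right 0)" by simp
  have "\<forall>\<^sub>F t in at_right 0. norm (nsq (\<lambda>x. heat_flow f t x - f x)) \<le> 2 * (\<Sum>m. kcoef t m * \<eta> m) + 2 * (t * S)\<^sup>2"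
    using eventually_at_right_less[of 0] eventually_at_right_real[of 0 1, OF zero_less_one]
  proof eventually_elim
    case (elim t)
    then have t: "0 < t" "t < 1" by auto
    have "nsq (\<lambda>x. heat_flow f t x - f x) \<le> 2 * nsq (mix (kcoef t) H) + 2 * nsq (b t)"
      unfolding decomp[OF t(1)] using abel_mix(4)[OF f t(1)] by (intro nsq_add_le bL t) (simp add: H_def[abs_def])
    also have "nsq (mix (kcoef t) H) \<le> (\<Sum>m. kcoef t m * \<eta> m)"
      using abel_mix(2)[OF f t(1)] by (simp add: \<eta>_def H_def[abs_def])
    also have "nsq (b t) \<le> (t * S)\<^sup>2" by (rule bn[OF t])
    finally show ?case using nsq_nonneg by simp
  qed
  then show ?thesis by (rule Lim_null_comparison[OF _ z])
qed

section \<open>The kernel and its integral representation\<close>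

definition lap_kernel :: "nat \<Rightarrow> nat \<Rightarrow> nat \<Rightarrow> real" where
  "lap_kernel n k j = (unit_lap ^^ n) (\<lambda>i. of_bool (i = j)) k"

lemma lap_kernel_0: "lap_kernel 0 k j = of_bool (k = j)" by (simp add: lap_kernel_def)
lemma lap_kernel_Suc: "lap_kernel (Suc n) k j = lap_kernel n k j - (lap_kernel n (k - 1) j + 2 * lap_kernel n k j + lap_kernel n (Suc k) j) / 4"
  by (simp add: lap_kernel_def unit_lap_def nbr_avg_def)

lemma lap_kernel_bound: "\<bar>lap_kernel n k j\<bar> \<le> 2 ^ n"
proof (induction n arbitrary: k)
  case 0 then show ?case by (simp add: lap_kernel_0)
next
  case (Suc n)
  have "lap_kernel (Suc n) k j = unit_lap (\<lambda>i. lap_kernel n i j) k" by (simp add: lap_kernel_def)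
  then show ?case using unit_lap_bound[of "\<lambda>i. lap_kernel n i j" "2 ^ n" k] Suc by simp
qed

text \<open>The integral kernel of \<open>haar_part n\<close>: a cell mean divides by the measure of
  the cell, hence the factors \<open>2 ^ Suc n\<close> and \<open>2 ^ n\<close>.\<close>

definition haar_kernel :: "nat \<Rightarrow> 'a \<Rightarrow> 'a \<Rightarrow> real" where
  "haar_kernel n x y = 2 ^ Suc n * of_bool (c (Suc n) x = c (Suc n) y) - 2 ^ n * of_bool (c n x = c n y)"

lemma haar_kernel_bound: "\<bar>haar_kernel n x y\<bar> \<le> 2 * 2 ^ n" by (simp add: haar_kernel_def)

definition heat_ker :: "real \<Rightarrow> 'a \<Rightarrow> 'a \<Rightarrow> real" where
  "heat_ker t x y = (\<Sum>n. pc t n * haar_kernel n x y) + (\<Sum>n. qc t n * lap_kernel n (c 0 x) (c 0 y))"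

lemma int_abs_cell:
  assumes f: "L2 \<mu> f"
  shows "integrable \<mu> (\<lambda>y. indicator (cell n k) y * f y)" "(LINT y|\<mu>. \<bar>indicator (cell n k) y * f y\<bar>) \<le> 1 + nsq f"
proof -
  show "integrable \<mu> (\<lambda>y. indicator (cell n k) y * f y)" by (intro integrable_one L2_lloc f bset_cell)
  have L: "L2 \<mu> (\<lambda>x. \<bar>f x\<bar>)" using f by (auto simp: L2_def)
  have "nsq (\<lambda>x. \<bar>f x\<bar>) = nsq f" by (simp add: nsq_def)
  then show "(LINT y|\<mu>. \<bar>indicator (cell n k) y * f y\<bar>) \<le> 1 + nsq f"
    using I_cell_bound[OF L, of n k] by (simp add: I_def abs_mult)
qed

lemma int_haar_kernel:
  assumes f: "L2 \<mu> f" and x: "x \<in> X"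
  shows "integrable \<mu> (\<lambda>y. haar_kernel n x y * f y)" and "(LINT y|\<mu>. haar_kernel n x y * f y) = haar_part n f x"
    and "(LINT y|\<mu>. \<bar>haar_kernel n x y * f y\<bar>) \<le> 3 * 2 ^ n * (1 + nsq f)"
proof -
  define a b where "a y = indicator (cell (Suc n) (c (Suc n) x)) y * f y" and "b y = indicator (cell n (c n x)) y * f y" for y
  have i: "integrable \<mu> a" "integrable \<mu> b" and ab: "(LINT y|\<mu>. \<bar>a y\<bar>) \<le> 1 + nsq f" "(LINT y|\<mu>. \<bar>b y\<bar>) \<le> 1 + nsq f"
    unfolding a_def b_def by (intro int_abs_cell f)+
  have eq: "haar_kernel n x y * f y = 2 ^ Suc n * a y - 2 ^ n * b y" if "y \<in> space \<mu>" for y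
    using that by (auto simp: haar_kernel_def a_def b_def space_mu indicator_def algebra_simps)
  have "integrable \<mu> (\<lambda>y. 2 ^ Suc n * a y - 2 ^ n * b y)" using i by auto
  then show "integrable \<mu> (\<lambda>y. haar_kernel n x y * f y)" by (subst Bochner_Integration.integrable_cong[OF refl eq])
  have "(LINT y|\<mu>. haar_kernel n x y * f y) = (LINT y|\<mu>. 2 ^ Suc n * a y - 2 ^ n * b y)"
    by (rule Bochner_Integration.integral_cong[OF refl eq])
  also have "\<dots> = 2 ^ Suc n * I (cell (Suc n) (c (Suc n) x)) f - 2 ^ n * I (cell n (c n x)) f"
    using i by (simp add: I_def a_def[abs_def] b_def[abs_def])
  finally show "(LINT y|\<mu>. haar_kernel n x y * f y) = haar_part n f x" using x by (simp add: haar_part_def cell_mean_def lev_in cell_avg_def)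
  have "(LINT y|\<mu>. \<bar>haar_kernel n x y * f y\<bar>) = (LINT y|\<mu>. \<bar>2 ^ Suc n * a y - 2 ^ n * b y\<bar>)"
    by (rule Bochner_Integration.integral_cong) (simp_all add: eq del: power_Suc)
  also have "\<dots> \<le> (LINT y|\<mu>. 2 ^ Suc n * \<bar>a y\<bar> + 2 ^ n * \<bar>b y\<bar>)"
  proof (rule integral_mono)
    show "\<bar>2 ^ Suc n * a y - 2 ^ n * b y\<bar> \<le> 2 ^ Suc n * \<bar>a y\<bar> + 2 ^ n * \<bar>b y\<bar>" for y
      using abs_triangle_ineq4[of "2 ^ Suc n * a y" "2 ^ n * b y"] by (simp only: abs_mult power_abs abs_numeral)
  qed (use i in auto)
  also have "\<dots> = 2 ^ Suc n * (LINT y|\<mu>. \<bar>a y\<bar>) + 2 ^ n * (LINT y|\<mu>. \<bar>b y\<bar>)" using i by simp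
  also have "\<dots> \<le> 2 ^ Suc n * (1 + nsq f) + 2 ^ n * (1 + nsq f)"
    using ab by (intro add_mono mult_left_mono) auto
  finally show "(LINT y|\<mu>. \<bar>haar_kernel n x y * f y\<bar>) \<le> 3 * 2 ^ n * (1 + nsq f)" by (simp add: algebra_simps)
qed

text \<open>Induction for all \<open>k\<close> at once, since the recurrence involves neighbours.
  The bound on the absolute integral is carried along for exchanging sum and integral.\<close>

lemma int_lap_kernel:
  assumes f: "L2 \<mu> f"
  shows "integrable \<mu> (\<lambda>y. lap_kernel n k (c 0 y) * f y) \<and> (LINT y|\<mu>. lap_kernel n k (c 0 y) * f y) = unit_lap_pow n f k
    \<and> (LINT y|\<mu>. \<bar>lap_kernel n k (c 0 y) * f y\<bar>) \<le> 2 ^ n * (1 + nsq f)"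
proof (induction n arbitrary: k)
  case 0
  have eq: "lap_kernel 0 k (c 0 y) * f y = indicator (cell 0 k) y * f y" if "y \<in> space \<mu>" for y
    using that by (auto simp: lap_kernel_0 space_mu indicator_def)
  have eq': "\<bar>lap_kernel 0 k (c 0 y) * f y\<bar> = \<bar>indicator (cell 0 k) y * f y\<bar>" if "y \<in> space \<mu>" for y
    by (simp only: eq[OF that])
  have "integrable \<mu> (\<lambda>y. lap_kernel 0 k (c 0 y) * f y) = integrable \<mu> (\<lambda>y. indicator (cell 0 k) y * f y)"
    by (rule Bochner_Integration.integrable_cong[OF refl eq])
  moreover have "(LINT y|\<mu>. lap_kernel 0 k (c 0 y) * f y) = (LINT y|\<mu>. indicator (cell 0 k) y * f y)"
    by (rule Bochner_Integration.integral_cong[OF refl eq])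
  moreover have "(LINT y|\<mu>. \<bar>lap_kernel 0 k (c 0 y) * f y\<bar>) = (LINT y|\<mu>. \<bar>indicator (cell 0 k) y * f y\<bar>)"
    by (rule Bochner_Integration.integral_cong[OF refl eq'])
  ultimately show ?case
    using int_abs_cell[OF f, of 0 k] by (simp only: unit_lap_pow_0 cell_avg_def I_def) simp
next
  case (Suc n)
  define a where "a k y = lap_kernel n k (c 0 y) * f y" for k y
  have i: "integrable \<mu> (a k)" and I: "integral\<^sup>L \<mu> (a k) = unit_lap_pow n f k" and ab: "(LINT y|\<mu>. \<bar>a k y\<bar>) \<le> 2 ^ n * (1 + nsq f)" for k
    using Suc unfolding a_def by auto
  have eq: "lap_kernel (Suc n) k (c 0 y) * f y = a k y - (a (k - 1) y + 2 * a k y + a (Suc k) y) / 4" for y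
    by (simp add: lap_kernel_Suc a_def field_simps)
  have ii: "integrable \<mu> (\<lambda>y. a k y - (a (k - 1) y + 2 * a k y + a (Suc k) y) / 4)" using i by auto
  have "(LINT y|\<mu>. \<bar>a k y - (a (k - 1) y + 2 * a k y + a (Suc k) y) / 4\<bar>) \<le>
      (LINT y|\<mu>. \<bar>a k y\<bar> / 2 + \<bar>a (k - 1) y\<bar> / 4 + \<bar>a (Suc k) y\<bar> / 4)"
  proof (rule integral_mono)
    show "integrable \<mu> (\<lambda>y. \<bar>a k y - (a (k - 1) y + 2 * a k y + a (Suc k) y) / 4\<bar>)" by (rule integrable_abs[OF ii])
    show "integrable \<mu> (\<lambda>y. \<bar>a k y\<bar> / 2 + \<bar>a (k - 1) y\<bar> / 4 + \<bar>a (Suc k) y\<bar> / 4)"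
      by (intro Bochner_Integration.integrable_add integrable_divide integrable_abs i)
    have "\<bar>p - (q + 2 * p + r) / 4\<bar> \<le> \<bar>p\<bar> / 2 + \<bar>q\<bar> / 4 + \<bar>r\<bar> / 4" for p q r :: real
      by (simp add: abs_if field_simps)
    then show "\<bar>a k y - (a (k - 1) y + 2 * a k y + a (Suc k) y) / 4\<bar> \<le> \<bar>a k y\<bar> / 2 + \<bar>a (k - 1) y\<bar> / 4 + \<bar>a (Suc k) y\<bar> / 4" for y .
  qed
  also have "\<dots> = (LINT y|\<mu>. \<bar>a k y\<bar>) / 2 + (LINT y|\<mu>. \<bar>a (k - 1) y\<bar>) / 4 + (LINT y|\<mu>. \<bar>a (Suc k) y\<bar>) / 4"
    using i by simp
  also have "\<dots> \<le> 2 ^ Suc n * (1 + nsq f)"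
  proof -
    have K: "0 \<le> 2 ^ n * (1 + nsq f)" using nsq_nonneg[of f] by simp
    have "p / 2 + q / 4 + r / 4 \<le> 2 * K" if "p \<le> K" "q \<le> K" "r \<le> K" "0 \<le> K" for p q r K :: real using that by simp
    from this[OF ab[of k] ab[of "k - 1"] ab[of "Suc k"] K] show ?thesis by (simp add: mult.assoc)
  qed
  finally show ?case
    unfolding eq using ii i I by (simp add: unit_lap_pow_Suc unit_lap_def nbr_avg_def)
qed

lemma int_series:
  fixes a B :: "nat \<Rightarrow> real" and K :: real and p :: "nat \<Rightarrow> 'a \<Rightarrow> real" and f :: "'a \<Rightarrow> real"
  assumes p: "\<And>n. integrable \<mu> (\<lambda>y. p n y * f y)" and B: "summable (\<lambda>n. \<bar>a n\<bar> * B n)"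
    and pb: "\<And>n y. \<bar>p n y\<bar> \<le> B n" and pi: "\<And>n. (LINT y|\<mu>. \<bar>p n y * f y\<bar>) \<le> K * B n"
  shows "integrable \<mu> (\<lambda>y. (\<Sum>n. a n * p n y) * f y)"
    and "(LINT y|\<mu>. (\<Sum>n. a n * p n y) * f y) = (\<Sum>n. a n * (LINT y|\<mu>. p n y * f y))"
proof -
  have sp: "summable (\<lambda>n. \<bar>a n * p n y\<bar>)" for y
    by (rule summable_comparison_test'[OF B]) (use pb in \<open>simp add: abs_mult mult_left_mono\<close>)
  have eq: "(\<Sum>n. a n * p n y) * f y = (\<Sum>n. a n * (p n y * f y))" for y
    using suminf_mult2[OF summable_rabs_cancel[OF sp[of y]], of "f y"] by (simp add: mult.assoc)
  have i: "integrable \<mu> (\<lambda>y. a n * (p n y * f y))" for n using p by auto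
  have ae: "AE y in \<mu>. summable (\<lambda>n. norm (a n * (p n y * f y)))"
  proof (intro AE_I2)
    fix y show "summable (\<lambda>n. norm (a n * (p n y * f y)))"
      using summable_mult2[OF sp[of y], of "\<bar>f y\<bar>"] by (simp add: abs_mult mult.assoc)
  qed
  have sn: "summable (\<lambda>n. LINT y|\<mu>. norm (a n * (p n y * f y)))"
  proof (rule summable_comparison_test')
    show "summable (\<lambda>n. K * (\<bar>a n\<bar> * B n))" by (intro summable_mult B)
    fix n :: nat
    have "(LINT y|\<mu>. norm (a n * (p n y * f y))) = \<bar>a n\<bar> * (LINT y|\<mu>. \<bar>p n y * f y\<bar>)" by (simp add: abs_mult)
    also have "\<dots> \<le> \<bar>a n\<bar> * (K * B n)" by (intro mult_left_mono pi) simp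
    finally show "norm (LINT y|\<mu>. norm (a n * (p n y * f y))) \<le> K * (\<bar>a n\<bar> * B n)" by (simp add: mult_ac)
  qed
  show "integrable \<mu> (\<lambda>y. (\<Sum>n. a n * p n y) * f y)" unfolding eq by (rule integrable_suminf[OF i ae sn])
  show "(LINT y|\<mu>. (\<Sum>n. a n * p n y) * f y) = (\<Sum>n. a n * (LINT y|\<mu>. p n y * f y))"
    unfolding eq using integral_suminf[OF i ae sn] by simp
qed

lemma heat_ker_integral:
  assumes f: "L2 \<mu> f" and x: "x \<in> X" and t: "0 < t"
  shows "integrable \<mu> (\<lambda>y. heat_ker t x y * f y)" and "(LINT y|\<mu>. heat_ker t x y * f y) = heat_flow f t x"
proof -
  have N: "0 \<le> nsq f" by (rule nsq_nonneg)
  have s1: "summable (\<lambda>n. \<bar>pc t n\<bar> * (3 * 2 ^ n))"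
    using summable_mult[OF pc_power_summable[OF t, of 2], of 3] pc_pos[of t] by (simp add: mult_ac abs_of_pos)
  have b1: "\<bar>haar_kernel n x y\<bar> \<le> 3 * 2 ^ n" for n y using haar_kernel_bound[of n x y] zero_le_power[of "2::real" n] by linarith
  have i1: "(LINT y|\<mu>. \<bar>haar_kernel n x y * f y\<bar>) \<le> (1 + nsq f) * (3 * 2 ^ n)" for n
    using int_haar_kernel(3)[OF f x, of n] by (simp add: mult_ac)
  note S1 = int_series[where p = "\<lambda>n. haar_kernel n x", OF int_haar_kernel(1)[OF f x] s1 b1 i1]
  have "\<bar>qc t n\<bar> * 2 ^ n = (2 * t) ^ n / fact n" for n using t by (simp add: abs_qc power_mult_distrib)
  then have s2: "summable (\<lambda>n. \<bar>qc t n\<bar> * 2 ^ n)" using summable_power_fact[of "2 * t"] by simp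
  have i2: "(LINT y|\<mu>. \<bar>lap_kernel n (c 0 x) (c 0 y) * f y\<bar>) \<le> (1 + nsq f) * 2 ^ n" for n
    using int_lap_kernel[OF f, of n "c 0 x"] by (simp add: mult_ac)
  note S2 = int_series[where p = "\<lambda>n y. lap_kernel n (c 0 x) (c 0 y)", OF _ s2 lap_kernel_bound i2]
  have i3: "integrable \<mu> (\<lambda>y. lap_kernel n (c 0 x) (c 0 y) * f y)" for n using int_lap_kernel[OF f] by blast
  show "integrable \<mu> (\<lambda>y. heat_ker t x y * f y)"
    unfolding heat_ker_def distrib_right by (intro Bochner_Integration.integrable_add S1(1) S2(1) i3)
  have "(LINT y|\<mu>. heat_ker t x y * f y) = (\<Sum>n. pc t n * haar_part n f x) + (\<Sum>n. qc t n * unit_lap_pow n f (c 0 x))"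
    unfolding heat_ker_def distrib_right Bochner_Integration.integral_add[OF S1(1) S2(1)[OF i3]] S1(2) S2(2)[OF i3]
    using int_haar_kernel(2)[OF f x] int_lap_kernel[OF f] by simp
  then show "(LINT y|\<mu>. heat_ker t x y * f y) = heat_flow f t x"
    using x by (simp add: heat_flow_def haar_flow_def unit_flow_def mix_def lev_in)
qed

text \<open>The kernels are locally constant in space, so finitely many terms vary with time only;
  the tails are small uniformly for \<open>t\<close> between \<open>t0 / 2\<close> and
  \<open>2 * t0\<close>.\<close>

lemma heat_ker_continuous:
  "continuous_map (prod_topology (subtopology euclideanreal {0<..}) (prod_topology RM.mtopology RM.mtopology))
     euclideanreal (\<lambda>(t, x, y). heat_ker t x y)"
proof (rule continuous_map_realI)
  fix z e assume z: "z \<in> topspace (prod_topology (subtopology euclideanreal {0<..}) (prod_topology RM.mtopology RM.mtopology))"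
    and e: "(e::real) > 0"
  obtain t0 x0 y0 where zeq: "z = (t0, x0, y0)" by (cases z)
  have t0: "t0 > 0" and x0: "x0 \<in> X" and y0: "y0 \<in> X" using z unfolding zeq by auto
  define B1 where "B1 n = pc (t0 / 2) n * (2 * 2 ^ n)" for n
  define B2 where "B2 n = (2 * (2 * t0)) ^ n / fact n" for n :: nat
  have sB1: "summable B1"
    using summable_mult[OF pc_power_summable[of "t0 / 2" 2], of 2] t0 by (simp add: B1_def[abs_def] mult_ac)
  have sB2: "summable B2" unfolding B2_def[abs_def] by (rule summable_power_fact)
  obtain N1 where N1: "(\<Sum>n. B1 (n + N1)) < e / 6" using small_tail[OF sB1, of "e / 6"] e by auto
  obtain N2 where N2: "(\<Sum>n. B2 (n + N2)) < e / 6" using small_tail[OF sB2, of "e / 6"] e by auto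
  have b1: "\<bar>pc t n * haar_kernel n x y\<bar> \<le> B1 n" if "t0 / 2 \<le> t" for t n x y
    unfolding abs_mult B1_def
    using that haar_kernel_bound[of n x y] pc_pos[of t n] by (intro mult_mono) (auto simp: pc_def)
  have b2: "\<bar>qc t n * lap_kernel n i j\<bar> \<le> B2 n" if "0 < t" "t \<le> 2 * t0" for t n i j
  proof -
    have "\<bar>qc t n * lap_kernel n i j\<bar> \<le> \<bar>t\<bar> ^ n / fact n * 2 ^ n"
      unfolding abs_mult abs_qc by (intro mult_left_mono lap_kernel_bound) simp
    also have "\<dots> \<le> (2 * t0) ^ n / fact n * 2 ^ n"
      using that by (intro mult_right_mono divide_right_mono power_mono) auto
    also have "\<dots> = B2 n"
      unfolding B2_def power_mult_distrib[of 2 "2 * t0" n] times_divide_eq_left by (simp only: mult.commute)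
    finally show ?thesis .
  qed
  define f1 where "f1 t = (\<Sum>n<N1. pc t n * haar_kernel n x0 y0)" for t
  define f2 where "f2 t = (\<Sum>n<N2. qc t n * lap_kernel n (c 0 x0) (c 0 y0))" for t
  have "isCont f1 t0" "isCont f2 t0" unfolding f1_def[abs_def] f2_def[abs_def] pc_def qc_def by (intro continuous_intros; simp)+
  then have "f1 \<midarrow>t0\<rightarrow> f1 t0" "f2 \<midarrow>t0\<rightarrow> f2 t0" by (simp_all add: isCont_def)
  then obtain d1 d2 where d1: "d1 > 0" "\<And>t. t \<noteq> t0 \<Longrightarrow> \<bar>t - t0\<bar> < d1 \<Longrightarrow> \<bar>f1 t - f1 t0\<bar> < e / 6"
    and d2: "d2 > 0" "\<And>t. t \<noteq> t0 \<Longrightarrow> \<bar>t - t0\<bar> < d2 \<Longrightarrow> \<bar>f2 t - f2 t0\<bar> < e / 6"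
    using LIM_D[of f1 "f1 t0" t0 "e / 6"] LIM_D[of f2 "f2 t0" t0 "e / 6"] e by auto
  define d where "d = min (min d1 d2) (t0 / 2)"
  define T where "T = {t0 - d<..<t0 + d}"
  \<comment> \<open>Haar kernels of index below \<open>N1\<close> involve levels up to
    \<open>N1\<close> only, so on these cells the finite sums do not depend on \<open>x\<close> and
    \<open>y\<close>.\<close>
  define U where "U = T \<times> (cell N1 (c N1 x0) \<times> cell N1 (c N1 y0))"
  have d: "d > 0" using d1 d2 t0 by (simp add: d_def)
  have Tpos: "T \<subseteq> {0<..}" by (auto simp: T_def d_def)
  have "openin (subtopology euclideanreal {0<..}) T"
    unfolding openin_subtopology using Tpos by (intro exI[of _ T]) (auto simp: T_def)
  then have oU: "openin (prod_topology (subtopology euclideanreal {0<..}) (prod_topology RM.mtopology RM.mtopology)) U"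
    unfolding U_def by (simp add: openin_prod_Times_iff openin_cell)
  have zU: "z \<in> U" unfolding zeq U_def using x0 y0 d by (simp add: T_def)
  have close: "\<bar>heat_ker t x y - heat_ker t0 x0 y0\<bar> < e" if txy: "(t, x, y) \<in> U" for t x y
  proof -
    have dle: "d \<le> d1" "d \<le> d2" "d \<le> t0 / 2" by (simp_all add: d_def)
    have "t0 - d < t" "t < t0 + d" using txy by (auto simp: U_def T_def)
    then have t: "\<bar>t - t0\<bar> < d" "t0 / 2 \<le> t" "t \<le> 2 * t0" "0 < t" using dle t0 by linarith+
    have x: "x \<in> X" "c N1 x = c N1 x0" and y: "y \<in> X" "c N1 y = c N1 y0" using txy by (auto simp: U_def)
    have cm: "c m x = c m x0" "c m y = c m y0" if "m \<le> N1" for m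
      using c_eq_le[OF x(1) x0 x(2) that] c_eq_le[OF y(1) y0 y(2) that] by auto
    have f1t: "(\<Sum>n<N1. pc t n * haar_kernel n x y) = f1 t"
      unfolding f1_def by (intro sum.cong refl) (simp add: haar_kernel_def cm)
    have "\<bar>f1 t - f1 t0\<bar> < e / 6" "\<bar>f2 t - f2 t0\<bar> < e / 6"
      using d1(2)[of t] d2(2)[of t] t(1) e dle by (cases "t = t0"; simp)+
    then have fin: "\<bar>(\<Sum>n<N1. pc t n * haar_kernel n x y) - (\<Sum>n<N1. pc t0 n * haar_kernel n x0 y0)\<bar> < e / 6"
      "\<bar>(\<Sum>n<N2. qc t n * lap_kernel n (c 0 x) (c 0 y)) - (\<Sum>n<N2. qc t0 n * lap_kernel n (c 0 x0) (c 0 y0))\<bar> < e / 6"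
      unfolding f1t by (simp_all add: f1_def f2_def cm)
    have 1: "\<bar>(\<Sum>n. pc t n * haar_kernel n x y) - (\<Sum>n. pc t0 n * haar_kernel n x0 y0)\<bar> < 3 * (e / 6)"
      by (rule series_close[OF sB1 _ _ N1 fin(1)]) (use t t0 in \<open>auto intro: b1\<close>)
    have 2: "\<bar>(\<Sum>n. qc t n * lap_kernel n (c 0 x) (c 0 y)) - (\<Sum>n. qc t0 n * lap_kernel n (c 0 x0) (c 0 y0))\<bar> < 3 * (e / 6)"
      by (rule series_close[OF sB2 _ _ N2 fin(2)]) (use t t0 in \<open>auto intro: b2\<close>)
    show ?thesis unfolding heat_ker_def using 1 2 by linarith
  qed
  show "\<exists>U. openin (prod_topology (subtopology euclideanreal {0<..}) (prod_topology RM.mtopology RM.mtopology)) U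
      \<and> z \<in> U \<and> (\<forall>w\<in>U. \<bar>(case w of (t, x, y) \<Rightarrow> heat_ker t x y) - (case z of (t, x, y) \<Rightarrow> heat_ker t x y)\<bar> < e)"
    using oU zU close unfolding zeq by (intro exI[of _ U]) auto
qed

lemma L2dist_nsq: "L2dist \<mu> u v = sqrt (nsq (\<lambda>x. u x - v x))"
  by (simp add: L2dist_def nsq_def)

lemma heat_kernel_heat_ker: "heat_kernel X E F \<mu> heat_ker"
  unfolding heat_kernel_def
proof (intro conjI allI impI)
  show "continuous_map (prod_topology (subtopology euclideanreal {0<..}) (prod_topology RM.mtopology RM.mtopology))
     euclideanreal (\<lambda>(t, x, y). heat_ker t x y)" by (rule heat_ker_continuous)
  fix f assume f: "L2 \<mu> f"
  show "\<exists>w u'. \<forall>t>0.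
          w t \<in> D_mu X E F \<mu> \<and>
          (AE x in \<mu>. integrable \<mu> (\<lambda>y. heat_ker t x y * f y) \<and> (LINT y|\<mu>. heat_ker t x y * f y) = w t x) \<and>
          L2 \<mu> (u' t) \<and>
          ((\<lambda>s. L2dist \<mu> (\<lambda>x. (w s x - w t x) / (s - t)) (u' t)) \<longlongrightarrow> 0) (at t within {0<..}) \<and>
          (\<forall>v\<in>D_mu X E F \<mu>. (LINT x|\<mu>. u' t x * v x) + E (w t) v = 0) \<and>
          ((\<lambda>s. L2dist \<mu> (w s) f) \<longlongrightarrow> 0) (at_right 0)"
  proof (rule exI[of _ "heat_flow f"], rule exI[of _ "heat_flow_deriv f"], intro allI impI conjI)
    fix t :: real assume t: "0 < t"
    show "heat_flow f t \<in> D_mu X E F \<mu>" using heat_flow_FL[OF f t] by (simp add: D_mu_eq)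
    show "AE x in \<mu>. integrable \<mu> (\<lambda>y. heat_ker t x y * f y) \<and> (LINT y|\<mu>. heat_ker t x y * f y) = heat_flow f t x"
      using heat_ker_integral[OF f _ t] by (intro AE_I2) (simp add: space_mu)
    show "L2 \<mu> (heat_flow_deriv f t)" by (rule heat_flow_deriv_L2(3)[OF f t])
    show "((\<lambda>s. L2dist \<mu> (\<lambda>x. (heat_flow f s x - heat_flow f t x) / (s - t)) (heat_flow_deriv f t)) \<longlongrightarrow> 0) (at t within {0<..})"
      unfolding L2dist_nsq using tendsto_real_sqrt[OF heat_flow_derivative[OF f t]] by simp
    show "\<forall>v\<in>D_mu X E F \<mu>. (LINT x|\<mu>. heat_flow_deriv f t x * v x) + E (heat_flow f t) v = 0"
      using weak_equation[OF f t] by (simp add: D_mu_eq ip_def)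
    show "((\<lambda>s. L2dist \<mu> (heat_flow f s) f) \<longlongrightarrow> 0) (at_right 0)"
      unfolding L2dist_nsq using tendsto_real_sqrt[OF heat_flow_initial[OF f]] by simp
  qed
qed

end

section \<open>Uniqueness and the spectral dimension\<close>

text \<open>The logarithm of \<open>h t * t powr q\<close> stays bounded while \<open>ln t\<close>
  tends to minus infinity, so multiplicative constants do not affect the exponent.\<close>

lemma log_ratio_limit:
  fixes h :: "real \<Rightarrow> real"
  assumes a: "0 < a" and ev: "\<forall>\<^sub>F t in at_right 0. a \<le> h t * t powr q \<and> h t * t powr q \<le> b"
  shows "((\<lambda>t. - 2 * ln (h t) / ln t) \<longlongrightarrow> 2 * q) (at_right 0)"
proof -
  have z: "((\<lambda>t. 2 * (\<bar>ln a\<bar> + \<bar>ln b\<bar>) / ln t) \<longlongrightarrow> 0) (at_right (0::real))"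
    by (rule tendsto_divide_0[OF tendsto_const filterlim_at_bot_imp_at_infinity[OF ln_at_0]])
  have "\<forall>\<^sub>F t in at_right 0. norm (- 2 * ln (h t) / ln t - 2 * q) \<le> norm (2 * (\<bar>ln a\<bar> + \<bar>ln b\<bar>) / ln t) * 1"
    using ev eventually_at_right_less[of 0] eventually_at_right_real[of 0 1, OF zero_less_one]
  proof eventually_elim
    case (elim t)
    define w where "w = h t * t powr q"
    have t: "0 < t" "t < 1" and w: "a \<le> w" "w \<le> b" using elim by (auto simp: w_def)
    have lt: "ln t < 0" using t by simp
    have w0: "0 < w" using a w by simp
    have ht: "h t = w * t powr (- q)" using t by (simp add: w_def powr_minus field_simps)
    have "ln (h t) = ln w - q * ln t" unfolding ht using w0 t by (simp add: ln_mult ln_powr)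
    then have eq: "- 2 * ln (h t) / ln t - 2 * q = - 2 * ln w / ln t"
      using lt by (simp add: diff_divide_distrib right_diff_distrib)
    have "ln a \<le> ln w" "ln w \<le> ln b" using a w w0 by auto
    then have "\<bar>ln w\<bar> \<le> \<bar>ln a\<bar> + \<bar>ln b\<bar>" by linarith
    then show ?case unfolding eq using lt by (simp add: abs_mult divide_right_mono_neg)
  qed
  then have "((\<lambda>t. - 2 * ln (h t) / ln t - 2 * q) \<longlongrightarrow> 0) (at_right 0)" by (rule tendsto_0_le[OF z])
  then show ?thesis by (rule LIM_zero_cancel)
qed

context dyadic
begin

section \<open>Uniqueness of the heat flow\<close>

lemma abs_ip_le:
  assumes u: "L2 \<mu> u" and v: "L2 \<mu> v" and K: "0 < K"
  shows "\<bar>ip u v\<bar> \<le> (K\<^sup>2 * nsq u + nsq v / K\<^sup>2) / 2"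
proof -
  have "ip (\<lambda>x. K * u x) (\<lambda>x. 1 / K * v x) = ip u v"
    using K by (simp add: ip_scale ip_sym[of u] ip_scale[of "1 / K" v u, simplified])
  moreover have "nsq (\<lambda>x. 1 / K * v x) = nsq v / K\<^sup>2" unfolding nsq_scale by (simp add: power_divide)
  ultimately show ?thesis
    using ip_le[OF L2_scale[OF u, of K] L2_scale[OF v, of "1 / K"]] by (simp only: nsq_scale)
qed

lemma tendsto_ip_zero:
  assumes L: "\<forall>\<^sub>F s in Q. L2 \<mu> (u s)" and v: "L2 \<mu> v" and z: "((\<lambda>s. nsq (u s)) \<longlongrightarrow> 0) Q"
  shows "((\<lambda>s. ip (u s) v) \<longlongrightarrow> 0) Q"
proof (rule tendstoI)
  fix e :: real assume e: "0 < e"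
  \<comment> \<open>Young's inequality with a parameter: this \<open>K\<close> puts the term with
    \<open>nsq v\<close> below \<open>e\<close> for every \<open>s\<close>, and then the other term
    tends to 0.\<close>
  define K where "K = sqrt ((nsq v + 1) / e)"
  have K2: "K\<^sup>2 = (nsq v + 1) / e" and K: "0 < K" using e nsq_nonneg[of v] by (simp_all add: K_def)
  have vK: "nsq v / K\<^sup>2 < e" unfolding K2 using e nsq_nonneg[of v] by (simp add: field_simps)
  have "((\<lambda>s. K\<^sup>2 * nsq (u s)) \<longlongrightarrow> 0) Q" using tendsto_mult_right_zero[OF z] by simp
  from tendstoD[OF this e] L show "\<forall>\<^sub>F s in Q. dist (ip (u s) v) 0 < e"
  proof eventually_elim
    case (elim s)
    then show ?case using abs_ip_le[OF elim(2) v K] vK by (simp add: dist_real_def)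
  qed
qed

lemma nsq_increment:
  assumes u: "L2 \<mu> u" and v: "L2 \<mu> v"
  shows "nsq u - nsq v = 2 * ip (\<lambda>x. u x - v x) v + nsq (\<lambda>x. u x - v x)"
proof -
  have uv: "L2 \<mu> (\<lambda>x. u x - v x)" by (rule L2_diff[OF u v])
  have "nsq (\<lambda>x. u x - v x) = ip u (\<lambda>x. u x - v x) - ip v (\<lambda>x. u x - v x)"
    by (simp add: ip_self[symmetric] ip_diff[OF u v uv])
  also have "\<dots> = (nsq u - ip u v) - (ip u v - nsq v)"
    using ip_diff[OF u v u] ip_diff[OF u v v] ip_sym[of u v]
    by (simp add: ip_sym[of u "\<lambda>x. u x - v x"] ip_sym[of v "\<lambda>x. u x - v x"] ip_self)
  finally show ?thesis using ip_diff[OF u v v] by (simp add: ip_self)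
qed

text \<open>By \<open>nsq_increment\<close> the difference quotient of the squared norm is an inner
  product with the quotient of \<open>z\<close> plus \<open>s - t\<close> times a bounded quadratic
  term.\<close>

lemma nsq_flow_derivative:
  assumes t: "0 < t" and z: "\<And>s. 0 < s \<Longrightarrow> L2 \<mu> (z s)" and z': "L2 \<mu> z'"
    and d: "((\<lambda>s. nsq (\<lambda>x. (z s x - z t x) / (s - t) - z' x)) \<longlongrightarrow> 0) (at t within {0<..})"
  shows "((\<lambda>s. nsq (z s)) has_real_derivative 2 * ip z' (z t)) (at t)"
proof -
  have at: "at t within {0<..} = at t" using t by (intro at_within_open) auto
  define y where "y s x = (z s x - z t x) / (s - t)" for s x
  have Ly: "L2 \<mu> (y s)" if "0 < s" for s
    using L2_scale[OF L2_diff[OF z[OF that] z[OF t]], of "1 / (s - t)"] by (simp add: y_def[abs_def])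
  have ev: "\<forall>\<^sub>F s in at t. 0 < s" using t by (intro eventually_at_in_open'[of "{0<..}", simplified]) auto
  have "((\<lambda>s. ip (\<lambda>x. y s x - z' x) (z t)) \<longlongrightarrow> 0) (at t)"
  proof (rule tendsto_ip_zero)
    show "\<forall>\<^sub>F s in at t. L2 \<mu> (\<lambda>x. y s x - z' x)" using ev by eventually_elim (intro L2_diff Ly z')
    show "((\<lambda>s. nsq (\<lambda>x. y s x - z' x)) \<longlongrightarrow> 0) (at t)" using d unfolding at y_def .
  qed (rule z[OF t])
  then have l1: "((\<lambda>s. 2 * (ip (\<lambda>x. y s x - z' x) (z t) + ip z' (z t))) \<longlongrightarrow> 2 * (0 + ip z' (z t))) (at t)"
    by (intro tendsto_mult tendsto_add tendsto_const)
  have l2: "((\<lambda>s. (s - t) * nsq (y s)) \<longlongrightarrow> 0) (at t)"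
  proof (rule Lim_null_comparison)
    have "((\<lambda>s. \<bar>s - t\<bar> * (2 * nsq (\<lambda>x. y s x - z' x) + 2 * nsq z')) \<longlongrightarrow> \<bar>t - t\<bar> * (2 * 0 + 2 * nsq z')) (at t)"
      using d unfolding at y_def by (intro tendsto_mult tendsto_add tendsto_const tendsto_rabs tendsto_diff tendsto_ident_at)
    then show "((\<lambda>s. \<bar>s - t\<bar> * (2 * nsq (\<lambda>x. y s x - z' x) + 2 * nsq z')) \<longlongrightarrow> 0) (at t)" by simp
    show "\<forall>\<^sub>F s in at t. norm ((s - t) * nsq (y s)) \<le> \<bar>s - t\<bar> * (2 * nsq (\<lambda>x. y s x - z' x) + 2 * nsq z')"
      using ev
    proof eventually_elim
      case (elim s)
      have "nsq (y s) \<le> 2 * nsq (\<lambda>x. y s x - z' x) + 2 * nsq z'"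
        using nsq_add_le[OF L2_diff[OF Ly[OF elim] z'] z'] by simp
      then show ?case using nsq_nonneg[of "y s"] by (simp add: abs_mult mult_left_mono)
    qed
  qed
  have "((\<lambda>s. (nsq (z s) - nsq (z t)) / (s - t)) \<longlongrightarrow> 2 * (0 + ip z' (z t)) + 0) (at t)"
  proof (rule Lim_transform_eventually[OF tendsto_add[OF l1 l2]])
    have "\<forall>\<^sub>F s in at t. s \<noteq> t" by (auto simp: eventually_at_filter)
    with ev show "\<forall>\<^sub>F s in at t. 2 * (ip (\<lambda>x. y s x - z' x) (z t) + ip z' (z t)) + (s - t) * nsq (y s)
        = (nsq (z s) - nsq (z t)) / (s - t)"
    proof eventually_elim
      case (elim s)
      have e: "(\<lambda>x. z s x - z t x) = (\<lambda>x. (s - t) * y s x)" using elim by (simp add: y_def)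
      have "nsq (z s) - nsq (z t) = 2 * ((s - t) * ip (y s) (z t)) + (s - t)\<^sup>2 * nsq (y s)"
        unfolding nsq_increment[OF z[OF elim(1)] z[OF t]] e ip_scale nsq_scale ..
      moreover have "ip (\<lambda>x. y s x - z' x) (z t) = ip (y s) (z t) - ip z' (z t)"
        by (rule ip_diff[OF Ly[OF elim(1)] z' z[OF t]])
      moreover have "(2 * ((s - t) * p) + (s - t)\<^sup>2 * q) / (s - t) = 2 * (p - r + r) + (s - t) * q" for p q r
        using elim by (simp add: field_simps power2_eq_square)
      ultimately show ?case by simp
    qed
  qed
  then show ?thesis by (simp add: has_field_derivative_iff)
qed

text \<open>The squared norm does not increase and tends to 0 at time 0.\<close>

lemma dissipative_flow_zero:
  assumes z: "\<And>s. 0 < s \<Longrightarrow> L2 \<mu> (z s)" and z': "\<And>s. 0 < s \<Longrightarrow> L2 \<mu> (z' s)"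
    and d: "\<And>t. 0 < t \<Longrightarrow> ((\<lambda>s. nsq (\<lambda>x. (z s x - z t x) / (s - t) - z' t x)) \<longlongrightarrow> 0) (at t within {0<..})"
    and dis: "\<And>t. 0 < t \<Longrightarrow> ip (z' t) (z t) \<le> 0" and init: "((\<lambda>s. nsq (z s)) \<longlongrightarrow> 0) (at_right 0)" and t: "0 < t"
  shows "nsq (z t) = 0"
proof -
  have mono: "nsq (z t) \<le> nsq (z s)" if s: "0 < s" "s < t" for s
  proof (rule DERIV_nonpos_imp_nonincreasing[of s t "\<lambda>s. nsq (z s)"])
    fix r assume "s \<le> r" "r \<le> t"
    then have r: "0 < r" using s by simp
    have "((\<lambda>s. nsq (z s)) has_real_derivative 2 * ip (z' r) (z r)) (at r)"
      by (rule nsq_flow_derivative[OF r z z'[OF r] d[OF r]])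
    then show "\<exists>y. ((\<lambda>s. nsq (z s)) has_real_derivative y) (at r) \<and> y \<le> 0" using dis[OF r] by auto
  qed (use s in simp)
  have "\<forall>\<^sub>F s in at_right 0. nsq (z t) \<le> nsq (z s)"
    using eventually_at_right_real[OF t] by eventually_elim (use mono in auto)
  then have "nsq (z t) \<le> 0" by (rule tendsto_lowerbound[OF init]) simp
  then show ?thesis using nsq_nonneg[of "z t"] by simp
qed

lemma nsq_zero_AE: "L2 \<mu> u \<Longrightarrow> nsq u = 0 \<Longrightarrow> AE x in \<mu>. u x = 0"
  unfolding nsq_def by (subst (asm) integral_nonneg_eq_0_iff_AE) (auto simp: L2_def)

text \<open>Energy method: the difference \<open>z\<close> of two solutions may be tested against
  itself, and \<open>ip (z' t) (z t) = - E (z t) (z t)\<close> makes it dissipative.\<close>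

lemma flow_unique:
  assumes f: "L2 \<mu> f" and t: "0 < t"
    and w: "\<And>t. 0 < t \<Longrightarrow> w t \<in> F \<and> L2 \<mu> (w t) \<and> L2 \<mu> (w' t)"
    and d: "\<And>t. 0 < t \<Longrightarrow> ((\<lambda>s. nsq (\<lambda>x. (w s x - w t x) / (s - t) - w' t x)) \<longlongrightarrow> 0) (at t within {0<..})"
    and weak: "\<And>t v. 0 < t \<Longrightarrow> v \<in> F \<Longrightarrow> L2 \<mu> v \<Longrightarrow> ip (w' t) v + E (w t) v = 0"
    and init: "((\<lambda>s. nsq (\<lambda>x. w s x - f x)) \<longlongrightarrow> 0) (at_right 0)"
  shows "AE x in \<mu>. w t x = heat_flow f t x"
proof -
  define z where "z t x = w t x - heat_flow f t x" for t x
  define z' where "z' t x = w' t x - heat_flow_deriv f t x" for t x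
  have zL: "L2 \<mu> (z s)" and z'L: "L2 \<mu> (z' s)" and zF: "z s \<in> F" if s: "0 < s" for s
    unfolding z_def[abs_def] z'_def[abs_def] using w[OF s] heat_flow_FL[OF f s] heat_flow_deriv_L2(3)[OF f s] by (auto intro: L2_diff F_diff)
  have "nsq (z t) = 0"
  proof (rule dissipative_flow_zero[OF zL z'L])
    fix t :: real assume t: "0 < t"
    let ?a = "\<lambda>s x. (w s x - w t x) / (s - t) - w' t x" and ?b = "\<lambda>s x. (heat_flow f s x - heat_flow f t x) / (s - t) - heat_flow_deriv f t x"
    have La: "L2 \<mu> (?a s)" and unit_lap: "L2 \<mu> (?b s)" if s: "0 < s" for s
      using L2_diff[OF L2_scale[OF L2_diff, of \<mu> "w s" "w t" "1 / (s - t)"], of "w' t"]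
        L2_diff[OF L2_scale[OF L2_diff, of \<mu> "heat_flow f s" "heat_flow f t" "1 / (s - t)"], of "heat_flow_deriv f t"]
        w[OF s] w[OF t] heat_flow_FL(2)[OF f s] heat_flow_FL(2)[OF f t] heat_flow_deriv_L2(3)[OF f t] by simp_all
    have lim: "((\<lambda>s. 2 * nsq (?a s) + 2 * nsq (?b s)) \<longlongrightarrow> 2 * 0 + 2 * 0) (at t within {0<..})"
      by (intro tendsto_add tendsto_mult tendsto_const d[OF t] heat_flow_derivative[OF f t])
    have eq: "(\<lambda>x. (z s x - z t x) / (s - t) - z' t x) = (\<lambda>x. ?a s x - ?b s x)" for s
      by (rule ext) (simp add: z_def z'_def diff_divide_distrib)
    show "((\<lambda>s. nsq (\<lambda>x. (z s x - z t x) / (s - t) - z' t x)) \<longlongrightarrow> 0) (at t within {0<..})"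
    proof (rule Lim_null_comparison)
      show "((\<lambda>s. 2 * nsq (?a s) + 2 * nsq (?b s)) \<longlongrightarrow> 0) (at t within {0<..})" using lim by simp
      show "\<forall>\<^sub>F s in at t within {0<..}. norm (nsq (\<lambda>x. (z s x - z t x) / (s - t) - z' t x)) \<le> 2 * nsq (?a s) + 2 * nsq (?b s)"
        unfolding eq eventually_at_filter using nsq_diff_le[OF La unit_lap] nsq_nonneg by (intro always_eventually) simp
    qed
    have "ip (z' t) (z t) = ip (w' t) (z t) - ip (heat_flow_deriv f t) (z t)"
      unfolding z'_def[abs_def] using w[OF t] heat_flow_deriv_L2(3)[OF f t] zL[OF t] by (intro ip_diff) auto
    also have "\<dots> = - (E (w t) (z t) - E (heat_flow f t) (z t))"
      using weak[OF t zF[OF t] zL[OF t]] weak_equation[OF f t zF[OF t] zL[OF t]] by simp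
    also have "E (w t) (z t) - E (heat_flow f t) (z t) = E (z t) (z t)"
      using RF.E_diff[of "w t" "heat_flow f t" "z t"] w[OF t] heat_flow_FL(1)[OF f t] zF[OF t] by (simp add: z_def[abs_def])
    finally show "ip (z' t) (z t) \<le> 0" using RF.E_nonneg[OF zF[OF t]] by simp
  next
    have lim: "((\<lambda>s. 2 * nsq (\<lambda>x. w s x - f x) + 2 * nsq (\<lambda>x. heat_flow f s x - f x)) \<longlongrightarrow> 2 * 0 + 2 * 0) (at_right 0)"
      by (intro tendsto_add tendsto_mult tendsto_const init heat_flow_initial[OF f])
    have eq: "z s = (\<lambda>x. (w s x - f x) - (heat_flow f s x - f x))" for s by (simp add: z_def[abs_def])
    have "nsq (z s) \<le> 2 * nsq (\<lambda>x. w s x - f x) + 2 * nsq (\<lambda>x. heat_flow f s x - f x)" if s: "0 < s" for s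
      unfolding eq using w[OF s] heat_flow_FL(2)[OF f s] f by (intro nsq_diff_le L2_diff) auto
    then have "\<forall>\<^sub>F s in at_right 0. norm (nsq (z s)) \<le> 2 * nsq (\<lambda>x. w s x - f x) + 2 * nsq (\<lambda>x. heat_flow f s x - f x)"
      unfolding eventually_at_filter using nsq_nonneg by (intro always_eventually) simp
    then show "((\<lambda>s. nsq (z s)) \<longlongrightarrow> 0) (at_right 0)" by (rule Lim_null_comparison) (use lim in simp)
  qed (simp_all add: t)
  then show ?thesis using nsq_zero_AE[OF zL[OF t]] by (simp add: z_def)
qed

section \<open>Uniqueness of the kernel on the diagonal\<close>

lemma continuous_triple_cell:
  assumes h: "continuous_map (prod_topology (subtopology euclideanreal {0<..}) (prod_topology RM.mtopology RM.mtopology))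
     euclideanreal (\<lambda>(t, x, y). h t x y)" and t: "0 < t" and x: "x \<in> X" and pos: "0 < h t x x"
  shows "\<exists>n. \<forall>y\<in>cell n (c n x). \<forall>z\<in>cell n (c n x). h t x x / 2 < h t y z"
proof -
  let ?T = "prod_topology (subtopology euclideanreal {0<..}) (prod_topology RM.mtopology RM.mtopology)"
  define S where "S = {w \<in> topspace ?T. (\<lambda>(t, x, y). h t x y) w \<in> {h t x x / 2<..}}"
  have "openin ?T S" unfolding S_def using h by (rule openin_continuous_map_preimage) simp
  moreover have "(t, x, x) \<in> S" unfolding S_def using t x pos by simp
  ultimately obtain U V where V: "openin (prod_topology RM.mtopology RM.mtopology) V" "(x, x) \<in> V" and U: "t \<in> U" "U \<times> V \<subseteq> S"
    using openin_prod_topology_alt[THEN iffD1, rule_format, of "subtopology euclideanreal {0<..}" _ S t "(x, x)"] by metis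
  obtain V1 V2 where V12: "openin RM.mtopology V1" "openin RM.mtopology V2" "x \<in> V1" "x \<in> V2" "V1 \<times> V2 \<subseteq> V"
    using openin_prod_topology_alt[THEN iffD1, rule_format, OF V] by metis
  then have "openin RM.mtopology (V1 \<inter> V2)" by blast
  then obtain n where n: "cell n (c n x) \<subseteq> V1 \<inter> V2" using V12 unfolding openin_R_iff by blast
  have "h t x x / 2 < h t y z" if "y \<in> cell n (c n x)" "z \<in> cell n (c n x)" for y z
  proof -
    have "(t, y, z) \<in> S" using that n V12 U by blast
    then show ?thesis by (simp add: S_def)
  qed
  then show ?thesis by blast
qed

lemma nsq_tendsto_of_L2dist:
  assumes "((\<lambda>s. L2dist \<mu> (a s) (b s)) \<longlongrightarrow> 0) Q" shows "((\<lambda>s. nsq (\<lambda>x. a s x - b s x)) \<longlongrightarrow> 0) Q"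
proof -
  have "(L2dist \<mu> (a s) (b s))\<^sup>2 = nsq (\<lambda>x. a s x - b s x)" for s unfolding L2dist_nsq using nsq_nonneg by simp
  then show ?thesis using tendsto_power[OF assms, of 2] by simp
qed

text \<open>The semigroup fixes a kernel only up to null sets. Joint continuity spreads a
  discrepancy at a diagonal point to a product of two cells of positive measure, where the indicator
  of the cell detects it.\<close>

lemma kernel_diagonal_eq:
  assumes p: "heat_kernel X E F \<mu> p" and t: "0 < t" and x: "x \<in> X"
  shows "p t x x = heat_ker t x x"
proof (rule ccontr)
  assume ne: "p t x x \<noteq> heat_ker t x x"
  let ?T = "prod_topology (subtopology euclideanreal {0<..}) (prod_topology RM.mtopology RM.mtopology)"
  have pc: "continuous_map ?T euclideanreal (\<lambda>(t, x, y). p t x y)" using p unfolding heat_kernel_def by (rule conjunct1)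
  \<comment> \<open>The sign makes the discrepancy positive, so both cases become one.\<close>
  define \<sigma> where "\<sigma> = sgn (p t x x - heat_ker t x x)"
  define h where "h t x y = \<sigma> * (p t x y - heat_ker t x y)" for t x y
  have pos: "0 < h t x x" unfolding h_def \<sigma>_def using ne by (simp add: sgn_if)
  have "continuous_map ?T euclideanreal (\<lambda>w. \<sigma> * ((\<lambda>(t, x, y). p t x y) w - (\<lambda>(t, x, y). heat_ker t x y) w))"
    by (intro continuous_map_real_mult_left continuous_map_diff pc heat_ker_continuous)
  moreover have "(\<lambda>w. \<sigma> * ((\<lambda>(t, x, y). p t x y) w - (\<lambda>(t, x, y). heat_ker t x y) w)) = (\<lambda>(t, x, y). h t x y)"
    by (rule ext) (simp add: h_def split: prod.split)
  ultimately have "continuous_map ?T euclideanreal (\<lambda>(t, x, y). h t x y)" by (simp only:)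
  from continuous_triple_cell[OF this t x pos]
  obtain n where n: "\<And>y z. y \<in> cell n (c n x) \<Longrightarrow> z \<in> cell n (c n x) \<Longrightarrow> h t x x / 2 < h t y z" by blast
  define C where "C = cell n (c n x)"
  define f where "f = (indicator C :: 'a \<Rightarrow> real)"
  have f: "L2 \<mu> f" unfolding f_def C_def by (intro L2_indicator) (simp_all add: emeasure_cell)
  have "\<exists>w w'. \<forall>t>0. w t \<in> D_mu X E F \<mu> \<and>
          (AE x in \<mu>. integrable \<mu> (\<lambda>y. p t x y * f y) \<and> (LINT y|\<mu>. p t x y * f y) = w t x) \<and>
          L2 \<mu> (w' t) \<and>
          ((\<lambda>s. L2dist \<mu> (\<lambda>x. (w s x - w t x) / (s - t)) (w' t)) \<longlongrightarrow> 0) (at t within {0<..}) \<and>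
          (\<forall>v\<in>D_mu X E F \<mu>. (LINT x|\<mu>. w' t x * v x) + E (w t) v = 0) \<and>
          ((\<lambda>s. L2dist \<mu> (w s) f) \<longlongrightarrow> 0) (at_right 0)"
    using p[unfolded heat_kernel_def, THEN conjunct2, rule_format, OF f] .
  then obtain w w' where w0: "\<forall>t>0. w t \<in> D_mu X E F \<mu> \<and>
          (AE x in \<mu>. integrable \<mu> (\<lambda>y. p t x y * f y) \<and> (LINT y|\<mu>. p t x y * f y) = w t x) \<and>
          L2 \<mu> (w' t) \<and>
          ((\<lambda>s. L2dist \<mu> (\<lambda>x. (w s x - w t x) / (s - t)) (w' t)) \<longlongrightarrow> 0) (at t within {0<..}) \<and>
          (\<forall>v\<in>D_mu X E F \<mu>. (LINT x|\<mu>. w' t x * v x) + E (w t) v = 0) \<and>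
          ((\<lambda>s. L2dist \<mu> (w s) f) \<longlongrightarrow> 0) (at_right 0)"
    by (elim exE)
  note w = w0[THEN spec, THEN mp]

  have "AE x in \<mu>. w t x = heat_flow f t x"
  proof (rule flow_unique[OF f t])
    fix t :: real assume t: "0 < t"
    show "w t \<in> F \<and> L2 \<mu> (w t) \<and> L2 \<mu> (w' t)" using w[OF t] by (simp add: D_mu_eq)
    show "((\<lambda>s. nsq (\<lambda>x. (w s x - w t x) / (s - t) - w' t x)) \<longlongrightarrow> 0) (at t within {0<..})"
      by (rule nsq_tendsto_of_L2dist[where a = "\<lambda>s x. (w s x - w t x) / (s - t)" and b = "\<lambda>s. w' t"]) (use w[OF t] in blast)
    show "ip (w' t) v + E (w t) v = 0" if "v \<in> F" "L2 \<mu> v" for v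
      using w[OF t] that by (simp add: D_mu_eq ip_def)
  next
    show "((\<lambda>s. nsq (\<lambda>x. w s x - f x)) \<longlongrightarrow> 0) (at_right 0)"
      by (rule nsq_tendsto_of_L2dist[where a = w and b = "\<lambda>s. f"]) (use w[OF t] in blast)
  qed
  moreover have "AE y in \<mu>. integrable \<mu> (\<lambda>z. p t y z * f z) \<and> (LINT z|\<mu>. p t y z * f z) = w t y" using w[OF t] by blast
  ultimately have "AE y in \<mu>. y \<notin> C"
    using AE_space
  proof eventually_elim
    case (elim y)
    have yX: "y \<in> X" using elim by (simp add: space_mu)
    note hi = heat_ker_integral[OF f yX t]
    show ?case
    proof
      assume y: "y \<in> C"
      have i: "integrable \<mu> (\<lambda>z. \<sigma> * (p t y z * f z - heat_ker t y z * f z))" using elim hi by simp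
      have z0: "(LINT z|\<mu>. \<sigma> * (p t y z * f z - heat_ker t y z * f z)) = 0" using elim hi by simp
      have "h t x x / 2 * (1 / 2 ^ n) = (LINT z|\<mu>. h t x x / 2 * f z)" by (simp add: f_def C_def measure_cell)
      also have "\<dots> \<le> (LINT z|\<mu>. \<sigma> * (p t y z * f z - heat_ker t y z * f z))"
      proof (rule integral_mono[OF _ i])
        show "integrable \<mu> (\<lambda>z. h t x x / 2 * f z)" by (simp add: f_def C_def emeasure_cell)
        fix z
        show "h t x x / 2 * f z \<le> \<sigma> * (p t y z * f z - heat_ker t y z * f z)"
        proof (cases "z \<in> C")
          case True
          then show ?thesis using n[of y z] y by (simp add: C_def f_def h_def)
        qed (simp add: f_def)
      qed
      finally have "h t x x / 2 * (1 / 2 ^ n) \<le> 0" unfolding z0 .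
      moreover have "0 < h t x x / 2 * (1 / 2 ^ n)" using pos by simp
      ultimately show False by linarith
    qed
  qed
  then have "emeasure \<mu> C = 0" by (subst (asm) AE_iff_measurable[of C]) (auto simp: C_def space_mu)
  then show False by (simp add: C_def emeasure_cell)
qed

section \<open>Bounds on the diagonal\<close>

lemma pc_le: "0 < t \<Longrightarrow> pc t n \<le> 1 / (8 ^ Suc n * t)"
proof -
  assume t: "0 < t"
  define u where "u = 8 ^ Suc n * t"
  have u: "0 < u" using t by (simp add: u_def)
  have "u \<le> exp u" using exp_ge_add_one_self[of u] by linarith
  then have "exp (- u) \<le> 1 / u" using u by (simp add: exp_minus field_simps)
  then show ?thesis by (simp add: pc_def u_def)
qed

text \<open>On the diagonal \<open>haar_kernel n x x = 2 ^ n\<close>. At level \<open>m\<close> the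
  eigenvalue is about \<open>1 / t\<close>: coarser levels form a geometric sum, finer ones are cut
  off by the exponential, and the unit cell part stays below \<open>exp 2\<close>.\<close>

lemma diagonal_bounds:
  assumes x: "x \<in> X" and t: "1 / 8 ^ Suc m < t" "t \<le> 1 / 8 ^ m"
  shows "exp (- 8) * 2 ^ m - exp 2 \<le> heat_ker t x x" "heat_ker t x x \<le> 3 * 2 ^ m + exp 2"
proof -
  have t0: "0 < t" using t(1) by (rule less_trans[rotated]) simp
  have t1: "t \<le> 1" using t(2) by (rule order_trans) simp
  define a where "a n = pc t n * 2 ^ n" for n
  have a: "(\<lambda>n. pc t n * haar_kernel n x x) = a" by (simp add: a_def haar_kernel_def fun_eq_iff)
  have sa: "summable a" unfolding a_def[abs_def] using t0 by (intro pc_power_summable) auto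
  have a0: "0 \<le> a n" for n using pc_pos[of t n] by (simp add: a_def)
  \<comment> \<open>The single term of level \<open>m\<close> already provides the lower bound
    \<open>exp (- 8) * 2 ^ m\<close>.\<close>
  have "8 ^ Suc m * t \<le> 8" using mult_left_mono[OF t(2), of "8 ^ Suc m"] by simp
  then have "exp (- 8) * 2 ^ m \<le> a m" by (simp add: a_def pc_def)
  also have "a m = sum a {m}" by simp
  also have "\<dots> \<le> suminf a" by (intro sum_le_suminf sa) (use a0 in auto)
  finally have lower: "exp (- 8) * 2 ^ m \<le> suminf a" .
  have le1: "a n \<le> 2 ^ n" for n using t0 by (simp add: a_def pc_def)
  \<comment> \<open>\<open>pc_le\<close> with \<open>8 ^ Suc m * t \<ge> 1\<close> gives the decay
    \<open>1 / 8 ^ n\<close>, of which \<open>1 / 4 ^ n\<close> is enough against the growth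
    \<open>2 ^ (n + m)\<close>.\<close>
  have le2: "a (n + m) \<le> 2 ^ m * (1 / 2) ^ n" for n
  proof -
    have "1 \<le> 8 ^ Suc m * t" using mult_left_mono[OF less_imp_le[OF t(1)], of "8 ^ Suc m"] by simp
    then have "8 ^ n * 1 \<le> 8 ^ n * (8 ^ Suc m * t)" by (intro mult_left_mono) auto
    then have "8 ^ n \<le> 8 ^ Suc (n + m) * t" by (simp add: power_add mult_ac)
    then have "1 / (8 ^ Suc (n + m) * t) \<le> 1 / 8 ^ n" using t0 by (intro divide_left_mono) auto
    then have "pc t (n + m) \<le> 1 / 8 ^ n" using pc_le[OF t0, of "n + m"] by linarith
    also have "\<dots> \<le> 1 / 4 ^ n" by (intro divide_left_mono power_mono) auto
    finally have "a (n + m) \<le> 1 / 4 ^ n * 2 ^ (n + m)" unfolding a_def by (intro mult_right_mono) auto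
    also have "\<dots> = 2 ^ m * (2 / 4) ^ n" by (simp only: power_add power_divide) (simp add: field_simps)
    finally show ?thesis by simp
  qed
  have "suminf a = (\<Sum>n. a (n + m)) + (\<Sum>n<m. a n)" by (rule suminf_split_initial_segment[OF sa])
  moreover have "(\<Sum>n. a (n + m)) \<le> (\<Sum>n. 2 ^ m * (1 / 2) ^ n)"
    using sa summable_iff_shift[of a m] by (intro suminf_le le2 summable_mult summable_geometric) auto
  moreover have "(\<Sum>n. 2 ^ m * (1 / 2) ^ n) = (2 ^ m * 2 :: real)"
    by (subst suminf_mult) (simp_all add: suminf_geometric)
  moreover have "(\<Sum>n<m. a n) \<le> (\<Sum>n<m. 2 ^ n)" by (intro sum_mono le1)
  moreover have "(\<Sum>n<m. 2 ^ n) \<le> (2::real) ^ m" by (induction m) auto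
  ultimately have upper: "suminf a \<le> 3 * 2 ^ m" by linarith
  define b where "b n = qc t n * lap_kernel n (c 0 x) (c 0 x)" for n
  have b1: "\<bar>b n\<bar> \<le> 2 ^ n / fact n" for n
  proof -
    have "\<bar>b n\<bar> \<le> \<bar>t\<bar> ^ n / fact n * 2 ^ n" unfolding b_def abs_mult abs_qc by (intro mult_left_mono lap_kernel_bound) simp
    also have "\<dots> \<le> 1 ^ n / fact n * 2 ^ n"
      using t0 t1 by (intro mult_right_mono divide_right_mono power_mono) auto
    finally show ?thesis by simp
  qed
  have sb: "summable (\<lambda>n. \<bar>b n\<bar>)" by (rule summable_comparison_test'[OF summable_power_fact[of 2]]) (use b1 in simp)
  have "\<bar>suminf b\<bar> \<le> (\<Sum>n. \<bar>b n\<bar>)" by (rule summable_rabs[OF sb])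
  also have "\<dots> \<le> (\<Sum>n. 2 ^ n / fact n)" by (rule suminf_le[OF b1 sb summable_power_fact])
  also have "\<dots> = exp 2" by (simp add: exp_def divide_inverse mult.commute)
  finally have "\<bar>suminf b\<bar> \<le> exp 2" .
  moreover have "heat_ker t x x = suminf a + suminf b" unfolding heat_ker_def a b_def[abs_def] ..
  ultimately show "exp (- 8) * 2 ^ m - exp 2 \<le> heat_ker t x x" "heat_ker t x x \<le> 3 * 2 ^ m + exp 2"
    using lower upper by linarith+
qed

text \<open>Since \<open>8 = 2 ^ 3\<close>, the cube root of \<open>t\<close> lies between
  \<open>1 / 2 ^ Suc m\<close> and \<open>1 / 2 ^ m\<close>, the reciprocal of the leading
  term.\<close>

lemma diagonal_scaled_bounds:
  assumes x: "x \<in> X" and t: "0 < t" "t \<le> 1"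
  shows "exp (- 8) / 2 - exp 2 * t powr (1 / 3) \<le> heat_ker t x x * t powr (1 / 3)"
    "heat_ker t x x * t powr (1 / 3) \<le> 3 + exp 2"
proof -
  obtain m where m: "1 / 8 ^ Suc m < t" "t \<le> 1 / 8 ^ m" using ex_power_between[of t 8] t by auto
  define y where "y = t powr (1 / 3)"
  have r: "(1 / 8 ^ k) powr (1 / 3) = 1 / (2::real) ^ k" for k
  proof -
    have "(1 / 8 ^ k :: real) = (1 / 2 ^ k) powr 3"
      by (simp add: powr_realpow power_divide flip: power_mult power_numeral_even)
         (simp add: power_mult mult.commute[of k])
    then have "(1 / 8 ^ k :: real) powr (1 / 3) = (1 / 2 ^ k) powr (3 * (1 / 3))" by (simp only: powr_powr)
    then show ?thesis by simp
  qed
  have y1: "y \<le> 1 / 2 ^ m" unfolding y_def r[symmetric] using m t by (intro powr_mono2) auto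
  have y2: "1 / 2 ^ Suc m \<le> y" unfolding y_def r[symmetric] using m t by (intro powr_mono2) auto
  have y: "0 \<le> y" "y \<le> 1" using y1 by (auto simp: y_def elim: order_trans)
  have p1: "2 ^ m * y \<le> 1" using mult_left_mono[OF y1, of "2 ^ m"] by simp
  have p2: "1 / 2 \<le> 2 ^ m * y" using mult_left_mono[OF y2, of "2 ^ m"] by simp
  note B = diagonal_bounds[OF x m]
  have "exp (- 8) / 2 - exp 2 * y \<le> (exp (- 8) * 2 ^ m - exp 2) * y"
    using mult_left_mono[OF p2, of "exp (- 8)"] by (simp add: algebra_simps)
  also have "\<dots> \<le> heat_ker t x x * y" by (intro mult_right_mono B y)
  finally show "exp (- 8) / 2 - exp 2 * t powr (1 / 3) \<le> heat_ker t x x * t powr (1 / 3)" by (simp add: y_def)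
  have "heat_ker t x x * y \<le> (3 * 2 ^ m + exp 2) * y" by (intro mult_right_mono B y)
  also have "\<dots> = 3 * (2 ^ m * y) + exp 2 * y" by (simp add: algebra_simps)
  also have "\<dots> \<le> 3 * 1 + exp 2 * 1" by (intro add_mono mult_left_mono p1 y) auto
  finally show "heat_ker t x x * t powr (1 / 3) \<le> 3 + exp 2" by (simp add: y_def)
qed

lemma spectral_limit:
  assumes p: "heat_kernel X E F \<mu> p" and x: "x \<in> X"
  shows "((\<lambda>t. - 2 * ln (p t x x) / ln t) \<longlongrightarrow> 2 / 3) (at_right 0)"
proof -
  have "((\<lambda>t. exp 2 * t powr (1 / 3)) \<longlongrightarrow> exp 2 * 0 powr (1 / 3)) (at_right (0::real))"
    by (intro tendsto_mult tendsto_const tendsto_powr' tendsto_ident_at) (auto simp: eventually_at_filter)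
  then have "((\<lambda>t. exp 2 * t powr (1 / 3)) \<longlongrightarrow> 0) (at_right (0::real))" by simp
  \<comment> \<open>Half of the leading constant \<open>exp (- 8) / 2\<close> is sacrificed to the
    bounded term.\<close>
  from order_tendstoD(2)[OF this, of "exp (- 8) / 4"]
  have "\<forall>\<^sub>F t in at_right 0. exp 2 * t powr (1 / 3) < exp (- 8) / (4::real)" by simp
  then have "\<forall>\<^sub>F t in at_right 0. exp (- 8) / 4 \<le> p t x x * t powr (1 / 3) \<and> p t x x * t powr (1 / 3) \<le> 3 + exp 2"
    using eventually_at_right_less[of 0] eventually_at_right_real[of 0 1, OF zero_less_one]
  proof eventually_elim
    case (elim t)
    have t: "0 < t" "t \<le> 1" using elim by auto
    show ?case using diagonal_scaled_bounds[OF x t] elim(1) kernel_diagonal_eq[OF p t(1) x] by simp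
  qed
  from log_ratio_limit[OF _ this] show ?thesis by simp
qed

end

section \<open>A dyadic subset of the line\<close>

text \<open>A dyadic number \<open>q > 0\<close> is split into two points: \<open>q\<close> belongs to the cells that start at \<open>q\<close>, and \<open>- q\<close>
  to the cells that end at \<open>q\<close>. The added points are countably many, so Lebesgue measure on the half-line
  gives each cell its length.\<close>

definition dyadic_points :: "real set" where
  "dyadic_points = {0..} \<union> {- (real j / 2 ^ m) | j m. 0 < j}"

definition dyadic_index :: "nat \<Rightarrow> real \<Rightarrow> nat" where
  "dyadic_index n x = (if 0 \<le> x then nat \<lfloor>2 ^ n * x\<rfloor> else nat (\<lceil>2 ^ n * (- x)\<rceil> - 1))"

definition dyadic_measure :: "real measure" where
  "dyadic_measure = distr (restrict_space lborel {0..})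
     (sigma dyadic_points {{x \<in> dyadic_points. dyadic_index n x = k} | n k. True}) (\<lambda>x. x)"

lemma dyadic_index_nonneg:
  assumes "0 \<le> x" shows "dyadic_index n x = k \<longleftrightarrow> real k \<le> 2 ^ n * x \<and> 2 ^ n * x < real k + 1"
proof -
  have "0 \<le> \<lfloor>2 ^ n * x\<rfloor>" using assms by simp
  then have "dyadic_index n x = k \<longleftrightarrow> \<lfloor>2 ^ n * x\<rfloor> = int k" using assms by (auto simp: dyadic_index_def)
  then show ?thesis by (simp add: floor_eq_iff)
qed

lemma dyadic_index_neg:
  assumes "x < 0" shows "dyadic_index n x = k \<longleftrightarrow> real k < 2 ^ n * (- x) \<and> 2 ^ n * (- x) \<le> real k + 1"
proof -
  have p: "0 < 2 ^ n * (- x)" using assms by (intro mult_pos_pos) auto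
  then have "0 < \<lceil>2 ^ n * (- x)\<rceil>" by (simp only: zero_less_ceiling)
  then have "dyadic_index n x = k \<longleftrightarrow> \<lceil>2 ^ n * (- x)\<rceil> = int k + 1" using assms by (auto simp: dyadic_index_def)
  also have "\<dots> \<longleftrightarrow> real k < 2 ^ n * (- x) \<and> 2 ^ n * (- x) \<le> real k + 1"
    unfolding ceiling_eq_iff by simp
  finally show ?thesis .
qed

lemma dyadic_index_close: "\<bar>2 ^ n * \<bar>x\<bar> - real (dyadic_index n x)\<bar> \<le> 1"
proof (cases "0 \<le> x")
  case True
  then show ?thesis using dyadic_index_nonneg[OF True, of n "dyadic_index n x"] by simp
next
  case False
  then have n: "x < 0" by simp
  show ?thesis using dyadic_index_neg[OF n, of n "dyadic_index n x"] n by (simp add: abs_le_iff)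
qed

lemma nat_div2_eq: "2 * k \<le> m \<Longrightarrow> m < 2 * k + 2 \<Longrightarrow> m div 2 = (k::nat)" by linarith

lemma dyadic_index_Suc: "dyadic_index (Suc n) x div 2 = dyadic_index n x"
proof (cases "0 \<le> x")
  case True
  show ?thesis
    using dyadic_index_nonneg[OF True, of n "dyadic_index n x"] dyadic_index_nonneg[OF True, of "Suc n" "dyadic_index (Suc n) x"]
    by (intro nat_div2_eq) auto
next
  case False
  then have x: "x < 0" by simp
  show ?thesis
    using dyadic_index_neg[OF x, of n "dyadic_index n x"] dyadic_index_neg[OF x, of "Suc n" "dyadic_index (Suc n) x"]
    by (intro nat_div2_eq) auto
qed

text \<open>The index of level \<open>n\<close> locates \<open>2 ^ n * \<bar>x\<bar>\<close> within
  1, so all indices together determine the absolute value.\<close>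

lemma dyadic_index_abs_eq:
  assumes "\<And>n. dyadic_index n x = dyadic_index n y" shows "\<bar>x\<bar> = \<bar>y\<bar>"
proof (rule ccontr)
  assume "\<bar>x\<bar> \<noteq> \<bar>y\<bar>"
  then have d: "0 < \<bar>\<bar>x\<bar> - \<bar>y\<bar>\<bar>" by simp
  obtain n where n: "2 / \<bar>\<bar>x\<bar> - \<bar>y\<bar>\<bar> < 2 ^ n" using real_arch_pow[of 2 "2 / \<bar>\<bar>x\<bar> - \<bar>y\<bar>\<bar>"] by auto
  have "\<bar>2 ^ n * \<bar>x\<bar> - 2 ^ n * \<bar>y\<bar>\<bar> \<le> 2"
    using dyadic_index_close[of n x] dyadic_index_close[of n y] assms[of n] by linarith
  also have "2 ^ n * \<bar>x\<bar> - 2 ^ n * \<bar>y\<bar> = 2 ^ n * (\<bar>x\<bar> - \<bar>y\<bar>)" by (simp add: right_diff_distrib)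
  finally have "2 ^ n * \<bar>\<bar>x\<bar> - \<bar>y\<bar>\<bar> \<le> 2" by (simp add: abs_mult)
  then show False using n d by (simp add: field_simps)
qed

text \<open>The twins \<open>q\<close> and \<open>- q\<close> part at the level \<open>m\<close>
  where \<open>q\<close> is a division point: one index is \<open>2 ^ m * q\<close>, the other is
  one less.\<close>

lemma dyadic_index_opposite:
  assumes x: "0 \<le> x" and y: "y \<in> dyadic_points" "y < 0" and eq: "\<And>n. dyadic_index n x = dyadic_index n y"
  shows False
proof -
  obtain j m where jm: "y = - (real j / 2 ^ m)" using y by (auto simp: dyadic_points_def)
  have "x = real j / 2 ^ m" using dyadic_index_abs_eq[OF eq] x y(2) jm by simp
  then have "2 ^ m * x = real j" "2 ^ m * (- y) = real j" using jm by simp_all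
  then show False
    using dyadic_index_nonneg[OF x, of m "dyadic_index m x"] dyadic_index_neg[OF y(2), of m "dyadic_index m x"] eq[of m] by simp
qed

lemma dyadic_index_inj:
  assumes "x \<in> dyadic_points" "y \<in> dyadic_points" "\<And>n. dyadic_index n x = dyadic_index n y"
  shows "x = y"
  using dyadic_index_abs_eq[of x y] dyadic_index_opposite[of x y] dyadic_index_opposite[of y x] assms
  by (cases "0 \<le> x"; cases "0 \<le> y") force+

text \<open>Nested intervals from \<open>a n\<close> to \<open>b n\<close> shrink to one number
  \<open>s\<close>. If \<open>s\<close> is never a right end, the point is \<open>s\<close>;
  otherwise the branch approaches \<open>s\<close> from the left and belongs to the twin
  \<open>- s\<close>.\<close>

lemma dyadic_index_ex:
  assumes h: "\<And>n. h (Suc n) div 2 = h n"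
  shows "\<exists>x\<in>dyadic_points. \<forall>n. dyadic_index n x = h n"
proof -
  define a b where "a n = real (h n) / 2 ^ n" and "b n = (real (h n) + 1) / 2 ^ n" for n
  have hs: "2 * h n \<le> h (Suc n)" "h (Suc n) + 1 \<le> 2 * (h n + 1)" for n
    using h[of n] by presburger+
  have hr: "2 * real (h n) \<le> real (h (Suc n))" "real (h (Suc n)) + 1 \<le> 2 * (real (h n) + 1)" for n
    using of_nat_mono[OF hs(1)[of n], where 'a = real] of_nat_mono[OF hs(2)[of n], where 'a = real] by simp_all
  have ia: "incseq a" by (rule incseq_SucI) (use hr(1) in \<open>simp add: a_def field_simps\<close>)
  have db: "decseq b"
  proof (rule decseq_SucI)
    fix n
    have "b (Suc n) \<le> 2 * (real (h n) + 1) / (2 * 2 ^ n)"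
      unfolding b_def power_Suc by (intro divide_right_mono hr) simp
    also have "\<dots> = b n" unfolding b_def by (rule mult_divide_mult_cancel_left) simp
    finally show "b (Suc n) \<le> b n" .
  qed
  have ab: "a n < b n" for n by (simp add: a_def b_def divide_strict_right_mono)
  have le: "a n \<le> b m" for n m
    using incseqD[OF ia, of n "max n m"] decseqD[OF db, of m "max n m"] ab[of "max n m"] by simp
  define s where "s = (SUP n. a n)"
  have as: "a n \<le> s" for n unfolding s_def by (rule cSUP_upper) (auto intro!: bdd_aboveI2[where M = "b 0"] le)
  have sb: "s \<le> b m" for m unfolding s_def by (rule cSUP_least) (auto intro: le)
  have s0: "0 \<le> s" using as[of 0] by (simp add: a_def order_trans[of 0 "real (h 0)"])
  have lo: "real (h n) \<le> 2 ^ n * s" and hi: "2 ^ n * s \<le> real (h n) + 1" for n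
    using as[of n] sb[of n] by (simp_all add: a_def b_def field_simps)
  show ?thesis
  proof (cases "\<forall>n. s < b n")
    case True
    have "dyadic_index n s = h n" for n
      unfolding dyadic_index_nonneg[OF s0] using lo True[rule_format, of n] by (simp add: b_def field_simps)
    then show ?thesis using s0 by (intro bexI[of _ s]) (auto simp: dyadic_points_def)
  next
    case False
    then obtain m where m: "s = b m" using sb by (meson antisym not_less)
    have sp: "0 < s" unfolding m b_def by simp
    \<comment> \<open>From level \<open>m\<close> on the right ends are at most \<open>s\<close>,
      and every left end lies strictly below its right end.\<close>
    have "a n \<noteq> s" for n
    proof
      assume "a n = s"
      moreover have "a n \<le> a (max n m)" by (rule incseqD[OF ia]) simp
      moreover have "b (max n m) \<le> b m" by (rule decseqD[OF db]) simp
      ultimately show False using ab[of "max n m"] m by linarith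
    qed
    then have "a n < s" for n using as[of n] by (simp add: less_le)
    then have lt: "real (h n) < 2 ^ n * s" for n by (simp add: a_def field_simps)
    have sm: "- s < 0" using sp by simp
    have "dyadic_index n (- s) = h n" for n unfolding dyadic_index_neg[OF sm] using lt hi by simp
    moreover have "- s \<in> dyadic_points"
      unfolding dyadic_points_def m b_def by (intro UnI2 CollectI exI[of _ "Suc (h m)"] exI[of _ m]) simp
    ultimately show ?thesis by blast
  qed
qed

text \<open>The added points are stored as negative numbers, so intersecting with the half-line
  leaves a plain interval, whose length is the measure of the cell.\<close>

lemma dyadic_cell_nonneg: "{x \<in> dyadic_points. dyadic_index n x = k} \<inter> {0..} = {real k / 2 ^ n ..< (real k + 1) / 2 ^ n}"
proof (intro equalityI subsetI)
  fix x assume "x \<in> {x \<in> dyadic_points. dyadic_index n x = k} \<inter> {0..}"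
  then have "0 \<le> x" "dyadic_index n x = k" by auto
  then show "x \<in> {real k / 2 ^ n ..< (real k + 1) / 2 ^ n}"
    using dyadic_index_nonneg[of x n k] by (simp add: field_simps)
next
  fix x assume x: "x \<in> {real k / 2 ^ n ..< (real k + 1) / 2 ^ n}"
  then have x0: "0 \<le> x" using order_trans[of 0 "real k / 2 ^ n" x] by simp
  then show "x \<in> {x \<in> dyadic_points. dyadic_index n x = k} \<inter> {0..}"
    using x dyadic_index_nonneg[OF x0, of n k] by (simp add: dyadic_points_def field_simps)
qed

interpretation dyadic_line: dyadic dyadic_points dyadic_index dyadic_measure
proof
  let ?S = "{{x \<in> dyadic_points. dyadic_index n x = k} | n k. True}"
  have S: "?S \<subseteq> Pow dyadic_points" by auto
  show "space dyadic_measure = dyadic_points" unfolding dyadic_measure_def space_distr by (rule space_measure_of[OF S])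
  show "sets dyadic_measure = sigma_sets dyadic_points ?S" unfolding dyadic_measure_def sets_distr by (rule sets_measure_of[OF S])
  have sp: "space (restrict_space lborel {0::real..}) = {0..}" by (simp add: space_restrict_space)
  have st: "{real k / 2 ^ n ..< (real k + 1) / 2 ^ n} \<in> sets (restrict_space lborel {0..})" for n k
  proof -
    have "{real k / 2 ^ n ..< (real k + 1) / 2 ^ n} \<subseteq> {0..}" unfolding dyadic_cell_nonneg[symmetric] by blast
    then show ?thesis by (subst sets_restrict_space_iff) auto
  qed
  have meas: "(\<lambda>x. x) \<in> measurable (restrict_space lborel {0..}) (sigma dyadic_points ?S)"
  proof (rule measurable_measure_of[OF S])
    show "(\<lambda>x. x) \<in> space (restrict_space lborel {0..}) \<rightarrow> dyadic_points"
      unfolding sp by (auto simp: dyadic_points_def)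
    fix B assume "B \<in> ?S"
    then obtain n k where B: "B = {x \<in> dyadic_points. dyadic_index n x = k}" by blast
    have "(\<lambda>x. x) -` B \<inter> space (restrict_space lborel {0..}) = {real k / 2 ^ n ..< (real k + 1) / 2 ^ n}"
      unfolding sp B dyadic_cell_nonneg[symmetric] by simp
    then show "(\<lambda>x. x) -` B \<inter> space (restrict_space lborel {0..}) \<in> sets (restrict_space lborel {0..})" using st by simp
  qed
  show "emeasure dyadic_measure {x \<in> dyadic_points. dyadic_index n x = k} = ennreal (1 / 2 ^ n)" for n k
  proof -
    let ?B = "{x \<in> dyadic_points. dyadic_index n x = k}"
    have "?B \<in> sets (sigma dyadic_points ?S)" unfolding sets_measure_of[OF S] by (rule sigma_sets.Basic) blast
    then have "emeasure dyadic_measure ?B = emeasure (restrict_space lborel {0..}) ((\<lambda>x. x) -` ?B \<inter> {0..})"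
      unfolding dyadic_measure_def by (subst emeasure_distr[OF meas]) (simp_all add: sp)
    also have "(\<lambda>x. x) -` ?B \<inter> {0..} = {real k / 2 ^ n ..< (real k + 1) / 2 ^ n}"
      unfolding dyadic_cell_nonneg[symmetric] by simp
    also have "emeasure (restrict_space lborel {0..}) \<dots> = emeasure lborel {real k / 2 ^ n ..< (real k + 1) / 2 ^ n}"
      by (rule emeasure_restrict_space) (auto simp: dyadic_cell_nonneg[symmetric])
    also have "\<dots> = ennreal ((real k + 1) / 2 ^ n - real k / 2 ^ n)"
      by (rule emeasure_lborel_Ico) (simp add: divide_right_mono)
    also have "(real k + 1) / 2 ^ n - real k / 2 ^ n = 1 / 2 ^ n" by (simp add: add_divide_distrib)
    finally show ?thesis .
  qed
qed (rule dyadic_index_Suc dyadic_index_inj dyadic_index_ex; assumption)+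

theorem mainTheorem3:
  shows "\<exists>(X :: real set) E F \<mu>.
    X \<noteq> {} \<and>
    resistance_form X E F \<and>
    Metric_space X (resistance_metric X E F) \<and>
    Metric_space.mcomplete X (resistance_metric X E F) \<and>
    dim_ARC X (resistance_metric X E F) < \<infinity> \<and>
    borel_measure_on X (resistance_metric X E F) \<mu> \<and>
    volume_doubling X (resistance_metric X E F) \<mu> \<and>
    (\<exists>p. heat_kernel X E F \<mu> p) \<and>
    (\<exists>ds::real.
       (\<forall>p. heat_kernel X E F \<mu> p \<longrightarrow>
          (\<forall>x\<in>X. ((\<lambda>t. - 2 * ln (p t x x) / ln t) \<longlongrightarrow> ds) (at_right 0))) \<and>
       ereal ds < dim_ARC X (resistance_metric X E F) \<and>
       dim_ARC X (resistance_metric X E F) < 2)"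
proof (rule exI[of _ dyadic_points], rule exI[of _ dyadic_line.E], rule exI[of _ dyadic_line.F],
    rule exI[of _ dyadic_measure], intro conjI)
  show "dyadic_points \<noteq> {}" by (rule dyadic_line.X_nonempty)
  show "resistance_form dyadic_points dyadic_line.E dyadic_line.F" by (rule dyadic_line.resistance_form)
  show "Metric_space dyadic_points (resistance_metric dyadic_points dyadic_line.E dyadic_line.F)"
    by (rule dyadic_line.Metric_space_R)
  show "Metric_space.mcomplete dyadic_points (resistance_metric dyadic_points dyadic_line.E dyadic_line.F)"
    by (rule dyadic_line.mcomplete_R)
  show "dim_ARC dyadic_points (resistance_metric dyadic_points dyadic_line.E dyadic_line.F) < \<infinity>"
    unfolding dyadic_line.dim_ARC_R by simp
  show "borel_measure_on dyadic_points (resistance_metric dyadic_points dyadic_line.E dyadic_line.F) dyadic_measure"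
    by (rule dyadic_line.borel_measure_on_R)
  show "volume_doubling dyadic_points (resistance_metric dyadic_points dyadic_line.E dyadic_line.F) dyadic_measure"
    by (rule dyadic_line.volume_doubling)
  show "\<exists>p. heat_kernel dyadic_points dyadic_line.E dyadic_line.F dyadic_measure p"
    using dyadic_line.heat_kernel_heat_ker by blast
  show "\<exists>ds::real.
       (\<forall>p. heat_kernel dyadic_points dyadic_line.E dyadic_line.F dyadic_measure p \<longrightarrow>
          (\<forall>x\<in>dyadic_points. ((\<lambda>t. - 2 * ln (p t x x) / ln t) \<longlongrightarrow> ds) (at_right 0))) \<and>
       ereal ds < dim_ARC dyadic_points (resistance_metric dyadic_points dyadic_line.E dyadic_line.F) \<and>
       dim_ARC dyadic_points (resistance_metric dyadic_points dyadic_line.E dyadic_line.F) < 2"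
  \<comment> \<open>Twice the exponent \<open>1 / 3\<close> of the diagonal, against conformal
    dimension 1.\<close>
  proof (rule exI[of _ "2 / 3"], intro conjI allI impI ballI)
    show "((\<lambda>t. - 2 * ln (p t x x) / ln t) \<longlongrightarrow> 2 / 3) (at_right 0)"
      if "heat_kernel dyadic_points dyadic_line.E dyadic_line.F dyadic_measure p" "x \<in> dyadic_points" for p x
      using that by (rule dyadic_line.spectral_limit)
  qed (simp_all add: dyadic_line.dim_ARC_R one_ereal_def)
qed

end
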